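(* Let $\Phi$ be an absolutely summable, translation-invariant, rotation-invariant potential on $(S^1)^{\mathbb{Z}^d}$ with continuous symmetry breaking, and let the discretization $T$ into $q$ arcs be fine enough that $\bar c<1$. Then $\mu\mapsto T\mu:=\mu\circ T^{-1}$ is a bijection from $\operatorname{ex}\mathcal{G}_\theta(\gamma^\Phi)$ to $\operatorname{ex}\mathcal{G}_\theta(\gamma')$, with inverse given by the kernel $\mu_G[\omega'](d\omega)$, i.e. $\mu'\mapsto\int\mu'(d\omega')\mu_G[\omega'](d\omega)$.
   Context: Continuous model. $G=\mathbb{Z}^d$, $S^1=[0,2\pi)$ (angles modulo $2\pi$) with Lebesgue measure $\lambda$, $\Omega=(S^1)^G$. A potential $\Phi=(\Phi_A)_{A\subset G\text{ finite}}$ consists of functions $\Phi_A:\Omega\to\mathbb{R}$ depending only on the coordinates in $A$; it is absolutely summable if $\sum_{A\ni i}\|\Phi_A\|<\infty$ for all $i$ ($\|\cdot\|$ the sup norm), translation-invariant if invariant under lattice shifts, rotation-invariant if $\Phi_A$ is unchanged when all spins are rotated by a common angle. $H_\Lambda=\sum_{A\cap\Lambda\ne\varnothing}\Phi_A$ for finite $\Lambda$. The specification $\gamma^\Phi$ has kernels $\gamma^\Phi_\Lambda(B|\eta)=\frac{\int 1_B(\omega_\Lambda\eta_{\Lambda^c})e^{-H_\Lambda(\omega_\Lambda\eta_{\Lambda^c})}\lambda^{\otimes\Lambda}(d\omega_\Lambda)}{\int e^{-H_\Lambda(\omega_\Lambda\eta_{\Lambda^c})}\lambda^{\otimes\Lambda}(d\omega_\Lambda)}$.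 For a specification $\gamma$, $\mathcal{G}(\gamma)$ is its set of Gibbs measures (solutions of the DLR equation), $\mathcal{G}_\theta(\gamma)$ the translation-invariant ones, $\operatorname{ex}$ denotes extreme points. Continuous symmetry breaking: with $\eta_\varphi$ the configuration constantly equal to $\varphi\in S^1$, the weak limits $\mu_\varphi=\lim_{\Lambda\nearrow G}\gamma^\Phi_\Lambda(\cdot|\eta_\varphi)$ exist, $\operatorname{ex}\mathcal{G}_\theta(\gamma^\Phi)=\{\mu_\varphi:\varphi\in S^1\}$, and $\mu_\varphi\ne\mu_\psi$ for $\varphi\neq\psi$. Discretization. $T:[0,2\pi)\to\{1,\dots,q\}$, $T(\varphi)=k$ iff $2\pi(k-1)/q\le\varphi<2\pi k/q$, extended sitewise to $T:\Omega\to\Omega'=\{1,\dots,q\}^G$; $S_a=T^{-1}(a)\subset S^1$. For $\omega'\in\Omega'$ let $\gamma^{\omega'}_\Lambda(\varphi|\omega)=\gamma^\Phi_\Lambda(\varphi 1_{\omega'_\Lambda}|\omega)/\gamma^\Phi_\Lambda(1_{\omega'_\Lambda}|\omega)$ be the specification constrained to $\Omega^{\omega'}=\prod_{i}S_{\omega'_i}$, where $1_{\omega'_\Lambda}$ is the indicator of $\{T(\omega_j)=\omega'_j\ \forall j\in\Lambda\}$. For $i\ne j$ put $\bar C_{ij}=\sup_{\omega'}\sup\|\gamma^{\omega'}_i(\cdot|_i\,|\omega)-\gamma^{\omega'}_i(\cdot|_i\,|\tilde\omega)\|_i$, the inner supremum over $\omega,\tilde\omega\in\Omega^{\omega'}$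 agreeing off $j$; here $\cdot|_i$ is the marginal at site $i$ and $\|\cdot\|_i$ total variation distance; $\bar C_{ii}=0$; $\bar c=\sup_i\sum_j\bar C_{ij}$. For finite (possibly empty) $\Lambda$ let $\mu_{G\setminus\Lambda}[\omega'_{G\setminus\Lambda}]$ be the unique Gibbs measure on $\prod_{j\in G\setminus\Lambda}S_{\omega'_j}$ for the system on $G\setminus\Lambda$ constrained to $\omega'_{G\setminus\Lambda}$ in which all $\Phi_A$ with $A\cap\Lambda\ne\varnothing$ are set to zero (a priori measure $\lambda$ restricted to the $S_{\omega'_j}$); for $\Lambda=\varnothing$, $\mu_G[\omega']$ is the unique Gibbs measure of $\gamma^{\omega'}$. The specification $\gamma'$ on $\Omega'$ is $\gamma'_\Lambda(\omega'_\Lambda|\omega'_{G\setminus\Lambda})=\frac{\mu_{G\setminus\Lambda}[\omega'_{G\setminus\Lambda}](\lambda^{\Lambda}(e^{-H_\Lambda}1_{\omega'_\Lambda}))}{\mu_{G\setminus\Lambda}[\omega'_{G\setminus\Lambda}](\lambda^{\Lambda}(e^{-H_\Lambda}))}$ for finite $\Lambda$, where $\lambda^\Lambda(\cdot)$ denotes integration of the spins in $\Lambda$ against $\lambda^{\otimes\Lambda}$. *)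

theory Defs
  imports "HOL-Probability.Probability" "HOL-Library.Real_Mod"
begin

section \<open>Spins and configurations\<close>

type_synonym 'd site = "int ^ 'd"
type_synonym 'd config = "'d site \<Rightarrow> real"
type_synonym 'd dconfig = "'d site \<Rightarrow> nat"

text \<open>Angles are represented by their representatives in \<open>[0, 2\<pi>)\<close>. The topology is that of the
  circle (pulled back along \<open>\<phi> \<mapsto> e\<^sup>i\<^sup>\<phi>\<close>), not the one of the half-open interval.\<close>

definition S1 :: "real set"
  where "S1 = {0..<2 * pi}"

definition circle_measure :: "real measure"
  where "circle_measure = restrict_space lborel S1"

definition circle_topology :: "real topology"
  where "circle_topology = pullback_topology S1 cis euclidean"

text \<open>Configurations on a set of sites \<open>V\<close> are extensional functions on \<open>V\<close>. Only the
  \<open>\<sigma>\<close>-algebra of the following product over \<open>V\<close> is used when \<open>V\<close> is infinite.\<close>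

definition cfg_space :: "'d::finite site set \<Rightarrow> 'd config measure"
  where "cfg_space V = PiM V (\<lambda>_. circle_measure)"

abbreviation Omega :: "'d::finite config set"
  where "Omega \<equiv> UNIV \<rightarrow>\<^sub>E S1"

definition dcfg_space :: "nat \<Rightarrow> 'd::finite dconfig measure"
  where "dcfg_space q = PiM UNIV (\<lambda>_. count_space {1..q})"

definition shift :: "'d::finite site \<Rightarrow> ('d site \<Rightarrow> 'a) \<Rightarrow> 'd site \<Rightarrow> 'a"
  where "shift x \<omega> = (\<lambda>i. \<omega> (i - x))"

section \<open>Potentials\<close>

text \<open>Only the values \<open>\<Phi> A \<omega>\<close> with \<open>A\<close> finite and \<open>\<omega> \<in> Omega\<close> matter.\<close>

type_synonym 'd potential = "'d site set \<Rightarrow> 'd config \<Rightarrow> real"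

definition is_potential :: "'d::finite potential \<Rightarrow> bool"
  where "is_potential \<Phi> \<longleftrightarrow> (\<forall>A. finite A \<longrightarrow>
     \<Phi> A \<in> borel_measurable (cfg_space UNIV) \<and>
     (\<forall>\<omega>\<in>Omega. \<forall>\<omega>'\<in>Omega. (\<forall>i\<in>A. \<omega> i = \<omega>' i) \<longrightarrow> \<Phi> A \<omega> = \<Phi> A \<omega>'))"

definition absolutely_summable :: "'d::finite potential \<Rightarrow> bool"
  where "absolutely_summable \<Phi> \<longleftrightarrow> (\<forall>i.
     (\<Sum>\<^sub>\<infinity>A\<in>{A. finite A \<and> i \<in> A}. SUP \<omega>\<in>Omega. ennreal \<bar>\<Phi> A \<omega>\<bar>) < \<infinity>)"

definition translation_invariant :: "'d::finite potential \<Rightarrow> bool"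
  where "translation_invariant \<Phi> \<longleftrightarrow> (\<forall>A x. finite A \<longrightarrow>
     (\<forall>\<omega>\<in>Omega. \<Phi> ((+) x ` A) (shift x \<omega>) = \<Phi> A \<omega>))"

definition rotation_invariant :: "'d::finite potential \<Rightarrow> bool"
  where "rotation_invariant \<Phi> \<longleftrightarrow> (\<forall>A \<alpha>. finite A \<longrightarrow>
     (\<forall>\<omega>\<in>Omega. \<Phi> A (\<lambda>i. (\<omega> i + \<alpha>) rmod (2 * pi)) = \<Phi> A \<omega>))"

section \<open>Specifications and Gibbs measures\<close>

type_synonym ('d, 'a) spec = "'d site set \<Rightarrow> ('d site \<Rightarrow> 'a) \<Rightarrow> ('d site \<Rightarrow> 'a) measure"

text \<open>The set of Gibbs measures of a specification for the system on the sites \<open>V\<close>, whose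
  configurations carry the \<open>\<sigma>\<close>-algebra of \<open>M\<close>.\<close>

definition gibbs_measures ::
    "'d::finite site set \<Rightarrow> ('d site \<Rightarrow> 'a) measure \<Rightarrow> ('d, 'a) spec \<Rightarrow> ('d site \<Rightarrow> 'a) measure set"
  where "gibbs_measures V M \<gamma> = {\<mu>. prob_space \<mu> \<and> sets \<mu> = sets M \<and>
     (\<forall>\<Lambda>. finite \<Lambda> \<and> \<Lambda> \<subseteq> V \<longrightarrow>
        (\<forall>B\<in>sets M. emeasure \<mu> B = (\<integral>\<^sup>+\<eta>. emeasure (\<gamma> \<Lambda> \<eta>) B \<partial>\<mu>)))}"

definition ti_gibbs_measures ::
    "('d::finite site \<Rightarrow> 'a) measure \<Rightarrow> ('d, 'a) spec \<Rightarrow> ('d site \<Rightarrow> 'a) measure set"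
  where "ti_gibbs_measures M \<gamma> =
     {\<mu> \<in> gibbs_measures UNIV M \<gamma>. \<forall>x. distr \<mu> M (shift x) = \<mu>}"

definition extreme_measures :: "'b measure set \<Rightarrow> 'b measure set"
  where "extreme_measures \<G> = {\<mu> \<in> \<G>. \<forall>\<nu>\<^sub>1\<in>\<G>. \<forall>\<nu>\<^sub>2\<in>\<G>. \<forall>t::real. 0 < t \<and> t < 1 \<and>
     (\<forall>B\<in>sets \<mu>. measure \<mu> B = t * measure \<nu>\<^sub>1 B + (1 - t) * measure \<nu>\<^sub>2 B) \<longrightarrow>
     \<nu>\<^sub>1 = \<mu> \<and> \<nu>\<^sub>2 = \<mu>}"

section \<open>The continuous model\<close>

text \<open>Hamiltonian of the system on the sites \<open>V\<close>, with all \<open>\<Phi> A\<close> with \<open>A \<not>\<subseteq> V\<close> set to zero.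
  Since \<open>\<Phi> A\<close> is a function on \<open>Omega\<close>, a configuration on \<open>V\<close> is extended to all sites;
  the spin value \<open>0\<close> used for this is irrelevant, because \<open>\<Phi> A\<close> only depends on the
  coordinates in \<open>A \<subseteq> V\<close>. For \<open>V = UNIV\<close> this is the usual Hamiltonian.\<close>

definition hamiltonian ::
    "'d::finite site set \<Rightarrow> 'd potential \<Rightarrow> 'd site set \<Rightarrow> 'd config \<Rightarrow> real"
  where "hamiltonian V \<Phi> \<Lambda> \<omega> =
     (\<Sum>\<^sub>\<infinity>A\<in>{A. finite A \<and> A \<subseteq> V \<and> A \<inter> \<Lambda> \<noteq> {}}. \<Phi> A (merge V (- V) (\<omega>, \<lambda>_. 0)))"

definition boltzmann_measure ::
    "'d::finite site set \<Rightarrow> 'd potential \<Rightarrow> 'd site set \<Rightarrow> 'd config \<Rightarrow> 'd config measure"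
  where "boltzmann_measure V \<Phi> \<Lambda> \<eta> =
     density (distr (PiM \<Lambda> (\<lambda>_. circle_measure)) (cfg_space V) (\<lambda>\<xi>. merge \<Lambda> (V - \<Lambda>) (\<xi>, \<eta>)))
       (\<lambda>\<omega>. ennreal (exp (- hamiltonian V \<Phi> \<Lambda> \<omega>)))"

definition gibbs_spec :: "'d::finite site set \<Rightarrow> 'd potential \<Rightarrow> ('d, real) spec"
  where "gibbs_spec V \<Phi> \<Lambda> \<eta> =
     scale_measure (1 / emeasure (boltzmann_measure V \<Phi> \<Lambda> \<eta>) (space (cfg_space V)))
       (boltzmann_measure V \<Phi> \<Lambda> \<eta>)"

text \<open>Weak convergence of measures on \<open>Omega\<close> along \<open>\<Lambda> \<nearrow> \<int>\<^sup>d\<close>, the limit being taken along the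
  net of all finite \<open>\<Lambda>\<close> directed by inclusion. Continuous functions are automatically bounded
  here, as the configuration space is compact.\<close>

definition weak_limit ::
    "('d::finite site set \<Rightarrow> 'd config measure) \<Rightarrow> 'd config measure \<Rightarrow> bool"
  where "weak_limit \<nu> \<mu> \<longleftrightarrow> prob_space \<mu> \<and> sets \<mu> = sets (cfg_space UNIV) \<and>
     (\<forall>f. continuous_map (product_topology (\<lambda>_. circle_topology) UNIV) euclideanreal f \<longrightarrow>
        ((\<lambda>\<Lambda>. integral\<^sup>L (\<nu> \<Lambda>) f) \<longlongrightarrow> integral\<^sup>L \<mu> f) (finite_subsets_at_top UNIV))"

definition continuous_symmetry_breaking :: "'d::finite potential \<Rightarrow> bool"
  where "continuous_symmetry_breaking \<Phi> \<longleftrightarrow> (\<exists>\<mu>.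
     (\<forall>\<phi>\<in>S1. weak_limit (\<lambda>\<Lambda>. gibbs_spec UNIV \<Phi> \<Lambda> (\<lambda>_. \<phi>)) (\<mu> \<phi>)) \<and>
     extreme_measures (ti_gibbs_measures (cfg_space UNIV) (gibbs_spec UNIV \<Phi>)) = \<mu> ` S1 \<and>
     inj_on \<mu> S1)"

section \<open>Discretization\<close>

definition discr :: "nat \<Rightarrow> real \<Rightarrow> nat"
  where "discr q \<phi> = (THE k. k \<in> {1..q} \<and>
     2 * pi * (real k - 1) / real q \<le> \<phi> \<and> \<phi> < 2 * pi * real k / real q)"

definition discr_cfg :: "nat \<Rightarrow> 'd::finite config \<Rightarrow> 'd dconfig"
  where "discr_cfg q \<omega> = (\<lambda>i. discr q (\<omega> i))"

definition spin_arc :: "nat \<Rightarrow> nat \<Rightarrow> real set"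
  where "spin_arc q a = {\<phi> \<in> S1. discr q \<phi> = a}"

definition discr_measure :: "nat \<Rightarrow> 'd::finite config measure \<Rightarrow> 'd dconfig measure"
  where "discr_measure q \<mu> = distr \<mu> (dcfg_space q) (discr_cfg q)"

section \<open>Constrained systems\<close>

definition constrained_spec ::
    "'d::finite site set \<Rightarrow> 'd potential \<Rightarrow> nat \<Rightarrow> 'd dconfig \<Rightarrow> ('d, real) spec"
  where "constrained_spec V \<Phi> q \<omega>' \<Lambda> \<eta> =
     uniform_measure (gibbs_spec V \<Phi> \<Lambda> \<eta>)
       {\<omega> \<in> space (cfg_space V). \<forall>j\<in>\<Lambda>. discr q (\<omega> j) = \<omega>' j}"

text \<open>The unique Gibbs measure \<open>\<mu>\<^sub>V[\<omega>'\<^sub>V]\<close> of the system on \<open>V\<close> constrained to \<open>\<omega>'\<^sub>V\<close>; it is a measure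
  on all configurations on \<open>V\<close> carried by the constrained ones. As conditioning on
  \<open>T(\<omega>\<^sub>j) = \<omega>'\<^sub>j\<close> for \<open>j \<in> \<Lambda>\<close> amounts to restricting the a priori measures to the arcs,
  \<open>constrained_spec\<close> covers also the case \<open>V = - \<Lambda>\<close>.\<close>

definition constrained_gibbs ::
    "'d::finite site set \<Rightarrow> 'd potential \<Rightarrow> nat \<Rightarrow> 'd dconfig \<Rightarrow> 'd config measure"
  where "constrained_gibbs V \<Phi> q \<omega>' = (THE \<mu>.
     \<mu> \<in> gibbs_measures V (cfg_space V) (constrained_spec V \<Phi> q \<omega>') \<and>
     (AE \<omega> in \<mu>. \<omega> \<in> (\<Pi>\<^sub>E i\<in>V. spin_arc q (\<omega>' i))))"

definition tv_dist :: "'b measure \<Rightarrow> 'b measure \<Rightarrow> ennreal"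
  where "tv_dist \<mu> \<nu> = (SUP B\<in>sets \<mu>. ennreal \<bar>measure \<mu> B - measure \<nu> B\<bar>)"

definition site_marginal :: "'d::finite site \<Rightarrow> 'd config measure \<Rightarrow> real measure"
  where "site_marginal i \<mu> = distr \<mu> circle_measure (\<lambda>\<omega>. \<omega> i)"

definition C_bar :: "'d::finite potential \<Rightarrow> nat \<Rightarrow> 'd site \<Rightarrow> 'd site \<Rightarrow> ennreal"
  where "C_bar \<Phi> q i j = (if i = j then 0 else
     (SUP \<omega>' \<in> UNIV \<rightarrow>\<^sub>E {1..q}.
      SUP (\<omega>, \<eta>) \<in> {(\<omega>, \<eta>). \<omega> \<in> (\<Pi>\<^sub>E k\<in>UNIV. spin_arc q (\<omega>' k)) \<and> \<eta> \<in> (\<Pi>\<^sub>E k\<in>UNIV. spin_arc q (\<omega>' k)) \<and>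
                              (\<forall>k. k \<noteq> j \<longrightarrow> \<omega> k = \<eta> k)}.
        tv_dist (site_marginal i (constrained_spec UNIV \<Phi> q \<omega>' {i} \<omega>))
                (site_marginal i (constrained_spec UNIV \<Phi> q \<omega>' {i} \<eta>))))"

definition c_bar :: "'d::finite potential \<Rightarrow> nat \<Rightarrow> ennreal"
  where "c_bar \<Phi> q = (SUP i. \<Sum>\<^sub>\<infinity>j\<in>UNIV. C_bar \<Phi> q i j)"

section \<open>The discretized specification\<close>

text \<open>\<open>\<mu>\<^sub>G\<^sub>\<setminus>\<^sub>\<Lambda>[\<omega>'](\<lambda>\<^sup>\<Lambda>(e\<^sup>-\<^sup>H f))\<close> for a function \<open>f\<close> of the spins in \<open>\<Lambda>\<close>.\<close>

definition discr_weight ::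
    "'d::finite potential \<Rightarrow> nat \<Rightarrow> 'd site set \<Rightarrow> 'd dconfig \<Rightarrow> ('d config \<Rightarrow> real) \<Rightarrow> real"
  where "discr_weight \<Phi> q \<Lambda> \<omega>' f =
     (LINT \<eta>|constrained_gibbs (- \<Lambda>) \<Phi> q \<omega>'. LINT \<xi>|PiM \<Lambda> (\<lambda>_. circle_measure).
        exp (- hamiltonian UNIV \<Phi> \<Lambda> (merge \<Lambda> (- \<Lambda>) (\<xi>, \<eta>))) * f \<xi>)"

definition discr_prob ::
    "'d::finite potential \<Rightarrow> nat \<Rightarrow> 'd site set \<Rightarrow> 'd dconfig \<Rightarrow> 'd dconfig \<Rightarrow> real"
  where "discr_prob \<Phi> q \<Lambda> \<omega>' \<sigma> =
     discr_weight \<Phi> q \<Lambda> \<omega>' (indicator {\<xi>. \<forall>j\<in>\<Lambda>. discr q (\<xi> j) = \<sigma> j}) /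
     discr_weight \<Phi> q \<Lambda> \<omega>' (\<lambda>_. 1)"

definition discr_spec :: "'d::finite potential \<Rightarrow> nat \<Rightarrow> ('d, nat) spec"
  where "discr_spec \<Phi> q \<Lambda> \<omega>' =
     distr (point_measure (\<Lambda> \<rightarrow>\<^sub>E {1..q}) (\<lambda>\<sigma>. ennreal (discr_prob \<Phi> q \<Lambda> \<omega>' \<sigma>)))
       (dcfg_space q) (\<lambda>\<sigma>. merge \<Lambda> (- \<Lambda>) (\<sigma>, \<omega>'))"

definition lift_measure :: "'d::finite potential \<Rightarrow> nat \<Rightarrow> 'd dconfig measure \<Rightarrow> 'd config measure"
  where "lift_measure \<Phi> q \<mu>' = \<mu>' \<bind> constrained_gibbs UNIV \<Phi> q"

end

theory Submission imports Defs begin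

text \<open>
A Gibbs measure \<open>\<mu>\<close> of the continuous model, conditioned on its discretized image \<open>\<sigma>\<close>, is a Gibbs
measure of the system constrained to the arcs of \<open>\<sigma>\<close>. Since \<open>c_bar < 1\<close>, Dobrushin's criterion leaves
exactly one such measure, \<open>cgibbs \<sigma>\<close>, so \<open>\<mu>\<close> is the mixture of the \<open>cgibbs \<sigma>\<close> with respect to its
image (\<open>gibbs_disintegration\<close>, \<open>lift_discr\<close>). Conversely \<open>cgibbs \<sigma>\<close> is carried by the configurations
with discretization \<open>\<sigma>\<close>, so the image of a mixture is the mixing measure (\<open>discr_lift\<close>). The
discretization and the kernel are therefore inverse to each other once both map Gibbs measures to
Gibbs measures (\<open>discr_measure_gibbs\<close>, \<open>lift_measure_gibbs\<close>). Both maps are affine and the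
discretization commutes with translations, hence the bijection restricts to the extreme points of
the translation-invariant Gibbs measures.

The DLR equations are used in an equivalent form without normalizing constants: for each site \<open>i\<close>,
weighting \<open>\<mu>\<close> with \<open>e^H\<close>, where \<open>H\<close> is the Hamiltonian of \<open>i\<close>, makes averaging the spin at \<open>i\<close> over
its a priori measure neutral (\<open>local_gibbs\<close>, \<open>gibbs_measures_iff_local\<close>). These identities are linear
in \<open>\<mu>\<close>, imply those for finite sets of sites, and survive the removal and the addition of sites.

One estimate carries existence, uniqueness, measurability and disintegration
(\<open>local_event_approx\<close>). Let the spins at finitely many sites be averaged one after the other, each
over its conditional distribution given the other spins and its own arc. If the sites are chosen
well, this turns the indicator of a local event into a function that is almost constant on every
fibre of the discretization, while its mean does not change under any measure that satisfies the
single-site identities at these sites. Two constrained Gibbs measures on the same fibre therefore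
agree, finite-volume distributions converge in total variation on each finite set of sites, and a
Gibbs measure of the unconstrained model gives a local event its mean constrained probability.

The kernels of the discretized specification involve the constrained system on the complement of
\<open>\<Lambda>\<close>. Its Gibbs measure is obtained from \<open>cgibbs \<sigma>\<close> by weighting with \<open>e^H\<close>, \<open>H\<close> being the
Hamiltonian of \<open>\<Lambda>\<close>, and forgetting the spins in \<open>\<Lambda>\<close> (\<open>local_gibbs_cut\<close>); that there is no other one
follows by adding the sites in \<open>\<Lambda>\<close> back one at a time (\<open>local_gibbs_glue\<close>). As a consequence the
discretized specification gives \<open>\<sigma>\<close> a probability proportional to the inverse of the mean of \<open>e^H\<close>
under \<open>cgibbs \<sigma>\<close> (\<open>discr_prob_eq\<close>), and this is what the two proofs of the Gibbs property use.
\<close>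

section \<open>Limits of measures\<close>

text \<open>Uniformity over all measurable sets makes the limit set function continuous at the empty set,
  hence countably additive.\<close>

lemma tv_cauchy_limit:
  fixes M :: "nat \<Rightarrow> 'a measure"
  assumes prob: "\<And>n. prob_space (M n)" and sets: "\<And>n. sets (M n) = sets N"
    and cauchy: "\<And>e. e > 0 \<Longrightarrow> \<exists>n0. \<forall>m\<ge>n0. \<forall>n\<ge>n0. \<forall>B\<in>sets N. \<bar>measure (M m) B - measure (M n) B\<bar> \<le> e"
  shows "\<exists>L. prob_space L \<and> sets L = sets N \<and> (\<forall>B\<in>sets N. (\<lambda>n. measure (M n) B) \<longlonglongrightarrow> measure L B)"
proof -
  interpret prob_space "M n" for n by (rule prob)
  define l where "l B = lim (\<lambda>n. measure (M n) B)" for B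
  have lim: "(\<lambda>n. measure (M n) B) \<longlonglongrightarrow> l B" if "B \<in> sets N" for B
  proof -
    have "Cauchy (\<lambda>n. measure (M n) B)"
    proof (rule metric_CauchyI)
      fix e :: real assume "0 < e"
      then obtain n0 where "\<forall>m\<ge>n0. \<forall>n\<ge>n0. \<forall>B\<in>sets N. \<bar>measure (M m) B - measure (M n) B\<bar> \<le> e / 2"
        using cauchy[of "e / 2"] by auto
      then show "\<exists>n0. \<forall>m\<ge>n0. \<forall>n\<ge>n0. dist (measure (M m) B) (measure (M n) B) < e"
        using that \<open>0 < e\<close> by (intro exI[of _ n0]) (fastforce simp: dist_real_def)
    qed
    then show ?thesis
      unfolding l_def using Cauchy_convergent_iff convergent_LIMSEQ_iff by blast
  qed
  have unif: "\<exists>n. \<forall>B\<in>sets N. \<bar>l B - measure (M n) B\<bar> \<le> e" if e: "e > 0" for e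
  proof -
    from cauchy[OF e] obtain n0
      where n0: "\<forall>m\<ge>n0. \<forall>n\<ge>n0. \<forall>B\<in>sets N. \<bar>measure (M m) B - measure (M n) B\<bar> \<le> e" by blast
    have "\<bar>l B - measure (M n0) B\<bar> \<le> e" if B: "B \<in> sets N" for B
    proof (rule LIMSEQ_le_const2)
      show "(\<lambda>n. \<bar>measure (M n) B - measure (M n0) B\<bar>) \<longlonglongrightarrow> \<bar>l B - measure (M n0) B\<bar>"
        by (intro tendsto_intros lim B)
    qed (use n0 B in blast)
    then show ?thesis by blast
  qed
  have l0: "0 \<le> l B" if "B \<in> sets N" for B
    by (rule LIMSEQ_le_const[OF lim[OF that]]) auto
  have pos: "positive (sets N) (\<lambda>B. ennreal (l B))"
    by (simp add: positive_def l_def)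
  have add: "additive (sets N) (\<lambda>B. ennreal (l B))"
    unfolding additive_def
  proof (intro ballI impI)
    fix x y assume xy: "x \<in> sets N" "y \<in> sets N" "x \<inter> y = {}"
    have "(\<lambda>n. measure (M n) (x \<union> y)) \<longlonglongrightarrow> l x + l y"
      using xy by (subst finite_measure_Union) (auto intro!: tendsto_intros lim simp: sets)
    with lim[of "x \<union> y"] xy have "l (x \<union> y) = l x + l y"
      by (intro LIMSEQ_unique) auto
    then show "ennreal (l (x \<union> y)) = ennreal (l x) + ennreal (l y)"
      using l0 xy by simp
  qed
  have ca: "countably_additive (sets N) (\<lambda>B. ennreal (l B))"
  proof (rule sets.empty_continuous_imp_countably_additive[OF pos add])
    fix A :: "nat \<Rightarrow> 'a set"
    assume A: "range A \<subseteq> sets N" "decseq A" "(\<Inter>i. A i) = {}"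
    have "(\<lambda>i. l (A i)) \<longlonglongrightarrow> 0"
    proof (rule LIMSEQ_I)
      fix e :: real assume e: "0 < e"
      with unif[of "e / 2"] obtain n where n: "\<forall>B\<in>sets N. \<bar>l B - measure (M n) B\<bar> \<le> e / 2" by auto
      have "(\<lambda>i. measure (M n) (A i)) \<longlonglongrightarrow> measure (M n) (\<Inter>i. A i)"
        using A by (intro finite_Lim_measure_decseq) (auto simp: sets)
      then have "(\<lambda>i. measure (M n) (A i)) \<longlonglongrightarrow> 0" by (simp add: A(3))
      from LIMSEQ_D[OF this, of "e / 2"] e obtain k
        where k: "\<And>i. i \<ge> k \<Longrightarrow> measure (M n) (A i) < e / 2" by auto
      have "norm (l (A i) - 0) < e" if "i \<ge> k" for i
      proof -
        have "A i \<in> sets N" using A by auto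
        with n l0 have "\<bar>l (A i) - measure (M n) (A i)\<bar> \<le> e / 2" "0 \<le> l (A i)" by auto
        with k[OF that] show ?thesis unfolding real_norm_def by linarith
      qed
      then show "\<exists>k. \<forall>i\<ge>k. norm (l (A i) - 0) < e" by blast
    qed
    then show "(\<lambda>i. ennreal (l (A i))) \<longlonglongrightarrow> 0"
      using tendsto_ennrealI by fastforce
  qed auto
  define L where "L = measure_of (space N) (sets N) (\<lambda>B. ennreal (l B))"
  have sL: "sets L = sets N" and spL: "space L = space N"
    by (simp_all add: L_def)
  have eL: "emeasure L B = ennreal (l B)" if "B \<in> sets N" for B
    unfolding L_def by (rule emeasure_measure_of_sigma[OF sets.sigma_algebra_axioms pos ca that])
  have mL: "measure L B = l B" if "B \<in> sets N" for B
    using eL[OF that] l0[OF that] by (simp add: measure_def)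
  have "(\<lambda>n. measure (M n) (space N)) \<longlonglongrightarrow> 1"
    using prob_space sets_eq_imp_space_eq[OF sets] by simp
  then have "l (space N) = 1"
    using lim[of "space N"] LIMSEQ_unique by blast
  then have "prob_space L"
    by (intro prob_spaceI) (simp add: spL eL)
  then show ?thesis using sL mL lim by (intro exI[of _ L]) auto
qed

text \<open>Up to \<open>1 / k\<close>, a function with values in \<open>[0, 1]\<close> is the mean of the indicators of its
  superlevel sets at \<open>1/k, \<dots>, k/k\<close>, so its integral is almost a finite sum of probabilities.\<close>

lemma measure_tendsto_imp_integral_tendsto:
  fixes M :: "nat \<Rightarrow> 'a measure" and g :: "'a \<Rightarrow> real"
  assumes M: "\<And>n. prob_space (M n)" "\<And>n. sets (M n) = sets N" and L: "prob_space L" "sets L = sets N"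
    and g[measurable]: "g \<in> borel_measurable N" and g01: "\<And>x. x \<in> space N \<Longrightarrow> 0 \<le> g x \<and> g x \<le> 1"
    and lim: "\<And>c. (\<lambda>n. measure (M n) {x \<in> space N. c \<le> g x}) \<longlonglongrightarrow> measure L {x \<in> space N. c \<le> g x}"
  shows "(\<lambda>n. integral\<^sup>L (M n) g) \<longlonglongrightarrow> integral\<^sup>L L g"
proof (rule LIMSEQ_I)
  fix e :: real assume e: "0 < e"
  then obtain k :: nat where k: "k > 0" "1 / real k < e / 3"
    using nat_approx_posE[of "e / 3"] by (metis divide_pos_pos zero_less_numeral zero_less_Suc)
  define s where "s P = (\<Sum>m=1..k. measure P {x \<in> space N. real m / real k \<le> g x}) / real k" for P :: "'a measure"
  have approx: "\<bar>integral\<^sup>L P g - s P\<bar> \<le> 1 / real k" if P: "prob_space P" "sets P = sets N" for P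
  proof -
    interpret prob_space P by fact
    have [measurable_cong]: "sets P = sets N" by fact
    have sp: "space P = space N" by (rule sets_eq_imp_space_eq) fact
    define h where "h x = (\<Sum>m=1..k. indicator {x \<in> space N. real m / real k \<le> g x} x) / real k" for x
    have [measurable]: "h \<in> borel_measurable N" unfolding h_def by measurable
    have h: "\<bar>g x - h x\<bar> \<le> 1 / real k" if x: "x \<in> space N" for x
    proof -
      have "(\<Sum>m=1..k. indicator {x \<in> space N. real m / real k \<le> g x} x) =
          real (card {m \<in> {1..k}. real m / real k \<le> g x})"
        using x by (simp add: indicator_def sum.If_cases Int_def cong: conj_cong)
      also have "{m \<in> {1..k}. real m / real k \<le> g x} = {1..nat \<lfloor>real k * g x\<rfloor>}"
      proof -
        have "real m / real k \<le> g x \<longleftrightarrow> m \<le> nat \<lfloor>real k * g x\<rfloor>" if "m \<ge> 1" for m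
        proof -
          have "real m / real k \<le> g x \<longleftrightarrow> real m \<le> real k * g x"
            using k by (simp add: divide_le_eq mult.commute)
          also have "\<dots> \<longleftrightarrow> int m \<le> \<lfloor>real k * g x\<rfloor>" by (simp add: le_floor_iff)
          also have "\<dots> \<longleftrightarrow> m \<le> nat \<lfloor>real k * g x\<rfloor>" using that by linarith
          finally show ?thesis .
        qed
        moreover have "nat \<lfloor>real k * g x\<rfloor> \<le> k"
        proof -
          have "real k * g x \<le> real k" using g01[OF x] by (simp add: mult_left_le)
          then have "\<lfloor>real k * g x\<rfloor> \<le> int k" by linarith
          then show ?thesis by simp
        qed
        ultimately show ?thesis by auto
      qed
      finally have hx: "h x = real (nat \<lfloor>real k * g x\<rfloor>) / real k" by (simp add: h_def)
      have "0 \<le> real k * g x" using g01[OF x] by simp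
      then have "real (nat \<lfloor>real k * g x\<rfloor>) = of_int \<lfloor>real k * g x\<rfloor>" by simp
      then have "\<bar>real k * g x - real (nat \<lfloor>real k * g x\<rfloor>)\<bar> \<le> 1" by linarith
      then have "\<bar>(real k * g x - real (nat \<lfloor>real k * g x\<rfloor>)) / real k\<bar> \<le> 1 / real k"
        using k by (simp add: divide_right_mono abs_divide)
      then show ?thesis using k by (simp add: hx diff_divide_distrib)
    qed
    have ig: "integrable P g"
      by (rule integrable_const_bound[of _ 1]) (use g01 sp in \<open>auto intro!: AE_I2 simp: abs_if dest!: g01\<close>)
    have ih: "integrable P h"
      unfolding h_def by (intro integrable_divide integrable_sum integrable_real_indicator) (auto simp: less_top[symmetric])
    have "integral\<^sup>L P h = s P"
      unfolding h_def s_def by (simp add: less_top[symmetric] sp Int_def cong: conj_cong)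
    then have "\<bar>integral\<^sup>L P g - s P\<bar> = \<bar>\<integral>x. g x - h x \<partial>P\<bar>"
      using ig ih by simp
    also have "\<dots> \<le> (\<integral>x. \<bar>g x - h x\<bar> \<partial>P)" by (rule integral_abs_bound)
    also have "\<dots> \<le> (\<integral>x. 1 / real k \<partial>P)"
      using ig ih h sp by (intro integral_mono) auto
    finally show ?thesis by (simp add: prob_space)
  qed
  have "(\<lambda>n. s (M n)) \<longlonglongrightarrow> s L"
    unfolding s_def by (intro tendsto_intros lim) (use k in auto)
  from LIMSEQ_D[OF this, of "e / 3"] e obtain n0 where n0: "\<And>n. n \<ge> n0 \<Longrightarrow> norm (s (M n) - s L) < e / 3" by auto
  have "norm (integral\<^sup>L (M n) g - integral\<^sup>L L g) < e" if "n \<ge> n0" for n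
  proof -
    have "\<bar>integral\<^sup>L (M n) g - s (M n)\<bar> < e / 3" "\<bar>integral\<^sup>L L g - s L\<bar> < e / 3" "\<bar>s (M n) - s L\<bar> < e / 3"
      using approx[OF M(1,2), of n] approx[OF L] n0[OF that] k by auto
    then show ?thesis unfolding real_norm_def by linarith
  qed
  then show "\<exists>n0. \<forall>n\<ge>n0. norm (integral\<^sup>L (M n) g - integral\<^sup>L L g) < e" by blast
qed

section \<open>Arcs\<close>

text \<open>The index is \<open>\<lfloor>\<phi> q / 2\<pi>\<rfloor> + 1\<close>, so the description in \<open>discr\<close> is definite.\<close>

lemma discr_iff:
  assumes q: "q \<ge> 1" and \<phi>: "\<phi> \<in> S1"
  shows "discr q \<phi> = k \<longleftrightarrow> k \<in> {1..q} \<and> 2 * pi * (real k - 1) / real q \<le> \<phi> \<and> \<phi> < 2 * pi * real k / real q"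
proof -
  define m where "m = nat \<lfloor>\<phi> * real q / (2 * pi)\<rfloor> + 1"
  have q0: "0 < real q" using q by simp
  have \<phi>0: "0 \<le> \<phi>" "\<phi> < 2 * pi" using \<phi> by (auto simp: S1_def)
  have iff: "k \<in> {1..q} \<and> 2 * pi * (real k - 1) / real q \<le> \<phi> \<and> \<phi> < 2 * pi * real k / real q \<longleftrightarrow> k = m" for k
  proof -
    define x where "x = \<phi> * real q / (2 * pi)"
    have x0: "0 \<le> x" "x < real q" using \<phi>0 q0 by (auto simp: x_def field_simps)
    have "2 * pi * (real k - 1) / real q \<le> \<phi> \<longleftrightarrow> real k - 1 \<le> x"
      using q0 by (simp add: x_def field_simps)
    moreover have "\<phi> < 2 * pi * real k / real q \<longleftrightarrow> x < real k"
      using q0 by (simp add: x_def field_simps)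
    moreover have "k \<in> {1..q} \<and> real k - 1 \<le> x \<and> x < real k \<longleftrightarrow> k = nat \<lfloor>x\<rfloor> + 1"
    proof
      assume a: "k \<in> {1..q} \<and> real k - 1 \<le> x \<and> x < real k"
      then have "\<lfloor>x\<rfloor> = int k - 1" by (intro floor_unique) auto
      then show "k = nat \<lfloor>x\<rfloor> + 1" using a by auto
    next
      assume k: "k = nat \<lfloor>x\<rfloor> + 1"
      have "real (nat \<lfloor>x\<rfloor>) = of_int \<lfloor>x\<rfloor>" using x0 by simp
      then have "real k - 1 \<le> x" "x < real k" using k by linarith+
      moreover have "k \<le> q" using \<open>real k - 1 \<le> x\<close> x0 by linarith
      ultimately show "k \<in> {1..q} \<and> real k - 1 \<le> x \<and> x < real k" using k by auto
    qed
    ultimately show ?thesis by (simp add: m_def x_def)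
  qed
  have "discr q \<phi> = m" unfolding discr_def iff by simp
  then show ?thesis using iff[of k] by auto
qed

lemma discr_in: "q \<ge> 1 \<Longrightarrow> \<phi> \<in> S1 \<Longrightarrow> discr q \<phi> \<in> {1..q}"
  using discr_iff by blast

lemma spin_arc_eq:
  assumes "q \<ge> 1" "a \<in> {1..q}"
  shows "spin_arc q a = {2 * pi * (real a - 1) / real q ..< 2 * pi * real a / real q}"
proof -
  have "2 * pi * real a / real q \<le> 2 * pi"
    using assms by (simp add: field_simps)
  moreover have "0 \<le> 2 * pi * (real a - 1) / real q" using assms by simp
  ultimately have "\<phi> \<in> S1" if "2 * pi * (real a - 1) / real q \<le> \<phi>" "\<phi> < 2 * pi * real a / real q" for \<phi>
    using that unfolding S1_def by auto
  then show ?thesis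
    unfolding spin_arc_def using discr_iff[OF assms(1), of _ a] assms(2) by fastforce
qed

lemma space_circle[simp]: "space circle_measure = S1"
  by (simp add: circle_measure_def space_restrict_space)

lemma sets_circle: "A \<in> sets circle_measure \<longleftrightarrow> A \<in> sets borel \<and> A \<subseteq> S1"
  by (auto simp: circle_measure_def sets_restrict_space_iff S1_def)

lemma S1_sets[measurable]: "S1 \<in> sets circle_measure" "S1 \<in> sets borel"
  by (auto simp: sets_circle S1_def)

lemma emeasure_circle: "A \<in> sets circle_measure \<Longrightarrow> emeasure circle_measure A = emeasure lborel A"
  unfolding circle_measure_def by (subst emeasure_restrict_space) (auto simp: S1_def sets_restrict_space_iff)

lemma emeasure_S1: "emeasure circle_measure S1 = ennreal (2 * pi)"
  by (simp add: emeasure_circle) (simp add: S1_def)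

lemma finite_circle: "finite_measure circle_measure"
  by (rule finite_measureI) (simp add: emeasure_S1)

lemma spin_arc_sets:
  assumes "q \<ge> 1" shows "spin_arc q a \<in> sets circle_measure"
proof (cases "a \<in> {1..q}")
  case True
  have "spin_arc q a \<subseteq> S1" by (auto simp: spin_arc_def)
  moreover have "spin_arc q a \<in> sets borel" by (simp add: spin_arc_eq[OF assms True])
  ultimately show ?thesis by (simp add: sets_circle)
next
  case False
  then have "spin_arc q a = {}" using discr_in[OF assms] by (auto simp: spin_arc_def)
  then show ?thesis by simp
qed

lemma emeasure_spin_arc:
  assumes "q \<ge> 1" "a \<in> {1..q}"
  shows "emeasure circle_measure (spin_arc q a) = ennreal (2 * pi / real q)"
proof -
  have "2 * pi * (real a - 1) / real q \<le> 2 * pi * real a / real q"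
    using assms by (intro divide_right_mono) auto
  moreover have "2 * pi * real a / real q - 2 * pi * (real a - 1) / real q = 2 * pi / real q"
    by (simp add: diff_divide_distrib algebra_simps)
  ultimately show ?thesis
    using emeasure_circle[OF spin_arc_sets[OF assms(1), of a]] by (simp add: spin_arc_eq[OF assms])
qed

lemma discr_measurable:
  assumes "q \<ge> 1" shows "discr q \<in> circle_measure \<rightarrow>\<^sub>M count_space {1..q}"
proof (rule measurable_count_space_eq2[THEN iffD2], simp, safe)
  fix a assume "a \<in> {1..q}"
  have "discr q -` {a} \<inter> space circle_measure = spin_arc q a" by (auto simp: spin_arc_def)
  then show "discr q -` {a} \<inter> space circle_measure \<in> sets circle_measure"
    using spin_arc_sets[OF assms] by simp
qed (use discr_in[OF assms] in auto)

section \<open>A priori measures\<close>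

text \<open>Normalizing the a priori measures does not change the specifications, where constant factors
  cancel, and turns averaging a spin into a Markov kernel.\<close>

definition apriori :: "real set \<Rightarrow> real measure"
  where "apriori A = uniform_measure circle_measure A"

definition admissible :: "real set \<Rightarrow> bool"
  where "admissible A \<longleftrightarrow> A \<in> sets circle_measure \<and> emeasure circle_measure A \<noteq> 0"

lemma sets_apriori[simp, measurable_cong]: "sets (apriori A) = sets circle_measure"
  and space_apriori[simp]: "space (apriori A) = S1"
  by (simp_all add: apriori_def)

lemma admissible_S1: "admissible S1"
  by (simp add: admissible_def emeasure_S1)

lemma admissible_arc: "q \<ge> 1 \<Longrightarrow> a \<in> {1..q} \<Longrightarrow> admissible (spin_arc q a)"
  by (simp add: admissible_def emeasure_spin_arc spin_arc_sets del: One_nat_def)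

lemma prob_space_apriori: "admissible A \<Longrightarrow> prob_space (apriori A)"
  unfolding apriori_def admissible_def
  by (intro prob_space_uniform_measure) (auto simp: finite_measure.emeasure_finite[OF finite_circle, simplified])

lemma nn_integral_apriori:
  assumes "f \<in> borel_measurable circle_measure" "A \<in> sets circle_measure"
  shows "(\<integral>\<^sup>+x. f x \<partial>apriori A) = (\<integral>\<^sup>+x. indicator A x * f x \<partial>circle_measure) / emeasure circle_measure A"
  unfolding apriori_def by (simp add: nn_integral_uniform_measure assms mult.commute)

lemma AE_apriori: "admissible A \<Longrightarrow> AE x in apriori A. x \<in> A"
  unfolding apriori_def admissible_def by (auto intro!: AE_uniform_measureI)

lemma ennreal_mult_cancel_divide:
  assumes "c \<noteq> 0" "c \<noteq> \<infinity>" "n \<noteq> (\<infinity>::ennreal)"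
  shows "c * s / (c * n) = s / n"
proof -
  have "c * s / (c * n) = (c / c) * (s / n)"
    using assms by (simp add: divide_ennreal_def ennreal_inverse_mult less_top ac_simps)
  then show ?thesis using assms by (simp add: ennreal_divide_self less_top)
qed

text \<open>All arcs have the same length, so the uniform distribution on the circle is the plain mean of
  those on the arcs.\<close>

lemma nn_integral_S1_arcs:
  assumes q: "q \<ge> 1" and f[measurable]: "f \<in> borel_measurable circle_measure"
  shows "(\<integral>\<^sup>+x. f x \<partial>apriori S1) = (\<Sum>a\<in>{1..q}. \<integral>\<^sup>+x. f x \<partial>apriori (spin_arc q a)) / of_nat q"
proof -
  note [measurable] = spin_arc_sets[OF q]
  have q0: "ennreal (2 * pi / real q) \<noteq> 0" "ennreal (2 * pi / real q) \<noteq> \<infinity>" using q by auto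
  have "(\<integral>\<^sup>+x. indicator S1 x * f x \<partial>circle_measure) =
    (\<integral>\<^sup>+x. (\<Sum>a\<in>{1..q}. indicator (spin_arc q a) x * f x) \<partial>circle_measure)"
  proof (rule nn_integral_cong)
    fix x assume "x \<in> space circle_measure"
    then have x: "x \<in> S1" by simp
    have "(\<Sum>a\<in>{1..q}. indicator (spin_arc q a) x * f x) = (\<Sum>a\<in>{1..q}. if a = discr q x then f x else 0)"
      using x by (intro sum.cong) (auto simp: spin_arc_def indicator_def)
    then show "indicator S1 x * f x = (\<Sum>a\<in>{1..q}. indicator (spin_arc q a) x * f x)"
      using x discr_in[OF q x] by simp
  qed
  also have "\<dots> = (\<Sum>a\<in>{1..q}. \<integral>\<^sup>+x. indicator (spin_arc q a) x * f x \<partial>circle_measure)"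
    by (rule nn_integral_sum) measurable
  also have "\<dots> = ennreal (2 * pi / real q) * (\<Sum>a\<in>{1..q}. \<integral>\<^sup>+x. f x \<partial>apriori (spin_arc q a))"
    unfolding sum_distrib_left
  proof (rule sum.cong[OF refl])
    fix a assume a: "a \<in> {1..q}"
    show "(\<integral>\<^sup>+x. indicator (spin_arc q a) x * f x \<partial>circle_measure) =
        ennreal (2 * pi / real q) * (\<integral>\<^sup>+x. f x \<partial>apriori (spin_arc q a))"
      using q0 unfolding nn_integral_apriori[OF f spin_arc_sets[OF q]] emeasure_spin_arc[OF q a]
      by (simp only: ennreal_times_divide mult.commute[of "ennreal (2 * pi / real q)"] mult_divide_eq_ennreal infinity_ennreal_def not_False_eq_True)
  qed
  finally have "(\<integral>\<^sup>+x. f x \<partial>apriori S1) =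
    ennreal (2 * pi / real q) * (\<Sum>a\<in>{1..q}. \<integral>\<^sup>+x. f x \<partial>apriori (spin_arc q a)) / ennreal (2 * pi)"
    by (simp add: nn_integral_apriori emeasure_S1)
  also have "ennreal (2 * pi) = ennreal (2 * pi / real q) * of_nat q"
    using q by (simp add: ennreal_of_nat_eq_real_of_nat ennreal_mult''[symmetric])
  finally show ?thesis
    using q0 q by (simp add: ennreal_mult_cancel_divide)
qed

text \<open>The a priori sets of a single spin: the circle in the unconstrained system, an arc in the
  constrained ones.\<close>

definition fibred :: "nat \<Rightarrow> real set \<Rightarrow> bool"
  where "fibred q A \<longleftrightarrow> A = S1 \<or> (\<exists>a\<in>{1..q}. A = spin_arc q a)"

lemma fibred_admissible: "q \<ge> 1 \<Longrightarrow> fibred q A \<Longrightarrow> admissible A"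
  by (auto simp: fibred_def admissible_S1 admissible_arc)

text \<open>A spin can be drawn in two steps, first its arc and then its position there. This lets the same
  single-site kernels act on the constrained and the unconstrained system.\<close>

lemma nn_integral_fibred:
  assumes q: "q \<ge> 1" and A: "fibred q A" and f[measurable]: "f \<in> borel_measurable circle_measure"
  shows "(\<integral>\<^sup>+x. (\<integral>\<^sup>+y. f y \<partial>apriori (spin_arc q (discr q x))) \<partial>apriori A) = (\<integral>\<^sup>+x. f x \<partial>apriori A)"
proof -
  note [measurable] = discr_measurable[OF q]
  have arc: "(\<integral>\<^sup>+x. (\<integral>\<^sup>+y. f y \<partial>apriori (spin_arc q (discr q x))) \<partial>apriori (spin_arc q a)) =
      (\<integral>\<^sup>+x. f x \<partial>apriori (spin_arc q a))" if a: "a \<in> {1..q}" for a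
  proof -
    interpret prob_space "apriori (spin_arc q a)" by (intro prob_space_apriori admissible_arc q a)
    have "(\<integral>\<^sup>+x. (\<integral>\<^sup>+y. f y \<partial>apriori (spin_arc q (discr q x))) \<partial>apriori (spin_arc q a)) =
      (\<integral>\<^sup>+x. (\<integral>\<^sup>+y. f y \<partial>apriori (spin_arc q a)) \<partial>apriori (spin_arc q a))"
    proof (rule nn_integral_cong_AE)
      show "AE x in apriori (spin_arc q a). (\<integral>\<^sup>+y. f y \<partial>apriori (spin_arc q (discr q x))) = (\<integral>\<^sup>+y. f y \<partial>apriori (spin_arc q a))"
        using AE_apriori[OF admissible_arc[OF q a]] by eventually_elim (auto simp: spin_arc_def)
    qed
    then show ?thesis using emeasure_space_1 by simp
  qed
  from A show ?thesis unfolding fibred_def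
  proof
    assume [simp]: "A = S1"
    have "(\<lambda>x. \<integral>\<^sup>+y. f y \<partial>apriori (spin_arc q (discr q x))) \<in> borel_measurable circle_measure"
      by (rule measurable_compose[OF discr_measurable[OF q]]) simp
    then show ?thesis by (simp add: nn_integral_S1_arcs[OF q] arc del: One_nat_def)
  qed (auto simp: arc)
qed

text \<open>Uniform distributions have densities with respect to \<open>circle_measure\<close>; the product of these
  densities gives the product measure, as a comparison on boxes shows.\<close>

lemma nn_integral_PiM_apriori:
  assumes fin: "finite \<Lambda>" and S: "\<And>i. i \<in> \<Lambda> \<Longrightarrow> admissible (S i)"
    and f[measurable]: "f \<in> borel_measurable (PiM \<Lambda> (\<lambda>_. circle_measure))"
  shows "(\<integral>\<^sup>+\<xi>. f \<xi> \<partial>PiM \<Lambda> (\<lambda>i. apriori (S i))) =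
    (\<integral>\<^sup>+\<xi>. (\<Prod>i\<in>\<Lambda>. indicator (S i) (\<xi> i) / emeasure circle_measure (S i)) * f \<xi> \<partial>PiM \<Lambda> (\<lambda>_. circle_measure))"
proof -
  define S' where "S' i = (if i \<in> \<Lambda> then S i else S1)" for i
  have S': "admissible (S' i)" for i using S by (auto simp: S'_def admissible_S1)
  have [measurable]: "S' i \<in> sets circle_measure" for i using S'[of i] by (simp add: admissible_def)
  interpret c: product_sigma_finite "\<lambda>_. circle_measure"
    by (intro product_sigma_finite.intro finite_measure.axioms finite_circle)
  interpret p: product_sigma_finite "\<lambda>i. apriori (S' i)"
    by (intro product_sigma_finite.intro prob_space_imp_sigma_finite prob_space_apriori S')
  let ?d = "\<lambda>i x. indicator (S' i) x / emeasure circle_measure (S' i) :: ennreal"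
  have dm[measurable]: "(\<lambda>\<xi>. \<Prod>i\<in>\<Lambda>. ?d i (\<xi> i)) \<in> borel_measurable (PiM \<Lambda> (\<lambda>_. circle_measure))"
    by measurable
  have "density (PiM \<Lambda> (\<lambda>_. circle_measure)) (\<lambda>\<xi>. \<Prod>i\<in>\<Lambda>. ?d i (\<xi> i)) = PiM \<Lambda> (\<lambda>i. apriori (S' i))"
  proof (rule p.PiM_eqI[OF fin])
    show "sets (density (PiM \<Lambda> (\<lambda>_. circle_measure)) (\<lambda>\<xi>. \<Prod>i\<in>\<Lambda>. ?d i (\<xi> i))) = sets (PiM \<Lambda> (\<lambda>i. apriori (S' i)))"
      by (simp cong: sets_PiM_cong)
    fix A assume A': "\<And>i. i \<in> \<Lambda> \<Longrightarrow> A i \<in> sets (apriori (S' i))"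
    then have A[measurable]: "\<And>i. i \<in> \<Lambda> \<Longrightarrow> A i \<in> sets circle_measure" by simp
    have "emeasure (density (PiM \<Lambda> (\<lambda>_. circle_measure)) (\<lambda>\<xi>. \<Prod>i\<in>\<Lambda>. ?d i (\<xi> i))) (Pi\<^sub>E \<Lambda> A) =
       (\<integral>\<^sup>+\<xi>. (\<Prod>i\<in>\<Lambda>. ?d i (\<xi> i)) * indicator (Pi\<^sub>E \<Lambda> A) \<xi> \<partial>PiM \<Lambda> (\<lambda>_. circle_measure))"
      using A fin by (intro emeasure_density dm sets_PiM_I_finite)
    also have "\<dots> = (\<integral>\<^sup>+\<xi>. (\<Prod>i\<in>\<Lambda>. ?d i (\<xi> i) * indicator (A i) (\<xi> i)) \<partial>PiM \<Lambda> (\<lambda>_. circle_measure))"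
    proof (rule nn_integral_cong)
      fix \<xi> assume "\<xi> \<in> space (PiM \<Lambda> (\<lambda>_. circle_measure))"
      then have "indicator (Pi\<^sub>E \<Lambda> A) \<xi> = (\<Prod>i\<in>\<Lambda>. indicator (A i) (\<xi> i) :: ennreal)"
        using fin by (auto simp: indicator_def space_PiM PiE_iff prod_zero_iff)
      then show "(\<Prod>i\<in>\<Lambda>. ?d i (\<xi> i)) * indicator (Pi\<^sub>E \<Lambda> A) \<xi> = (\<Prod>i\<in>\<Lambda>. ?d i (\<xi> i) * indicator (A i) (\<xi> i))"
        by (simp add: prod.distrib)
    qed
    also have "\<dots> = (\<Prod>i\<in>\<Lambda>. \<integral>\<^sup>+x. ?d i x * indicator (A i) x \<partial>circle_measure)"
      by (rule c.product_nn_integral_prod[OF fin]) measurable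
    also have "\<dots> = (\<Prod>i\<in>\<Lambda>. emeasure (apriori (S' i)) (A i))"
      unfolding apriori_def uniform_measure_def
      by (intro prod.cong refl) (simp add: emeasure_density)
    finally show "emeasure (density (PiM \<Lambda> (\<lambda>_. circle_measure)) (\<lambda>\<xi>. \<Prod>i\<in>\<Lambda>. ?d i (\<xi> i))) (Pi\<^sub>E \<Lambda> A) =
      (\<Prod>i\<in>\<Lambda>. emeasure (apriori (S' i)) (A i))" .
  qed
  also have "PiM \<Lambda> (\<lambda>i. apriori (S' i)) = PiM \<Lambda> (\<lambda>i. apriori (S i))"
    by (intro PiM_cong) (auto simp: S'_def)
  finally have "PiM \<Lambda> (\<lambda>i. apriori (S i)) = density (PiM \<Lambda> (\<lambda>_. circle_measure)) (\<lambda>\<xi>. \<Prod>i\<in>\<Lambda>. ?d i (\<xi> i))" ..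
  then have "(\<integral>\<^sup>+\<xi>. f \<xi> \<partial>PiM \<Lambda> (\<lambda>i. apriori (S i))) =
      (\<integral>\<^sup>+\<xi>. (\<Prod>i\<in>\<Lambda>. ?d i (\<xi> i)) * f \<xi> \<partial>PiM \<Lambda> (\<lambda>_. circle_measure))"
    by (simp add: nn_integral_density)
  also have "\<dots> = (\<integral>\<^sup>+\<xi>. (\<Prod>i\<in>\<Lambda>. indicator (S i) (\<xi> i) / emeasure circle_measure (S i)) * f \<xi> \<partial>PiM \<Lambda> (\<lambda>_. circle_measure))"
    by (intro nn_integral_cong arg_cong2[of _ _ _ _ times] prod.cong refl) (auto simp: S'_def)
  finally show ?thesis .
qed

section \<open>Hamiltonians\<close>

text \<open>Absolute summability is a statement about extended nonnegative reals, while Hamiltonians are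
  sums of reals.\<close>

lemma summable_on_real_of_ennreal:
  fixes f :: "'a \<Rightarrow> ennreal"
  assumes "infsum f A < \<infinity>"
  shows "\<And>a. a \<in> A \<Longrightarrow> f a < \<infinity>" "(\<lambda>a. enn2real (f a)) summable_on A"
    "(\<Sum>\<^sub>\<infinity>a\<in>A. enn2real (f a)) \<le> enn2real (infsum f A)"
proof -
  have fin: "sum f F \<le> infsum f A" if "finite F" "F \<subseteq> A" for F
  proof -
    have "sum f F = infsum f F" using that by simp
    also have "\<dots> \<le> infsum f A"
      using that by (intro infsum_mono_neutral nonneg_summable_on_complete) auto
    finally show ?thesis .
  qed
  show lt: "f a < \<infinity>" if "a \<in> A" for a
    using fin[of "{a}"] that assms by (auto simp: less_top)
  have b: "(\<Sum>a\<in>F. enn2real (f a)) \<le> enn2real (infsum f A)" if F: "finite F" "F \<subseteq> A" for F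
  proof -
    have "(\<Sum>a\<in>F. enn2real (f a)) = enn2real (sum f F)"
      using F lt by (subst enn2real_sum) auto
    also have "\<dots> \<le> enn2real (infsum f A)"
      using fin[OF F] assms by (intro enn2real_mono) auto
    finally show ?thesis .
  qed
  show s: "(\<lambda>a. enn2real (f a)) summable_on A"
    by (rule nonneg_bdd_above_summable_on) (auto intro!: bdd_aboveI2 b)
  show "(\<Sum>\<^sub>\<infinity>a\<in>A. enn2real (f a)) \<le> enn2real (infsum f A)"
    by (rule infsum_le_finite_sums[OF s]) (auto intro: b)
qed

text \<open>The extension to all sites that occurs in \<open>hamiltonian\<close>.\<close>

definition extend :: "'d::finite site set \<Rightarrow> 'd config \<Rightarrow> 'd config"
  where "extend V \<omega> = merge V (- V) (\<omega>, \<lambda>_. 0)"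

lemma space_cfg: "space (cfg_space V) = V \<rightarrow>\<^sub>E S1"
  by (simp add: cfg_space_def space_PiM)

lemma zero_S1[simp]: "0 \<in> S1" by (simp add: S1_def)

lemma extend_Omega: "\<omega> \<in> V \<rightarrow>\<^sub>E S1 \<Longrightarrow> extend V \<omega> \<in> Omega"
  by (auto simp: extend_def merge_def)

lemma extend_UNIV[simp]: "extend UNIV \<omega> = \<omega>"
  by (auto simp: extend_def merge_def)

lemma extend_measurable[measurable]: "extend V \<in> cfg_space V \<rightarrow>\<^sub>M cfg_space UNIV"
  unfolding cfg_space_def
proof (rule measurable_PiM_single')
  fix i :: "'a site"
  show "(\<lambda>\<omega>. extend V \<omega> i) \<in> (\<Pi>\<^sub>M i\<in>V. circle_measure) \<rightarrow>\<^sub>M circle_measure"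
  proof (cases "i \<in> V")
    case True
    then show ?thesis by (simp add: extend_def merge_def)
  qed (simp add: extend_def merge_def)
qed (auto simp: space_PiM extend_Omega)

locale gibbs_model =
  fixes \<Phi> :: "'d::finite potential" and q :: nat
  assumes pot: "is_potential \<Phi>" and summ: "absolutely_summable \<Phi>" and q: "q \<ge> 1"
begin

text \<open>The sup norm of \<open>\<Phi> A\<close>, finite for finite nonempty \<open>A\<close>.\<close>

definition nb :: "'d site set \<Rightarrow> real"
  where "nb A = enn2real (SUP \<omega>\<in>Omega. ennreal \<bar>\<Phi> A \<omega>\<bar>)"

definition acts :: "'d site set \<Rightarrow> 'd site set \<Rightarrow> 'd site set set"
  where "acts V \<Lambda> = {A. finite A \<and> A \<subseteq> V \<and> A \<inter> \<Lambda> \<noteq> {}}"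

abbreviation "ham V \<equiv> hamiltonian V \<Phi>"

lemma nb_nonneg[simp]: "0 \<le> nb A" by (simp add: nb_def)

lemma summable_norms: "(\<Sum>\<^sub>\<infinity>A\<in>{A. finite A \<and> i \<in> A}. SUP \<omega>\<in>Omega. ennreal \<bar>\<Phi> A \<omega>\<bar>) < \<infinity>"
  using summ by (simp add: absolutely_summable_def)

lemma nb_bound:
  assumes "finite A" "A \<noteq> {}" "\<omega> \<in> Omega"
  shows "\<bar>\<Phi> A \<omega>\<bar> \<le> nb A"
proof -
  obtain i where "i \<in> A" using assms by auto
  then have "(SUP \<omega>\<in>Omega. ennreal \<bar>\<Phi> A \<omega>\<bar>) < \<infinity>"
    using summable_on_real_of_ennreal(1)[OF summable_norms[of i]] assms by simp
  moreover have "ennreal \<bar>\<Phi> A \<omega>\<bar> \<le> (SUP \<omega>\<in>Omega. ennreal \<bar>\<Phi> A \<omega>\<bar>)"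
    using assms(3) by (rule SUP_upper)
  ultimately have "enn2real (ennreal \<bar>\<Phi> A \<omega>\<bar>) \<le> nb A"
    unfolding nb_def by (intro enn2real_mono) auto
  then show ?thesis by simp
qed

lemma nb_summable:
  assumes "finite \<Lambda>" shows "nb summable_on acts V \<Lambda>"
proof -
  have "nb summable_on acts UNIV \<Lambda>"
    using assms
  proof (induction \<Lambda>)
    case (insert i \<Lambda>)
    have "nb summable_on {A. finite A \<and> i \<in> A}"
      using summable_on_real_of_ennreal(2)[OF summable_norms[of i]] by (simp add: nb_def[abs_def])
    then have "nb summable_on (acts UNIV \<Lambda> \<union> ({A. finite A \<and> i \<in> A} - acts UNIV \<Lambda>))"
      using insert.IH by (intro summable_on_Un_disjoint) (auto intro: summable_on_subset_banach)
    moreover have "acts UNIV (insert i \<Lambda>) = acts UNIV \<Lambda> \<union> ({A. finite A \<and> i \<in> A} - acts UNIV \<Lambda>)"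
      by (auto simp: acts_def)
    ultimately show ?case by simp
  qed (simp add: acts_def)
  then show ?thesis by (rule summable_on_subset_banach) (auto simp: acts_def)
qed

lemma interaction_summable:
  assumes "finite \<Lambda>" "\<omega> \<in> Omega"
  shows "(\<lambda>A. norm (\<Phi> A \<omega>)) summable_on acts V \<Lambda>"
  by (rule Infinite_Sum.abs_summable_on_comparison_test'[OF nb_summable[OF assms(1)]])
     (use nb_bound assms(2) in \<open>auto simp: acts_def\<close>)

lemma interaction_summable':
  assumes "finite \<Lambda>" "\<omega> \<in> Omega"
  shows "(\<lambda>A. \<Phi> A \<omega>) summable_on acts V \<Lambda>"
  using interaction_summable[OF assms] by (rule abs_summable_summable)

lemma ham_infsum: "ham V \<Lambda> \<omega> = (\<Sum>\<^sub>\<infinity>A\<in>acts V \<Lambda>. \<Phi> A (extend V \<omega>))"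
  by (simp add: hamiltonian_def acts_def extend_def)

lemma countable_acts: "countable (acts V \<Lambda>)"
  by (rule countable_subset[OF _ countable_Collect_finite]) (auto simp: acts_def)

text \<open>As an integral over a counting measure the Hamiltonian is accessible to Fubini-type
  measurability results and to dominated convergence.\<close>

lemma ham_LINT:
  assumes "finite \<Lambda>" "\<omega> \<in> V \<rightarrow>\<^sub>E S1"
  shows "ham V \<Lambda> \<omega> = (LINT A|count_space (acts V \<Lambda>). \<Phi> A (extend V \<omega>))"
proof -
  have "(\<lambda>A. norm (\<Phi> A (extend V \<omega>))) summable_on acts V \<Lambda>"
    using assms by (intro interaction_summable extend_Omega)
  then have "Infinite_Set_Sum.abs_summable_on (\<lambda>A. \<Phi> A (extend V \<omega>)) (acts V \<Lambda>)"
    by (rule abs_summable_equivalent[THEN iffD1])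
  then have "infsetsum (\<lambda>A. \<Phi> A (extend V \<omega>)) (acts V \<Lambda>) = ham V \<Lambda> \<omega>"
    unfolding ham_infsum by (rule infsetsum_infsum)
  then show ?thesis by (simp add: infsetsum_def)
qed

text \<open>A bound for the Hamiltonians of \<open>\<Lambda>\<close>, uniform in the configuration and in the surrounding system.\<close>

definition hb :: "'d site set \<Rightarrow> real" where "hb \<Lambda> = (\<Sum>\<^sub>\<infinity>A\<in>acts UNIV \<Lambda>. nb A)"

lemma ham_bound:
  assumes "finite \<Lambda>" "\<omega> \<in> V \<rightarrow>\<^sub>E S1"
  shows "\<bar>ham V \<Lambda> \<omega>\<bar> \<le> hb \<Lambda>"
proof -
  have s: "(\<lambda>A. norm (\<Phi> A (extend V \<omega>))) summable_on acts V \<Lambda>"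
    using assms by (intro interaction_summable extend_Omega)
  have "\<bar>ham V \<Lambda> \<omega>\<bar> \<le> (\<Sum>\<^sub>\<infinity>A\<in>acts V \<Lambda>. \<bar>\<Phi> A (extend V \<omega>)\<bar>)"
    using norm_infsum_bound[OF s] by (simp add: ham_infsum)
  also have "\<dots> \<le> hb \<Lambda>"
    unfolding hb_def
  proof (rule infsum_mono_neutral)
    show "(\<lambda>A. \<bar>\<Phi> A (extend V \<omega>)\<bar>) summable_on acts V \<Lambda>" using s by simp
    show "nb summable_on acts UNIV \<Lambda>" by (rule nb_summable[OF assms(1)])
  qed (use nb_bound extend_Omega[OF assms(2)] in \<open>auto simp: acts_def\<close>)
  finally show ?thesis .
qed

lemma potential_measurable: "finite A \<Longrightarrow> \<Phi> A \<in> borel_measurable (cfg_space UNIV)"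
  using pot by (simp add: is_potential_def)

lemma potential_local:
  "finite A \<Longrightarrow> \<omega> \<in> Omega \<Longrightarrow> \<eta> \<in> Omega \<Longrightarrow> (\<And>i. i \<in> A \<Longrightarrow> \<omega> i = \<eta> i) \<Longrightarrow> \<Phi> A \<omega> = \<Phi> A \<eta>"
  using pot unfolding is_potential_def by blast

lemma ham_measurable[measurable]:
  assumes "finite \<Lambda>" shows "ham V \<Lambda> \<in> borel_measurable (cfg_space V)"
proof -
  interpret sigma_finite_measure "count_space (acts V \<Lambda>)"
    by (rule sigma_finite_measure_count_space_countable[OF countable_acts])
  have "(\<lambda>(\<omega>, A). \<Phi> A (extend V \<omega>)) \<in> borel_measurable (cfg_space V \<Otimes>\<^sub>M count_space (acts V \<Lambda>))"
  proof -
    have "(\<lambda>x. (\<lambda>A x. \<Phi> A (extend V (fst x))) (snd x) x) \<in> borel_measurable (cfg_space V \<Otimes>\<^sub>M count_space (acts V \<Lambda>))"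
    proof (rule measurable_compose_countable'[where f="\<lambda>A x. \<Phi> A (extend V (fst x))" and g=snd, OF _ _ countable_acts])
      fix A assume "A \<in> acts V \<Lambda>"
      then have [measurable]: "\<Phi> A \<in> borel_measurable (cfg_space UNIV)"
        by (intro potential_measurable) (simp add: acts_def)
      show "(\<lambda>x. \<Phi> A (extend V (fst x))) \<in> borel_measurable (cfg_space V \<Otimes>\<^sub>M count_space (acts V \<Lambda>))"
        by measurable
    qed measurable
    then show ?thesis by (simp add: case_prod_beta')
  qed
  then have "(\<lambda>\<omega>. LINT A|count_space (acts V \<Lambda>). \<Phi> A (extend V \<omega>)) \<in> borel_measurable (cfg_space V)"
    by (rule borel_measurable_lebesgue_integral)
  then show ?thesis
    by (rule measurable_cong[THEN iffD1, rotated]) (simp add: ham_LINT[OF assms] space_cfg)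
qed

text \<open>A set that meets \<open>\<Lambda> \<union> \<Lambda>'\<close> either meets \<open>\<Lambda>\<close> or is a subset of the complement of \<open>\<Lambda>\<close> that meets
  \<open>\<Lambda>'\<close>. Splitting Boltzmann factors in two ways by this identity is the algebra behind all
  manipulations of Gibbs measures below, and the reason for treating systems on arbitrary \<open>V\<close>.\<close>

lemma ham_Un:
  assumes "finite \<Lambda>" "finite \<Lambda>'" "\<omega> \<in> V \<rightarrow>\<^sub>E S1"
  shows "ham V (\<Lambda> \<union> \<Lambda>') \<omega> = ham V \<Lambda> \<omega> + ham (V - \<Lambda>) \<Lambda>' (restrict \<omega> (V - \<Lambda>))"
proof -
  have O: "extend V \<omega> \<in> Omega" by (rule extend_Omega) fact
  have "restrict \<omega> (V - \<Lambda>) \<in> (V - \<Lambda>) \<rightarrow>\<^sub>E S1" using assms(3) by auto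
  from extend_Omega[OF this] have O': "extend (V - \<Lambda>) (restrict \<omega> (V - \<Lambda>)) \<in> Omega" .
  have "acts V (\<Lambda> \<union> \<Lambda>') = acts V \<Lambda> \<union> acts (V - \<Lambda>) \<Lambda>'" by (auto simp: acts_def)
  moreover have "acts V \<Lambda> \<inter> acts (V - \<Lambda>) \<Lambda>' = {}" by (auto simp: acts_def)
  moreover have "(\<Sum>\<^sub>\<infinity>A\<in>acts (V - \<Lambda>) \<Lambda>'. \<Phi> A (extend V \<omega>)) = ham (V - \<Lambda>) \<Lambda>' (restrict \<omega> (V - \<Lambda>))"
    unfolding ham_infsum
    by (intro infsum_cong potential_local O O') (auto simp: acts_def extend_def merge_def)
  ultimately show ?thesis
    unfolding ham_infsum[of V]
    by (simp add: infsum_Un_disjoint interaction_summable'[OF assms(1) O] interaction_summable'[OF assms(2) O])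
qed

text \<open>Dominated convergence: every interaction term is eventually constant.\<close>

lemma ham_tendsto:
  assumes "finite \<Lambda>" and \<omega>: "\<And>n. \<omega> n \<in> Omega" "\<eta> \<in> Omega"
    and ev: "\<And>i. eventually (\<lambda>n. \<omega> n i = \<eta> i) sequentially"
  shows "(\<lambda>n. ham UNIV \<Lambda> (\<omega> n)) \<longlonglongrightarrow> ham UNIV \<Lambda> \<eta>"
proof -
  have "(\<lambda>n. LINT A|count_space (acts UNIV \<Lambda>). \<Phi> A (\<omega> n)) \<longlonglongrightarrow> (LINT A|count_space (acts UNIV \<Lambda>). \<Phi> A \<eta>)"
  proof (rule integral_dominated_convergence[where w=nb])
    show "integrable (count_space (acts UNIV \<Lambda>)) nb"
    proof -
      have "(\<lambda>A. norm (nb A)) summable_on acts UNIV \<Lambda>" using nb_summable[OF assms(1)] by simp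
      then have "Infinite_Set_Sum.abs_summable_on nb (acts UNIV \<Lambda>)"
        by (rule abs_summable_equivalent[THEN iffD1])
      then show ?thesis by (simp add: Infinite_Set_Sum.abs_summable_on_def)
    qed
    have "(\<lambda>n. \<Phi> A (\<omega> n)) \<longlonglongrightarrow> \<Phi> A \<eta>" if "A \<in> acts UNIV \<Lambda>" for A
    proof -
      have A: "finite A" using that by (simp add: acts_def)
      have "eventually (\<lambda>n. \<forall>i\<in>A. \<omega> n i = \<eta> i) sequentially"
        using A ev by (simp add: eventually_ball_finite)
      then have "eventually (\<lambda>n. \<Phi> A (\<omega> n) = \<Phi> A \<eta>) sequentially"
        by eventually_elim (intro potential_local A \<omega>; simp)
      then show ?thesis by (rule tendsto_eventually)
    qed
    then show "AE A in count_space (acts UNIV \<Lambda>). (\<lambda>n. \<Phi> A (\<omega> n)) \<longlonglongrightarrow> \<Phi> A \<eta>"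
      by (simp add: AE_count_space)
    show "AE A in count_space (acts UNIV \<Lambda>). norm (\<Phi> A (\<omega> n)) \<le> nb A" for n
      using nb_bound \<omega>(1)[of n] by (auto simp: AE_count_space acts_def)
  qed auto
  then show ?thesis
    using \<omega> by (simp add: ham_LINT[OF assms(1)])
qed

end

section \<open>Resampling and the DLR equation\<close>

definition resample1 :: "real set \<Rightarrow> 'd::finite site \<Rightarrow> ('d config \<Rightarrow> ennreal) \<Rightarrow> 'd config \<Rightarrow> ennreal"
  where "resample1 A i f \<eta> = (\<integral>\<^sup>+x. f (\<eta>(i := x)) \<partial>apriori A)"

definition resample :: "'d::finite site set \<Rightarrow> ('d site \<Rightarrow> real set) \<Rightarrow> 'd site set \<Rightarrow> ('d config \<Rightarrow> ennreal) \<Rightarrow> 'd config \<Rightarrow> ennreal"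
  where "resample V S \<Lambda> f \<eta> = (\<integral>\<^sup>+\<xi>. f (merge \<Lambda> (V - \<Lambda>) (\<xi>, \<eta>)) \<partial>PiM \<Lambda> (\<lambda>i. apriori (S i)))"

lemma merge_merge: "merge \<Lambda> (V - \<Lambda>) (\<xi>, merge \<Lambda> (V - \<Lambda>) (\<xi>', \<eta>)) = merge \<Lambda> (V - \<Lambda>) (\<xi>, \<eta>)"
  by (auto simp: merge_def)

lemma restrict_merge_off: "restrict (merge \<Lambda> (V - \<Lambda>) (\<xi>, \<eta>)) (V - \<Lambda>) = restrict \<eta> (V - \<Lambda>)"
  by (auto simp: merge_def restrict_def)

lemma restrict_upd_off: "restrict (\<eta>(i := x)) (V - {i}) = restrict \<eta> (V - {i})"
  by (auto simp: restrict_def)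

lemma merge_insert:
  assumes "i \<in> V" "i \<notin> \<Lambda>"
  shows "merge (insert i \<Lambda>) (V - insert i \<Lambda>) (\<xi>(i := x), \<eta>) = (merge \<Lambda> (V - \<Lambda>) (\<xi>, \<eta>))(i := x)"
  using assms by (auto simp: merge_def)

lemma merge_empty_left: "\<eta> \<in> V \<rightarrow>\<^sub>E S1 \<Longrightarrow> merge {} (V - {}) (\<xi>, \<eta>) = \<eta>"
  by (auto simp: merge_def PiE_def extensional_def)

lemma upd_measurable:
  assumes "i \<in> V"
  shows "(\<lambda>(\<eta>, x). \<eta>(i := x)) \<in> cfg_space V \<Otimes>\<^sub>M circle_measure \<rightarrow>\<^sub>M cfg_space V"
  using measurable_add_dim[where I=V and M="\<lambda>_. circle_measure" and i=i] assms by (simp add: cfg_space_def insert_absorb)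

lemma upd_measurable':
  assumes "i \<in> V" "\<eta> \<in> V \<rightarrow>\<^sub>E S1"
  shows "(\<lambda>x. \<eta>(i := x)) \<in> circle_measure \<rightarrow>\<^sub>M cfg_space V"
  using measurable_compose[OF measurable_Pair1' upd_measurable[OF assms(1)], of \<eta>] assms(2)
  by (simp add: space_cfg)

lemma merge_measurable:
  assumes "\<Lambda> \<subseteq> V"
  shows "(\<lambda>(\<xi>, \<eta>). merge \<Lambda> (V - \<Lambda>) (\<xi>, \<eta>)) \<in> PiM \<Lambda> (\<lambda>_. circle_measure) \<Otimes>\<^sub>M cfg_space V \<rightarrow>\<^sub>M cfg_space V"
proof -
  have V: "\<Lambda> \<union> (V - \<Lambda>) = V" using assms by auto
  have [measurable]: "(\<lambda>\<eta>. restrict \<eta> (V - \<Lambda>)) \<in> cfg_space V \<rightarrow>\<^sub>M cfg_space (V - \<Lambda>)"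
    unfolding cfg_space_def by (rule measurable_restrict_subset) auto
  have [measurable]: "merge \<Lambda> (V - \<Lambda>) \<in> PiM \<Lambda> (\<lambda>_. circle_measure) \<Otimes>\<^sub>M cfg_space (V - \<Lambda>) \<rightarrow>\<^sub>M cfg_space V"
    using measurable_merge[of \<Lambda> "V - \<Lambda>" "\<lambda>_. circle_measure"] unfolding cfg_space_def V .
  have "(\<lambda>x. merge \<Lambda> (V - \<Lambda>) (fst x, restrict (snd x) (V - \<Lambda>))) \<in> PiM \<Lambda> (\<lambda>_. circle_measure) \<Otimes>\<^sub>M cfg_space V \<rightarrow>\<^sub>M cfg_space V"
    by measurable
  then show ?thesis by (simp add: case_prod_beta')
qed

lemma merge_measurable':
  assumes "\<Lambda> \<subseteq> V" "\<eta> \<in> V \<rightarrow>\<^sub>E S1"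
  shows "(\<lambda>\<xi>. merge \<Lambda> (V - \<Lambda>) (\<xi>, \<eta>)) \<in> PiM \<Lambda> (\<lambda>_. circle_measure) \<rightarrow>\<^sub>M cfg_space V"
  using measurable_compose[OF measurable_Pair2' merge_measurable[OF assms(1)], of \<eta>] assms(2)
  by (simp add: space_cfg)

lemma merge_space:
  "\<Lambda> \<subseteq> V \<Longrightarrow> \<eta> \<in> V \<rightarrow>\<^sub>E S1 \<Longrightarrow> \<xi> \<in> \<Lambda> \<rightarrow>\<^sub>E S1 \<Longrightarrow> merge \<Lambda> (V - \<Lambda>) (\<xi>, \<eta>) \<in> V \<rightarrow>\<^sub>E S1"
  by (auto simp: merge_def PiE_def extensional_def Pi_iff)

lemma sets_PiM_apriori: "sets (PiM \<Lambda> (\<lambda>i. apriori (S i))) = sets (PiM \<Lambda> (\<lambda>_. circle_measure))"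
  by (rule sets_PiM_cong) auto

lemma space_PiM_apriori: "space (PiM \<Lambda> (\<lambda>i. apriori (S i))) = \<Lambda> \<rightarrow>\<^sub>E S1"
  by (simp add: space_PiM)

lemma resample1_measurable:
  assumes "i \<in> V" "admissible A" and f: "f \<in> borel_measurable (cfg_space V)"
  shows "resample1 A i f \<in> borel_measurable (cfg_space V)"
proof -
  interpret prob_space "apriori A" by (rule prob_space_apriori) fact
  have "(\<lambda>x. f ((\<lambda>(\<eta>, x). \<eta>(i := x)) x)) \<in> borel_measurable (cfg_space V \<Otimes>\<^sub>M circle_measure)"
    by (rule measurable_compose[OF upd_measurable f]) fact
  then have "(\<lambda>(\<eta>, x). f (\<eta>(i := x))) \<in> borel_measurable (cfg_space V \<Otimes>\<^sub>M apriori A)"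
    by (simp add: case_prod_beta' cong: measurable_cong_sets sets_pair_measure_cong)
  then show ?thesis
    unfolding resample1_def[abs_def] by (rule borel_measurable_nn_integral)
qed

lemma resample_measurable:
  assumes "\<Lambda> \<subseteq> V" "finite \<Lambda>" "\<And>i. i \<in> \<Lambda> \<Longrightarrow> admissible (S i)" and f: "f \<in> borel_measurable (cfg_space V)"
  shows "resample V S \<Lambda> f \<in> borel_measurable (cfg_space V)"
proof -
  interpret prob_space "PiM \<Lambda> (\<lambda>i. apriori (S i))" by (intro prob_space_PiM prob_space_apriori assms)
  have "(\<lambda>x. f ((\<lambda>(\<xi>, \<eta>). merge \<Lambda> (V - \<Lambda>) (\<xi>, \<eta>)) x)) \<in> borel_measurable (PiM \<Lambda> (\<lambda>_. circle_measure) \<Otimes>\<^sub>M cfg_space V)"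
    by (rule measurable_compose[OF merge_measurable f]) fact
  then have "(\<lambda>(\<xi>, \<eta>). f (merge \<Lambda> (V - \<Lambda>) (\<xi>, \<eta>))) \<in> borel_measurable (PiM \<Lambda> (\<lambda>i. apriori (S i)) \<Otimes>\<^sub>M cfg_space V)"
    by (simp add: case_prod_beta' cong: measurable_cong_sets sets_pair_measure_cong sets_PiM_apriori)
  then have "(\<lambda>(\<eta>, \<xi>). f (merge \<Lambda> (V - \<Lambda>) (\<xi>, \<eta>))) \<in> borel_measurable (cfg_space V \<Otimes>\<^sub>M PiM \<Lambda> (\<lambda>i. apriori (S i)))"
    using measurable_compose[OF measurable_pair_swap'] by (fastforce simp: case_prod_beta')
  then show ?thesis
    unfolding resample_def[abs_def] by (rule borel_measurable_nn_integral)
qed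

lemma resample1_mult:
  assumes "i \<in> V" "\<eta> \<in> V \<rightarrow>\<^sub>E S1" "f \<in> borel_measurable (cfg_space V)"
    and k: "\<And>x. k (\<eta>(i := x)) = k \<eta>"
  shows "resample1 A i (\<lambda>\<omega>. k \<omega> * f \<omega>) \<eta> = k \<eta> * resample1 A i f \<eta>"
  unfolding resample1_def k
  by (rule nn_integral_cmult) (use measurable_compose[OF upd_measurable' assms(3)] assms in \<open>simp cong: measurable_cong_sets\<close>)

lemma resample_mult:
  assumes "\<Lambda> \<subseteq> V" "\<eta> \<in> V \<rightarrow>\<^sub>E S1" "f \<in> borel_measurable (cfg_space V)"
    and k: "\<And>\<xi>. k (merge \<Lambda> (V - \<Lambda>) (\<xi>, \<eta>)) = k \<eta>"
  shows "resample V S \<Lambda> (\<lambda>\<omega>. k \<omega> * f \<omega>) \<eta> = k \<eta> * resample V S \<Lambda> f \<eta>"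
  unfolding resample_def k
  by (rule nn_integral_cmult)
     (use measurable_compose[OF merge_measurable' assms(3)] assms in \<open>simp cong: measurable_cong_sets add: sets_PiM_apriori\<close>)

lemma resample_const:
  assumes S: "\<And>i. i \<in> \<Lambda> \<Longrightarrow> admissible (S i)"
    and k: "\<And>\<xi>. k (merge \<Lambda> (V - \<Lambda>) (\<xi>, \<eta>)) = k \<eta>"
  shows "resample V S \<Lambda> k \<eta> = k \<eta>"
proof -
  interpret prob_space "PiM \<Lambda> (\<lambda>i. apriori (S i))" by (intro prob_space_PiM prob_space_apriori S)
  show ?thesis unfolding resample_def k by (simp add: emeasure_space_1)
qed

lemma resample_merge: "resample V S \<Lambda> f (merge \<Lambda> (V - \<Lambda>) (\<xi>, \<eta>)) = resample V S \<Lambda> f \<eta>"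
  by (simp add: resample_def merge_merge)

lemma resample_empty: "\<eta> \<in> V \<rightarrow>\<^sub>E S1 \<Longrightarrow> resample V S {} f \<eta> = f \<eta>"
  unfolding resample_def using merge_empty_left[of \<eta> V]
  by (simp add: PiM_empty nn_integral_count_space_finite)

lemma resample_insert:
  assumes fin: "finite \<Lambda>" and i: "i \<notin> \<Lambda>" "insert i \<Lambda> \<subseteq> V" and S: "\<And>i. admissible (S i)"
    and f: "f \<in> borel_measurable (cfg_space V)" and \<eta>: "\<eta> \<in> V \<rightarrow>\<^sub>E S1"
  shows "resample V S (insert i \<Lambda>) f \<eta> = resample V S \<Lambda> (resample1 (S i) i f) \<eta>"
proof -
  interpret product_sigma_finite "\<lambda>i. apriori (S i)"
    by (intro product_sigma_finite.intro prob_space_imp_sigma_finite prob_space_apriori S)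
  have "(\<lambda>\<xi>. f (merge (insert i \<Lambda>) (V - insert i \<Lambda>) (\<xi>, \<eta>))) \<in> borel_measurable (PiM (insert i \<Lambda>) (\<lambda>i. apriori (S i)))"
    using measurable_compose[OF merge_measurable'[OF i(2) \<eta>] f] by (simp cong: measurable_cong_sets add: sets_PiM_apriori)
  then show ?thesis
    unfolding resample_def resample1_def using i
    by (subst product_nn_integral_insert[OF fin i(1)]) (simp_all add: merge_insert)
qed

lemma resample_singleton:
  assumes "i \<in> V" "\<And>i. admissible (S i)" "f \<in> borel_measurable (cfg_space V)" "\<eta> \<in> V \<rightarrow>\<^sub>E S1"
  shows "resample V S {i} f \<eta> = resample1 (S i) i f \<eta>"
  using resample_insert[of "{}" i V S f \<eta>] assms by (simp add: resample_empty)

context gibbs_model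
begin

definition boltz :: "'d site set \<Rightarrow> 'd site set \<Rightarrow> 'd config \<Rightarrow> ennreal"
  where "boltz V \<Lambda> \<omega> = ennreal (exp (- ham V \<Lambda> \<omega>))"

definition inv_boltz :: "'d site set \<Rightarrow> 'd site set \<Rightarrow> 'd config \<Rightarrow> ennreal"
  where "inv_boltz V \<Lambda> \<omega> = ennreal (exp (ham V \<Lambda> \<omega>))"

lemma boltz_measurable[measurable]: "finite \<Lambda> \<Longrightarrow> boltz V \<Lambda> \<in> borel_measurable (cfg_space V)"
  and inv_boltz_measurable[measurable]: "finite \<Lambda> \<Longrightarrow> inv_boltz V \<Lambda> \<in> borel_measurable (cfg_space V)"
  unfolding boltz_def[abs_def] inv_boltz_def[abs_def] by measurable

lemma boltz_inv: "boltz V \<Lambda> \<omega> * (inv_boltz V \<Lambda> \<omega> * x) = x" "inv_boltz V \<Lambda> \<omega> * (boltz V \<Lambda> \<omega> * x) = x"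
  by (simp_all add: boltz_def inv_boltz_def mult.assoc[symmetric] ennreal_mult[symmetric] exp_minus)

lemma inv_boltz_Un:
  assumes "finite \<Lambda>" "finite \<Lambda>'" "\<omega> \<in> V \<rightarrow>\<^sub>E S1"
  shows "inv_boltz V (\<Lambda> \<union> \<Lambda>') \<omega> = inv_boltz V \<Lambda> \<omega> * inv_boltz (V - \<Lambda>) \<Lambda>' (restrict \<omega> (V - \<Lambda>))"
  unfolding inv_boltz_def ham_Un[OF assms] by (simp add: exp_add ennreal_mult)

text \<open>The DLR equation of the single-site kernels, multiplied through by the normalizing factor: for
  \<open>f\<close> of the form \<open>boltz V {i} * g\<close> the left side is the mean of \<open>g\<close>. In this form the equation is linear
  in \<open>f\<close> and \<open>\<mu>\<close>, and the factors \<open>inv_boltz\<close> of several sites combine by \<open>inv_boltz_Un\<close>.\<close>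

definition local_gibbs :: "'d site set \<Rightarrow> ('d site \<Rightarrow> real set) \<Rightarrow> 'd config measure \<Rightarrow> bool"
  where "local_gibbs V S \<mu> \<longleftrightarrow> prob_space \<mu> \<and> sets \<mu> = sets (cfg_space V) \<and>
    (\<forall>i\<in>V. \<forall>f\<in>borel_measurable (cfg_space V).
      (\<integral>\<^sup>+\<omega>. inv_boltz V {i} \<omega> * f \<omega> \<partial>\<mu>) = (\<integral>\<^sup>+\<omega>. inv_boltz V {i} \<omega> * resample1 (S i) i f \<omega> \<partial>\<mu>))"

lemma local_gibbsD:
  assumes "local_gibbs V S \<mu>"
  shows "prob_space \<mu>" "sets \<mu> = sets (cfg_space V)" "space \<mu> = V \<rightarrow>\<^sub>E S1"
    "\<And>i f. i \<in> V \<Longrightarrow> f \<in> borel_measurable (cfg_space V) \<Longrightarrow>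
      (\<integral>\<^sup>+\<omega>. inv_boltz V {i} \<omega> * f \<omega> \<partial>\<mu>) = (\<integral>\<^sup>+\<omega>. inv_boltz V {i} \<omega> * resample1 (S i) i f \<omega> \<partial>\<mu>)"
  using assms sets_eq_imp_space_eq[of \<mu> "cfg_space V"] by (auto simp: local_gibbs_def space_cfg)

text \<open>The factor \<open>inv_boltz\<close> of \<open>insert i \<Lambda>\<close> is the one of \<open>i\<close> times a term without the spin at \<open>i\<close>, and
  also the one of \<open>\<Lambda>\<close> times a term without the spins in \<open>\<Lambda>\<close>. So the spin at \<open>i\<close> and then those in
  \<open>\<Lambda>\<close> can be averaged.\<close>

lemma local_gibbs_multi:
  assumes \<mu>: "local_gibbs V S \<mu>" and S: "\<And>i. admissible (S i)"
    and \<Lambda>: "finite \<Lambda>" "\<Lambda> \<subseteq> V" and f: "f \<in> borel_measurable (cfg_space V)"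
  shows "(\<integral>\<^sup>+\<omega>. inv_boltz V \<Lambda> \<omega> * f \<omega> \<partial>\<mu>) = (\<integral>\<^sup>+\<omega>. inv_boltz V \<Lambda> \<omega> * resample V S \<Lambda> f \<omega> \<partial>\<mu>)"
  using \<Lambda> f
proof (induction \<Lambda> arbitrary: f)
  case empty
  then show ?case
    by (intro nn_integral_cong) (simp add: resample_empty local_gibbsD(3)[OF \<mu>])
next
  case (insert i \<Lambda>)
  note f[measurable] = insert.prems(2)
  have i: "i \<in> V" and \<Lambda>: "\<Lambda> \<subseteq> V" using insert.prems by auto
  note [measurable] = resample1_measurable[OF i S]
  define k where "k \<omega> = inv_boltz (V - \<Lambda>) {i} (restrict \<omega> (V - \<Lambda>))" for \<omega>
  define kk where "kk \<omega> = inv_boltz (V - {i}) \<Lambda> (restrict \<omega> (V - {i}))" for \<omega>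
  have [measurable]: "(\<lambda>\<eta>. restrict \<eta> (V - A)) \<in> cfg_space V \<rightarrow>\<^sub>M cfg_space (V - A)" for A
    unfolding cfg_space_def by (rule measurable_restrict_subset) auto
  have [measurable]: "k \<in> borel_measurable (cfg_space V)" "kk \<in> borel_measurable (cfg_space V)"
    unfolding k_def[abs_def] kk_def[abs_def] using insert.hyps by measurable
  have k: "inv_boltz V (insert i \<Lambda>) \<omega> = inv_boltz V \<Lambda> \<omega> * k \<omega>"
    and kk: "inv_boltz V (insert i \<Lambda>) \<omega> = inv_boltz V {i} \<omega> * kk \<omega>" if "\<omega> \<in> V \<rightarrow>\<^sub>E S1" for \<omega>
    using inv_boltz_Un[of \<Lambda> "{i}" \<omega> V] inv_boltz_Un[of "{i}" \<Lambda> \<omega> V] that insert.hyps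
    by (simp_all add: k_def kk_def)
  have [simp]: "k (merge \<Lambda> (V - \<Lambda>) (\<xi>, \<omega>)) = k \<omega>" "kk (\<eta>(i := x)) = kk \<eta>" for \<xi> \<omega> \<eta> x
    by (simp_all add: k_def kk_def restrict_merge_off restrict_upd_off)
  have "(\<integral>\<^sup>+\<omega>. inv_boltz V (insert i \<Lambda>) \<omega> * f \<omega> \<partial>\<mu>) = (\<integral>\<^sup>+\<omega>. inv_boltz V {i} \<omega> * (kk \<omega> * f \<omega>) \<partial>\<mu>)"
    by (intro nn_integral_cong) (simp add: local_gibbsD(3)[OF \<mu>] kk mult.assoc)
  also have "\<dots> = (\<integral>\<^sup>+\<omega>. inv_boltz V {i} \<omega> * resample1 (S i) i (\<lambda>\<omega>. kk \<omega> * f \<omega>) \<omega> \<partial>\<mu>)"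
    by (rule local_gibbsD(4)[OF \<mu> i]) measurable
  also have "\<dots> = (\<integral>\<^sup>+\<omega>. inv_boltz V \<Lambda> \<omega> * (k \<omega> * resample1 (S i) i f \<omega>) \<partial>\<mu>)"
  proof (intro nn_integral_cong)
    fix \<omega> assume "\<omega> \<in> space \<mu>"
    then have \<omega>: "\<omega> \<in> V \<rightarrow>\<^sub>E S1" by (simp add: local_gibbsD(3)[OF \<mu>])
    have "resample1 (S i) i (\<lambda>\<omega>. kk \<omega> * f \<omega>) \<omega> = kk \<omega> * resample1 (S i) i f \<omega>"
      by (rule resample1_mult[OF i \<omega> f]) simp
    then show "inv_boltz V {i} \<omega> * resample1 (S i) i (\<lambda>\<omega>. kk \<omega> * f \<omega>) \<omega> = inv_boltz V \<Lambda> \<omega> * (k \<omega> * resample1 (S i) i f \<omega>)"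
      using k[OF \<omega>] kk[OF \<omega>] by (simp add: mult.assoc[symmetric])
  qed
  also have "\<dots> = (\<integral>\<^sup>+\<omega>. inv_boltz V \<Lambda> \<omega> * resample V S \<Lambda> (\<lambda>\<omega>. k \<omega> * resample1 (S i) i f \<omega>) \<omega> \<partial>\<mu>)"
    by (rule insert.IH[OF \<Lambda>]) measurable
  also have "\<dots> = (\<integral>\<^sup>+\<omega>. inv_boltz V (insert i \<Lambda>) \<omega> * resample V S (insert i \<Lambda>) f \<omega> \<partial>\<mu>)"
  proof (intro nn_integral_cong)
    fix \<omega> assume "\<omega> \<in> space \<mu>"
    then have \<omega>: "\<omega> \<in> V \<rightarrow>\<^sub>E S1" by (simp add: local_gibbsD(3)[OF \<mu>])
    have "resample V S \<Lambda> (\<lambda>\<omega>. k \<omega> * resample1 (S i) i f \<omega>) \<omega> = k \<omega> * resample V S \<Lambda> (resample1 (S i) i f) \<omega>"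
      by (rule resample_mult[OF \<Lambda> \<omega>]) simp_all
    then show "inv_boltz V \<Lambda> \<omega> * resample V S \<Lambda> (\<lambda>\<omega>. k \<omega> * resample1 (S i) i f \<omega>) \<omega> =
        inv_boltz V (insert i \<Lambda>) \<omega> * resample V S (insert i \<Lambda>) f \<omega>"
      using k[OF \<omega>] resample_insert[OF insert.hyps insert.prems(1) S f \<omega>] by (simp add: mult.assoc[symmetric])
  qed
  finally show ?case .
qed

lemma boltz_bounds:
  assumes "finite \<Lambda>" "\<omega> \<in> V \<rightarrow>\<^sub>E S1"
  shows "ennreal (exp (- hb \<Lambda>)) \<le> boltz V \<Lambda> \<omega>" "boltz V \<Lambda> \<omega> \<le> ennreal (exp (hb \<Lambda>))"
    "ennreal (exp (- hb \<Lambda>)) \<le> inv_boltz V \<Lambda> \<omega>" "inv_boltz V \<Lambda> \<omega> \<le> ennreal (exp (hb \<Lambda>))"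
  using ham_bound[OF assms] by (auto simp: boltz_def inv_boltz_def abs_le_iff intro!: ennreal_leI)

lemma resample_boltz_bounds:
  assumes "finite \<Lambda>" "\<Lambda> \<subseteq> V" "\<eta> \<in> V \<rightarrow>\<^sub>E S1" and S: "\<And>i. i \<in> \<Lambda> \<Longrightarrow> admissible (S i)"
  shows "ennreal (exp (- hb \<Lambda>)) \<le> resample V S \<Lambda> (boltz V \<Lambda>) \<eta>"
    "resample V S \<Lambda> (boltz V \<Lambda>) \<eta> \<le> ennreal (exp (hb \<Lambda>))"
    "resample V S \<Lambda> (boltz V \<Lambda>) \<eta> \<noteq> 0" "resample V S \<Lambda> (boltz V \<Lambda>) \<eta> \<noteq> \<infinity>"
proof -
  interpret prob_space "PiM \<Lambda> (\<lambda>i. apriori (S i))" by (intro prob_space_PiM prob_space_apriori S)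
  have b: "ennreal (exp (- hb \<Lambda>)) \<le> boltz V \<Lambda> (merge \<Lambda> (V - \<Lambda>) (\<xi>, \<eta>))"
    "boltz V \<Lambda> (merge \<Lambda> (V - \<Lambda>) (\<xi>, \<eta>)) \<le> ennreal (exp (hb \<Lambda>))" if "\<xi> \<in> \<Lambda> \<rightarrow>\<^sub>E S1" for \<xi>
    using boltz_bounds[OF assms(1) merge_space[OF assms(2,3) that]] by auto
  have "(\<integral>\<^sup>+\<xi>. ennreal (exp (- hb \<Lambda>)) \<partial>PiM \<Lambda> (\<lambda>i. apriori (S i))) \<le> resample V S \<Lambda> (boltz V \<Lambda>) \<eta>"
    unfolding resample_def by (intro nn_integral_mono b) (simp add: space_PiM_apriori)
  then show 1: "ennreal (exp (- hb \<Lambda>)) \<le> resample V S \<Lambda> (boltz V \<Lambda>) \<eta>"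
    by (simp add: emeasure_space_1)
  have "resample V S \<Lambda> (boltz V \<Lambda>) \<eta> \<le> (\<integral>\<^sup>+\<xi>. ennreal (exp (hb \<Lambda>)) \<partial>PiM \<Lambda> (\<lambda>i. apriori (S i)))"
    unfolding resample_def by (intro nn_integral_mono b) (simp add: space_PiM_apriori)
  then show 2: "resample V S \<Lambda> (boltz V \<Lambda>) \<eta> \<le> ennreal (exp (hb \<Lambda>))"
    by (simp add: emeasure_space_1)
  have "0 < ennreal (exp (- hb \<Lambda>))" by simp
  with 1 show "resample V S \<Lambda> (boltz V \<Lambda>) \<eta> \<noteq> 0" by auto
  from 2 show "resample V S \<Lambda> (boltz V \<Lambda>) \<eta> \<noteq> \<infinity>" by (auto simp: top_unique)
qed

text \<open>The mean of \<open>f\<close> under the Gibbs kernel of \<open>\<Lambda>\<close> with boundary condition \<open>\<eta>\<close> and a priori sets \<open>S\<close>.\<close>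

definition gibbs_avg :: "'d site set \<Rightarrow> ('d site \<Rightarrow> real set) \<Rightarrow> 'd site set \<Rightarrow> ('d config \<Rightarrow> ennreal) \<Rightarrow> 'd config \<Rightarrow> ennreal"
  where "gibbs_avg V S \<Lambda> f \<eta> = resample V S \<Lambda> (\<lambda>\<omega>. boltz V \<Lambda> \<omega> * f \<omega>) \<eta> / resample V S \<Lambda> (boltz V \<Lambda>) \<eta>"

text \<open>The average does not depend on the spins in \<open>\<Lambda>\<close>, so it factors out of \<open>resample\<close>, and its
  denominator cancels.\<close>

lemma local_gibbs_avg:
  assumes \<mu>: "local_gibbs V S \<mu>" and S: "\<And>i. admissible (S i)"
    and \<Lambda>: "finite \<Lambda>" "\<Lambda> \<subseteq> V" and f[measurable]: "f \<in> borel_measurable (cfg_space V)"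
  shows "(\<integral>\<^sup>+\<omega>. gibbs_avg V S \<Lambda> f \<omega> \<partial>\<mu>) = (\<integral>\<^sup>+\<omega>. f \<omega> \<partial>\<mu>)"
proof -
  let ?Z = "resample V S \<Lambda> (boltz V \<Lambda>)"
  note sp = local_gibbsD(3)[OF \<mu>]
  note [measurable] = resample_measurable[OF \<Lambda>(2,1) S] boltz_measurable[OF \<Lambda>(1)]
  have [measurable]: "gibbs_avg V S \<Lambda> f \<in> borel_measurable (cfg_space V)"
    unfolding gibbs_avg_def[abs_def] by measurable
  have const: "gibbs_avg V S \<Lambda> f (merge \<Lambda> (V - \<Lambda>) (\<xi>, \<eta>)) = gibbs_avg V S \<Lambda> f \<eta>" for \<xi> \<eta>
    by (simp add: gibbs_avg_def resample_merge)
  have "(\<integral>\<^sup>+\<omega>. gibbs_avg V S \<Lambda> f \<omega> \<partial>\<mu>) = (\<integral>\<^sup>+\<omega>. inv_boltz V \<Lambda> \<omega> * (gibbs_avg V S \<Lambda> f \<omega> * boltz V \<Lambda> \<omega>) \<partial>\<mu>)"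
    by (intro nn_integral_cong) (simp add: boltz_inv mult.commute[of "gibbs_avg _ _ _ _ _"])
  also have "\<dots> = (\<integral>\<^sup>+\<omega>. inv_boltz V \<Lambda> \<omega> * resample V S \<Lambda> (\<lambda>\<omega>. gibbs_avg V S \<Lambda> f \<omega> * boltz V \<Lambda> \<omega>) \<omega> \<partial>\<mu>)"
    by (rule local_gibbs_multi[OF \<mu> S \<Lambda>]) measurable
  also have "\<dots> = (\<integral>\<^sup>+\<omega>. inv_boltz V \<Lambda> \<omega> * resample V S \<Lambda> (\<lambda>\<omega>. boltz V \<Lambda> \<omega> * f \<omega>) \<omega> \<partial>\<mu>)"
  proof (intro nn_integral_cong)
    fix \<omega> assume "\<omega> \<in> space \<mu>"
    then have \<omega>: "\<omega> \<in> V \<rightarrow>\<^sub>E S1" by (simp add: sp)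
    have "resample V S \<Lambda> (\<lambda>\<omega>. gibbs_avg V S \<Lambda> f \<omega> * boltz V \<Lambda> \<omega>) \<omega> = gibbs_avg V S \<Lambda> f \<omega> * ?Z \<omega>"
      by (rule resample_mult[OF \<Lambda>(2) \<omega>]) (simp_all add: const \<Lambda>)
    also have "\<dots> = resample V S \<Lambda> (\<lambda>\<omega>. boltz V \<Lambda> \<omega> * f \<omega>) \<omega>"
      unfolding gibbs_avg_def using resample_boltz_bounds(3,4)[OF \<Lambda> \<omega> S]
      by (simp add: ennreal_divide_times ennreal_divide_self less_top)
    finally show "inv_boltz V \<Lambda> \<omega> * resample V S \<Lambda> (\<lambda>\<omega>. gibbs_avg V S \<Lambda> f \<omega> * boltz V \<Lambda> \<omega>) \<omega> =
      inv_boltz V \<Lambda> \<omega> * resample V S \<Lambda> (\<lambda>\<omega>. boltz V \<Lambda> \<omega> * f \<omega>) \<omega>" by simp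
  qed
  also have "\<dots> = (\<integral>\<^sup>+\<omega>. inv_boltz V \<Lambda> \<omega> * (boltz V \<Lambda> \<omega> * f \<omega>) \<partial>\<mu>)"
    by (rule local_gibbs_multi[OF \<mu> S \<Lambda>, symmetric]) measurable
  also have "\<dots> = (\<integral>\<^sup>+\<omega>. f \<omega> \<partial>\<mu>)" by (simp add: boltz_inv)
  finally show ?thesis .
qed

text \<open>The kernel behind \<open>gibbs_avg\<close>, needed to extend the DLR equation from events to functions.\<close>

definition avg_kernel :: "'d site set \<Rightarrow> ('d site \<Rightarrow> real set) \<Rightarrow> 'd site set \<Rightarrow> 'd config \<Rightarrow> 'd config measure"
  where "avg_kernel V S \<Lambda> \<eta> = scale_measure (inverse (resample V S \<Lambda> (boltz V \<Lambda>) \<eta>))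
     (density (distr (PiM \<Lambda> (\<lambda>i. apriori (S i))) (cfg_space V) (\<lambda>\<xi>. merge \<Lambda> (V - \<Lambda>) (\<xi>, \<eta>))) (boltz V \<Lambda>))"

lemma sets_avg_kernel[simp]: "sets (avg_kernel V S \<Lambda> \<eta>) = sets (cfg_space V)"
  by (simp add: avg_kernel_def)

lemma nn_integral_avg_kernel:
  assumes \<Lambda>: "finite \<Lambda>" "\<Lambda> \<subseteq> V" "\<eta> \<in> V \<rightarrow>\<^sub>E S1" and f[measurable]: "f \<in> borel_measurable (cfg_space V)"
  shows "(\<integral>\<^sup>+\<omega>. f \<omega> \<partial>avg_kernel V S \<Lambda> \<eta>) = gibbs_avg V S \<Lambda> f \<eta>"
proof -
  note [measurable] = boltz_measurable[OF \<Lambda>(1)]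
  have [measurable]: "(\<lambda>\<xi>. merge \<Lambda> (V - \<Lambda>) (\<xi>, \<eta>)) \<in> PiM \<Lambda> (\<lambda>i. apriori (S i)) \<rightarrow>\<^sub>M cfg_space V"
    using merge_measurable'[OF \<Lambda>(2,3)] by (simp cong: measurable_cong_sets add: sets_PiM_apriori)
  show ?thesis
    unfolding avg_kernel_def gibbs_avg_def resample_def
    by (simp add: nn_integral_scale_measure nn_integral_density nn_integral_distr divide_ennreal_def mult.commute)
qed

lemma avg_kernel_prob:
  assumes \<Lambda>: "finite \<Lambda>" "\<Lambda> \<subseteq> V" "\<eta> \<in> V \<rightarrow>\<^sub>E S1" and S: "\<And>i. i \<in> \<Lambda> \<Longrightarrow> admissible (S i)"
  shows "prob_space (avg_kernel V S \<Lambda> \<eta>)"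
proof
  have "emeasure (avg_kernel V S \<Lambda> \<eta>) (space (avg_kernel V S \<Lambda> \<eta>)) = (\<integral>\<^sup>+\<omega>. 1 \<partial>avg_kernel V S \<Lambda> \<eta>)"
    by simp
  also have "\<dots> = gibbs_avg V S \<Lambda> (\<lambda>_. 1) \<eta>"
    by (rule nn_integral_avg_kernel[OF \<Lambda>]) simp
  also have "\<dots> = 1"
    using resample_boltz_bounds(3,4)[OF \<Lambda> S] by (simp add: gibbs_avg_def ennreal_divide_self less_top)
  finally show "emeasure (avg_kernel V S \<Lambda> \<eta>) (space (avg_kernel V S \<Lambda> \<eta>)) = 1" .
qed

lemma gibbs_avg_measurable:
  assumes \<Lambda>: "finite \<Lambda>" "\<Lambda> \<subseteq> V" and S: "\<And>i. i \<in> \<Lambda> \<Longrightarrow> admissible (S i)" and f[measurable]: "f \<in> borel_measurable (cfg_space V)"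
  shows "gibbs_avg V S \<Lambda> f \<in> borel_measurable (cfg_space V)"
proof -
  note [measurable] = resample_measurable[OF \<Lambda>(2,1) S] boltz_measurable[OF \<Lambda>(1)]
  show ?thesis unfolding gibbs_avg_def[abs_def] by measurable
qed

lemma avg_kernel_measurable:
  assumes \<Lambda>: "finite \<Lambda>" "\<Lambda> \<subseteq> V" and S: "\<And>i. admissible (S i)" and \<mu>: "sets \<mu> = sets (cfg_space V)"
  shows "avg_kernel V S \<Lambda> \<in> \<mu> \<rightarrow>\<^sub>M subprob_algebra (cfg_space V)"
proof (rule measurable_subprob_algebra)
  have sp: "space \<mu> = V \<rightarrow>\<^sub>E S1" using sets_eq_imp_space_eq[OF \<mu>] by (simp add: space_cfg)
  note [measurable_cong] = \<mu>
  note [measurable] = gibbs_avg_measurable[OF \<Lambda> S]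
  show "subprob_space (avg_kernel V S \<Lambda> \<eta>)" if "\<eta> \<in> space \<mu>" for \<eta>
    using that sp by (intro prob_space_imp_subprob_space avg_kernel_prob \<Lambda> S) auto
  fix A assume A[measurable]: "A \<in> sets (cfg_space V)"
  have "gibbs_avg V S \<Lambda> (indicator A) \<in> borel_measurable \<mu>" by measurable
  moreover have "gibbs_avg V S \<Lambda> (indicator A) \<eta> = emeasure (avg_kernel V S \<Lambda> \<eta>) A" if "\<eta> \<in> space \<mu>" for \<eta>
    using that nn_integral_avg_kernel[OF \<Lambda>, of \<eta> "indicator A" S] A by (simp add: sp)
  ultimately show "(\<lambda>\<eta>. emeasure (avg_kernel V S \<Lambda> \<eta>) A) \<in> borel_measurable \<mu>"
    by (simp cong: measurable_cong)
qed simp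

text \<open>The Gibbs averages of \<open>inv_boltz * f\<close> and of \<open>inv_boltz * resample f\<close> coincide, as the Boltzmann
  factors cancel in the numerator; the DLR equation equates their integrals with those of the
  functions themselves.\<close>

lemma local_gibbsI:
  assumes \<mu>: "prob_space \<mu>" "sets \<mu> = sets (cfg_space V)" and S: "\<And>i. admissible (S i)"
    and dlr: "\<And>i B. i \<in> V \<Longrightarrow> B \<in> sets (cfg_space V) \<Longrightarrow> emeasure \<mu> B = (\<integral>\<^sup>+\<eta>. gibbs_avg V S {i} (indicator B) \<eta> \<partial>\<mu>)"
  shows "local_gibbs V S \<mu>"
  unfolding local_gibbs_def
proof (intro conjI \<mu> ballI)
  interpret prob_space \<mu> by fact
  have sp: "space \<mu> = V \<rightarrow>\<^sub>E S1" using sets_eq_imp_space_eq[OF \<mu>(2)] by (simp add: space_cfg)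
  note [measurable_cong] = \<mu>(2)
  fix i and f :: "'d config \<Rightarrow> ennreal" assume i: "i \<in> V" and f[measurable]: "f \<in> borel_measurable (cfg_space V)"
  then have \<Lambda>: "finite {i}" "{i} \<subseteq> V" by auto
  note [measurable] = gibbs_avg_measurable[OF \<Lambda> S] resample_measurable[OF \<Lambda>(2,1) S]
  have K: "avg_kernel V S {i} \<in> \<mu> \<rightarrow>\<^sub>M subprob_algebra (cfg_space V)"
    by (rule avg_kernel_measurable[OF \<Lambda> S \<mu>(2)])
  have \<mu>_bind: "\<mu> = \<mu> \<bind> avg_kernel V S {i}"
  proof (rule measure_eqI)
    show "sets \<mu> = sets (\<mu> \<bind> avg_kernel V S {i})"
      using not_empty \<mu>(2) by (subst sets_bind[where N="cfg_space V"]) auto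
    fix A assume A: "A \<in> sets \<mu>"
    then have A': "A \<in> sets (cfg_space V)" by (simp add: \<mu>(2))
    have "emeasure (\<mu> \<bind> avg_kernel V S {i}) A = (\<integral>\<^sup>+\<eta>. emeasure (avg_kernel V S {i} \<eta>) A \<partial>\<mu>)"
      by (rule emeasure_bind[OF not_empty K A'])
    also have "\<dots> = (\<integral>\<^sup>+\<eta>. gibbs_avg V S {i} (indicator A) \<eta> \<partial>\<mu>)"
      using A' by (intro nn_integral_cong) (simp add: nn_integral_avg_kernel[OF \<Lambda>, symmetric] sp)
    finally show "emeasure \<mu> A = emeasure (\<mu> \<bind> avg_kernel V S {i}) A"
      using dlr[OF i A'] by simp
  qed
  have avg: "(\<integral>\<^sup>+\<omega>. g \<omega> \<partial>\<mu>) = (\<integral>\<^sup>+\<omega>. gibbs_avg V S {i} g \<omega> \<partial>\<mu>)" if "g \<in> borel_measurable (cfg_space V)" for g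
  proof -
    have "(\<integral>\<^sup>+\<omega>. g \<omega> \<partial>\<mu>) = (\<integral>\<^sup>+\<omega>. \<integral>\<^sup>+\<omega>'. g \<omega>' \<partial>avg_kernel V S {i} \<omega> \<partial>\<mu>)"
      by (subst \<mu>_bind) (rule nn_integral_bind[OF that K])
    also have "\<dots> = (\<integral>\<^sup>+\<omega>. gibbs_avg V S {i} g \<omega> \<partial>\<mu>)"
      by (intro nn_integral_cong nn_integral_avg_kernel[OF \<Lambda> _ that]) (simp add: sp)
    finally show ?thesis .
  qed
  let ?R = "resample V S {i} f"
  have "(\<integral>\<^sup>+\<omega>. inv_boltz V {i} \<omega> * f \<omega> \<partial>\<mu>) = (\<integral>\<^sup>+\<omega>. gibbs_avg V S {i} (\<lambda>\<omega>. inv_boltz V {i} \<omega> * f \<omega>) \<omega> \<partial>\<mu>)"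
    by (rule avg) measurable
  also have "\<dots> = (\<integral>\<^sup>+\<omega>. gibbs_avg V S {i} (\<lambda>\<omega>. inv_boltz V {i} \<omega> * ?R \<omega>) \<omega> \<partial>\<mu>)"
    by (intro nn_integral_cong) (simp add: gibbs_avg_def boltz_inv resample_const[where k="?R", OF S] resample_merge)
  also have "\<dots> = (\<integral>\<^sup>+\<omega>. inv_boltz V {i} \<omega> * ?R \<omega> \<partial>\<mu>)"
    by (rule avg[symmetric]) measurable
  also have "\<dots> = (\<integral>\<^sup>+\<omega>. inv_boltz V {i} \<omega> * resample1 (S i) i f \<omega> \<partial>\<mu>)"
    by (intro nn_integral_cong) (simp add: sp resample_singleton[OF i S f])
  finally show "(\<integral>\<^sup>+\<omega>. inv_boltz V {i} \<omega> * f \<omega> \<partial>\<mu>) = (\<integral>\<^sup>+\<omega>. inv_boltz V {i} \<omega> * resample1 (S i) i f \<omega> \<partial>\<mu>)" .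
qed

text \<open>The DLR equations at single sites imply those of all finite sets by \<open>local_gibbs_multi\<close>.
  Leaving the kernel \<open>K\<close> open covers the constrained and the unconstrained specification at once.\<close>

lemma gibbs_measures_iff_local:
  assumes S: "\<And>i. admissible (S i)"
    and K: "\<And>\<Lambda> \<eta> B. finite \<Lambda> \<Longrightarrow> \<Lambda> \<subseteq> V \<Longrightarrow> \<eta> \<in> V \<rightarrow>\<^sub>E S1 \<Longrightarrow> B \<in> sets (cfg_space V) \<Longrightarrow>
      emeasure (K \<Lambda> \<eta>) B = gibbs_avg V S \<Lambda> (indicator B) \<eta>"
  shows "\<mu> \<in> gibbs_measures V (cfg_space V) K \<longleftrightarrow> local_gibbs V S \<mu>"
proof
  assume \<mu>: "\<mu> \<in> gibbs_measures V (cfg_space V) K"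
  then have p: "prob_space \<mu>" "sets \<mu> = sets (cfg_space V)" by (auto simp: gibbs_measures_def)
  show "local_gibbs V S \<mu>"
  proof (rule local_gibbsI[OF p S])
    fix i B assume i: "i \<in> V" and B: "B \<in> sets (cfg_space V)"
    have "emeasure \<mu> B = (\<integral>\<^sup>+\<eta>. emeasure (K {i} \<eta>) B \<partial>\<mu>)"
      using \<mu> i B by (simp add: gibbs_measures_def)
    also have "\<dots> = (\<integral>\<^sup>+\<eta>. gibbs_avg V S {i} (indicator B) \<eta> \<partial>\<mu>)"
      using i B sets_eq_imp_space_eq[OF p(2)] by (intro nn_integral_cong K) (auto simp: space_cfg)
    finally show "emeasure \<mu> B = (\<integral>\<^sup>+\<eta>. gibbs_avg V S {i} (indicator B) \<eta> \<partial>\<mu>)" .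
  qed
next
  assume \<mu>: "local_gibbs V S \<mu>"
  show "\<mu> \<in> gibbs_measures V (cfg_space V) K"
    unfolding gibbs_measures_def
  proof (safe intro!: local_gibbsD(1,2)[OF \<mu>])
    fix \<Lambda> B assume \<Lambda>: "finite \<Lambda>" "\<Lambda> \<subseteq> V" and B: "B \<in> sets (cfg_space V)"
    have "emeasure \<mu> B = (\<integral>\<^sup>+\<omega>. indicator B \<omega> \<partial>\<mu>)"
      using B local_gibbsD(2)[OF \<mu>] by simp
    also have "\<dots> = (\<integral>\<^sup>+\<eta>. gibbs_avg V S \<Lambda> (indicator B) \<eta> \<partial>\<mu>)"
      using B by (intro local_gibbs_avg[OF \<mu> S \<Lambda>, symmetric]) simp
    also have "\<dots> = (\<integral>\<^sup>+\<eta>. emeasure (K \<Lambda> \<eta>) B \<partial>\<mu>)"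
      using local_gibbsD(3)[OF \<mu>] by (intro nn_integral_cong K[symmetric] \<Lambda> B) simp
    finally show "emeasure \<mu> B = (\<integral>\<^sup>+\<eta>. emeasure (K \<Lambda> \<eta>) B \<partial>\<mu>)" .
  qed
qed

end

lemma space_dcfg: "space (dcfg_space q) = UNIV \<rightarrow>\<^sub>E {1..q}"
  by (simp add: dcfg_space_def space_PiM)

lemma discr_cfg_measurable:
  assumes q: "q \<ge> 1" shows "discr_cfg q \<in> cfg_space UNIV \<rightarrow>\<^sub>M (dcfg_space q :: 'd::finite dconfig measure)"
  unfolding dcfg_space_def cfg_space_def
proof (rule measurable_PiM_single')
  fix i :: "'d site"
  have "(\<lambda>\<omega>. \<omega> i) \<in> PiM UNIV (\<lambda>_. circle_measure) \<rightarrow>\<^sub>M circle_measure" by simp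
  then show "(\<lambda>\<omega>. discr_cfg q \<omega> i) \<in> PiM UNIV (\<lambda>_. circle_measure) \<rightarrow>\<^sub>M count_space {1..q}"
    unfolding discr_cfg_def by (rule measurable_compose) (rule discr_measurable[OF q])
next
  show "discr_cfg q \<in> space (PiM UNIV (\<lambda>_. circle_measure)) \<rightarrow> (UNIV \<rightarrow>\<^sub>E space (count_space {1..q}))"
    using discr_in[OF q] unfolding discr_cfg_def by (auto simp: space_PiM PiE_def Pi_iff simp del: One_nat_def)
qed

context gibbs_model
begin

definition arcs :: "'d dconfig \<Rightarrow> 'd site \<Rightarrow> real set"
  where "arcs \<sigma> i = spin_arc q (\<sigma> i)"

lemma arcs_admissible: "\<sigma> \<in> UNIV \<rightarrow>\<^sub>E {1..q} \<Longrightarrow> admissible (arcs \<sigma> i)"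
  unfolding arcs_def by (intro admissible_arc q) auto

lemma emeasure_boltzmann:
  assumes \<Lambda>: "finite \<Lambda>" "\<Lambda> \<subseteq> V" "\<eta> \<in> V \<rightarrow>\<^sub>E S1" and C[measurable]: "C \<in> sets (cfg_space V)"
  shows "emeasure (boltzmann_measure V \<Phi> \<Lambda> \<eta>) C =
    (\<integral>\<^sup>+\<xi>. boltz V \<Lambda> (merge \<Lambda> (V - \<Lambda>) (\<xi>, \<eta>)) * indicator C (merge \<Lambda> (V - \<Lambda>) (\<xi>, \<eta>)) \<partial>PiM \<Lambda> (\<lambda>_. circle_measure))"
proof -
  note [measurable] = boltz_measurable[OF \<Lambda>(1)] merge_measurable'[OF \<Lambda>(2,3)]
  show ?thesis
    unfolding boltzmann_measure_def boltz_def[symmetric]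
    by (subst emeasure_density) (simp_all add: nn_integral_distr)
qed

text \<open>Conditioning the spins in \<open>\<Lambda>\<close> on the sets \<open>S\<close> restricts their a priori measures to \<open>S\<close>; the
  constants from normalization cancel in the quotient.\<close>

lemma uniform_gibbs_spec:
  assumes \<Lambda>: "finite \<Lambda>" "\<Lambda> \<subseteq> V" "\<eta> \<in> V \<rightarrow>\<^sub>E S1" and S: "\<And>i. admissible (S i)"
    and B: "B \<in> sets (cfg_space V)"
  shows "emeasure (uniform_measure (gibbs_spec V \<Phi> \<Lambda> \<eta>) {\<omega> \<in> space (cfg_space V). \<forall>j\<in>\<Lambda>. \<omega> j \<in> S j}) B =
      gibbs_avg V S \<Lambda> (indicator B) \<eta>"
    and "emeasure (gibbs_spec V \<Phi> \<Lambda> \<eta>) B = gibbs_avg V (\<lambda>_. S1) \<Lambda> (indicator B) \<eta>"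
proof -
  define b where "b C = emeasure (boltzmann_measure V \<Phi> \<Lambda> \<eta>) C" for C
  define A where "A S = {\<omega> \<in> space (cfg_space V). \<forall>j\<in>\<Lambda>. \<omega> j \<in> S j}" for S :: "'d site \<Rightarrow> real set"
  have A_sets: "A S \<in> sets (cfg_space V)" if S: "\<And>i. admissible (S i)" for S
  proof -
    have "{\<omega> \<in> space (cfg_space V). \<omega> j \<in> S j} \<in> sets (cfg_space V)" if "j \<in> \<Lambda>" for j
    proof -
      have [measurable]: "S j \<in> sets circle_measure" using S that by (simp add: admissible_def)
      have "j \<in> V" using that \<Lambda> by auto
      then have [measurable]: "(\<lambda>\<omega>. \<omega> j) \<in> cfg_space V \<rightarrow>\<^sub>M circle_measure"
        by (simp add: cfg_space_def)
      show ?thesis by measurable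
    qed
    then show ?thesis unfolding A_def using \<Lambda>(1) by (intro sets.sets_Collect_finite_All) auto
  qed
  \<comment> \<open>The constant is the product of the inverse lengths of the sets \<open>S i\<close>.\<close>
  have key: "\<exists>\<kappa>. \<kappa> \<noteq> 0 \<and> \<kappa> \<noteq> \<infinity> \<and> (\<forall>B\<in>sets (cfg_space V). resample V S \<Lambda> (\<lambda>\<omega>. boltz V \<Lambda> \<omega> * indicator B \<omega>) \<eta> = \<kappa> * b (A S \<inter> B))"
    if S: "\<And>i. admissible (S i)" for S
  proof (intro exI conjI ballI)
    let ?\<kappa> = "\<Prod>i\<in>\<Lambda>. inverse (emeasure circle_measure (S i))"
    have fin: "emeasure circle_measure X \<noteq> \<infinity>" for X
      using finite_measure.emeasure_finite[OF finite_circle] by simp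
    show "?\<kappa> \<noteq> 0" using \<Lambda>(1) fin by (simp add: prod_zero_iff)
    show "?\<kappa> \<noteq> \<infinity>"
      using S by (auto simp: ennreal_prod_eq_top admissible_def)
    fix B assume B[measurable]: "B \<in> sets (cfg_space V)"
    note [measurable] = boltz_measurable[OF \<Lambda>(1)] merge_measurable'[OF \<Lambda>(2,3)] A_sets[OF S]
    let ?m = "\<lambda>\<xi>. merge \<Lambda> (V - \<Lambda>) (\<xi>, \<eta>)"
    have "resample V S \<Lambda> (\<lambda>\<omega>. boltz V \<Lambda> \<omega> * indicator B \<omega>) \<eta> =
      (\<integral>\<^sup>+\<xi>. (\<Prod>i\<in>\<Lambda>. indicator (S i) (\<xi> i) / emeasure circle_measure (S i)) * (boltz V \<Lambda> (?m \<xi>) * indicator B (?m \<xi>)) \<partial>PiM \<Lambda> (\<lambda>_. circle_measure))"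
      unfolding resample_def by (rule nn_integral_PiM_apriori[OF \<Lambda>(1) S]) measurable
    also have "\<dots> = (\<integral>\<^sup>+\<xi>. ?\<kappa> * (boltz V \<Lambda> (?m \<xi>) * indicator (A S \<inter> B) (?m \<xi>)) \<partial>PiM \<Lambda> (\<lambda>_. circle_measure))"
    proof (rule nn_integral_cong)
      fix \<xi> assume "\<xi> \<in> space (PiM \<Lambda> (\<lambda>_. circle_measure))"
      then have \<xi>: "\<xi> \<in> \<Lambda> \<rightarrow>\<^sub>E S1" by (simp add: space_PiM)
      have "?m \<xi> \<in> A S \<longleftrightarrow> (\<forall>i\<in>\<Lambda>. \<xi> i \<in> S i)"
        using merge_space[OF \<Lambda>(2,3) \<xi>] by (auto simp: A_def space_cfg merge_def)
      then have "(\<Prod>i\<in>\<Lambda>. indicator (S i) (\<xi> i)) = (indicator (A S) (?m \<xi>) :: ennreal)"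
        using \<Lambda>(1) by (auto simp: indicator_def prod_zero_iff)
      then show "(\<Prod>i\<in>\<Lambda>. indicator (S i) (\<xi> i) / emeasure circle_measure (S i)) * (boltz V \<Lambda> (?m \<xi>) * indicator B (?m \<xi>)) =
        ?\<kappa> * (boltz V \<Lambda> (?m \<xi>) * indicator (A S \<inter> B) (?m \<xi>))"
        by (simp add: divide_ennreal_def prod.distrib indicator_inter_arith ac_simps)
    qed
    also have "\<dots> = ?\<kappa> * b (A S \<inter> B)"
      unfolding b_def by (subst emeasure_boltzmann[OF \<Lambda>]) (simp_all add: nn_integral_cmult)
    finally show "resample V S \<Lambda> (\<lambda>\<omega>. boltz V \<Lambda> \<omega> * indicator B \<omega>) \<eta> = ?\<kappa> * b (A S \<inter> B)" .
  qed
  have ratio: "gibbs_avg V S \<Lambda> (indicator B) \<eta> = b (A S \<inter> B) / b (A S)"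
    and bA: "b (A S) \<noteq> 0" "b (A S) \<noteq> \<infinity>"
    if S: "\<And>i. admissible (S i)" for S
  proof -
    obtain \<kappa> where \<kappa>: "\<kappa> \<noteq> 0" "\<kappa> \<noteq> \<infinity>"
      and eq: "\<forall>B\<in>sets (cfg_space V). resample V S \<Lambda> (\<lambda>\<omega>. boltz V \<Lambda> \<omega> * indicator B \<omega>) \<eta> = \<kappa> * b (A S \<inter> B)"
      using key[of S, OF S] by blast
    have "resample V S \<Lambda> (boltz V \<Lambda>) \<eta> = resample V S \<Lambda> (\<lambda>\<omega>. boltz V \<Lambda> \<omega> * indicator (space (cfg_space V)) \<omega>) \<eta>"
      unfolding resample_def using merge_space[OF \<Lambda>(2,3)]
      by (intro nn_integral_cong) (simp add: space_PiM_apriori space_cfg)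
    also have "\<dots> = \<kappa> * b (A S)"
    proof -
      have "A S \<inter> space (cfg_space V) = A S" by (auto simp: A_def)
      then show ?thesis using eq by simp
    qed
    finally have Z: "resample V S \<Lambda> (boltz V \<Lambda>) \<eta> = \<kappa> * b (A S)" .
    show 0: "b (A S) \<noteq> 0" "b (A S) \<noteq> \<infinity>"
      using resample_boltz_bounds(3,4)[of \<Lambda> V \<eta> S] \<Lambda> S \<kappa> unfolding Z by (auto simp: ennreal_mult_eq_top_iff)
    show "gibbs_avg V S \<Lambda> (indicator B) \<eta> = b (A S \<inter> B) / b (A S)"
      unfolding gibbs_avg_def Z using eq B \<kappa> 0 by (simp add: ennreal_mult_cancel_divide)
  qed
  have S1: "A (\<lambda>_. S1) = space (cfg_space V)" using \<Lambda>(2) by (auto simp: A_def space_cfg PiE_def)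
  note b1 = bA[of "\<lambda>_. S1", unfolded S1, OF admissible_S1]
  have spec: "emeasure (gibbs_spec V \<Phi> \<Lambda> \<eta>) C = b C / b (space (cfg_space V))" for C
    unfolding gibbs_spec_def b_def by (simp add: divide_ennreal_def mult.commute)
  have sets_spec: "sets (gibbs_spec V \<Phi> \<Lambda> \<eta>) = sets (cfg_space V)"
    by (simp add: gibbs_spec_def boltzmann_measure_def)
  show "emeasure (gibbs_spec V \<Phi> \<Lambda> \<eta>) B = gibbs_avg V (\<lambda>_. S1) \<Lambda> (indicator B) \<eta>"
    using ratio[of "\<lambda>_. S1", OF admissible_S1] sets.sets_into_space[OF B] unfolding spec S1 by (simp add: Int_absorb1)
  have "emeasure (uniform_measure (gibbs_spec V \<Phi> \<Lambda> \<eta>) (A S)) B = (b (A S \<inter> B) / b (space (cfg_space V))) / (b (A S) / b (space (cfg_space V)))"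
    using A_sets[OF S] B by (subst emeasure_uniform_measure) (simp_all add: sets_spec spec)
  also have "\<dots> = b (A S \<inter> B) / b (A S)"
    unfolding divide_ennreal_def[of _ "b (space (cfg_space V))"] mult.commute[of _ "inverse (b (space (cfg_space V)))"]
    using b1 bA[OF S] by (intro ennreal_mult_cancel_divide) auto
  finally show "emeasure (uniform_measure (gibbs_spec V \<Phi> \<Lambda> \<eta>) {\<omega> \<in> space (cfg_space V). \<forall>j\<in>\<Lambda>. \<omega> j \<in> S j}) B = gibbs_avg V S \<Lambda> (indicator B) \<eta>"
    unfolding ratio[OF S] A_def[of S] .
qed

lemma emeasure_constrained_spec:
  assumes \<Lambda>: "finite \<Lambda>" "\<Lambda> \<subseteq> V" "\<eta> \<in> V \<rightarrow>\<^sub>E S1" and \<sigma>: "\<sigma> \<in> UNIV \<rightarrow>\<^sub>E {1..q}"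
    and B: "B \<in> sets (cfg_space V)"
  shows "emeasure (constrained_spec V \<Phi> q \<sigma> \<Lambda> \<eta>) B = gibbs_avg V (arcs \<sigma>) \<Lambda> (indicator B) \<eta>"
proof -
  have "{\<omega> \<in> space (cfg_space V). \<forall>j\<in>\<Lambda>. discr q (\<omega> j) = \<sigma> j} = {\<omega> \<in> space (cfg_space V). \<forall>j\<in>\<Lambda>. \<omega> j \<in> arcs \<sigma> j}"
    using \<Lambda>(2) by (auto simp: space_cfg arcs_def spin_arc_def PiE_def Pi_iff subset_eq)
  then show ?thesis
    unfolding constrained_spec_def using uniform_gibbs_spec(1)[OF \<Lambda> arcs_admissible[OF \<sigma>] B] by simp
qed

lemma gibbs_measures_free:
  "\<mu> \<in> gibbs_measures V (cfg_space V) (gibbs_spec V \<Phi>) \<longleftrightarrow> local_gibbs V (\<lambda>_. S1) \<mu>"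
  by (rule gibbs_measures_iff_local) (auto intro!: admissible_S1 uniform_gibbs_spec(2))

lemma gibbs_measures_constrained:
  assumes "\<sigma> \<in> UNIV \<rightarrow>\<^sub>E {1..q}"
  shows "\<mu> \<in> gibbs_measures V (cfg_space V) (constrained_spec V \<Phi> q \<sigma>) \<longleftrightarrow> local_gibbs V (arcs \<sigma>) \<mu>"
  by (rule gibbs_measures_iff_local) (auto intro!: arcs_admissible emeasure_constrained_spec assms)

text \<open>A resampled spin lies in \<open>S i\<close>, so the complementary event has measure zero after weighting with a
  positive function.\<close>

lemma local_gibbs_AE_site:
  assumes \<mu>: "local_gibbs V S \<mu>" and S: "\<And>i. admissible (S i)" and i: "i \<in> V"
  shows "AE \<omega> in \<mu>. \<omega> i \<in> S i"
proof -
  note sp = local_gibbsD(3)[OF \<mu>]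
  note [measurable_cong] = local_gibbsD(2)[OF \<mu>]
  have [measurable]: "S i \<in> sets circle_measure" using S by (simp add: admissible_def)
  have [measurable]: "(\<lambda>\<omega>. \<omega> i) \<in> cfg_space V \<rightarrow>\<^sub>M circle_measure" using i by (simp add: cfg_space_def)
  define f :: "'d config \<Rightarrow> ennreal" where "f \<omega> = indicator (S1 - S i) (\<omega> i)" for \<omega>
  have [measurable]: "f \<in> borel_measurable (cfg_space V)"
    unfolding f_def[abs_def] by measurable
  note [measurable] = inv_boltz_measurable[of "{i}" V]
  have R: "resample1 (S i) i f \<omega> = 0" for \<omega>
  proof -
    have "resample1 (S i) i f \<omega> = (\<integral>\<^sup>+x. 0 \<partial>apriori (S i))"
      unfolding resample1_def f_def
    proof (rule nn_integral_cong_AE)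
      show "AE x in apriori (S i). indicator (S1 - S i) (fun_upd \<omega> i x i) = (0::ennreal)"
        using AE_apriori[OF S, of i] by eventually_elim simp
    qed
    then show ?thesis by simp
  qed
  have "(\<integral>\<^sup>+\<omega>. inv_boltz V {i} \<omega> * f \<omega> \<partial>\<mu>) = 0"
    by (subst local_gibbsD(4)[OF \<mu> i]) (simp_all add: R)
  then have "AE \<omega> in \<mu>. inv_boltz V {i} \<omega> * f \<omega> = 0"
    by (subst (asm) nn_integral_0_iff_AE) simp_all
  then show ?thesis
    using AE_space by eventually_elim (use i in \<open>auto simp: inv_boltz_def f_def indicator_def sp split: if_splits\<close>)
qed

lemma local_gibbs_AE:
  assumes \<mu>: "local_gibbs V S \<mu>" and S: "\<And>i. admissible (S i)"
  shows "AE \<omega> in \<mu>. \<omega> \<in> Pi\<^sub>E V S"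
proof -
  have "AE \<omega> in \<mu>. \<forall>i\<in>V. \<omega> i \<in> S i"
    using local_gibbs_AE_site[OF \<mu> S] by (simp add: AE_ball_countable)
  moreover have "AE \<omega> in \<mu>. \<omega> \<in> V \<rightarrow>\<^sub>E S1"
    using local_gibbsD(3)[OF \<mu>] by (intro AE_I2) simp
  ultimately show ?thesis by eventually_elim (auto simp: PiE_def)
qed

lemma constrained_gibbs_eq:
  assumes "\<sigma> \<in> UNIV \<rightarrow>\<^sub>E {1..q}"
  shows "constrained_gibbs V \<Phi> q \<sigma> = (THE \<mu>. local_gibbs V (arcs \<sigma>) \<mu>)"
proof -
  have "\<mu> \<in> gibbs_measures V (cfg_space V) (constrained_spec V \<Phi> q \<sigma>) \<and> (AE \<omega> in \<mu>. \<omega> \<in> (\<Pi>\<^sub>E i\<in>V. spin_arc q (\<sigma> i)))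
    \<longleftrightarrow> local_gibbs V (arcs \<sigma>) \<mu>" for \<mu>
    unfolding gibbs_measures_constrained[OF assms]
    using local_gibbs_AE[of V "arcs \<sigma>" \<mu>] arcs_admissible[OF assms] by (auto simp: arcs_def[abs_def])
  then show ?thesis by (simp add: constrained_gibbs_def)
qed

end

section \<open>Dobrushin contraction\<close>

lemma PiE_UNIV_iff: "f \<in> Pi\<^sub>E UNIV S \<longleftrightarrow> (\<forall>i. f i \<in> S i)"
  by (auto simp: PiE_def Pi_iff)

text \<open>For densities \<open>a\<close> and \<open>b\<close>, the means of \<open>g\<close> differ by at most its oscillation times the total
  variation distance: subtract from \<open>g\<close> its infimum, then keep only the set where \<open>a > b\<close>. The
  absence of a factor 2 matters, since the contraction condition is \<open>c_bar < 1\<close>.\<close>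

lemma integral_diff_le_tv:
  fixes a b g :: "'a \<Rightarrow> real"
  assumes p: "prob_space P" and a[measurable]: "a \<in> borel_measurable P" and b[measurable]: "b \<in> borel_measurable P"
    and g[measurable]: "g \<in> borel_measurable P"
    and bnd: "\<And>x. x \<in> space P \<Longrightarrow> \<bar>a x\<bar> \<le> K" "\<And>x. x \<in> space P \<Longrightarrow> \<bar>b x\<bar> \<le> K" "\<And>x. x \<in> space P \<Longrightarrow> \<bar>g x\<bar> \<le> 1"
    and eq: "(\<integral>x. a x \<partial>P) = (\<integral>x. b x \<partial>P)"
    and X: "AE x in P. x \<in> X" "X \<noteq> {}" "X \<subseteq> space P" and osc: "\<And>x y. x \<in> X \<Longrightarrow> y \<in> X \<Longrightarrow> g x - g y \<le> D"
    and tv: "\<And>B. B \<in> sets P \<Longrightarrow> (\<integral>x. a x * indicator B x \<partial>P) - (\<integral>x. b x * indicator B x \<partial>P) \<le> t"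
  shows "(\<integral>x. g x * a x \<partial>P) - (\<integral>x. g x * b x \<partial>P) \<le> D * t"
proof -
  interpret prob_space P by fact
  obtain x0 where x0: "x0 \<in> X" using X by auto
  have D0: "0 \<le> D" using osc[OF x0 x0] by simp
  define m where "m = (INF x\<in>X. g x)"
  have bdd: "bdd_below (g ` X)" using bnd(3) X by (intro bdd_belowI2[of _ "-1"]) (force simp: abs_le_iff)
  have m1: "m \<le> g x" if "x \<in> X" for x unfolding m_def using bdd that by (rule cINF_lower)
  have m2: "g x - m \<le> D" if "x \<in> X" for x
  proof -
    have "g x - D \<le> m" unfolding m_def using X osc[OF that] by (intro cINF_greatest) (auto simp: algebra_simps)
    then show ?thesis by simp
  qed
  define B where "B = {x \<in> space P. a x > b x}"
  have [measurable]: "B \<in> sets P" unfolding B_def by measurable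
  have ia: "integrable P a" and ib: "integrable P b"
    using bnd by (auto intro!: integrable_const_bound[where B=K] AE_I2)
  have i1: "integrable P (\<lambda>x. g x * a x)" "integrable P (\<lambda>x. g x * b x)"
    by (rule Bochner_Integration.integrable_bound[OF ia], simp, use bnd in \<open>auto intro!: AE_I2 simp: abs_mult mult_left_le_one_le\<close>)
       (rule Bochner_Integration.integrable_bound[OF ib], simp, use bnd in \<open>auto intro!: AE_I2 simp: abs_mult mult_left_le_one_le\<close>)
  have i2: "integrable P (\<lambda>x. a x * indicator B x)" "integrable P (\<lambda>x. b x * indicator B x)"
    using ia ib by (auto intro!: integrable_real_mult_indicator)
  have "(\<integral>x. g x * a x \<partial>P) - (\<integral>x. g x * b x \<partial>P) = (\<integral>x. g x * a x - g x * b x - m * (a x - b x) \<partial>P)"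
    using i1 ia ib eq by simp
  also have "\<dots> \<le> (\<integral>x. D * (a x * indicator B x - b x * indicator B x) \<partial>P)"
  proof (rule integral_mono_AE)
    show "AE x in P. g x * a x - g x * b x - m * (a x - b x) \<le> D * (a x * indicator B x - b x * indicator B x)"
      using X(1)
    proof eventually_elim
      case (elim x)
      have "g x * a x - g x * b x - m * (a x - b x) = (g x - m) * (a x - b x)" by (simp add: algebra_simps)
      also have "\<dots> \<le> D * (a x * indicator B x - b x * indicator B x)"
      proof (cases "x \<in> B")
        case True
        then show ?thesis using m1[OF elim] m2[OF elim] by (auto simp: B_def intro!: mult_right_mono)
      next
        case False
        then have "a x \<le> b x" using elim X by (auto simp: B_def)
        then show ?thesis using False m1[OF elim] by (simp add: mult_nonneg_nonpos)
      qed
      finally show ?case .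
    qed
  qed (use i1 i2 ia ib in auto)
  also have "\<dots> = D * ((\<integral>x. a x * indicator B x \<partial>P) - (\<integral>x. b x * indicator B x \<partial>P))"
    using i2 by simp
  also have "\<dots> \<le> D * t" using tv D0 by (intro mult_left_mono) auto
  finally show ?thesis .
qed

context gibbs_model
begin

definition fibre_eq :: "'d config \<Rightarrow> 'd config \<Rightarrow> bool"
  where "fibre_eq \<omega> \<eta> \<longleftrightarrow> \<omega> \<in> Omega \<and> \<eta> \<in> Omega \<and> (\<forall>k. discr q (\<omega> k) = discr q (\<eta> k))"

definition arc_at :: "'d config \<Rightarrow> 'd site \<Rightarrow> real set"
  where "arc_at \<omega> i = spin_arc q (discr q (\<omega> i))"

definition site_weight :: "'d site \<Rightarrow> 'd config \<Rightarrow> real \<Rightarrow> real"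
  where "site_weight i \<omega> x = exp (- ham UNIV {i} (fun_upd \<omega> i x))"

definition site_norm :: "'d site \<Rightarrow> 'd config \<Rightarrow> real"
  where "site_norm i \<omega> = (\<integral>x. site_weight i \<omega> x \<partial>apriori (arc_at \<omega> i))"

text \<open>The conditional distribution of the spin at \<open>i\<close> given the other spins and its own arc; it depends
  on \<open>\<omega> i\<close> only through the arc.\<close>

definition site_cond :: "'d site \<Rightarrow> 'd config \<Rightarrow> real measure"
  where "site_cond i \<omega> = density (apriori (arc_at \<omega> i)) (\<lambda>x. ennreal (site_weight i \<omega> x / site_norm i \<omega>))"

lemma arc_at_admissible: "\<omega> \<in> Omega \<Longrightarrow> admissible (arc_at \<omega> i)"
  unfolding arc_at_def by (intro admissible_arc q discr_in) auto

lemma Omega_upd: "\<omega> \<in> Omega \<Longrightarrow> x \<in> S1 \<Longrightarrow> fun_upd \<omega> i x \<in> Omega"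
  by auto

lemma arc_at_subset: "arc_at \<omega> i \<subseteq> S1"
  by (auto simp: arc_at_def spin_arc_def)

lemma arc_at_nonempty: "\<omega> \<in> Omega \<Longrightarrow> arc_at \<omega> i \<noteq> {}"
  by (auto simp: arc_at_def spin_arc_def)

lemma fibre_eq_arc_at: "fibre_eq \<omega> \<eta> \<Longrightarrow> arc_at \<omega> i = arc_at \<eta> i"
  by (simp add: fibre_eq_def arc_at_def)

lemma site_weight_measurable[measurable]:
  assumes "\<omega> \<in> Omega" shows "site_weight i \<omega> \<in> borel_measurable circle_measure"
proof -
  have [measurable]: "ham UNIV {i} \<in> borel_measurable (cfg_space UNIV)" by (rule ham_measurable) simp
  have [measurable]: "(\<lambda>x. fun_upd \<omega> i x) \<in> circle_measure \<rightarrow>\<^sub>M cfg_space UNIV" by (rule upd_measurable') (use assms in auto)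
  show ?thesis unfolding site_weight_def[abs_def] by measurable
qed

lemma site_weight_bounds:
  assumes "\<omega> \<in> Omega" "x \<in> S1"
  shows "exp (- hb {i}) \<le> site_weight i \<omega> x" "site_weight i \<omega> x \<le> exp (hb {i})" "0 < site_weight i \<omega> x"
  using ham_bound[of "{i}" "fun_upd \<omega> i x" UNIV] Omega_upd[OF assms, of i]
  by (auto simp: site_weight_def abs_le_iff)

lemma site_weight_integrable: "\<omega> \<in> Omega \<Longrightarrow> integrable (apriori (arc_at \<omega> i)) (site_weight i \<omega>)"
  and site_norm_bounds: "\<omega> \<in> Omega \<Longrightarrow> exp (- hb {i}) \<le> site_norm i \<omega>" "\<omega> \<in> Omega \<Longrightarrow> 0 < site_norm i \<omega>"
proof -
  assume \<omega>: "\<omega> \<in> Omega"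
  interpret prob_space "apriori (arc_at \<omega> i)" by (intro prob_space_apriori arc_at_admissible \<omega>)
  show *: "integrable (apriori (arc_at \<omega> i)) (site_weight i \<omega>)"
    by (rule integrable_const_bound[where B="exp (hb {i})"])
       (use site_weight_bounds[OF \<omega>] site_weight_measurable[OF \<omega>] in \<open>auto intro!: AE_I2 simp: abs_of_pos less_imp_le\<close>)
  have "(\<integral>x. exp (- hb {i}) \<partial>apriori (arc_at \<omega> i)) \<le> site_norm i \<omega>"
    unfolding site_norm_def using * site_weight_bounds[OF \<omega>] by (intro integral_mono) auto
  then show "exp (- hb {i}) \<le> site_norm i \<omega>" using prob_space by simp
  then show "0 < site_norm i \<omega>" by (rule less_le_trans[rotated]) simp
qed

lemma sets_site_cond[simp]: "sets (site_cond i \<omega>) = sets circle_measure"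
  by (simp add: site_cond_def)

lemma space_site_cond[simp]: "space (site_cond i \<omega>) = S1"
  by (simp add: site_cond_def)

lemma integral_site_cond:
  fixes g :: "real \<Rightarrow> real"
  assumes \<omega>: "\<omega> \<in> Omega" and g[measurable]: "g \<in> borel_measurable circle_measure"
  shows "(\<integral>x. g x \<partial>site_cond i \<omega>) = (\<integral>x. g x * (site_weight i \<omega> x / site_norm i \<omega>) \<partial>apriori (arc_at \<omega> i))"
  unfolding site_cond_def
  using site_weight_measurable[OF \<omega>] site_weight_bounds(3)[OF \<omega>] site_norm_bounds(2)[OF \<omega>]
  by (subst integral_density) (auto intro!: AE_I2 simp: less_imp_le mult.commute)

lemma emeasure_site_cond:
  assumes \<omega>: "\<omega> \<in> Omega" and B[measurable]: "B \<in> sets circle_measure"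
  shows "emeasure (site_cond i \<omega>) B =
    (\<integral>\<^sup>+x. boltz UNIV {i} (fun_upd \<omega> i x) * indicator B x \<partial>apriori (arc_at \<omega> i)) / (\<integral>\<^sup>+x. boltz UNIV {i} (fun_upd \<omega> i x) \<partial>apriori (arc_at \<omega> i))"
proof -
  note [measurable] = site_weight_measurable[OF \<omega>]
  have b: "boltz UNIV {i} (fun_upd \<omega> i x) = ennreal (site_weight i \<omega> x)" for x
    by (simp add: boltz_def site_weight_def)
  have Z: "(\<integral>\<^sup>+x. boltz UNIV {i} (fun_upd \<omega> i x) \<partial>apriori (arc_at \<omega> i)) = ennreal (site_norm i \<omega>)"
    unfolding b site_norm_def using site_weight_integrable[OF \<omega>]
    by (intro nn_integral_eq_integral) (auto intro!: AE_I2 simp: less_imp_le[OF site_weight_bounds(3)[OF \<omega>]])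
  have "emeasure (site_cond i \<omega>) B = (\<integral>\<^sup>+x. ennreal (site_weight i \<omega> x / site_norm i \<omega>) * indicator B x \<partial>apriori (arc_at \<omega> i))"
    unfolding site_cond_def by (rule emeasure_density) simp_all
  also have "\<dots> = (\<integral>\<^sup>+x. boltz UNIV {i} (fun_upd \<omega> i x) * indicator B x / ennreal (site_norm i \<omega>) \<partial>apriori (arc_at \<omega> i))"
    unfolding b
    by (intro nn_integral_cong)
       (auto simp: divide_ennreal less_imp_le[OF site_weight_bounds(3)[OF \<omega>]] site_norm_bounds(2)[OF \<omega>] indicator_def)
  also have "\<dots> = (\<integral>\<^sup>+x. boltz UNIV {i} (fun_upd \<omega> i x) * indicator B x \<partial>apriori (arc_at \<omega> i)) / ennreal (site_norm i \<omega>)"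
    unfolding b by (rule nn_integral_divide) measurable
  finally show ?thesis by (simp add: Z)
qed

lemma prob_space_site_cond:
  assumes \<omega>: "\<omega> \<in> Omega" shows "prob_space (site_cond i \<omega>)"
proof
  let ?I = "\<integral>\<^sup>+x. boltz UNIV {i} (fun_upd \<omega> i x) \<partial>apriori (arc_at \<omega> i)"
  have Z: "?I = ennreal (site_norm i \<omega>)"
    unfolding site_norm_def boltz_def site_weight_def[symmetric] using site_weight_integrable[OF \<omega>]
    by (intro nn_integral_eq_integral) (auto intro!: AE_I2 simp: less_imp_le[OF site_weight_bounds(3)[OF \<omega>]])
  have "(\<integral>\<^sup>+x. boltz UNIV {i} (fun_upd \<omega> i x) * indicator S1 x \<partial>apriori (arc_at \<omega> i)) = ?I"
    by (intro nn_integral_cong) simp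
  then have "emeasure (site_cond i \<omega>) S1 = ?I / ?I"
    using emeasure_site_cond[OF \<omega> S1_sets(1), of i] by simp
  then show "emeasure (site_cond i \<omega>) (space (site_cond i \<omega>)) = 1"
    unfolding Z using site_norm_bounds(2)[OF \<omega>, of i] by (simp add: ennreal_divide_self)
qed

lemma site_marginal_constrained:
  assumes \<sigma>: "\<sigma> \<in> UNIV \<rightarrow>\<^sub>E {1..q}" and \<omega>: "\<omega> \<in> (\<Pi>\<^sub>E k\<in>UNIV. spin_arc q (\<sigma> k))"
  shows "site_marginal i (constrained_spec UNIV \<Phi> q \<sigma> {i} \<omega>) = site_cond i \<omega>"
proof (rule measure_eqI)
  show "sets (site_marginal i (constrained_spec UNIV \<Phi> q \<sigma> {i} \<omega>)) = sets (site_cond i \<omega>)"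
    by (simp add: site_marginal_def)
  fix B assume "B \<in> sets (site_marginal i (constrained_spec UNIV \<Phi> q \<sigma> {i} \<omega>))"
  then have B[measurable]: "B \<in> sets circle_measure" by (simp add: site_marginal_def)
  have \<omega>': "\<omega> \<in> Omega" using \<omega> by (auto simp: spin_arc_def)
  have arc: "arcs \<sigma> i = arc_at \<omega> i" using \<omega> by (auto simp: arcs_def arc_at_def spin_arc_def PiE_UNIV_iff)
  have [measurable]: "(\<lambda>\<omega>. \<omega> i) \<in> cfg_space UNIV \<rightarrow>\<^sub>M circle_measure" by (simp add: cfg_space_def)
  have sets: "sets (constrained_spec UNIV \<Phi> q \<sigma> {i} \<omega>) = sets (cfg_space UNIV)"
    by (simp add: constrained_spec_def gibbs_spec_def boltzmann_measure_def)
  have "(\<lambda>\<omega>. \<omega> i) -` B \<inter> space (cfg_space UNIV) \<in> sets (cfg_space UNIV)" by measurable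
  then have e: "emeasure (site_marginal i (constrained_spec UNIV \<Phi> q \<sigma> {i} \<omega>)) B =
      gibbs_avg UNIV (arcs \<sigma>) {i} (indicator ((\<lambda>\<omega>. \<omega> i) -` B \<inter> space (cfg_space UNIV))) \<omega>"
    unfolding site_marginal_def using sets_eq_imp_space_eq[OF sets]
    by (subst emeasure_distr) (auto simp: emeasure_constrained_spec[OF _ _ \<omega>' \<sigma>] cong: measurable_cong_sets[OF sets refl])
  note [measurable] = boltz_measurable[of "{i}" UNIV]
  have "(\<integral>\<^sup>+x. boltz UNIV {i} (fun_upd \<omega> i x) * indicator ((\<lambda>\<omega>. \<omega> i) -` B \<inter> space (cfg_space UNIV)) (fun_upd \<omega> i x) \<partial>apriori (arc_at \<omega> i)) =
     (\<integral>\<^sup>+x. boltz UNIV {i} (fun_upd \<omega> i x) * indicator B x \<partial>apriori (arc_at \<omega> i))"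
    using Omega_upd[OF \<omega>'] by (intro nn_integral_cong) (auto simp: space_cfg indicator_def)
  then show "emeasure (site_marginal i (constrained_spec UNIV \<Phi> q \<sigma> {i} \<omega>)) B = emeasure (site_cond i \<omega>) B"
    unfolding e emeasure_site_cond[OF \<omega>' B] gibbs_avg_def
    by (simp add: resample_singleton[OF _ arcs_admissible[OF \<sigma>] _ \<omega>'] resample1_def arc)
qed

end

locale dobrushin_model = gibbs_model \<Phi> q for \<Phi> :: "'d::finite potential" and q +
  assumes c_less: "c_bar \<Phi> q < 1"
begin

definition infl :: "'d site \<Rightarrow> 'd site \<Rightarrow> real" where "infl i j = enn2real (C_bar \<Phi> q i j)"

definition c :: real where "c = enn2real (c_bar \<Phi> q)"

lemma c_bounds: "0 \<le> c" "c < 1"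
  using c_less less_trans[OF c_less ennreal_one_less_top] by (auto simp: c_def)

lemma infl_nonneg[simp]: "0 \<le> infl i j" by (simp add: infl_def)

lemma infl_self[simp]: "infl i i = 0" by (simp add: infl_def C_bar_def)

lemma C_bar_sum: "(\<Sum>\<^sub>\<infinity>j\<in>UNIV. C_bar \<Phi> q i j) \<le> c_bar \<Phi> q"
  unfolding c_bar_def by (rule SUP_upper) simp

lemma infl_summable: "infl i summable_on A"
  and infl_sum: "(\<Sum>\<^sub>\<infinity>j\<in>UNIV. infl i j) \<le> c"
  and C_bar_finite: "C_bar \<Phi> q i j < \<infinity>"
proof -
  have fin: "(\<Sum>\<^sub>\<infinity>j\<in>UNIV. C_bar \<Phi> q i j) < \<infinity>"
    using C_bar_sum[of i] c_less by (metis ennreal_one_less_top infinity_ennreal_def le_less_trans less_trans)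
  note s = summable_on_real_of_ennreal[OF fin]
  have "infl i summable_on UNIV" unfolding infl_def[abs_def] by (rule s(2))
  then show "infl i summable_on A" by (rule summable_on_subset_banach) simp
  have "enn2real (\<Sum>\<^sub>\<infinity>j\<in>UNIV. C_bar \<Phi> q i j) \<le> c"
    unfolding c_def using c_less C_bar_sum
    by (intro enn2real_mono) (auto intro: less_trans[OF _ ennreal_one_less_top])
  then show "(\<Sum>\<^sub>\<infinity>j\<in>UNIV. infl i j) \<le> c" using s(3) unfolding infl_def by linarith
  show "C_bar \<Phi> q i j < \<infinity>" by (rule s(1)) simp
qed

lemma influence_step:
  assumes fe: "fibre_eq \<omega> \<eta>" and off: "\<And>k. k \<noteq> j \<Longrightarrow> \<omega> k = \<eta> k" and B: "B \<in> sets circle_measure"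
  shows "\<bar>measure (site_cond i \<omega>) B - measure (site_cond i \<eta>) B\<bar> \<le> infl i j"
proof (cases "i = j")
  case True
  have upd: "fun_upd \<omega> i x = fun_upd \<eta> i x" for x using off True by (auto simp: fun_eq_iff)
  have "arc_at \<omega> = arc_at \<eta>" using fibre_eq_arc_at[OF fe] by auto
  then have "site_cond i \<omega> = site_cond i \<eta>"
    unfolding site_cond_def site_norm_def site_weight_def[abs_def] upd by simp
  then show ?thesis using True by simp
next
  case False
  have \<omega>: "\<omega> \<in> Omega" "\<eta> \<in> Omega" using fe by (auto simp: fibre_eq_def)
  define \<sigma> where "\<sigma> k = discr q (\<omega> k)" for k
  have \<sigma>: "\<sigma> \<in> UNIV \<rightarrow>\<^sub>E {1..q}" using \<omega>(1) discr_in[OF q] by (simp only: \<sigma>_def PiE_UNIV_iff) blast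
  have arc: "\<omega> \<in> (\<Pi>\<^sub>E k\<in>UNIV. spin_arc q (\<sigma> k))" "\<eta> \<in> (\<Pi>\<^sub>E k\<in>UNIV. spin_arc q (\<sigma> k))"
    using fe by (auto simp: \<sigma>_def spin_arc_def fibre_eq_def PiE_UNIV_iff)
  have "ennreal \<bar>measure (site_cond i \<omega>) B - measure (site_cond i \<eta>) B\<bar> \<le> tv_dist (site_cond i \<omega>) (site_cond i \<eta>)"
    unfolding tv_dist_def by (rule SUP_upper2[of B]) (use B in auto)
  also have "\<dots> = tv_dist (site_marginal i (constrained_spec UNIV \<Phi> q \<sigma> {i} \<omega>)) (site_marginal i (constrained_spec UNIV \<Phi> q \<sigma> {i} \<eta>))"
    by (simp only: site_marginal_constrained[OF \<sigma> arc(1)] site_marginal_constrained[OF \<sigma> arc(2)])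
  also have "\<dots> \<le> C_bar \<Phi> q i j"
    unfolding C_bar_def if_not_P[OF False]
    by (intro SUP_upper2[OF \<sigma>] SUP_upper2[of "(\<omega>, \<eta>)"]) (use arc off in auto)
  finally have "enn2real (ennreal \<bar>measure (site_cond i \<omega>) B - measure (site_cond i \<eta>) B\<bar>) \<le> infl i j"
    unfolding infl_def using C_bar_finite by (intro enn2real_mono) auto
  then show ?thesis by simp
qed

text \<open>The spins in \<open>D\<close> are changed one at a time.\<close>

lemma influence_finite:
  assumes "finite D" and "fibre_eq \<omega> \<eta>" and "\<And>k. k \<notin> D \<Longrightarrow> \<omega> k = \<eta> k" and B: "B \<in> sets circle_measure"
  shows "\<bar>measure (site_cond i \<omega>) B - measure (site_cond i \<eta>) B\<bar> \<le> (\<Sum>j\<in>D. infl i j)"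
  using assms(1,2,3)
proof (induction D arbitrary: \<omega>)
  case empty
  then have "\<omega> = \<eta>" by auto
  then show ?case by simp
next
  case (insert j D)
  define \<zeta> where "\<zeta> = fun_upd \<omega> j (\<eta> j)"
  have 1: "fibre_eq \<omega> \<zeta>" "fibre_eq \<zeta> \<eta>" using insert.prems(1) by (auto simp: fibre_eq_def \<zeta>_def PiE_UNIV_iff)
  have "\<bar>measure (site_cond i \<omega>) B - measure (site_cond i \<zeta>) B\<bar> \<le> infl i j"
    by (rule influence_step[OF 1(1) _ B]) (simp add: \<zeta>_def)
  moreover have "\<bar>measure (site_cond i \<zeta>) B - measure (site_cond i \<eta>) B\<bar> \<le> (\<Sum>j\<in>D. infl i j)"
    using insert.prems(2) by (intro insert.IH 1) (auto simp: \<zeta>_def)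
  ultimately show ?case using insert.hyps by simp
qed

text \<open>An infinite change of the boundary condition is a limit of finite ones, along which the weights
  converge by \<open>ham_tendsto\<close>.\<close>

lemma influence:
  assumes fe: "fibre_eq \<omega> \<eta>" and B[measurable]: "B \<in> sets circle_measure"
  shows "\<bar>measure (site_cond i \<omega>) B - measure (site_cond i \<eta>) B\<bar> \<le> (\<Sum>\<^sub>\<infinity>j\<in>{j. \<omega> j \<noteq> \<eta> j}. infl i j)"
proof -
  define \<zeta> where "\<zeta> n k = (if to_nat k < n then \<eta> k else \<omega> k)" for n :: nat and k :: "'d site"
  have O: "\<omega> \<in> Omega" "\<eta> \<in> Omega" using fe by (auto simp: fibre_eq_def)
  have \<zeta>: "fibre_eq \<omega> (\<zeta> n)" "\<zeta> n \<in> Omega" for n using fe by (auto simp: fibre_eq_def \<zeta>_def PiE_UNIV_iff)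
  have bound: "\<bar>measure (site_cond i \<omega>) B - measure (site_cond i (\<zeta> n)) B\<bar> \<le> (\<Sum>\<^sub>\<infinity>j\<in>{j. \<omega> j \<noteq> \<eta> j}. infl i j)" for n
  proof -
    define D where "D = {j. \<omega> j \<noteq> \<eta> j \<and> to_nat j < n}"
    have "finite (to_nat -` {..<n} :: 'd site set)" by (intro finite_vimageI) auto
    then have fin: "finite D" by (rule finite_subset[rotated]) (auto simp: D_def)
    have "\<bar>measure (site_cond i \<omega>) B - measure (site_cond i (\<zeta> n)) B\<bar> \<le> (\<Sum>j\<in>D. infl i j)"
      by (rule influence_finite[OF fin \<zeta>(1) _ B]) (auto simp: D_def \<zeta>_def)
    also have "\<dots> \<le> (\<Sum>\<^sub>\<infinity>j\<in>{j. \<omega> j \<noteq> \<eta> j}. infl i j)"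
      by (rule finite_sum_le_infsum[OF infl_summable fin]) (auto simp: D_def)
    finally show ?thesis .
  qed
  have arc: "arc_at (\<zeta> n) i = arc_at \<eta> i" for n
    using fibre_eq_arc_at[OF \<zeta>(1)[of n]] fibre_eq_arc_at[OF fe] by simp
  let ?P = "apriori (arc_at \<eta> i)"
  interpret prob_space ?P by (intro prob_space_apriori arc_at_admissible O)
  have meas: "measure (site_cond i \<xi>) B = (\<integral>x. indicator B x * site_weight i \<xi> x \<partial>?P) / (\<integral>x. site_weight i \<xi> x \<partial>?P)"
    if "\<xi> \<in> Omega" "arc_at \<xi> i = arc_at \<eta> i" for \<xi>
  proof -
    have "measure (site_cond i \<xi>) B = (\<integral>x. indicator B x \<partial>site_cond i \<xi>)"
      using sets.sets_into_space[OF B] by (simp add: Int_absorb2)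
    also have "\<dots> = (\<integral>x. indicator B x * (site_weight i \<xi> x / site_norm i \<xi>) \<partial>apriori (arc_at \<xi> i))"
      by (rule integral_site_cond[OF that(1)]) simp
    also have "\<dots> = (\<integral>x. indicator B x * site_weight i \<xi> x \<partial>apriori (arc_at \<xi> i)) / site_norm i \<xi>"
      by simp
    finally show ?thesis by (simp add: site_norm_def that(2))
  qed
  have w: "(\<lambda>n. site_weight i (\<zeta> n) x) \<longlonglongrightarrow> site_weight i \<eta> x" if "x \<in> S1" for x
  proof -
    have "(\<lambda>n. ham UNIV {i} (fun_upd (\<zeta> n) i x)) \<longlonglongrightarrow> ham UNIV {i} (fun_upd \<eta> i x)"
    proof (rule ham_tendsto)
      fix k :: "'d site"
      have "eventually (\<lambda>n. to_nat k < n) sequentially" by (rule eventually_gt_at_top)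
      then show "eventually (\<lambda>n. fun_upd (\<zeta> n) i x k = fun_upd \<eta> i x k) sequentially"
        by eventually_elim (simp add: \<zeta>_def)
    qed (use Omega_upd[OF \<zeta>(2) that] Omega_upd[OF O(2) that] in simp_all)
    then show ?thesis unfolding site_weight_def by (intro tendsto_intros)
  qed
  note [measurable] = site_weight_measurable[OF \<zeta>(2)] site_weight_measurable[OF O(2)]
  have dom: "(\<lambda>n. \<integral>x. h x * site_weight i (\<zeta> n) x \<partial>?P) \<longlonglongrightarrow> (\<integral>x. h x * site_weight i \<eta> x \<partial>?P)"
    if h[measurable]: "h \<in> borel_measurable circle_measure" and h1: "\<And>x. \<bar>h x\<bar> \<le> 1" for h :: "real \<Rightarrow> real"
  proof (rule integral_dominated_convergence[where w="\<lambda>_. exp (hb {i})"])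
    show "AE x in ?P. (\<lambda>n. h x * site_weight i (\<zeta> n) x) \<longlonglongrightarrow> h x * site_weight i \<eta> x"
      by (intro AE_I2 tendsto_intros w) simp
    show "AE x in ?P. norm (h x * site_weight i (\<zeta> n) x) \<le> exp (hb {i})" for n
    proof (rule AE_I2)
      fix x assume "x \<in> space ?P"
      then have x: "x \<in> S1" by simp
      have "\<bar>h x\<bar> * site_weight i (\<zeta> n) x \<le> 1 * exp (hb {i})"
        using site_weight_bounds[OF \<zeta>(2)[of n] x, of i] h1 by (intro mult_mono) auto
      then show "norm (h x * site_weight i (\<zeta> n) x) \<le> exp (hb {i})"
        using site_weight_bounds(3)[OF \<zeta>(2)[of n] x, of i] by (simp add: abs_mult)
    qed
  qed simp_all
  have "(\<lambda>n. measure (site_cond i (\<zeta> n)) B) \<longlonglongrightarrow> measure (site_cond i \<eta>) B"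
    unfolding meas[OF \<zeta>(2) arc] meas[OF O(2) refl]
    using dom[of "indicator B"] dom[of "\<lambda>_. 1"] site_norm_bounds(2)[OF O(2), of i]
    by (intro tendsto_divide) (auto simp: site_norm_def)
  then have "(\<lambda>n. \<bar>measure (site_cond i \<omega>) B - measure (site_cond i (\<zeta> n)) B\<bar>) \<longlonglongrightarrow> \<bar>measure (site_cond i \<omega>) B - measure (site_cond i \<eta>) B\<bar>"
    by (intro tendsto_intros)
  then show ?thesis by (rule LIMSEQ_le_const2) (use bound in blast)
qed

end

context gibbs_model
begin

text \<open>The single-site kernel that keeps the arc of the spin. It makes no reference to a constraint, so
  it acts on all constrained systems and on the unconstrained one.\<close>

definition site_avg :: "'d site \<Rightarrow> ('d config \<Rightarrow> real) \<Rightarrow> 'd config \<Rightarrow> real"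
  where "site_avg i f \<omega> = (\<integral>x. f (fun_upd \<omega> i x) \<partial>site_cond i \<omega>)"

definition unit_valued :: "('d config \<Rightarrow> real) \<Rightarrow> bool"
  where "unit_valued f \<longleftrightarrow> f \<in> borel_measurable (cfg_space UNIV) \<and> (\<forall>\<omega>\<in>Omega. 0 \<le> f \<omega> \<and> f \<omega> \<le> 1)"

lemma unit_valuedD:
  assumes "unit_valued f"
  shows "f \<in> borel_measurable (cfg_space UNIV)" "\<And>\<omega>. \<omega> \<in> Omega \<Longrightarrow> 0 \<le> f \<omega>" "\<And>\<omega>. \<omega> \<in> Omega \<Longrightarrow> f \<omega> \<le> 1"
  using assms by (auto simp: unit_valued_def)

lemma comp_upd_measurable:
  assumes "f \<in> borel_measurable (cfg_space UNIV)" "\<omega> \<in> Omega"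
  shows "(\<lambda>x. f (fun_upd \<omega> i x)) \<in> borel_measurable circle_measure"
  by (rule measurable_compose[OF upd_measurable' assms(1)]) (use assms in auto)

lemma site_avg_bounds:
  assumes f: "unit_valued f" and \<omega>: "\<omega> \<in> Omega"
  shows "0 \<le> site_avg i f \<omega>" "site_avg i f \<omega> \<le> 1" "integrable (site_cond i \<omega>) (\<lambda>x. f (fun_upd \<omega> i x))"
proof -
  interpret prob_space "site_cond i \<omega>" by (rule prob_space_site_cond[OF \<omega>])
  have m[measurable]: "(\<lambda>x. f (fun_upd \<omega> i x)) \<in> borel_measurable (site_cond i \<omega>)"
    using comp_upd_measurable[OF unit_valuedD(1)[OF f] \<omega>] by (simp cong: measurable_cong_sets)
  have b: "0 \<le> f (fun_upd \<omega> i x)" "f (fun_upd \<omega> i x) \<le> 1" if "x \<in> S1" for x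
    using unit_valuedD(2,3)[OF f] Omega_upd[OF \<omega> that] by auto
  show i: "integrable (site_cond i \<omega>) (\<lambda>x. f (fun_upd \<omega> i x))"
    by (rule integrable_const_bound[where B=1]) (use b in \<open>auto intro!: AE_I2\<close>)
  show "0 \<le> site_avg i f \<omega>" unfolding site_avg_def by (rule integral_nonneg_AE) (use b in \<open>auto intro!: AE_I2\<close>)
  have "site_avg i f \<omega> \<le> (\<integral>x. 1 \<partial>site_cond i \<omega>)"
    unfolding site_avg_def using i b by (intro integral_mono) auto
  then show "site_avg i f \<omega> \<le> 1" using prob_space by simp
qed

lemma ennreal_site_avg:
  assumes f: "unit_valued f" and \<omega>: "\<omega> \<in> Omega"
  shows "ennreal (site_avg i f \<omega>) =
    resample1 (arc_at \<omega> i) i (\<lambda>\<omega>. boltz UNIV {i} \<omega> * ennreal (f \<omega>)) \<omega> / resample1 (arc_at \<omega> i) i (boltz UNIV {i}) \<omega>"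
proof -
  note [measurable] = comp_upd_measurable[OF unit_valuedD(1)[OF f] \<omega>] site_weight_measurable[OF \<omega>]
  have b: "boltz UNIV {i} (fun_upd \<omega> i x) = ennreal (site_weight i \<omega> x)" for x
    by (simp add: boltz_def site_weight_def)
  have Z: "resample1 (arc_at \<omega> i) i (boltz UNIV {i}) \<omega> = ennreal (site_norm i \<omega>)"
    unfolding resample1_def b site_norm_def using site_weight_integrable[OF \<omega>]
    by (intro nn_integral_eq_integral) (auto intro!: AE_I2 simp: less_imp_le[OF site_weight_bounds(3)[OF \<omega>]])
  have b01: "0 \<le> f (fun_upd \<omega> i x)" if "x \<in> S1" for x
    using unit_valuedD(2)[OF f] Omega_upd[OF \<omega> that] by auto
  have "ennreal (site_avg i f \<omega>) = (\<integral>\<^sup>+x. ennreal (f (fun_upd \<omega> i x)) \<partial>site_cond i \<omega>)"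
    unfolding site_avg_def
    by (rule nn_integral_eq_integral[symmetric]) (use site_avg_bounds(3)[OF f \<omega>] b01 in \<open>auto intro!: AE_I2\<close>)
  also have "\<dots> = (\<integral>\<^sup>+x. ennreal (site_weight i \<omega> x / site_norm i \<omega>) * ennreal (f (fun_upd \<omega> i x)) \<partial>apriori (arc_at \<omega> i))"
    unfolding site_cond_def by (rule nn_integral_density) measurable
  also have "\<dots> = (\<integral>\<^sup>+x. boltz UNIV {i} (fun_upd \<omega> i x) * ennreal (f (fun_upd \<omega> i x)) / ennreal (site_norm i \<omega>) \<partial>apriori (arc_at \<omega> i))"
    unfolding b
    by (intro nn_integral_cong)
       (simp add: divide_ennreal[symmetric] less_imp_le[OF site_weight_bounds(3)[OF \<omega>]] site_norm_bounds(2)[OF \<omega>] divide_ennreal_def ac_simps)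
  also have "\<dots> = resample1 (arc_at \<omega> i) i (\<lambda>\<omega>. boltz UNIV {i} \<omega> * ennreal (f \<omega>)) \<omega> / ennreal (site_norm i \<omega>)"
    unfolding b resample1_def by (rule nn_integral_divide) measurable
  finally show ?thesis by (simp add: Z)
qed

lemma unit_valued_site_avg:
  assumes f: "unit_valued f" shows "unit_valued (site_avg i f)"
  unfolding unit_valued_def
proof (intro conjI ballI site_avg_bounds f)
  note [measurable] = unit_valuedD(1)[OF f] boltz_measurable[of "{i}" UNIV] discr_measurable[OF q]
  define h where "h a \<omega> = enn2real (resample1 (spin_arc q a) i (\<lambda>\<omega>. boltz UNIV {i} \<omega> * ennreal (f \<omega>)) \<omega> /
    resample1 (spin_arc q a) i (boltz UNIV {i}) \<omega>)" for a and \<omega> :: "'d config"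
  have "(\<lambda>\<omega>. h (discr q (\<omega> i)) \<omega>) \<in> borel_measurable (cfg_space UNIV)"
  proof (rule measurable_compose_countable'[where f=h and I="{1..q}"])
    fix a assume "a \<in> {1..q}"
    then have a: "admissible (spin_arc q a)" by (intro admissible_arc q)
    note [measurable] = resample1_measurable[OF UNIV_I a]
    show "h a \<in> borel_measurable (cfg_space UNIV)" unfolding h_def[abs_def] by measurable
  next
    have "(\<lambda>\<omega>. \<omega> i) \<in> cfg_space UNIV \<rightarrow>\<^sub>M circle_measure" by (simp add: cfg_space_def)
    then show "(\<lambda>\<omega>. discr q (\<omega> i)) \<in> cfg_space UNIV \<rightarrow>\<^sub>M count_space {1..q}"
      by (rule measurable_compose) (rule discr_measurable[OF q])
  qed simp
  then show "site_avg i f \<in> borel_measurable (cfg_space UNIV)"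
  proof (rule measurable_cong[THEN iffD1, rotated])
    fix \<omega> :: "'d config" assume "\<omega> \<in> space (cfg_space UNIV)"
    then have \<omega>: "\<omega> \<in> Omega" by (simp add: space_cfg)
    have "site_avg i f \<omega> = enn2real (ennreal (site_avg i f \<omega>))"
      using site_avg_bounds(1)[OF f \<omega>] by simp
    then show "h (discr q (\<omega> i)) \<omega> = site_avg i f \<omega>"
      unfolding ennreal_site_avg[OF f \<omega>] by (simp add: h_def arc_at_def)
  qed
qed auto

text \<open>The condition of \<open>local_gibbs\<close> at a single site. Finite-volume distributions satisfy it only inside
  their volume.\<close>

definition site_inv :: "real set \<Rightarrow> 'd site \<Rightarrow> 'd config measure \<Rightarrow> bool"
  where "site_inv A i \<mu> \<longleftrightarrow> (\<forall>f\<in>borel_measurable (cfg_space UNIV).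
      (\<integral>\<^sup>+\<omega>. inv_boltz UNIV {i} \<omega> * f \<omega> \<partial>\<mu>) = (\<integral>\<^sup>+\<omega>. inv_boltz UNIV {i} \<omega> * resample1 A i f \<omega> \<partial>\<mu>))"

lemma local_gibbs_site_inv: "local_gibbs UNIV S \<mu> \<Longrightarrow> site_inv (S i) i \<mu>"
  by (simp add: local_gibbs_def site_inv_def)

text \<open>By \<open>nn_integral_fibred\<close> the spin at \<open>i\<close> is averaged by choosing first its arc and then its position
  there; the kernel \<open>site_avg i\<close> preserves the second step.\<close>

lemma site_avg_invariant:
  assumes \<mu>: "prob_space \<mu>" "sets \<mu> = sets (cfg_space UNIV)" and inv: "site_inv A i \<mu>" and A: "fibred q A"
    and f: "unit_valued f"
  shows "(\<integral>\<omega>. site_avg i f \<omega> \<partial>\<mu>) = (\<integral>\<omega>. f \<omega> \<partial>\<mu>)"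
proof -
  interpret prob_space \<mu> by fact
  have sp: "space \<mu> = Omega" using sets_eq_imp_space_eq[OF \<mu>(2)] by (simp add: space_cfg)
  have admA: "admissible A" by (rule fibred_admissible[OF q A])
  note [measurable_cong] = \<mu>(2)
  note uf = unit_valuedD[OF f] and ug = unit_valuedD[OF unit_valued_site_avg[OF f]]
  note [measurable] = uf(1) ug(1)[of i] boltz_measurable[of "{i}" UNIV] resample1_measurable[OF UNIV_I admA]
  have invD: "(\<integral>\<^sup>+\<omega>. inv_boltz UNIV {i} \<omega> * f \<omega> \<partial>\<mu>) = (\<integral>\<^sup>+\<omega>. inv_boltz UNIV {i} \<omega> * resample1 A i f \<omega> \<partial>\<mu>)"
    if "f \<in> borel_measurable (cfg_space UNIV)" for f using inv that unfolding site_inv_def by blast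
  have key: "resample1 A i (\<lambda>\<omega>. boltz UNIV {i} \<omega> * ennreal (site_avg i f \<omega>)) \<omega> = resample1 A i (\<lambda>\<omega>. boltz UNIV {i} \<omega> * ennreal (f \<omega>)) \<omega>"
    if \<omega>: "\<omega> \<in> Omega" for \<omega>
  proof -
    define h where "h g x = boltz UNIV {i} (fun_upd \<omega> i x) * ennreal (g (fun_upd \<omega> i x))" for g and x :: real
    have hm: "h g \<in> borel_measurable circle_measure" if [measurable]: "g \<in> borel_measurable (cfg_space UNIV)" for g
      unfolding h_def by (rule measurable_compose[OF upd_measurable', of i UNIV \<omega>]) (use \<omega> in auto)
    have bm: "(\<lambda>x. boltz UNIV {i} (fun_upd \<omega> i x)) \<in> borel_measurable circle_measure"
      by (rule measurable_compose[OF upd_measurable', of i UNIV \<omega>]) (use \<omega> in auto)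
    have "resample1 A i (\<lambda>\<omega>. boltz UNIV {i} \<omega> * ennreal (site_avg i f \<omega>)) \<omega> =
       (\<integral>\<^sup>+x. (\<integral>\<^sup>+y. h (site_avg i f) y \<partial>apriori (spin_arc q (discr q x))) \<partial>apriori A)"
      unfolding resample1_def using nn_integral_fibred[OF q A hm[OF ug(1)]] by (simp add: h_def)
    also have "\<dots> = (\<integral>\<^sup>+x. (\<integral>\<^sup>+y. h f y \<partial>apriori (spin_arc q (discr q x))) \<partial>apriori A)"
    proof (rule nn_integral_cong)
      fix x assume "x \<in> space (apriori A)"
      then have x: "x \<in> S1" by simp
      define \<omega>x where "\<omega>x = fun_upd \<omega> i x"
      have \<omega>x: "\<omega>x \<in> Omega" unfolding \<omega>x_def by (rule Omega_upd[OF \<omega> x])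
      let ?arc = "spin_arc q (discr q x)"
      have adm: "admissible ?arc" by (intro admissible_arc q discr_in x)
      have arcx: "arc_at \<omega>x i = ?arc" by (simp add: arc_at_def \<omega>x_def)
      let ?N = "resample1 ?arc i (\<lambda>\<omega>. boltz UNIV {i} \<omega> * ennreal (f \<omega>)) \<omega>"
      let ?Z = "resample1 ?arc i (boltz UNIV {i}) \<omega>"
      have Z: "?Z \<noteq> 0" "?Z \<noteq> \<infinity>"
        using resample_boltz_bounds(3,4)[of "{i}" UNIV \<omega> "\<lambda>_. ?arc"] adm \<omega>
        by (simp_all add: resample_singleton)
      have "(\<integral>\<^sup>+y. h (site_avg i f) y \<partial>apriori ?arc) = (\<integral>\<^sup>+y. boltz UNIV {i} (fun_upd \<omega> i y) * (?N / ?Z) \<partial>apriori ?arc)"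
      proof (rule nn_integral_cong_AE)
        show "AE y in apriori ?arc. h (site_avg i f) y = boltz UNIV {i} (fun_upd \<omega> i y) * (?N / ?Z)"
          using AE_apriori[OF adm]
        proof eventually_elim
          case (elim y)
          then have y: "y \<in> S1" "discr q y = discr q x" by (auto simp: spin_arc_def)
          have "ennreal (site_avg i f (fun_upd \<omega> i y)) = ?N / ?Z"
            by (subst ennreal_site_avg[OF f Omega_upd[OF \<omega> y(1)]]) (simp add: arc_at_def y resample1_def)
          then show ?case by (simp add: h_def)
        qed
      qed
      also have "\<dots> = ?Z * (?N / ?Z)"
        unfolding resample1_def
        by (rule nn_integral_multc) (simp add: bm cong: measurable_cong_sets)
      also have "\<dots> = ?N" using Z by (simp add: ennreal_times_divide mult.commute[of ?Z] mult_divide_eq_ennreal)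
      finally show "(\<integral>\<^sup>+y. h (site_avg i f) y \<partial>apriori ?arc) = (\<integral>\<^sup>+y. h f y \<partial>apriori ?arc)"
        by (simp add: h_def resample1_def)
    qed
    also have "\<dots> = resample1 A i (\<lambda>\<omega>. boltz UNIV {i} \<omega> * ennreal (f \<omega>)) \<omega>"
      unfolding resample1_def using nn_integral_fibred[OF q A hm[OF uf(1)]] by (simp add: h_def)
    finally show ?thesis .
  qed
  have "(\<integral>\<^sup>+\<omega>. ennreal (site_avg i f \<omega>) \<partial>\<mu>) = (\<integral>\<^sup>+\<omega>. inv_boltz UNIV {i} \<omega> * (boltz UNIV {i} \<omega> * ennreal (site_avg i f \<omega>)) \<partial>\<mu>)"
    by (simp add: boltz_inv)
  also have "\<dots> = (\<integral>\<^sup>+\<omega>. inv_boltz UNIV {i} \<omega> * resample1 A i (\<lambda>\<omega>. boltz UNIV {i} \<omega> * ennreal (site_avg i f \<omega>)) \<omega> \<partial>\<mu>)"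
    by (rule invD) measurable
  also have "\<dots> = (\<integral>\<^sup>+\<omega>. inv_boltz UNIV {i} \<omega> * resample1 A i (\<lambda>\<omega>. boltz UNIV {i} \<omega> * ennreal (f \<omega>)) \<omega> \<partial>\<mu>)"
    by (intro nn_integral_cong) (simp add: sp key)
  also have "\<dots> = (\<integral>\<^sup>+\<omega>. inv_boltz UNIV {i} \<omega> * (boltz UNIV {i} \<omega> * ennreal (f \<omega>)) \<partial>\<mu>)"
    by (rule invD[symmetric]) measurable
  also have "\<dots> = (\<integral>\<^sup>+\<omega>. ennreal (f \<omega>) \<partial>\<mu>)" by (simp add: boltz_inv)
  finally have eq: "(\<integral>\<^sup>+\<omega>. ennreal (site_avg i f \<omega>) \<partial>\<mu>) = (\<integral>\<^sup>+\<omega>. ennreal (f \<omega>) \<partial>\<mu>)" .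
  have "(\<integral>\<omega>. g \<omega> \<partial>\<mu>) = enn2real (\<integral>\<^sup>+\<omega>. ennreal (g \<omega>) \<partial>\<mu>)" if g: "unit_valued g" for g
  proof (rule integral_eq_nn_integral)
    show "g \<in> borel_measurable \<mu>" using unit_valuedD(1)[OF g] by simp
    show "AE \<omega> in \<mu>. 0 \<le> g \<omega>" using unit_valuedD(2)[OF g] by (intro AE_I2) (simp add: sp)
  qed
  then show ?thesis using eq f unit_valued_site_avg[OF f] by simp
qed

end

context dobrushin_model
begin

text \<open>The number \<open>d j\<close> bounds the effect of changing the spin at \<open>j\<close> within its arc; nothing is said about
  configurations with different discretizations.\<close>

definition lip :: "('d site \<Rightarrow> real) \<Rightarrow> ('d config \<Rightarrow> real) \<Rightarrow> bool"
  where "lip d f \<longleftrightarrow> (\<forall>\<omega> \<eta>. fibre_eq \<omega> \<eta> \<longrightarrow> \<bar>f \<omega> - f \<eta>\<bar> \<le> (\<Sum>\<^sub>\<infinity>j\<in>{j. \<omega> j \<noteq> \<eta> j}. d j))"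

text \<open>How \<open>site_avg i\<close> transforms a modulus: the dependence on the spin at \<open>i\<close> is handed over to the other
  sites according to their influence on that spin.\<close>

definition dstep :: "'d site \<Rightarrow> ('d site \<Rightarrow> real) \<Rightarrow> 'd site \<Rightarrow> real"
  where "dstep i d j = (if j = i then 0 else d j + infl i j * d i)"

definition modulus :: "('d site \<Rightarrow> real) \<Rightarrow> bool"
  where "modulus d \<longleftrightarrow> (\<forall>j. 0 \<le> d j) \<and> d summable_on UNIV"

lemma modulus_summable: "modulus d \<Longrightarrow> d summable_on A"
  unfolding modulus_def by (auto intro: summable_on_subset_banach)

lemma infl_mult_summable: "(\<lambda>j. infl i j * x) summable_on A"
  by (rule summable_on_cmult_left) (rule infl_summable)

lemma modulus_dstep:
  assumes d: "modulus d" shows "modulus (dstep i d)"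
  unfolding modulus_def
proof (intro conjI allI)
  have s: "(\<lambda>j. d j + infl i j * d i) summable_on UNIV"
    by (intro summable_on_add modulus_summable[OF d] infl_mult_summable)
  show "dstep i d summable_on UNIV"
    by (rule summable_on_comparison_test[OF s]) (use d in \<open>auto simp: dstep_def modulus_def\<close>)
qed (use d in \<open>auto simp: dstep_def modulus_def\<close>)

text \<open>A change of the boundary condition acts on \<open>site_avg\<close> in two ways: directly through \<open>f\<close>, and through
  the distribution of the resampled spin.\<close>

lemma lip_site_avg_le:
  assumes f: "unit_valued f" and lip: "lip d f" and d: "modulus d" and fe: "fibre_eq \<omega> \<eta>"
  shows "site_avg i f \<omega> - site_avg i f \<eta> \<le> (\<Sum>\<^sub>\<infinity>j\<in>{j. \<omega> j \<noteq> \<eta> j}. dstep i d j)"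
proof -
  have O: "\<omega> \<in> Omega" "\<eta> \<in> Omega" using fe by (auto simp: fibre_eq_def)
  let ?D = "{j. \<omega> j \<noteq> \<eta> j}"
  let ?P = "apriori (arc_at \<omega> i)"
  have arc: "arc_at \<eta> i = arc_at \<omega> i" using fibre_eq_arc_at[OF fe] by simp
  interpret P: prob_space ?P by (intro prob_space_apriori arc_at_admissible O)
  define p where "p x = site_weight i \<omega> x / site_norm i \<omega>" for x
  define p' where "p' x = site_weight i \<eta> x / site_norm i \<eta>" for x
  have adm: "admissible (arc_at \<omega> i)" by (intro arc_at_admissible O)
  note [measurable] = site_weight_measurable[OF O(1)] site_weight_measurable[OF O(2)]
    comp_upd_measurable[OF unit_valuedD(1)[OF f] O(1)] comp_upd_measurable[OF unit_valuedD(1)[OF f] O(2)]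
  have [measurable]: "p \<in> borel_measurable circle_measure" "p' \<in> borel_measurable circle_measure"
    unfolding p_def[abs_def] p'_def[abs_def] by measurable
  have p0: "0 \<le> p x" "0 \<le> p' x" "p x \<le> exp (hb {i}) / exp (- hb {i})" "p' x \<le> exp (hb {i}) / exp (- hb {i})" if "x \<in> S1" for x
    using site_weight_bounds[OF O(1) that, of i] site_weight_bounds[OF O(2) that, of i] site_norm_bounds[OF O(1), of i] site_norm_bounds[OF O(2), of i]
    unfolding p_def p'_def by (auto intro!: divide_nonneg_nonneg frac_le)
  have int: "(\<integral>x. g x \<partial>site_cond i \<omega>) = (\<integral>x. g x * p x \<partial>?P)" "(\<integral>x. g x \<partial>site_cond i \<eta>) = (\<integral>x. g x * p' x \<partial>?P)"
    if "g \<in> borel_measurable circle_measure" for g :: "real \<Rightarrow> real"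
    using integral_site_cond[OF O(1) that, of i] integral_site_cond[OF O(2) that, of i] by (simp_all add: p_def p'_def arc)
  have one: "(\<integral>x. p x \<partial>?P) = 1" "(\<integral>x. p' x \<partial>?P) = 1"
    using int[of "\<lambda>_. 1"] prob_space.prob_space[OF prob_space_site_cond[OF O(1), of i]] prob_space.prob_space[OF prob_space_site_cond[OF O(2), of i]]
    by simp_all
  have b01: "0 \<le> f (fun_upd \<xi> i x)" "f (fun_upd \<xi> i x) \<le> 1" if "x \<in> S1" "\<xi> \<in> Omega" for x \<xi>
    using unit_valuedD(2,3)[OF f] Omega_upd[OF that(2,1)] by auto
  have ip: "integrable ?P p"
    by (rule P.integrable_const_bound[where B="exp (hb {i}) / exp (- hb {i})"]) (use p0 in \<open>auto intro!: AE_I2\<close>)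
  have ifp: "integrable ?P (\<lambda>x. f (fun_upd \<xi> i x) * p x)" if "\<xi> \<in> {\<omega>, \<eta>}" for \<xi>
    by (rule Bochner_Integration.integrable_bound[OF ip])
       (use that b01 p0 O in \<open>auto intro!: AE_I2 simp: abs_mult mult_left_le_one_le\<close>)
  have arc_S1: "x \<in> S1" if "x \<in> arc_at \<omega> i" for x using that arc_at_subset by auto
  have fe': "fibre_eq (fun_upd \<omega> i x) (fun_upd \<eta> i x)" if "x \<in> S1" for x
    using fe that by (auto simp: fibre_eq_def PiE_UNIV_iff)
  \<comment> \<open>The direct effect: the boundary conditions differ, the distribution of the resampled spin is the same.\<close>
  have "(\<integral>x. f (fun_upd \<omega> i x) * p x \<partial>?P) \<le> (\<integral>x. f (fun_upd \<eta> i x) * p x + (\<Sum>\<^sub>\<infinity>j\<in>?D - {i}. d j) * p x \<partial>?P)"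
  proof (rule integral_mono_AE)
    show "AE x in ?P. f (fun_upd \<omega> i x) * p x \<le> f (fun_upd \<eta> i x) * p x + (\<Sum>\<^sub>\<infinity>j\<in>?D - {i}. d j) * p x"
    proof (rule AE_I2)
      fix x assume "x \<in> space ?P"
      then have x: "x \<in> S1" by simp
      have "{j. fun_upd \<omega> i x j \<noteq> fun_upd \<eta> i x j} = ?D - {i}" by auto
      then have "f (fun_upd \<omega> i x) \<le> f (fun_upd \<eta> i x) + (\<Sum>\<^sub>\<infinity>j\<in>?D - {i}. d j)"
        using lip fe'[OF x] unfolding lip_def by (metis abs_le_D1 diff_le_eq add.commute)
      then show "f (fun_upd \<omega> i x) * p x \<le> f (fun_upd \<eta> i x) * p x + (\<Sum>\<^sub>\<infinity>j\<in>?D - {i}. d j) * p x"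
        using p0(1)[OF x] by (simp add: distrib_right[symmetric] mult_right_mono)
    qed
  qed (use ifp ip in auto)
  also have "\<dots> = (\<integral>x. f (fun_upd \<eta> i x) * p x \<partial>?P) + (\<Sum>\<^sub>\<infinity>j\<in>?D - {i}. d j)"
    using ifp ip one by simp
  finally have 1: "(\<integral>x. f (fun_upd \<omega> i x) * p x \<partial>?P) \<le> (\<integral>x. f (fun_upd \<eta> i x) * p x \<partial>?P) + (\<Sum>\<^sub>\<infinity>j\<in>?D - {i}. d j)" .
  \<comment> \<open>The indirect effect: only the distribution of the resampled spin changes.\<close>
  have 2: "(\<integral>x. f (fun_upd \<eta> i x) * p x \<partial>?P) - (\<integral>x. f (fun_upd \<eta> i x) * p' x \<partial>?P) \<le> d i * (\<Sum>\<^sub>\<infinity>j\<in>?D. infl i j)"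
  proof (rule integral_diff_le_tv[where X="arc_at \<omega> i" and K="exp (hb {i}) / exp (- hb {i})"])
    show "AE x in ?P. x \<in> arc_at \<omega> i" by (rule AE_apriori[OF adm])
    show "f (fun_upd \<eta> i x) - f (fun_upd \<eta> i y) \<le> d i" if xy: "x \<in> arc_at \<omega> i" "y \<in> arc_at \<omega> i" for x y
    proof -
      have "discr q x = discr q y" using xy by (auto simp: arc_at_def spin_arc_def)
      then have "fibre_eq (fun_upd \<eta> i x) (fun_upd \<eta> i y)"
        using O arc_S1[OF xy(1)] arc_S1[OF xy(2)] by (auto simp: fibre_eq_def PiE_UNIV_iff)
      then have "f (fun_upd \<eta> i x) - f (fun_upd \<eta> i y) \<le> (\<Sum>\<^sub>\<infinity>j\<in>{j. fun_upd \<eta> i x j \<noteq> fun_upd \<eta> i y j}. d j)"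
        using lip unfolding lip_def by (metis abs_le_D1)
      also have "\<dots> \<le> (\<Sum>\<^sub>\<infinity>j\<in>{i}. d j)"
        using d by (intro infsum_mono_neutral modulus_summable[OF d]) (auto simp: modulus_def)
      finally show ?thesis by simp
    qed
    show "(\<integral>x. p x * indicator B x \<partial>?P) - (\<integral>x. p' x * indicator B x \<partial>?P) \<le> (\<Sum>\<^sub>\<infinity>j\<in>?D. infl i j)" if "B \<in> sets ?P" for B
    proof -
      have B[measurable]: "B \<in> sets circle_measure" using that by simp
      have BS: "B \<inter> S1 = B" using sets.sets_into_space[OF B] by auto
      have "measure (site_cond i \<omega>) B = (\<integral>x. p x * indicator B x \<partial>?P)" "measure (site_cond i \<eta>) B = (\<integral>x. p' x * indicator B x \<partial>?P)"
        using int[of "indicator B"] BS by (simp_all add: mult.commute)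
      then show ?thesis using influence[OF fe B, of i] by linarith
    qed
  qed (use one p0 b01 O arc_at_subset arc_at_nonempty[OF O(1)] P.prob_space_axioms in \<open>auto simp: abs_le_iff\<close>)
  have "site_avg i f \<omega> - site_avg i f \<eta> = (\<integral>x. f (fun_upd \<omega> i x) * p x \<partial>?P) - (\<integral>x. f (fun_upd \<eta> i x) * p' x \<partial>?P)"
    unfolding site_avg_def by (simp add: int)
  also have "\<dots> \<le> (\<Sum>\<^sub>\<infinity>j\<in>?D - {i}. d j) + d i * (\<Sum>\<^sub>\<infinity>j\<in>?D. infl i j)"
    using 1 2 by linarith
  also have "(\<Sum>\<^sub>\<infinity>j\<in>?D. infl i j) = (\<Sum>\<^sub>\<infinity>j\<in>?D - {i}. infl i j)"
    by (rule infsum_cong_neutral) auto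
  also have "(\<Sum>\<^sub>\<infinity>j\<in>?D - {i}. d j) + d i * (\<Sum>\<^sub>\<infinity>j\<in>?D - {i}. infl i j) = (\<Sum>\<^sub>\<infinity>j\<in>?D - {i}. d j + infl i j * d i)"
    unfolding infsum_add[OF modulus_summable[OF d] infl_mult_summable] infsum_cmult_left' by simp
  also have "\<dots> = (\<Sum>\<^sub>\<infinity>j\<in>?D. dstep i d j)"
    by (rule infsum_cong_neutral) (auto simp: dstep_def)
  finally show ?thesis .
qed

lemma lip_site_avg:
  assumes f: "unit_valued f" and lip: "lip d f" and d: "modulus d"
  shows "lip (dstep i d) (site_avg i f)"
  unfolding lip_def
proof (intro allI impI)
  fix \<omega> \<eta> :: "'d config" assume fe: "fibre_eq \<omega> \<eta>"
  then have fe': "fibre_eq \<eta> \<omega>" by (auto simp: fibre_eq_def)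
  have "{j. \<eta> j \<noteq> \<omega> j} = {j. \<omega> j \<noteq> \<eta> j}" by auto
  then show "\<bar>site_avg i f \<omega> - site_avg i f \<eta>\<bar> \<le> (\<Sum>\<^sub>\<infinity>j\<in>{j. \<omega> j \<noteq> \<eta> j}. dstep i d j)"
    using lip_site_avg_le[OF f lip d fe, of i] lip_site_avg_le[OF f lip d fe', of i] by (simp add: abs_le_iff)
qed

lemma modulus_sweep: "modulus d \<Longrightarrow> modulus (fold dstep xs d)"
  by (induction xs arbitrary: d) (auto simp: modulus_dstep)

lemma unit_valued_sweep: "unit_valued f \<Longrightarrow> unit_valued (fold site_avg xs f)"
  by (induction xs arbitrary: f) (auto simp: unit_valued_site_avg)

lemma lip_sweep: "unit_valued f \<Longrightarrow> lip d f \<Longrightarrow> modulus d \<Longrightarrow> lip (fold dstep xs d) (fold site_avg xs f)"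
  by (induction xs arbitrary: f d) (auto simp: unit_valued_site_avg lip_site_avg modulus_dstep)

text \<open>The quantity that decreases along a sweep. The sites in \<open>A\<close>, which are still to be visited, count
  only with the factor \<open>c\<close> by which a visit reduces their contribution.\<close>

definition wsum :: "'d site set \<Rightarrow> ('d site \<Rightarrow> real) \<Rightarrow> real"
  where "wsum A d = (\<Sum>\<^sub>\<infinity>j\<in>UNIV. (if j \<in> A then c else 1) * d j)"

lemma wsum_summable: "modulus d \<Longrightarrow> (\<lambda>j. (if j \<in> A then c else 1) * d j) summable_on UNIV"
  by (rule summable_on_comparison_test[of d])
     (use c_bounds in \<open>auto simp: modulus_def mult_left_le_one_le\<close>)

text \<open>The visit of \<open>x\<close> replaces \<open>d x\<close> by contributions at other sites of total at most \<open>c * d x\<close>.\<close>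

lemma wsum_dstep:
  assumes d: "modulus d" shows "wsum A (dstep x d) \<le> wsum (insert x A) d"
proof -
  have d0: "0 \<le> d j" for j using d by (simp add: modulus_def)
  have sx: "(\<lambda>j. if j = x then - (c * d x) else 0) summable_on UNIV"
    using summable_on_cong_neutral[of "{x}" UNIV "\<lambda>j. if j = x then - (c * d x) else 0" "\<lambda>j. if j = x then - (c * d x) else 0"]
    by auto
  have ix: "(\<Sum>\<^sub>\<infinity>j\<in>UNIV. if j = x then - (c * d x) else 0) = - (c * d x)"
    using infsum_cong_neutral[of "{x}" UNIV "\<lambda>j. if j = x then - (c * d x) else 0" "\<lambda>j. if j = x then - (c * d x) else 0"]
    by auto
  have "wsum A (dstep x d) \<le> (\<Sum>\<^sub>\<infinity>j\<in>UNIV. (if j \<in> insert x A then c else 1) * d j + (infl x j * d x + (if j = x then - (c * d x) else 0)))"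
    unfolding wsum_def
  proof (rule infsum_mono)
    fix j
    have "(if j \<in> A then c else 1) * (infl x j * d x) \<le> infl x j * d x"
      using c_bounds d0 by (auto simp: mult_left_le_one_le)
    then show "(if j \<in> A then c else 1) * dstep x d j \<le> (if j \<in> insert x A then c else 1) * d j + (infl x j * d x + (if j = x then - (c * d x) else 0))"
      by (auto simp: dstep_def distrib_left split: if_splits)
  qed (intro wsum_summable modulus_dstep d summable_on_add infl_mult_summable sx)+
  also have "\<dots> = wsum (insert x A) d + ((\<Sum>\<^sub>\<infinity>j\<in>UNIV. infl x j) * d x - c * d x)"
    unfolding wsum_def
    by (subst infsum_add infsum_cmult_left' ix | intro wsum_summable summable_on_add infl_mult_summable sx d)+ simp
  also have "\<dots> \<le> wsum (insert x A) d"
    using mult_right_mono[OF infl_sum[of x] d0[of x]] by simp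
  finally show ?thesis .
qed

lemma sweep_sum: "modulus d \<Longrightarrow> (\<Sum>\<^sub>\<infinity>j\<in>UNIV. fold dstep xs d j) \<le> wsum (set xs) d"
proof (induction xs arbitrary: d)
  case Nil
  then show ?case by (simp add: wsum_def)
next
  case (Cons x xs)
  have "(\<Sum>\<^sub>\<infinity>j\<in>UNIV. fold dstep (x # xs) d j) \<le> wsum (set xs) (dstep x d)"
    using Cons.IH[OF modulus_dstep[OF Cons.prems]] by simp
  also have "\<dots> \<le> wsum (set (x # xs)) d" using wsum_dstep[OF Cons.prems] by simp
  finally show ?case .
qed

text \<open>A finite set of sites carries at least half of the total modulus. A sweep through it reduces this
  half by the factor \<open>c\<close>.\<close>

lemma sweep_half:
  assumes d: "modulus d"
  shows "\<exists>xs. (\<Sum>\<^sub>\<infinity>j\<in>UNIV. fold dstep xs d j) \<le> (1 + c) / 2 * (\<Sum>\<^sub>\<infinity>j\<in>UNIV. d j)"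
proof -
  let ?T = "\<Sum>\<^sub>\<infinity>j\<in>UNIV. d j"
  have T0: "0 \<le> ?T" using d by (intro infsum_nonneg) (auto simp: modulus_def)
  obtain F where F: "finite F" "?T / 2 \<le> sum d F"
  proof (cases "?T = 0")
    case True then show ?thesis using that[of "{}"] by simp
  next
    case False
    then obtain F where F: "finite F" "dist (sum d F) ?T \<le> ?T / 2"
      using infsum_finite_approximation[OF modulus_summable[OF d], of "?T / 2" UNIV] T0 by auto
    then have "\<bar>sum d F - ?T\<bar> \<le> ?T / 2" by (simp add: dist_real_def)
    then have "?T / 2 \<le> sum d F" by linarith
    then show ?thesis using that F(1) by blast
  qed
  obtain xs where xs: "set xs = F" using finite_list[OF F(1)] by auto
  have sF: "(\<lambda>j. if j \<in> F then - ((1 - c) * d j) else 0) summable_on UNIV"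
    using summable_on_cong_neutral[of F UNIV "\<lambda>j. if j \<in> F then - ((1 - c) * d j) else 0" "\<lambda>j. if j \<in> F then - ((1 - c) * d j) else 0"] F(1)
    by auto
  have iF: "(\<Sum>\<^sub>\<infinity>j\<in>UNIV. if j \<in> F then - ((1 - c) * d j) else 0) = - ((1 - c) * sum d F)"
    using infsum_cong_neutral[of F UNIV "\<lambda>j. if j \<in> F then - ((1 - c) * d j) else 0" "\<lambda>j. if j \<in> F then - ((1 - c) * d j) else 0"] F(1)
    by (simp add: sum_distrib_left sum_negf)
  have "wsum F d = (\<Sum>\<^sub>\<infinity>j\<in>UNIV. d j + (if j \<in> F then - ((1 - c) * d j) else 0))"
    unfolding wsum_def by (intro infsum_cong) (simp add: algebra_simps)
  also have "\<dots> = ?T - (1 - c) * sum d F"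
    by (subst infsum_add[OF modulus_summable[OF d] sF]) (simp add: iF)
  also have "\<dots> \<le> ?T - (1 - c) * (?T / 2)"
    using F(2) c_bounds by (intro diff_left_mono mult_left_mono) auto
  also have "\<dots> = (1 + c) / 2 * ?T" by (simp add: field_simps)
  finally show ?thesis using sweep_sum[OF d, of xs] xs by (intro exI[of _ xs]) simp
qed

lemma sweep_small:
  assumes d: "modulus d" and e: "0 < e"
  shows "\<exists>xs. (\<Sum>\<^sub>\<infinity>j\<in>UNIV. fold dstep xs d j) \<le> e"
proof -
  let ?r = "(1 + c) / 2" and ?T = "\<Sum>\<^sub>\<infinity>j\<in>UNIV. d j"
  have r: "0 \<le> ?r" "?r < 1" using c_bounds by auto
  have pow: "\<exists>xs. (\<Sum>\<^sub>\<infinity>j\<in>UNIV. fold dstep xs d j) \<le> ?r ^ n * ?T" for n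
  proof (induction n)
    case 0
    show ?case by (rule exI[of _ "[]"]) simp
  next
    case (Suc n)
    then obtain xs where xs: "(\<Sum>\<^sub>\<infinity>j\<in>UNIV. fold dstep xs d j) \<le> ?r ^ n * ?T" by blast
    from sweep_half[OF modulus_sweep[OF d, of xs]] obtain ys
      where ys: "(\<Sum>\<^sub>\<infinity>j\<in>UNIV. fold dstep ys (fold dstep xs d) j) \<le> ?r * (\<Sum>\<^sub>\<infinity>j\<in>UNIV. fold dstep xs d j)" by blast
    also have "\<dots> \<le> ?r * (?r ^ n * ?T)" using xs r by (intro mult_left_mono) auto
    finally show ?case by (intro exI[of _ "xs @ ys"]) (simp add: mult.assoc)
  qed
  have "(\<lambda>n. ?r ^ n * ?T) \<longlonglongrightarrow> 0 * ?T"
    by (intro tendsto_intros LIMSEQ_realpow_zero r)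
  then have "eventually (\<lambda>n. ?r ^ n * ?T < e) sequentially"
    by (intro order_tendstoD) (use e in auto)
  then obtain n where "?r ^ n * ?T < e" by (auto simp: eventually_sequentially)
  with pow[of n] show ?thesis by (meson le_less_trans less_imp_le)
qed

definition local_event :: "'d site set \<Rightarrow> 'd config set \<Rightarrow> bool"
  where "local_event J B \<longleftrightarrow> B \<in> sets (cfg_space UNIV) \<and>
    (\<forall>\<omega>\<in>Omega. \<forall>\<eta>\<in>Omega. (\<forall>j\<in>J. \<omega> j = \<eta> j) \<longrightarrow> (\<omega> \<in> B \<longleftrightarrow> \<eta> \<in> B))"

lemma local_event_lip:
  assumes J: "finite J" and B: "local_event J B"
  shows "unit_valued (indicator B)" "lip (indicator J) (indicator B)" "modulus (indicator J)"
proof -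
  define d :: "'d site \<Rightarrow> real" where "d = indicator J"
  define f :: "'d config \<Rightarrow> real" where "f = indicator B"
  have d: "modulus d"
    unfolding modulus_def d_def
    using summable_on_cong_neutral[of J UNIV "indicator J" "indicator J :: 'd site \<Rightarrow> real"] J by auto
  have Bs[measurable]: "B \<in> sets (cfg_space UNIV)" using B unfolding local_event_def by blast
  have f: "unit_valued f" by (simp add: unit_valued_def f_def)
  have lf: "lip d f"
    unfolding lip_def
  proof (intro allI impI)
    fix \<omega> \<eta> :: "'d config" assume fe: "fibre_eq \<omega> \<eta>"
    have nn: "0 \<le> (\<Sum>\<^sub>\<infinity>j\<in>{j. \<omega> j \<noteq> \<eta> j}. d j)" by (intro infsum_nonneg) (simp add: d_def)
    show "\<bar>f \<omega> - f \<eta>\<bar> \<le> (\<Sum>\<^sub>\<infinity>j\<in>{j. \<omega> j \<noteq> \<eta> j}. d j)"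
    proof (cases "\<forall>j\<in>J. \<omega> j = \<eta> j")
      case True
      then have "\<omega> \<in> B \<longleftrightarrow> \<eta> \<in> B" using B fe unfolding local_event_def fibre_eq_def by blast
      then have "f \<omega> = f \<eta>" by (simp add: f_def indicator_def)
      then show ?thesis using nn by simp
    next
      case False
      then obtain j where j: "j \<in> J" "\<omega> j \<noteq> \<eta> j" by auto
      have "\<bar>f \<omega> - f \<eta>\<bar> \<le> 1" by (auto simp: f_def indicator_def)
      also have "1 = sum d {j}" using j by (simp add: d_def)
      also have "\<dots> \<le> (\<Sum>\<^sub>\<infinity>j\<in>{j. \<omega> j \<noteq> \<eta> j}. d j)"
        by (rule finite_sum_le_infsum[OF modulus_summable[OF d]]) (use j in \<open>auto simp: d_def\<close>)
      finally show ?thesis .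
    qed
  qed
  show "unit_valued (indicator B)" "lip (indicator J) (indicator B)" "modulus (indicator J)"
    using f lf d by (simp_all add: f_def d_def)
qed

text \<open>The indicator of the event is averaged along sweeps until its total modulus is at most \<open>e\<close>. The
  set \<open>N\<close> of visited sites depends on \<open>J\<close> and \<open>e\<close> only; this uniformity in the event, in the measure
  and in the constraint yields convergence in total variation on the spins in \<open>J\<close>.\<close>

lemma local_event_approx:
  assumes J: "finite J" and e: "0 < e"
  shows "\<exists>N. finite N \<and> (\<forall>B. local_event J B \<longrightarrow> (\<exists>g. unit_valued g \<and> (\<forall>\<omega> \<eta>. fibre_eq \<omega> \<eta> \<longrightarrow> \<bar>g \<omega> - g \<eta>\<bar> \<le> e) \<and>
    (\<forall>\<mu> A. prob_space \<mu> \<longrightarrow> sets \<mu> = sets (cfg_space UNIV) \<longrightarrow> (\<forall>i\<in>N. fibred q (A i) \<and> site_inv (A i) i \<mu>) \<longrightarrow>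
      measure \<mu> B = (\<integral>\<omega>. g \<omega> \<partial>\<mu>))))"
proof -
  define d :: "'d site \<Rightarrow> real" where "d = indicator J"
  have d: "modulus d"
    unfolding modulus_def d_def
    using summable_on_cong_neutral[of J UNIV "indicator J" "indicator J :: 'd site \<Rightarrow> real"] J by auto
  from sweep_small[OF d e] obtain xs where xs: "(\<Sum>\<^sub>\<infinity>j\<in>UNIV. fold dstep xs d j) \<le> e" ..
  show ?thesis
  proof (rule exI, rule conjI)
    show "finite (set xs)" by (rule finite_set)
  next
    show "\<forall>B. local_event J B \<longrightarrow> (\<exists>g. unit_valued g \<and> (\<forall>\<omega> \<eta>. fibre_eq \<omega> \<eta> \<longrightarrow> \<bar>g \<omega> - g \<eta>\<bar> \<le> e) \<and>
      (\<forall>\<mu> A. prob_space \<mu> \<longrightarrow> sets \<mu> = sets (cfg_space UNIV) \<longrightarrow> (\<forall>i\<in>set xs. fibred q (A i) \<and> site_inv (A i) i \<mu>) \<longrightarrow>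
        measure \<mu> B = (\<integral>\<omega>. g \<omega> \<partial>\<mu>)))"
    proof (rule allI, rule impI)
    fix B assume B: "local_event J B"
    define f :: "'d config \<Rightarrow> real" where "f = indicator B"
    have Bs[measurable]: "B \<in> sets (cfg_space UNIV)" using B unfolding local_event_def by blast
    have f: "unit_valued f" and lf: "lip d f"
      unfolding f_def d_def by (rule local_event_lip[OF J B])+
    show "\<exists>g. unit_valued g \<and> (\<forall>\<omega> \<eta>. fibre_eq \<omega> \<eta> \<longrightarrow> \<bar>g \<omega> - g \<eta>\<bar> \<le> e) \<and>
      (\<forall>\<mu> A. prob_space \<mu> \<longrightarrow> sets \<mu> = sets (cfg_space UNIV) \<longrightarrow> (\<forall>i\<in>set xs. fibred q (A i) \<and> site_inv (A i) i \<mu>) \<longrightarrow>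
        measure \<mu> B = (\<integral>\<omega>. g \<omega> \<partial>\<mu>))"
    proof (rule exI[of _ "fold site_avg xs f"], rule conjI, rule unit_valued_sweep[OF f], rule conjI; intro allI impI)
      fix \<omega> \<eta> :: "'d config" assume fe: "fibre_eq \<omega> \<eta>"
      have md: "modulus (fold dstep xs d)" by (rule modulus_sweep[OF d])
      have "\<bar>fold site_avg xs f \<omega> - fold site_avg xs f \<eta>\<bar> \<le> (\<Sum>\<^sub>\<infinity>j\<in>{j. \<omega> j \<noteq> \<eta> j}. fold dstep xs d j)"
        using lip_sweep[OF f lf d, of xs] fe by (simp add: lip_def)
      also have "\<dots> \<le> (\<Sum>\<^sub>\<infinity>j\<in>UNIV. fold dstep xs d j)"
        using md by (intro infsum_mono_neutral modulus_summable[OF md]) (auto simp: modulus_def)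
      also note xs
      finally show "\<bar>fold site_avg xs f \<omega> - fold site_avg xs f \<eta>\<bar> \<le> e" .
    next
      fix \<mu> :: "'d config measure" and A
      assume \<mu>: "prob_space \<mu>" "sets \<mu> = sets (cfg_space UNIV)" and inv: "\<forall>i\<in>set xs. fibred q (A i) \<and> site_inv (A i) i \<mu>"
      have "(\<integral>\<omega>. fold site_avg ys h \<omega> \<partial>\<mu>) = (\<integral>\<omega>. h \<omega> \<partial>\<mu>)" if "set ys \<subseteq> set xs" "unit_valued h" for ys h
        using that
      proof (induction ys arbitrary: h)
        case (Cons y ys)
        have "(\<integral>\<omega>. fold site_avg (y # ys) h \<omega> \<partial>\<mu>) = (\<integral>\<omega>. site_avg y h \<omega> \<partial>\<mu>)"
          using Cons.IH[OF _ unit_valued_site_avg[OF Cons.prems(2)]] Cons.prems(1) by simp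
        also have "\<dots> = (\<integral>\<omega>. h \<omega> \<partial>\<mu>)"
          by (rule site_avg_invariant[OF \<mu>]) (use inv Cons.prems in auto)
        finally show ?case .
      qed simp
      moreover have "(\<integral>\<omega>. f \<omega> \<partial>\<mu>) = measure \<mu> B"
      proof -
        have "B \<subseteq> space \<mu>" using Bs sets.sets_into_space[of B \<mu>] \<mu>(2) by simp
        then show ?thesis by (simp add: f_def Int_absorb2)
      qed
      ultimately show "measure \<mu> B = (\<integral>\<omega>. fold site_avg xs f \<omega> \<partial>\<mu>)" using f by simp
    qed
    qed
  qed
qed

end

section \<open>Existence and uniqueness of the constrained Gibbs measures\<close>

lemma (in prob_space) integral_close:
  fixes g :: "'a \<Rightarrow> real"
  assumes g: "integrable M g" and "AE x in M. \<bar>g x - a\<bar> \<le> e"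
  shows "\<bar>(\<integral>x. g x \<partial>M) - a\<bar> \<le> e"
proof -
  have "AE x in M. g x \<le> a + e" "AE x in M. a - e \<le> g x"
    using assms(2) by (eventually_elim, linarith)+
  then have "(\<integral>x. g x \<partial>M) \<le> (\<integral>x. a + e \<partial>M)" "(\<integral>x. a - e \<partial>M) \<le> (\<integral>x. g x \<partial>M)"
    by (intro integral_mono_AE g; simp)+
  then show ?thesis using prob_space by (simp add: abs_le_iff)
qed

context gibbs_model
begin

lemma unit_valued_integrable:
  assumes "unit_valued f" "prob_space \<mu>" "sets \<mu> = sets (cfg_space UNIV)"
  shows "integrable \<mu> f"
proof -
  interpret prob_space \<mu> by fact
  note [measurable_cong] = assms(3)
  note [measurable] = unit_valuedD(1)[OF assms(1)]
  have "space \<mu> = Omega" using sets_eq_imp_space_eq[OF assms(3)] by (simp add: space_cfg)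
  then show ?thesis
    by (intro integrable_const_bound[where B=1]) (use unit_valuedD(2,3)[OF assms(1)] in \<open>auto intro!: AE_I2\<close>)
qed

definition in_fibre :: "'d dconfig \<Rightarrow> 'd config measure \<Rightarrow> bool"
  where "in_fibre \<sigma> \<mu> \<longleftrightarrow> prob_space \<mu> \<and> sets \<mu> = sets (cfg_space UNIV) \<and> (AE \<omega> in \<mu>. \<omega> \<in> Pi\<^sub>E UNIV (arcs \<sigma>))"

lemma fibre_eq_arcs:
  assumes "\<omega> \<in> Pi\<^sub>E UNIV (arcs \<sigma>)" "\<eta> \<in> Pi\<^sub>E UNIV (arcs \<sigma>)" shows "fibre_eq \<omega> \<eta>"
  using assms by (auto simp: fibre_eq_def arcs_def spin_arc_def PiE_UNIV_iff)

lemma arcs_PiE_nonempty: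
  assumes "\<sigma> \<in> UNIV \<rightarrow>\<^sub>E {1..q}"
  obtains \<omega> where "\<omega> \<in> Pi\<^sub>E UNIV (arcs \<sigma>)"
proof -
  have "arcs \<sigma> i \<noteq> {}" for i
    using arcs_admissible[OF assms, of i] by (auto simp: admissible_def)
  then have "(\<lambda>i. SOME x. x \<in> arcs \<sigma> i) \<in> Pi\<^sub>E UNIV (arcs \<sigma>)"
    by (simp add: PiE_UNIV_iff some_in_eq)
  then show ?thesis by (rule that)
qed

lemma arcs_fibred: "\<sigma> \<in> UNIV \<rightarrow>\<^sub>E {1..q} \<Longrightarrow> fibred q (arcs \<sigma> i)"
  unfolding fibred_def arcs_def by (metis PiE_mem UNIV_I)

lemma boltz_Un:
  assumes "finite \<Lambda>" "finite \<Lambda>'" "\<omega> \<in> V \<rightarrow>\<^sub>E S1"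
  shows "boltz V (\<Lambda> \<union> \<Lambda>') \<omega> = boltz V \<Lambda> \<omega> * boltz (V - \<Lambda>) \<Lambda>' (restrict \<omega> (V - \<Lambda>))"
  unfolding boltz_def ham_Un[OF assms] by (simp add: exp_add[symmetric] ennreal_mult[symmetric])

definition prodm :: "'d dconfig \<Rightarrow> 'd config measure"
  where "prodm \<sigma> = PiM UNIV (\<lambda>i. apriori (arcs \<sigma> i))"

text \<open>An exhaustion by finite sets, from an enumeration of all sites.\<close>

definition vol :: "nat \<Rightarrow> 'd site set" where "vol n = {j. to_nat j < n}"

text \<open>The Boltzmann factor is applied to the product measure on all sites instead of fixing a boundary
  condition. All volumes then live on one space, and \<open>\<sigma>\<close> enters through the product measure only,
  which makes the dependence on \<open>\<sigma>\<close> measurable.\<close>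

definition fin_vol :: "nat \<Rightarrow> 'd dconfig \<Rightarrow> 'd config measure"
  where "fin_vol n \<sigma> = density (prodm \<sigma>) (\<lambda>\<omega>. boltz UNIV (vol n) \<omega> / (\<integral>\<^sup>+\<omega>. boltz UNIV (vol n) \<omega> \<partial>prodm \<sigma>))"

lemma finite_vol[simp]: "finite (vol n)"
proof -
  have "finite (to_nat -` {..<n} :: 'd site set)" by (intro finite_vimageI) auto
  then show ?thesis by (rule finite_subset[rotated]) (auto simp: vol_def)
qed

lemma vol_covers: assumes "finite N" shows "\<exists>n0. \<forall>n\<ge>n0. N \<subseteq> vol n"
proof (intro exI allI impI subsetI)
  fix n j assume n: "Suc (Max (insert 0 (to_nat ` N))) \<le> n" and j: "j \<in> N"
  then have "to_nat j \<le> Max (insert 0 (to_nat ` N))" using assms by (intro Max_ge) auto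
  then show "j \<in> vol n" using n by (simp add: vol_def)
qed

lemma sets_prodm[simp, measurable_cong]: "sets (prodm \<sigma>) = sets (cfg_space UNIV)"
  unfolding prodm_def cfg_space_def by (rule sets_PiM_cong) auto

lemma sets_fin_vol[simp, measurable_cong]: "sets (fin_vol n \<sigma>) = sets (cfg_space UNIV)"
  by (simp add: fin_vol_def)

lemma space_prodm[simp]: "space (prodm \<sigma>) = Omega"
  by (simp add: prodm_def space_PiM)

lemma prob_space_prodm: "\<sigma> \<in> UNIV \<rightarrow>\<^sub>E {1..q} \<Longrightarrow> prob_space (prodm \<sigma>)"
  unfolding prodm_def by (intro prob_space_PiM prob_space_apriori arcs_admissible)

lemma prodm_resample:
  assumes \<sigma>: "\<sigma> \<in> UNIV \<rightarrow>\<^sub>E {1..q}" and f[measurable]: "f \<in> borel_measurable (cfg_space UNIV)"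
  shows "(\<integral>\<^sup>+\<omega>. f \<omega> \<partial>prodm \<sigma>) = (\<integral>\<^sup>+\<omega>. resample1 (arcs \<sigma> i) i f \<omega> \<partial>prodm \<sigma>)"
proof -
  let ?A = "apriori (arcs \<sigma> i)"
  interpret A: prob_space ?A by (intro prob_space_apriori arcs_admissible \<sigma>)
  interpret P: prob_space "prodm \<sigma>" by (rule prob_space_prodm[OF \<sigma>])
  interpret AP: pair_sigma_finite ?A "prodm \<sigma>" ..
  have m: "(\<lambda>(x, X). fun_upd X i x) \<in> ?A \<Otimes>\<^sub>M prodm \<sigma> \<rightarrow>\<^sub>M cfg_space UNIV"
  proof -
    have "(\<lambda>p. (\<lambda>(\<eta>, x). fun_upd \<eta> i x) (snd p, fst p)) \<in> circle_measure \<Otimes>\<^sub>M cfg_space UNIV \<rightarrow>\<^sub>M cfg_space UNIV"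
      by (rule measurable_compose[OF _ upd_measurable]) auto
    then show ?thesis by (simp add: case_prod_beta' cong: measurable_cong_sets sets_pair_measure_cong)
  qed
  have "distr (?A \<Otimes>\<^sub>M prodm \<sigma>) (prodm \<sigma>) (\<lambda>(x, X). fun_upd X i x) = prodm \<sigma>"
    using distr_pair_PiM_eq_PiM[of UNIV "\<lambda>i. apriori (arcs \<sigma> i)" i] prob_space_apriori[OF arcs_admissible[OF \<sigma>]]
    by (simp add: prodm_def)
  then have "(\<integral>\<^sup>+\<omega>. f \<omega> \<partial>prodm \<sigma>) = (\<integral>\<^sup>+\<omega>. f \<omega> \<partial>distr (?A \<Otimes>\<^sub>M prodm \<sigma>) (prodm \<sigma>) (\<lambda>(x, X). fun_upd X i x))" by simp
  also have "\<dots> = (\<integral>\<^sup>+p. f ((\<lambda>(x, X). fun_upd X i x) p) \<partial>(?A \<Otimes>\<^sub>M prodm \<sigma>))"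
    using m by (intro nn_integral_distr) (simp_all cong: measurable_cong_sets)
  also have "\<dots> = (\<integral>\<^sup>+X. \<integral>\<^sup>+x. f (fun_upd X i x) \<partial>?A \<partial>prodm \<sigma>)"
    using measurable_compose[OF m f] by (subst AP.nn_integral_snd[symmetric]) (simp_all add: case_prod_beta')
  finally show ?thesis by (simp add: resample1_def)
qed

lemma fin_vol_norm:
  assumes \<sigma>: "\<sigma> \<in> UNIV \<rightarrow>\<^sub>E {1..q}"
  shows "(\<integral>\<^sup>+\<omega>. boltz UNIV (vol n) \<omega> \<partial>prodm \<sigma>) \<noteq> 0" "(\<integral>\<^sup>+\<omega>. boltz UNIV (vol n) \<omega> \<partial>prodm \<sigma>) \<noteq> \<infinity>"
proof -
  interpret P: prob_space "prodm \<sigma>" by (rule prob_space_prodm[OF \<sigma>])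
  have "(\<integral>\<^sup>+\<omega>. ennreal (exp (- hb (vol n))) \<partial>prodm \<sigma>) \<le> (\<integral>\<^sup>+\<omega>. boltz UNIV (vol n) \<omega> \<partial>prodm \<sigma>)"
    by (intro nn_integral_mono boltz_bounds) auto
  then have "ennreal (exp (- hb (vol n))) \<le> (\<integral>\<^sup>+\<omega>. boltz UNIV (vol n) \<omega> \<partial>prodm \<sigma>)"
    using P.emeasure_space_1 by simp
  moreover have "0 < ennreal (exp (- hb (vol n)))" by simp
  ultimately show "(\<integral>\<^sup>+\<omega>. boltz UNIV (vol n) \<omega> \<partial>prodm \<sigma>) \<noteq> 0" by auto
  have "(\<integral>\<^sup>+\<omega>. boltz UNIV (vol n) \<omega> \<partial>prodm \<sigma>) \<le> (\<integral>\<^sup>+\<omega>. ennreal (exp (hb (vol n))) \<partial>prodm \<sigma>)"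
    by (intro nn_integral_mono boltz_bounds) auto
  then have "(\<integral>\<^sup>+\<omega>. boltz UNIV (vol n) \<omega> \<partial>prodm \<sigma>) \<le> ennreal (exp (hb (vol n)))"
    using P.emeasure_space_1 by simp
  then show "(\<integral>\<^sup>+\<omega>. boltz UNIV (vol n) \<omega> \<partial>prodm \<sigma>) \<noteq> \<infinity>" by (auto simp: top_unique)
qed

lemma nn_integral_fin_vol:
  assumes [measurable]: "f \<in> borel_measurable (cfg_space UNIV)"
  shows "(\<integral>\<^sup>+\<omega>. f \<omega> \<partial>fin_vol n \<sigma>) = (\<integral>\<^sup>+\<omega>. boltz UNIV (vol n) \<omega> * f \<omega> \<partial>prodm \<sigma>) / (\<integral>\<^sup>+\<omega>. boltz UNIV (vol n) \<omega> \<partial>prodm \<sigma>)"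
proof -
  note [measurable] = boltz_measurable[OF finite_vol, of UNIV]
  have "(\<integral>\<^sup>+\<omega>. f \<omega> \<partial>fin_vol n \<sigma>) = (\<integral>\<^sup>+\<omega>. boltz UNIV (vol n) \<omega> / (\<integral>\<^sup>+\<omega>. boltz UNIV (vol n) \<omega> \<partial>prodm \<sigma>) * f \<omega> \<partial>prodm \<sigma>)"
    unfolding fin_vol_def by (rule nn_integral_density) measurable
  also have "\<dots> = (\<integral>\<^sup>+\<omega>. boltz UNIV (vol n) \<omega> * f \<omega> / (\<integral>\<^sup>+\<omega>. boltz UNIV (vol n) \<omega> \<partial>prodm \<sigma>) \<partial>prodm \<sigma>)"
    by (simp add: divide_ennreal_def ac_simps)
  also have "\<dots> = (\<integral>\<^sup>+\<omega>. boltz UNIV (vol n) \<omega> * f \<omega> \<partial>prodm \<sigma>) / (\<integral>\<^sup>+\<omega>. boltz UNIV (vol n) \<omega> \<partial>prodm \<sigma>)"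
    by (rule nn_integral_divide) measurable
  finally show ?thesis .
qed

lemma fin_vol_in_fibre:
  assumes \<sigma>: "\<sigma> \<in> UNIV \<rightarrow>\<^sub>E {1..q}" shows "in_fibre \<sigma> (fin_vol n \<sigma>)"
  unfolding in_fibre_def
proof (intro conjI)
  show "prob_space (fin_vol n \<sigma>)"
  proof
    have "emeasure (fin_vol n \<sigma>) (space (fin_vol n \<sigma>)) = (\<integral>\<^sup>+\<omega>. 1 \<partial>fin_vol n \<sigma>)" by simp
    also have "\<dots> = 1"
      using fin_vol_norm[OF \<sigma>, of n] by (subst nn_integral_fin_vol) (simp_all add: ennreal_divide_self less_top)
    finally show "emeasure (fin_vol n \<sigma>) (space (fin_vol n \<sigma>)) = 1" .
  qed
  note [measurable] = boltz_measurable[OF finite_vol, of UNIV]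
  have "AE \<omega> in prodm \<sigma>. \<forall>i. \<omega> i \<in> arcs \<sigma> i"
    unfolding prodm_def
    by (subst AE_all_countable, intro allI AE_PiM_component AE_apriori prob_space_apriori arcs_admissible \<sigma>) auto
  then show "AE \<omega> in fin_vol n \<sigma>. \<omega> \<in> Pi\<^sub>E UNIV (arcs \<sigma>)"
    unfolding fin_vol_def by (subst AE_density) (auto simp: PiE_UNIV_iff)
qed simp

text \<open>After multiplication with \<open>inv_boltz UNIV {i}\<close> the density no longer depends on the spin at \<open>i\<close>, and
  the product measure is invariant under averaging this spin.\<close>

lemma fin_vol_site_inv:
  assumes \<sigma>: "\<sigma> \<in> UNIV \<rightarrow>\<^sub>E {1..q}" and i: "i \<in> vol n"
  shows "site_inv (arcs \<sigma> i) i (fin_vol n \<sigma>)"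
  unfolding site_inv_def
proof
  fix f :: "'d config \<Rightarrow> ennreal" assume f[measurable]: "f \<in> borel_measurable (cfg_space UNIV)"
  define k where "k \<omega> = boltz (UNIV - {i}) (vol n) (restrict \<omega> (UNIV - {i}))" for \<omega>
  have [measurable]: "(\<lambda>\<eta>. restrict \<eta> (UNIV - {i})) \<in> cfg_space UNIV \<rightarrow>\<^sub>M cfg_space (UNIV - {i})"
    unfolding cfg_space_def by (rule measurable_restrict_subset) auto
  have adm: "admissible (arcs \<sigma> i)" by (rule arcs_admissible[OF \<sigma>])
  note [measurable] = boltz_measurable[OF finite_vol] inv_boltz_measurable[of "{i}" UNIV] resample1_measurable[OF UNIV_I adm]
  have [measurable]: "k \<in> borel_measurable (cfg_space UNIV)" unfolding k_def[abs_def] by measurable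
  have vol: "{i} \<union> vol n = vol n" using i by auto
  have k: "boltz UNIV (vol n) \<omega> * (inv_boltz UNIV {i} \<omega> * x) = k \<omega> * x" if "\<omega> \<in> Omega" for \<omega> x
  proof -
    have "boltz UNIV (vol n) \<omega> = boltz UNIV {i} \<omega> * k \<omega>"
      using boltz_Un[of "{i}" "vol n" \<omega> UNIV] that by (simp only: vol k_def) simp
    then have "boltz UNIV (vol n) \<omega> * (inv_boltz UNIV {i} \<omega> * x) = boltz UNIV {i} \<omega> * (inv_boltz UNIV {i} \<omega> * (k \<omega> * x))"
      by (simp add: ac_simps)
    then show ?thesis by (simp add: boltz_inv)
  qed
  have "(\<integral>\<^sup>+\<omega>. k \<omega> * f \<omega> \<partial>prodm \<sigma>) = (\<integral>\<^sup>+\<omega>. resample1 (arcs \<sigma> i) i (\<lambda>\<omega>. k \<omega> * f \<omega>) \<omega> \<partial>prodm \<sigma>)"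
    by (rule prodm_resample[OF \<sigma>]) measurable
  also have "\<dots> = (\<integral>\<^sup>+\<omega>. k \<omega> * resample1 (arcs \<sigma> i) i f \<omega> \<partial>prodm \<sigma>)"
    by (intro nn_integral_cong resample1_mult[of i UNIV] f) (simp_all add: k_def restrict_upd_off)
  finally have "(\<integral>\<^sup>+\<omega>. boltz UNIV (vol n) \<omega> * (inv_boltz UNIV {i} \<omega> * f \<omega>) \<partial>prodm \<sigma>) =
      (\<integral>\<^sup>+\<omega>. boltz UNIV (vol n) \<omega> * (inv_boltz UNIV {i} \<omega> * resample1 (arcs \<sigma> i) i f \<omega>) \<partial>prodm \<sigma>)"
    by (simp add: k cong: nn_integral_cong_simp)
  then show "(\<integral>\<^sup>+\<omega>. inv_boltz UNIV {i} \<omega> * f \<omega> \<partial>fin_vol n \<sigma>) = (\<integral>\<^sup>+\<omega>. inv_boltz UNIV {i} \<omega> * resample1 (arcs \<sigma> i) i f \<omega> \<partial>fin_vol n \<sigma>)"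
    by (simp add: nn_integral_fin_vol)
qed

text \<open>Cylinder sets are local events and form a generator that is closed under intersection.\<close>

lemma cfg_measure_eqI:
  assumes "finite_measure \<mu>" "sets \<mu> = sets (cfg_space UNIV)" "sets \<nu> = sets (cfg_space UNIV)"
    and "\<And>J B. finite J \<Longrightarrow> B \<in> sets (cfg_space UNIV) \<Longrightarrow>
      (\<forall>\<omega>\<in>Omega. \<forall>\<eta>\<in>Omega. (\<forall>j\<in>J. \<omega> j = \<eta> j) \<longrightarrow> (\<omega> \<in> B \<longleftrightarrow> \<eta> \<in> B)) \<Longrightarrow> emeasure \<mu> B = emeasure \<nu> B"
  shows "\<mu> = (\<nu> :: 'd config measure)"
proof (rule measure_eqI_PiM_infinite[where I=UNIV and M="\<lambda>_. circle_measure"])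
  fix A and J :: "'d site set" assume J: "finite J" and A: "\<And>i. i \<in> J \<Longrightarrow> A i \<in> sets circle_measure"
  let ?B = "prod_emb UNIV (\<lambda>_. circle_measure) J (Pi\<^sub>E J A)"
  show "emeasure \<mu> ?B = emeasure \<nu> ?B"
  proof (rule assms(4)[OF J])
    show "?B \<in> sets (cfg_space UNIV)"
      unfolding cfg_space_def using J A by (intro sets_PiM_I) auto
    have "\<omega> \<in> ?B \<longleftrightarrow> (\<forall>j\<in>J. \<omega> j \<in> A j)" if "\<omega> \<in> Omega" for \<omega>
      using that by (auto simp: prod_emb_def PiE_iff)
    then show "\<forall>\<omega>\<in>Omega. \<forall>\<eta>\<in>Omega. (\<forall>j\<in>J. \<omega> j = \<eta> j) \<longrightarrow> (\<omega> \<in> ?B \<longleftrightarrow> \<eta> \<in> ?B)" by simp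
  qed
qed (use assms in \<open>auto simp: cfg_space_def\<close>)

lemma prodm_kernel: "prodm \<in> dcfg_space q \<rightarrow>\<^sub>M prob_algebra (cfg_space UNIV)"
proof (rule measurable_prob_algebra_generated)
  show "sets (cfg_space UNIV :: 'd config measure) = sigma_sets (UNIV \<rightarrow>\<^sub>E S1) (prod_algebra UNIV (\<lambda>_. circle_measure))"
    unfolding cfg_space_def sets_PiM by simp
  show "prod_algebra UNIV (\<lambda>_. circle_measure) \<subseteq> Pow (UNIV \<rightarrow>\<^sub>E S1 :: 'd config set)"
    using prod_algebra_sets_into_space[of UNIV "\<lambda>_. circle_measure"] by simp
  fix B :: "'d config set" assume "B \<in> prod_algebra UNIV (\<lambda>_. circle_measure)"
  then obtain J E where B: "B = prod_emb UNIV (\<lambda>_. circle_measure) J (Pi\<^sub>E J E)" "finite J" "\<And>i. i \<in> J \<Longrightarrow> E i \<in> sets circle_measure"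
    by (elim prod_algebraE) auto
  have "(\<lambda>\<sigma>. \<Prod>i\<in>J. emeasure (apriori (spin_arc q (\<sigma> i))) (E i)) \<in> borel_measurable (dcfg_space q)"
  proof (rule borel_measurable_prod_ennreal)
    fix i assume "i \<in> J"
    have "(\<lambda>\<sigma>. \<sigma> i) \<in> dcfg_space q \<rightarrow>\<^sub>M count_space {1..q}" by (simp add: dcfg_space_def)
    then show "(\<lambda>\<sigma>. emeasure (apriori (spin_arc q (\<sigma> i))) (E i)) \<in> borel_measurable (dcfg_space q)"
      by (rule measurable_compose) simp
  qed
  moreover have "emeasure (prodm \<sigma>) B = (\<Prod>i\<in>J. emeasure (apriori (spin_arc q (\<sigma> i))) (E i))" if "\<sigma> \<in> space (dcfg_space q)" for \<sigma>
  proof -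
    have \<sigma>: "\<sigma> \<in> UNIV \<rightarrow>\<^sub>E {1..q}" using that by (simp add: space_dcfg)
    have "B = prod_emb UNIV (\<lambda>i. apriori (arcs \<sigma> i)) J (Pi\<^sub>E J E)"
      by (simp add: B(1) prod_emb_def)
    then show ?thesis
      using emeasure_PiM_emb[of UNIV "\<lambda>i. apriori (arcs \<sigma> i)" J E] B(2,3) prob_space_apriori[OF arcs_admissible[OF \<sigma>]]
      by (simp add: prodm_def arcs_def)
  qed
  ultimately show "(\<lambda>\<sigma>. emeasure (prodm \<sigma>) B) \<in> borel_measurable (dcfg_space q)"
    by (simp cong: measurable_cong)
qed (use prob_space_prodm in \<open>auto intro: Int_stable_prod_algebra simp: space_dcfg\<close>)

lemma fin_vol_measurable:
  assumes [measurable]: "B \<in> sets (cfg_space UNIV)"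
  shows "(\<lambda>\<sigma>. emeasure (fin_vol n \<sigma>) B) \<in> borel_measurable (dcfg_space q)"
proof -
  note [measurable] = boltz_measurable[OF finite_vol, of UNIV] measurable_prob_algebraD[OF prodm_kernel]
    nn_integral_measurable_subprob_algebra
  have "(\<lambda>\<sigma>. (\<integral>\<^sup>+\<omega>. boltz UNIV (vol n) \<omega> * indicator B \<omega> \<partial>prodm \<sigma>) / (\<integral>\<^sup>+\<omega>. boltz UNIV (vol n) \<omega> \<partial>prodm \<sigma>)) \<in> borel_measurable (dcfg_space q)"
    by measurable
  also have "(\<lambda>\<sigma>. (\<integral>\<^sup>+\<omega>. boltz UNIV (vol n) \<omega> * indicator B \<omega> \<partial>prodm \<sigma>) / (\<integral>\<^sup>+\<omega>. boltz UNIV (vol n) \<omega> \<partial>prodm \<sigma>)) = (\<lambda>\<sigma>. emeasure (fin_vol n \<sigma>) B)"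
    by (intro ext) (subst nn_integral_fin_vol[symmetric], simp_all)
  finally show ?thesis .
qed

end

context dobrushin_model
begin

text \<open>Both measures give the event the mean of one and the same function, which is almost constant on
  the fibre that carries them.\<close>

lemma local_event_close:
  assumes J: "finite J" and e: "0 < e"
  shows "\<exists>N. finite N \<and> (\<forall>B \<sigma> \<mu> \<nu>. local_event J B \<longrightarrow> \<sigma> \<in> UNIV \<rightarrow>\<^sub>E {1..q} \<longrightarrow> in_fibre \<sigma> \<mu> \<longrightarrow> in_fibre \<sigma> \<nu> \<longrightarrow>
    (\<forall>i\<in>N. site_inv (arcs \<sigma> i) i \<mu>) \<longrightarrow> (\<forall>i\<in>N. site_inv (arcs \<sigma> i) i \<nu>) \<longrightarrow> \<bar>measure \<mu> B - measure \<nu> B\<bar> \<le> e)"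
proof -
  have "0 < e / 2" using e by simp
  from local_event_approx[OF J this] obtain N where N: "finite N"
    and approx: "\<forall>B. local_event J B \<longrightarrow> (\<exists>g. unit_valued g \<and> (\<forall>\<omega> \<eta>. fibre_eq \<omega> \<eta> \<longrightarrow> \<bar>g \<omega> - g \<eta>\<bar> \<le> e / 2) \<and>
    (\<forall>\<mu> A. prob_space \<mu> \<longrightarrow> sets \<mu> = sets (cfg_space UNIV) \<longrightarrow> (\<forall>i\<in>N. fibred q (A i) \<and> site_inv (A i) i \<mu>) \<longrightarrow>
      measure \<mu> B = (\<integral>\<omega>. g \<omega> \<partial>\<mu>)))" by (elim exE conjE)
  have main: "\<bar>measure \<mu> B - measure \<nu> B\<bar> \<le> e"
    if B: "local_event J B" and \<sigma>: "\<sigma> \<in> UNIV \<rightarrow>\<^sub>E {1..q}" and \<mu>: "in_fibre \<sigma> \<mu>" and \<nu>: "in_fibre \<sigma> \<nu>"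
      and inv: "\<forall>i\<in>N. site_inv (arcs \<sigma> i) i \<mu>" "\<forall>i\<in>N. site_inv (arcs \<sigma> i) i \<nu>" for B \<sigma> \<mu> \<nu>
  proof -
    from approx[rule_format, OF B] obtain g where g: "unit_valued g"
      and osc: "\<forall>\<omega> \<eta>. fibre_eq \<omega> \<eta> \<longrightarrow> \<bar>g \<omega> - g \<eta>\<bar> \<le> e / 2"
      and meas: "\<forall>\<mu> A. prob_space \<mu> \<longrightarrow> sets \<mu> = sets (cfg_space UNIV) \<longrightarrow> (\<forall>i\<in>N. fibred q (A i) \<and> site_inv (A i) i \<mu>) \<longrightarrow>
        measure \<mu> B = (\<integral>\<omega>. g \<omega> \<partial>\<mu>)" by (elim exE conjE)
    obtain \<omega>0 where \<omega>0: "\<omega>0 \<in> Pi\<^sub>E UNIV (arcs \<sigma>)" using arcs_PiE_nonempty[OF \<sigma>] .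
    have close: "\<bar>measure \<mu> B - g \<omega>0\<bar> \<le> e / 2" if \<mu>: "in_fibre \<sigma> \<mu>" and inv: "\<forall>i\<in>N. site_inv (arcs \<sigma> i) i \<mu>" for \<mu>
    proof -
      have p: "prob_space \<mu>" "sets \<mu> = sets (cfg_space UNIV)" "AE \<omega> in \<mu>. \<omega> \<in> Pi\<^sub>E UNIV (arcs \<sigma>)"
        using \<mu> by (simp_all add: in_fibre_def)
      have "measure \<mu> B = (\<integral>\<omega>. g \<omega> \<partial>\<mu>)"
        using meas[rule_format, OF p(1,2), of "arcs \<sigma>"] inv arcs_fibred[OF \<sigma>] by simp
      moreover have "AE \<omega> in \<mu>. \<bar>g \<omega> - g \<omega>0\<bar> \<le> e / 2"
        using p(3) by eventually_elim (rule osc[rule_format, OF fibre_eq_arcs[OF _ \<omega>0]])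
      ultimately show ?thesis
        using prob_space.integral_close[OF p(1) unit_valued_integrable[OF g p(1,2)]] by metis
    qed
    from close[OF \<mu> inv(1)] close[OF \<nu> inv(2)] show ?thesis by linarith
  qed
  show ?thesis using N main by (intro exI[of _ N]) simp
qed

lemma local_gibbs_in_fibre:
  assumes "\<sigma> \<in> UNIV \<rightarrow>\<^sub>E {1..q}" "local_gibbs UNIV (arcs \<sigma>) \<mu>" shows "in_fibre \<sigma> \<mu>"
  unfolding in_fibre_def using local_gibbsD(1,2)[OF assms(2)] local_gibbs_AE[OF assms(2) arcs_admissible[OF assms(1)]] by simp

lemma local_gibbs_unique:
  assumes \<sigma>: "\<sigma> \<in> UNIV \<rightarrow>\<^sub>E {1..q}" and \<mu>: "local_gibbs UNIV (arcs \<sigma>) \<mu>" and \<nu>: "local_gibbs UNIV (arcs \<sigma>) \<nu>"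
  shows "\<mu> = \<nu>"
proof (rule cfg_measure_eqI)
  interpret \<mu>: prob_space \<mu> by (rule local_gibbsD(1)[OF \<mu>])
  interpret \<nu>: prob_space \<nu> by (rule local_gibbsD(1)[OF \<nu>])
  show "finite_measure \<mu>" by (rule \<mu>.finite_measure_axioms)
  fix J and B :: "'d config set" assume J: "finite J" and B: "B \<in> sets (cfg_space UNIV)"
    "\<forall>\<omega>\<in>Omega. \<forall>\<eta>\<in>Omega. (\<forall>j\<in>J. \<omega> j = \<eta> j) \<longrightarrow> (\<omega> \<in> B \<longleftrightarrow> \<eta> \<in> B)"
  then have lB: "local_event J B" unfolding local_event_def by (intro conjI)
  have "\<bar>measure \<mu> B - measure \<nu> B\<bar> \<le> 0 + e" if e: "0 < e" for e
  proof -
    from local_event_close[OF J e] obtain N where "\<forall>B \<sigma> \<mu> \<nu>. local_event J B \<longrightarrow> \<sigma> \<in> UNIV \<rightarrow>\<^sub>E {1..q} \<longrightarrow> in_fibre \<sigma> \<mu> \<longrightarrow> in_fibre \<sigma> \<nu> \<longrightarrow>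
      (\<forall>i\<in>N. site_inv (arcs \<sigma> i) i \<mu>) \<longrightarrow> (\<forall>i\<in>N. site_inv (arcs \<sigma> i) i \<nu>) \<longrightarrow> \<bar>measure \<mu> B - measure \<nu> B\<bar> \<le> e" by (elim exE conjE)
    from this[rule_format, OF lB \<sigma> local_gibbs_in_fibre[OF \<sigma> \<mu>] local_gibbs_in_fibre[OF \<sigma> \<nu>]]
    show ?thesis using local_gibbs_site_inv[OF \<mu>] local_gibbs_site_inv[OF \<nu>] by simp
  qed
  then have "\<bar>measure \<mu> B - measure \<nu> B\<bar> \<le> 0" by (rule field_le_epsilon)
  then show "emeasure \<mu> B = emeasure \<nu> B"
    by (simp add: \<mu>.emeasure_eq_measure \<nu>.emeasure_eq_measure)
qed (use local_gibbsD(2) \<mu> \<nu> in auto)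

lemma fin_vol_cauchy:
  assumes J: "finite J" and e: "0 < e"
  shows "\<exists>n0. \<forall>m\<ge>n0. \<forall>n\<ge>n0. \<forall>B \<sigma>. local_event J B \<longrightarrow> \<sigma> \<in> UNIV \<rightarrow>\<^sub>E {1..q} \<longrightarrow>
    \<bar>measure (fin_vol m \<sigma>) B - measure (fin_vol n \<sigma>) B\<bar> \<le> e"
proof -
  from local_event_close[OF J e] obtain N where N: "finite N" and close: "\<forall>B \<sigma> \<mu> \<nu>. local_event J B \<longrightarrow> \<sigma> \<in> UNIV \<rightarrow>\<^sub>E {1..q} \<longrightarrow> in_fibre \<sigma> \<mu> \<longrightarrow> in_fibre \<sigma> \<nu> \<longrightarrow>
      (\<forall>i\<in>N. site_inv (arcs \<sigma> i) i \<mu>) \<longrightarrow> (\<forall>i\<in>N. site_inv (arcs \<sigma> i) i \<nu>) \<longrightarrow> \<bar>measure \<mu> B - measure \<nu> B\<bar> \<le> e" by (elim exE conjE)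
  from vol_covers[OF N] obtain n0 where n0: "\<forall>n\<ge>n0. N \<subseteq> vol n" ..
  show ?thesis
  proof (intro exI[of _ n0] allI impI)
    fix m n B and \<sigma> :: "'d dconfig" assume "n0 \<le> m" "n0 \<le> n" and B: "local_event J B" and \<sigma>: "\<sigma> \<in> UNIV \<rightarrow>\<^sub>E {1..q}"
    then have "N \<subseteq> vol m" "N \<subseteq> vol n" using n0 by auto
    then show "\<bar>measure (fin_vol m \<sigma>) B - measure (fin_vol n \<sigma>) B\<bar> \<le> e"
      using close[rule_format, OF B \<sigma> fin_vol_in_fibre[OF \<sigma>] fin_vol_in_fibre[OF \<sigma>], of m n] fin_vol_site_inv[OF \<sigma>] by blast
  qed
qed

end

text \<open>Kolmogorov's extension theorem is applied to real spins, which form a Polish space; clamping maps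
  the resulting configurations back to the circle.\<close>

definition clamp :: "real \<Rightarrow> real" where "clamp x = (if x \<in> S1 then x else 0)"

lemma clamp_S1[simp]: "clamp x \<in> S1" "x \<in> S1 \<Longrightarrow> clamp x = x"
  by (auto simp: clamp_def)

lemma clamp_measurable[measurable]: "clamp \<in> borel \<rightarrow>\<^sub>M circle_measure"
proof -
  have "clamp \<in> borel \<rightarrow>\<^sub>M restrict_space borel S1"
    unfolding clamp_def by (rule measurable_restrict_space2) (auto simp: zero_S1)
  moreover have "sets (restrict_space borel S1) = sets circle_measure"
    by (auto simp: circle_measure_def sets_restrict_space)
  ultimately show ?thesis by (simp cong: measurable_cong_sets)
qed

lemma circle_borel[measurable]: "(\<lambda>x. x) \<in> circle_measure \<rightarrow>\<^sub>M borel"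
  unfolding circle_measure_def by (rule measurable_restrict_space1) simp

context dobrushin_model
begin

definition clamp_cfg :: "'d site set \<Rightarrow> 'd config \<Rightarrow> 'd config"
  where "clamp_cfg J \<xi> = (\<lambda>i. if i \<in> J then clamp (\<xi> i) else 0)"

lemma clamp_cfg_Omega[simp]: "clamp_cfg J \<xi> \<in> Omega"
  by (simp add: clamp_cfg_def PiE_UNIV_iff)

lemma clamp_cfg_measurable: "clamp_cfg J \<in> PiM J (\<lambda>_. borel) \<rightarrow>\<^sub>M cfg_space UNIV"
  unfolding cfg_space_def
proof (rule measurable_PiM_single')
  fix i :: "'d site"
  show "(\<lambda>\<xi>. clamp_cfg J \<xi> i) \<in> PiM J (\<lambda>_. borel) \<rightarrow>\<^sub>M circle_measure"
  proof (cases "i \<in> J")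
    case True
    then have "(\<lambda>\<xi>. \<xi> i) \<in> PiM J (\<lambda>_. borel) \<rightarrow>\<^sub>M borel" by simp
    then have "(\<lambda>\<xi>. clamp (\<xi> i)) \<in> PiM J (\<lambda>_. borel) \<rightarrow>\<^sub>M circle_measure"
      by (rule measurable_compose) (rule clamp_measurable)
    then show ?thesis using True by (simp add: clamp_cfg_def)
  qed (simp add: clamp_cfg_def)
qed (auto simp: PiE_UNIV_iff clamp_cfg_def)

lemma restrict_borel_measurable: "(\<lambda>\<omega>. restrict \<omega> (J :: 'd site set)) \<in> cfg_space UNIV \<rightarrow>\<^sub>M PiM J (\<lambda>_. borel)"
proof (rule measurable_restrict[where X="\<lambda>i \<omega>. \<omega> i"])
  fix i :: "'d site"
  have "(\<lambda>\<omega>. \<omega> i) \<in> cfg_space UNIV \<rightarrow>\<^sub>M circle_measure" by (simp add: cfg_space_def)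
  then show "(\<lambda>\<omega>. \<omega> i) \<in> cfg_space UNIV \<rightarrow>\<^sub>M borel" by (rule measurable_compose) (rule circle_borel)
qed

lemma local_event_restrict:
  assumes "X \<in> sets (PiM J (\<lambda>_. borel))"
  shows "local_event J ((\<lambda>\<omega>. restrict \<omega> J) -` X \<inter> Omega)"
  unfolding local_event_def
proof (intro conjI ballI impI)
  show "(\<lambda>\<omega>. restrict \<omega> J) -` X \<inter> Omega \<in> sets (cfg_space UNIV)"
    using measurable_sets[OF restrict_borel_measurable assms] by (simp add: space_cfg)
  fix \<omega> \<eta> :: "'d config" assume "\<omega> \<in> Omega" "\<eta> \<in> Omega" "\<forall>j\<in>J. \<omega> j = \<eta> j"
  moreover from this have "restrict \<omega> J = restrict \<eta> J" by (auto simp: restrict_def)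
  ultimately show "\<omega> \<in> (\<lambda>\<omega>. restrict \<omega> J) -` X \<inter> Omega \<longleftrightarrow> \<eta> \<in> (\<lambda>\<omega>. restrict \<omega> J) -` X \<inter> Omega" by simp
qed

lemma fin_vol_marginal_limit:
  assumes \<sigma>: "\<sigma> \<in> UNIV \<rightarrow>\<^sub>E {1..q}" and J: "finite J"
  shows "\<exists>L. prob_space L \<and> sets L = sets (PiM J (\<lambda>_. borel)) \<and>
    (\<forall>X\<in>sets (PiM J (\<lambda>_. borel)). (\<lambda>n. measure (fin_vol n \<sigma>) ((\<lambda>\<omega>. restrict \<omega> J) -` X \<inter> Omega)) \<longlonglongrightarrow> measure L X)"
proof -
  define M where "M n = distr (fin_vol n \<sigma>) (PiM J (\<lambda>_. borel)) (\<lambda>\<omega>. restrict \<omega> J)" for n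
  have p: "prob_space (fin_vol n \<sigma>)" for n using fin_vol_in_fibre[OF \<sigma>] by (simp add: in_fibre_def)
  have m: "(\<lambda>\<omega>. restrict \<omega> J) \<in> fin_vol n \<sigma> \<rightarrow>\<^sub>M PiM J (\<lambda>_. borel)" for n
    using restrict_borel_measurable by (simp cong: measurable_cong_sets)
  have sp: "space (fin_vol n \<sigma>) = Omega" for n by (simp add: fin_vol_def)
  have eq: "measure (M n) X = measure (fin_vol n \<sigma>) ((\<lambda>\<omega>. restrict \<omega> J) -` X \<inter> Omega)" if "X \<in> sets (PiM J (\<lambda>_. borel))" for n X
    unfolding M_def by (subst measure_distr[OF m that]) (simp add: sp)
  have "\<exists>L. prob_space L \<and> sets L = sets (PiM J (\<lambda>_. borel)) \<and> (\<forall>X\<in>sets (PiM J (\<lambda>_. borel)). (\<lambda>n. measure (M n) X) \<longlonglongrightarrow> measure L X)"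
  proof (rule tv_cauchy_limit)
    show "prob_space (M n)" for n unfolding M_def by (rule prob_space.prob_space_distr[OF p m])
    show "sets (M n) = sets (PiM J (\<lambda>_. borel))" for n by (simp add: M_def)
    fix e :: real assume "0 < e"
    from fin_vol_cauchy[OF J this] obtain n0 where n0: "\<forall>m\<ge>n0. \<forall>n\<ge>n0. \<forall>B \<sigma>. local_event J B \<longrightarrow> \<sigma> \<in> UNIV \<rightarrow>\<^sub>E {1..q} \<longrightarrow>
      \<bar>measure (fin_vol m \<sigma>) B - measure (fin_vol n \<sigma>) B\<bar> \<le> e" ..
    show "\<exists>n0. \<forall>m\<ge>n0. \<forall>n\<ge>n0. \<forall>X\<in>sets (PiM J (\<lambda>_. borel)). \<bar>measure (M m) X - measure (M n) X\<bar> \<le> e"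
    proof (intro exI[of _ n0] allI impI ballI)
      fix m n X assume mn: "n0 \<le> m" "n0 \<le> n" and X: "X \<in> sets (PiM J (\<lambda>_. borel :: real measure))"
      show "\<bar>measure (M m) X - measure (M n) X\<bar> \<le> e"
        unfolding eq[OF X] by (rule n0[rule_format, OF mn local_event_restrict[OF X] \<sigma>])
    qed
  qed
  then show ?thesis by (simp add: eq cong: ball_cong)
qed

text \<open>The limits of the marginals inherit the consistency of the marginals and extend to all sites by
  Kolmogorov's theorem.\<close>

lemma fin_vol_limit:
  assumes \<sigma>: "\<sigma> \<in> UNIV \<rightarrow>\<^sub>E {1..q}"
  shows "\<exists>L. prob_space L \<and> sets L = sets (cfg_space UNIV) \<and>
    (\<forall>J B. finite J \<longrightarrow> local_event J B \<longrightarrow> (\<lambda>n. measure (fin_vol n \<sigma>) B) \<longlonglongrightarrow> measure L B)"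
proof -
  define good where "good J L \<longleftrightarrow> prob_space L \<and> sets L = sets (PiM J (\<lambda>_. borel)) \<and>
    (\<forall>X\<in>sets (PiM J (\<lambda>_. borel)). (\<lambda>n. measure (fin_vol n \<sigma>) ((\<lambda>\<omega>. restrict \<omega> J) -` X \<inter> Omega)) \<longlonglongrightarrow> measure L X)"
    for J :: "'d site set" and L :: "'d config measure"
  define P where "P J = (SOME L. good J L)" for J
  have P: "good J (P J)" if "finite J" for J
    using fin_vol_marginal_limit[OF \<sigma> that] someI_ex[of "good J"] by (simp add: P_def good_def)
  have Pp: "prob_space (P J)" and Ps: "sets (P J) = sets (PiM J (\<lambda>_. borel))"
    and Pl: "\<And>X. X \<in> sets (PiM J (\<lambda>_. borel)) \<Longrightarrow> (\<lambda>n. measure (fin_vol n \<sigma>) ((\<lambda>\<omega>. restrict \<omega> J) -` X \<inter> Omega)) \<longlonglongrightarrow> measure (P J) X"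
    if "finite J" for J using P[OF that] by (simp_all add: good_def)
  have proj: "P J = distr (P H) (PiM J (\<lambda>_. borel)) (\<lambda>f. restrict f J)" if JH: "J \<subseteq> H" "finite H" for J H
  proof (rule measure_eqI)
    have J: "finite J" using JH by (rule finite_subset)
    show "sets (P J) = sets (distr (P H) (PiM J (\<lambda>_. borel)) (\<lambda>f. restrict f J))" using Ps[OF J] by simp
    have m: "(\<lambda>f. restrict f J) \<in> P H \<rightarrow>\<^sub>M PiM J (\<lambda>_. borel)"
      using measurable_restrict_subset[OF JH(1), of "\<lambda>_. borel"] Ps[OF JH(2)] by (simp cong: measurable_cong_sets)
    interpret PJ: prob_space "P J" by (rule Pp[OF J])
    interpret PH: prob_space "P H" by (rule Pp[OF JH(2)])
    interpret D: prob_space "distr (P H) (PiM J (\<lambda>_. borel)) (\<lambda>f. restrict f J)" by (rule PH.prob_space_distr[OF m])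
    fix X assume "X \<in> sets (P J)"
    then have X: "X \<in> sets (PiM J (\<lambda>_. borel))" using Ps[OF J] by simp
    let ?Y = "(\<lambda>f. restrict f J) -` X \<inter> space (P H)"
    have Y: "?Y \<in> sets (PiM H (\<lambda>_. borel))" using measurable_sets[OF m X] Ps[OF JH(2)] by simp
    have spH: "space (P H) = H \<rightarrow>\<^sub>E UNIV" using sets_eq_imp_space_eq[OF Ps[OF JH(2)]] by (simp add: space_PiM)
    have "(\<lambda>\<omega>. restrict \<omega> H) -` ?Y \<inter> Omega = (\<lambda>\<omega>. restrict \<omega> J) -` X \<inter> Omega"
      using JH(1) by (auto simp: spH Int_absorb1)
    then have "(\<lambda>n. measure (fin_vol n \<sigma>) ((\<lambda>\<omega>. restrict \<omega> J) -` X \<inter> Omega)) \<longlonglongrightarrow> measure (P H) ?Y"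
      using Pl[OF JH(2) Y] by simp
    with Pl[OF J X] have "measure (P J) X = measure (P H) ?Y" by (rule LIMSEQ_unique)
    also have "\<dots> = measure (distr (P H) (PiM J (\<lambda>_. borel)) (\<lambda>f. restrict f J)) X"
      by (rule measure_distr[OF m X, symmetric])
    finally show "emeasure (P J) X = emeasure (distr (P H) (PiM J (\<lambda>_. borel)) (\<lambda>f. restrict f J)) X"
      by (simp add: PJ.emeasure_eq_measure D.emeasure_eq_measure)
  qed
  interpret PP: polish_projective UNIV P
    by (intro polish_projective.intro projective_family.intro) (erule (1) proj, erule Pp)
  define L where "L = distr PP.lim (cfg_space UNIV) (clamp_cfg UNIV)"
  have sl: "sets PP.lim = sets (PiM UNIV (\<lambda>_. borel))" by (rule PP.sets_lim)
  have m: "clamp_cfg UNIV \<in> PP.lim \<rightarrow>\<^sub>M cfg_space UNIV"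
    using clamp_cfg_measurable[of UNIV] sl by (simp cong: measurable_cong_sets)
  have spl: "space PP.lim = UNIV" using sets_eq_imp_space_eq[OF sl] by (simp add: space_PiM)
  have "(\<lambda>n. measure (fin_vol n \<sigma>) B) \<longlonglongrightarrow> measure L B" if J: "finite J" and B: "local_event J B" for J B
  proof -
    have Bs: "B \<in> sets (cfg_space UNIV)" and loc: "\<forall>\<omega>\<in>Omega. \<forall>\<eta>\<in>Omega. (\<forall>j\<in>J. \<omega> j = \<eta> j) \<longrightarrow> (\<omega> \<in> B \<longleftrightarrow> \<eta> \<in> B)"
      using B unfolding local_event_def by blast+
    have BO: "B \<subseteq> Omega" using sets.sets_into_space[OF Bs] by (simp add: space_cfg)
    define X where "X = clamp_cfg J -` B \<inter> space (PiM J (\<lambda>_. borel))"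
    have X: "X \<in> sets (PiM J (\<lambda>_. borel))" unfolding X_def by (rule measurable_sets[OF clamp_cfg_measurable Bs])
    have iff: "clamp_cfg J (restrict \<omega> J) \<in> B \<longleftrightarrow> clamp_cfg UNIV \<omega> \<in> B" for \<omega>
      by (rule loc[rule_format]) (auto simp: clamp_cfg_def PiE_UNIV_iff)
    have clampO: "clamp_cfg UNIV \<omega> = \<omega>" if "\<omega> \<in> Omega" for \<omega>
      using that by (auto simp: clamp_cfg_def PiE_UNIV_iff)
    have rs: "restrict \<omega> J \<in> space (PiM J (\<lambda>_. borel))" for \<omega> :: "'d config" by (simp add: space_PiM)
    have 1: "(\<lambda>\<omega>. restrict \<omega> J) -` X \<inter> Omega = B"
      using BO rs by (auto simp: X_def iff clampO)
    have "clamp_cfg UNIV -` B \<inter> space PP.lim = prod_emb UNIV (\<lambda>_. borel) J X"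
      using rs by (auto simp: prod_emb_def X_def iff spl space_PiM)
    then have "measure L B = measure PP.lim (prod_emb UNIV (\<lambda>_. borel) J X)"
      unfolding L_def by (subst measure_distr[OF m Bs]) simp
    also have "\<dots> = measure (P J) X" by (rule PP.measure_lim_emb[OF subset_UNIV J X])
    finally show ?thesis using Pl[OF J X] by (simp add: 1)
  qed
  moreover have "prob_space L" unfolding L_def by (rule PP.P.prob_space_distr[OF m])
  ultimately show ?thesis by (intro exI[of _ L]) (simp add: L_def)
qed

text \<open>In large volumes a local event \<open>A\<close> has the mean of \<open>site_avg i\<close>, applied to its indicator, as its
  probability. This function is not local, but has a summable modulus, so that its mean converges
  as well and the identity passes to the limit.\<close>

lemma fin_vol_limit_local_gibbs:
  assumes \<sigma>: "\<sigma> \<in> UNIV \<rightarrow>\<^sub>E {1..q}" and L: "prob_space L" "sets L = sets (cfg_space UNIV)"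
    and lim: "\<And>J B. finite J \<Longrightarrow> local_event J B \<Longrightarrow> (\<lambda>n. measure (fin_vol n \<sigma>) B) \<longlonglongrightarrow> measure L B"
  shows "local_gibbs UNIV (arcs \<sigma>) L"
proof -
  interpret L: prob_space L by (rule L(1))
  have spL: "space L = Omega" using sets_eq_imp_space_eq[OF L(2)] by (simp add: space_cfg)
  note [measurable_cong] = L(2)
  have fv: "prob_space (fin_vol n \<sigma>)" "AE \<omega> in fin_vol n \<sigma>. \<omega> \<in> Pi\<^sub>E UNIV (arcs \<sigma>)" for n
    using fin_vol_in_fibre[OF \<sigma>] by (simp_all add: in_fibre_def)
  have S: "admissible (arcs \<sigma> i)" for i by (rule arcs_admissible[OF \<sigma>])
  have AE_L: "AE \<omega> in L. \<omega> \<in> Pi\<^sub>E UNIV (arcs \<sigma>)"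
  proof -
    have "AE \<omega> in L. \<omega> i \<in> arcs \<sigma> i" for i
    proof -
      define B where "B = {\<omega> \<in> Omega. \<omega> i \<in> arcs \<sigma> i}"
      have [measurable]: "arcs \<sigma> i \<in> sets circle_measure" using S[of i] by (simp add: admissible_def)
      have [measurable]: "(\<lambda>\<omega>. \<omega> i) \<in> cfg_space UNIV \<rightarrow>\<^sub>M circle_measure" by (simp add: cfg_space_def)
      have "{\<omega> \<in> space (cfg_space UNIV). \<omega> i \<in> arcs \<sigma> i} \<in> sets (cfg_space UNIV)" by measurable
      then have B: "B \<in> sets (cfg_space UNIV)" by (simp add: B_def space_cfg)
      then have "local_event {i} B" unfolding local_event_def by (simp add: B_def)
      from lim[OF _ this] have "(\<lambda>n. measure (fin_vol n \<sigma>) B) \<longlonglongrightarrow> measure L B" by simp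
      moreover have "measure (fin_vol n \<sigma>) B = 1" for n
      proof -
        interpret F: prob_space "fin_vol n \<sigma>" by (rule fv)
        have "AE \<omega> in fin_vol n \<sigma>. \<omega> \<in> B"
          using fv(2) AE_space by eventually_elim (auto simp: B_def PiE_UNIV_iff fin_vol_def)
        then show ?thesis using B by (intro F.prob_eq_1[THEN iffD2]) auto
      qed
      ultimately have "(\<lambda>n. 1) \<longlonglongrightarrow> measure L B" by simp
      then have "measure L B = 1" by (rule LIMSEQ_unique[OF _ tendsto_const])
      then have "AE \<omega> in L. \<omega> \<in> B" using B L(2) by (intro L.prob_eq_1[THEN iffD1]) auto
      then show ?thesis by eventually_elim (simp add: B_def)
    qed
    then have "AE \<omega> in L. \<forall>i. \<omega> i \<in> arcs \<sigma> i" by (simp add: AE_all_countable)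
    then show ?thesis by eventually_elim (simp add: PiE_UNIV_iff)
  qed
  obtain \<omega>0 where \<omega>0: "\<omega>0 \<in> Pi\<^sub>E UNIV (arcs \<sigma>)" using arcs_PiE_nonempty[OF \<sigma>] .
  have arcsO: "\<omega> \<in> Omega" if "\<omega> \<in> Pi\<^sub>E UNIV (arcs \<sigma>)" for \<omega>
    using that by (auto simp: PiE_UNIV_iff arcs_def spin_arc_def)
  \<comment> \<open>Fixing the spins off a large finite set \<open>F\<close> to those of \<open>\<omega>0\<close> changes \<open>g\<close> little on the fibre and
    makes its superlevel sets local events.\<close>
  have lip_lim: "(\<lambda>n. integral\<^sup>L (fin_vol n \<sigma>) g) \<longlonglongrightarrow> integral\<^sup>L L g"
    if g: "unit_valued g" and lg: "lip d g" and d: "modulus d" for g d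
  proof (rule LIMSEQ_I)
    fix e :: real assume e: "0 < e"
    obtain F where F: "finite F" "infsum d (- F) < e / 3"
    proof -
      from infsum_finite_approximation[OF modulus_summable[OF d], of "e / 4" UNIV] e
      obtain F where F: "finite F" "dist (sum d F) (infsum d UNIV) \<le> e / 4" by auto
      have "infsum d UNIV = infsum d (F \<union> - F)" by simp
      also have "\<dots> = sum d F + infsum d (- F)"
        using F(1) by (subst infsum_Un_disjoint) (auto intro: modulus_summable[OF d])
      finally have "infsum d (- F) \<le> e / 4" using F(2) by (simp add: dist_real_def)
      then show ?thesis using that F(1) e by force
    qed
    define gF where "gF \<omega> = g (merge F (- F) (\<omega>, \<omega>0))" for \<omega>
    have mO: "merge F (- F) (\<omega>, \<omega>0) \<in> Omega" if "\<omega> \<in> Omega" for \<omega>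
      using that arcsO[OF \<omega>0] by (auto simp: merge_def PiE_UNIV_iff)
    have mm: "(\<lambda>\<omega>. merge F (- F) (\<omega>, \<omega>0)) \<in> cfg_space UNIV \<rightarrow>\<^sub>M cfg_space UNIV"
      unfolding cfg_space_def
    proof (rule measurable_PiM_single')
      fix i :: "'d site"
      show "(\<lambda>\<omega>. merge F (- F) (\<omega>, \<omega>0) i) \<in> PiM UNIV (\<lambda>_. circle_measure) \<rightarrow>\<^sub>M circle_measure"
        using arcsO[OF \<omega>0] by (cases "i \<in> F") (auto simp: merge_def PiE_UNIV_iff)
    qed (use mO in \<open>auto simp: space_PiM\<close>)
    have gF: "unit_valued gF"
      unfolding unit_valued_def gF_def
      using unit_valuedD[OF g] mO measurable_compose[OF mm unit_valuedD(1)[OF g]] by auto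
    have close: "\<bar>g \<omega> - gF \<omega>\<bar> \<le> e / 3" if \<omega>: "\<omega> \<in> Pi\<^sub>E UNIV (arcs \<sigma>)" for \<omega>
    proof -
      have mf: "merge F (- F) (\<omega>, \<omega>0) \<in> Pi\<^sub>E UNIV (arcs \<sigma>)" using \<omega> \<omega>0 by (auto simp: merge_def PiE_UNIV_iff)
      have "\<bar>g \<omega> - gF \<omega>\<bar> \<le> infsum d {j. \<omega> j \<noteq> merge F (- F) (\<omega>, \<omega>0) j}"
        using lg fibre_eq_arcs[OF \<omega> mf] unfolding lip_def gF_def by blast
      also have "\<dots> \<le> infsum d (- F)"
        using d by (intro infsum_mono_neutral modulus_summable[OF d]) (auto simp: modulus_def)
      finally show ?thesis using F(2) by simp
    qed
    have int_close: "\<bar>integral\<^sup>L \<mu> g - integral\<^sup>L \<mu> gF\<bar> \<le> e / 3"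
      if "prob_space \<mu>" "sets \<mu> = sets (cfg_space UNIV)" "AE \<omega> in \<mu>. \<omega> \<in> Pi\<^sub>E UNIV (arcs \<sigma>)" for \<mu>
    proof -
      note i = unit_valued_integrable[OF g that(1,2)] unit_valued_integrable[OF gF that(1,2)]
      have "AE \<omega> in \<mu>. \<bar>g \<omega> - gF \<omega> - 0\<bar> \<le> e / 3"
        using that(3) by eventually_elim (simp only: diff_0_right close)
      from prob_space.integral_close[OF that(1) _ this] i show ?thesis by simp
    qed
    have "(\<lambda>n. integral\<^sup>L (fin_vol n \<sigma>) gF) \<longlonglongrightarrow> integral\<^sup>L L gF"
    proof (rule measure_tendsto_imp_integral_tendsto[where N="cfg_space UNIV"])
      show "gF \<in> borel_measurable (cfg_space UNIV)" by (rule unit_valuedD(1)[OF gF])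
      fix c :: real
      have [measurable]: "gF \<in> borel_measurable (cfg_space UNIV)" by (rule unit_valuedD(1)[OF gF])
      let ?B = "{\<omega> \<in> space (cfg_space UNIV). c \<le> gF \<omega>}"
      have "local_event F ?B"
        unfolding local_event_def
      proof (intro conjI ballI impI)
        show "?B \<in> sets (cfg_space UNIV)" by measurable
        fix \<omega> \<eta> :: "'d config" assume "\<omega> \<in> Omega" "\<eta> \<in> Omega" "\<forall>j\<in>F. \<omega> j = \<eta> j"
        moreover from this have "merge F (- F) (\<omega>, \<omega>0) = merge F (- F) (\<eta>, \<omega>0)" by (auto simp: merge_def)
        ultimately show "\<omega> \<in> ?B \<longleftrightarrow> \<eta> \<in> ?B" by (simp add: space_cfg gF_def)
      qed
      then show "(\<lambda>n. measure (fin_vol n \<sigma>) ?B) \<longlonglongrightarrow> measure L ?B" by (rule lim[OF F(1)])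
    qed (use fv L unit_valuedD(2,3)[OF gF] in \<open>auto simp: space_cfg\<close>)
    from LIMSEQ_D[OF this, of "e / 3"] e obtain n0 where n0: "\<And>n. n \<ge> n0 \<Longrightarrow> \<bar>integral\<^sup>L (fin_vol n \<sigma>) gF - integral\<^sup>L L gF\<bar> < e / 3" by auto
    have "norm (integral\<^sup>L (fin_vol n \<sigma>) g - integral\<^sup>L L g) < e" if "n \<ge> n0" for n
      using n0[OF that] int_close[OF fv(1) sets_fin_vol fv(2), of n] int_close[OF L AE_L] unfolding real_norm_def by linarith
    then show "\<exists>n0. \<forall>n\<ge>n0. norm (integral\<^sup>L (fin_vol n \<sigma>) g - integral\<^sup>L L g) < e" by blast
  qed
  show ?thesis
  proof (rule local_gibbsI[OF L S])
    fix i :: "'d site" and B :: "'d config set" assume "B \<in> sets (cfg_space UNIV)"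
    have \<Lambda>: "finite {i}" "{i} \<subseteq> UNIV" by auto
    define K where "K = L \<bind> avg_kernel UNIV (arcs \<sigma>) {i}"
    note [measurable] = gibbs_avg_measurable[OF \<Lambda> S]
    have Km: "avg_kernel UNIV (arcs \<sigma>) {i} \<in> L \<rightarrow>\<^sub>M subprob_algebra (cfg_space UNIV)"
      by (rule avg_kernel_measurable[OF \<Lambda> S L(2)])
    have eK: "emeasure K A = (\<integral>\<^sup>+\<eta>. gibbs_avg UNIV (arcs \<sigma>) {i} (indicator A) \<eta> \<partial>L)" if "A \<in> sets (cfg_space UNIV)" for A
    proof -
      have "emeasure K A = (\<integral>\<^sup>+\<eta>. emeasure (avg_kernel UNIV (arcs \<sigma>) {i} \<eta>) A \<partial>L)"
        unfolding K_def by (rule emeasure_bind[OF L.not_empty Km that])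
      also have "\<dots> = (\<integral>\<^sup>+\<eta>. gibbs_avg UNIV (arcs \<sigma>) {i} (indicator A) \<eta> \<partial>L)"
        using that by (intro nn_integral_cong) (simp add: nn_integral_avg_kernel[OF \<Lambda>, symmetric] spL)
      finally show ?thesis .
    qed
    have "L = K"
    proof (rule cfg_measure_eqI)
      show "finite_measure L" by (rule L.finite_measure_axioms)
      show "sets K = sets (cfg_space UNIV)"
        unfolding K_def using L.not_empty by (subst sets_bind[where N="cfg_space UNIV"]) auto
      fix J and A :: "'d config set" assume J: "finite J" and A[measurable]: "A \<in> sets (cfg_space UNIV)"
        and "\<forall>\<omega>\<in>Omega. \<forall>\<eta>\<in>Omega. (\<forall>j\<in>J. \<omega> j = \<eta> j) \<longrightarrow> (\<omega> \<in> A \<longleftrightarrow> \<eta> \<in> A)"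
      then have lA: "local_event J A" unfolding local_event_def by (intro conjI)
      define f :: "'d config \<Rightarrow> real" where "f = indicator A"
      have f: "unit_valued f" "lip (indicator J) f" "modulus (indicator J)"
        unfolding f_def by (rule local_event_lip[OF J lA])+
      have "(\<lambda>n. integral\<^sup>L (fin_vol n \<sigma>) (site_avg i f)) \<longlonglongrightarrow> integral\<^sup>L L (site_avg i f)"
        by (rule lip_lim[OF unit_valued_site_avg[OF f(1)] lip_site_avg[OF f] modulus_dstep[OF f(3)]])
      moreover have "eventually (\<lambda>n. integral\<^sup>L (fin_vol n \<sigma>) (site_avg i f) = measure (fin_vol n \<sigma>) A) sequentially"
      proof -
        obtain n0 where "\<forall>n\<ge>n0. {i} \<subseteq> vol n" using vol_covers[of "{i}"] by auto
        then have "integral\<^sup>L (fin_vol n \<sigma>) (site_avg i f) = measure (fin_vol n \<sigma>) A" if "n \<ge> n0" for n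
        proof -
          have "i \<in> vol n" using \<open>\<forall>n\<ge>n0. {i} \<subseteq> vol n\<close> that by auto
          then have "integral\<^sup>L (fin_vol n \<sigma>) (site_avg i f) = integral\<^sup>L (fin_vol n \<sigma>) f"
            by (intro site_avg_invariant[OF fv(1) sets_fin_vol fin_vol_site_inv[OF \<sigma>] arcs_fibred[OF \<sigma>] f(1)])
          also have "\<dots> = measure (fin_vol n \<sigma>) A"
            using sets.sets_into_space[OF A] by (simp add: f_def fin_vol_def space_cfg Int_absorb2)
          finally show ?thesis .
        qed
        then show ?thesis by (auto simp: eventually_sequentially)
      qed
      ultimately have "(\<lambda>n. measure (fin_vol n \<sigma>) A) \<longlonglongrightarrow> integral\<^sup>L L (site_avg i f)"
        by (rule Lim_transform_eventually)
      with lim[OF J lA] have eq: "measure L A = integral\<^sup>L L (site_avg i f)" by (rule LIMSEQ_unique)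
      have "emeasure K A = (\<integral>\<^sup>+\<omega>. ennreal (site_avg i f \<omega>) \<partial>L)"
        unfolding eK[OF A]
      proof (rule nn_integral_cong_AE)
        show "AE \<omega> in L. gibbs_avg UNIV (arcs \<sigma>) {i} (indicator A) \<omega> = ennreal (site_avg i f \<omega>)"
          using AE_L
        proof eventually_elim
          case (elim \<omega>)
          have \<omega>: "\<omega> \<in> Omega" by (rule arcsO[OF elim])
          have arc: "arc_at \<omega> i = arcs \<sigma> i"
            using elim by (auto simp: arc_at_def arcs_def spin_arc_def PiE_UNIV_iff)
          note [measurable] = boltz_measurable[OF \<Lambda>(1), of UNIV]
          show ?case
            by (subst ennreal_site_avg[OF f(1) \<omega>])
               (simp add: gibbs_avg_def arc f_def ennreal_indicator resample_singleton[OF UNIV_I S _ \<omega>])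
        qed
      qed
      also have "\<dots> = ennreal (integral\<^sup>L L (site_avg i f))"
        using unit_valuedD(2)[OF unit_valued_site_avg[OF f(1)]]
        by (intro nn_integral_eq_integral unit_valued_integrable[OF unit_valued_site_avg[OF f(1)] L] AE_I2) (simp add: spL)
      finally show "emeasure L A = emeasure K A" by (simp add: eq[symmetric] L.emeasure_eq_measure)
    qed (rule L(2))
    then show "emeasure L B = (\<integral>\<^sup>+\<eta>. gibbs_avg UNIV (arcs \<sigma>) {i} (indicator B) \<eta> \<partial>L)"
      using eK[OF \<open>B \<in> sets (cfg_space UNIV)\<close>] by simp
  qed
qed

abbreviation cgibbs :: "'d dconfig \<Rightarrow> 'd config measure"
  where "cgibbs \<equiv> constrained_gibbs UNIV \<Phi> q"

lemma cgibbs_local_gibbs: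
  assumes \<sigma>: "\<sigma> \<in> UNIV \<rightarrow>\<^sub>E {1..q}"
  shows "local_gibbs UNIV (arcs \<sigma>) (cgibbs \<sigma>)"
    and "\<And>\<mu>. local_gibbs UNIV (arcs \<sigma>) \<mu> \<Longrightarrow> \<mu> = cgibbs \<sigma>"
    and "\<And>J B. finite J \<Longrightarrow> local_event J B \<Longrightarrow> (\<lambda>n. measure (fin_vol n \<sigma>) B) \<longlonglongrightarrow> measure (cgibbs \<sigma>) B"
proof -
  from fin_vol_limit[OF \<sigma>] obtain L where L: "prob_space L" "sets L = sets (cfg_space UNIV)"
    and lim: "\<forall>J B. finite J \<longrightarrow> local_event J B \<longrightarrow> (\<lambda>n. measure (fin_vol n \<sigma>) B) \<longlonglongrightarrow> measure L B" by (elim exE conjE)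
  have LG: "local_gibbs UNIV (arcs \<sigma>) L"
    by (rule fin_vol_limit_local_gibbs[OF \<sigma> L lim[rule_format]])
  have eq: "cgibbs \<sigma> = L"
    unfolding constrained_gibbs_eq[OF \<sigma>] by (rule the_equality) (rule LG, erule local_gibbs_unique[OF \<sigma> _ LG])
  show "local_gibbs UNIV (arcs \<sigma>) (cgibbs \<sigma>)" unfolding eq by (rule LG)
  show "\<And>\<mu>. local_gibbs UNIV (arcs \<sigma>) \<mu> \<Longrightarrow> \<mu> = cgibbs \<sigma>" unfolding eq by (rule local_gibbs_unique[OF \<sigma> _ LG])
  show "\<And>J B. finite J \<Longrightarrow> local_event J B \<Longrightarrow> (\<lambda>n. measure (fin_vol n \<sigma>) B) \<longlonglongrightarrow> measure (cgibbs \<sigma>) B"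
    unfolding eq by (rule lim[rule_format])
qed

text \<open>Probabilities of cylinder sets are pointwise limits of their finite-volume counterparts, which
  are measurable in \<open>\<sigma>\<close>.\<close>

lemma cgibbs_kernel: "cgibbs \<in> dcfg_space q \<rightarrow>\<^sub>M prob_algebra (cfg_space UNIV)"
proof (rule measurable_prob_algebra_generated)
  show "sets (cfg_space UNIV :: 'd config measure) = sigma_sets (UNIV \<rightarrow>\<^sub>E S1) (prod_algebra UNIV (\<lambda>_. circle_measure))"
    unfolding cfg_space_def sets_PiM by simp
  show "prod_algebra UNIV (\<lambda>_. circle_measure) \<subseteq> Pow (UNIV \<rightarrow>\<^sub>E S1 :: 'd config set)"
    using prod_algebra_sets_into_space[of UNIV "\<lambda>_. circle_measure"] by simp
  fix B :: "'d config set" assume "B \<in> prod_algebra UNIV (\<lambda>_. circle_measure)"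
  then obtain J E where B: "B = prod_emb UNIV (\<lambda>_. circle_measure) J (Pi\<^sub>E J E)" "finite J" "\<And>i. i \<in> J \<Longrightarrow> E i \<in> sets circle_measure"
    by (elim prod_algebraE) auto
  have lB: "local_event J B"
    unfolding local_event_def
  proof
    show "B \<in> sets (cfg_space UNIV)"
      unfolding cfg_space_def B(1) using B(2,3) by (intro sets_PiM_I) auto
    have "\<omega> \<in> B \<longleftrightarrow> (\<forall>j\<in>J. \<omega> j \<in> E j)" if "\<omega> \<in> Omega" for \<omega>
      using that by (auto simp: B(1) prod_emb_def PiE_iff)
    then show "\<forall>\<omega>\<in>Omega. \<forall>\<eta>\<in>Omega. (\<forall>j\<in>J. \<omega> j = \<eta> j) \<longrightarrow> (\<omega> \<in> B \<longleftrightarrow> \<eta> \<in> B)" by simp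
  qed
  then have Bs: "B \<in> sets (cfg_space UNIV)" unfolding local_event_def by (rule conjunct1)
  have "(\<lambda>\<sigma>. measure (cgibbs \<sigma>) B) \<in> borel_measurable (dcfg_space q)"
  proof (rule borel_measurable_LIMSEQ_real)
    show "(\<lambda>\<sigma>. measure (fin_vol n \<sigma>) B) \<in> borel_measurable (dcfg_space q)" for n
      unfolding measure_def using fin_vol_measurable[OF Bs] by measurable
    show "(\<lambda>n. measure (fin_vol n \<sigma>) B) \<longlonglongrightarrow> measure (cgibbs \<sigma>) B" if "\<sigma> \<in> space (dcfg_space q)" for \<sigma>
      using that by (intro cgibbs_local_gibbs(3)[OF _ B(2) lB]) (simp add: space_dcfg)
  qed
  then have "(\<lambda>\<sigma>. ennreal (measure (cgibbs \<sigma>) B)) \<in> borel_measurable (dcfg_space q)" by measurable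
  moreover have "emeasure (cgibbs \<sigma>) B = ennreal (measure (cgibbs \<sigma>) B)" if "\<sigma> \<in> space (dcfg_space q)" for \<sigma>
  proof -
    interpret prob_space "cgibbs \<sigma>" using that by (intro local_gibbsD(1)[OF cgibbs_local_gibbs(1)]) (simp add: space_dcfg)
    show ?thesis by (rule emeasure_eq_measure)
  qed
  ultimately show "(\<lambda>\<sigma>. emeasure (cgibbs \<sigma>) B) \<in> borel_measurable (dcfg_space q)"
    by (simp cong: measurable_cong)
next
  fix \<sigma> :: "'d dconfig" assume "\<sigma> \<in> space (dcfg_space q)"
  then have \<sigma>: "\<sigma> \<in> UNIV \<rightarrow>\<^sub>E {1..q}" by (simp add: space_dcfg)
  show "prob_space (cgibbs \<sigma>)" "sets (cgibbs \<sigma>) = sets (cfg_space UNIV)"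
    by (rule local_gibbsD[OF cgibbs_local_gibbs(1)[OF \<sigma>]])+
qed (rule Int_stable_prod_algebra)

text \<open>By \<open>local_event_approx\<close> the probability of a local event is the mean of a function that is almost
  constant on fibres. On each fibre this function is close to the constrained probability of the
  event, since it also has the right mean under the constrained measure.\<close>

lemma gibbs_disintegration:
  assumes \<mu>: "local_gibbs UNIV (\<lambda>_. S1) \<mu>" and B: "B \<in> sets (cfg_space UNIV)"
  shows "emeasure \<mu> B = (\<integral>\<^sup>+\<omega>. emeasure (cgibbs (discr_cfg q \<omega>)) B \<partial>\<mu>)"
proof -
  interpret \<mu>: prob_space \<mu> by (rule local_gibbsD(1)[OF \<mu>])
  note s\<mu> = local_gibbsD(2)[OF \<mu>] and sp = local_gibbsD(3)[OF \<mu>]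
  have TD: "discr_cfg q \<omega> \<in> UNIV \<rightarrow>\<^sub>E {1..q}" if "\<omega> \<in> Omega" for \<omega> :: "'d config"
    unfolding PiE_UNIV_iff discr_cfg_def using that by (intro allI discr_in[OF q]) (simp add: PiE_UNIV_iff)
  have Tm: "discr_cfg q \<in> \<mu> \<rightarrow>\<^sub>M dcfg_space q"
    unfolding measurable_cong_sets[OF s\<mu> refl] by (rule discr_cfg_measurable[OF q])
  have Km: "(\<lambda>\<omega>. cgibbs (discr_cfg q \<omega>)) \<in> \<mu> \<rightarrow>\<^sub>M subprob_algebra (cfg_space UNIV)"
    by (rule measurable_compose[OF Tm measurable_prob_algebraD[OF cgibbs_kernel]])
  define K where "K = \<mu> \<bind> (\<lambda>\<omega>. cgibbs (discr_cfg q \<omega>))"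
  have eK: "emeasure K A = (\<integral>\<^sup>+\<omega>. emeasure (cgibbs (discr_cfg q \<omega>)) A \<partial>\<mu>)" if "A \<in> sets (cfg_space UNIV)" for A
    unfolding K_def by (rule emeasure_bind[OF \<mu>.not_empty Km that])
  have "\<mu> = K"
  proof (rule cfg_measure_eqI)
    show "finite_measure \<mu>" by (rule \<mu>.finite_measure_axioms)
    show "sets K = sets (cfg_space UNIV)"
      unfolding K_def using \<mu>.not_empty Km by (intro sets_bind[where N="cfg_space UNIV"]) (auto dest: sets_kernel)
    fix J and A :: "'d config set" assume J: "finite J" and A[measurable]: "A \<in> sets (cfg_space UNIV)"
      and "\<forall>\<omega>\<in>Omega. \<forall>\<eta>\<in>Omega. (\<forall>j\<in>J. \<omega> j = \<eta> j) \<longrightarrow> (\<omega> \<in> A \<longleftrightarrow> \<eta> \<in> A)"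
    then have lA: "local_event J A" unfolding local_event_def by (intro conjI)
    define h where "h \<omega> = measure (cgibbs (discr_cfg q \<omega>)) A" for \<omega> :: "'d config"
    have prob: "prob_space (cgibbs (discr_cfg q \<omega>))" if "\<omega> \<in> Omega" for \<omega>
      by (rule local_gibbsD(1)[OF cgibbs_local_gibbs(1)[OF TD[OF that]]])
    have hm: "h \<in> borel_measurable \<mu>"
    proof -
      have "(\<lambda>\<omega>. emeasure (cgibbs (discr_cfg q \<omega>)) A) \<in> borel_measurable \<mu>"
        by (rule measurable_compose[OF Km measurable_emeasure_subprob_algebra[OF A]])
      then show ?thesis unfolding h_def measure_def by measurable
    qed
    have h01: "0 \<le> h \<omega>" "h \<omega> \<le> 1" if "\<omega> \<in> Omega" for \<omega>
      using prob_space.prob_le_1[OF prob[OF that]] by (simp_all add: h_def)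
    have hi: "integrable \<mu> h"
      by (rule \<mu>.integrable_const_bound[where B=1]) (use h01 hm sp in \<open>auto intro!: AE_I2\<close>)
    have "emeasure K A = (\<integral>\<^sup>+\<omega>. ennreal (h \<omega>) \<partial>\<mu>)"
      unfolding eK[OF A] h_def
      by (intro nn_integral_cong finite_measure.emeasure_eq_measure prob_space.finite_measure prob) (simp add: sp)
    also have "\<dots> = ennreal (integral\<^sup>L \<mu> h)"
      by (rule nn_integral_eq_integral[OF hi]) (use h01 sp in \<open>auto intro!: AE_I2\<close>)
    finally have K: "emeasure K A = ennreal (integral\<^sup>L \<mu> h)" .
    have "\<bar>measure \<mu> A - integral\<^sup>L \<mu> h\<bar> \<le> 0 + e" if e: "0 < e" for e
    proof -
      from local_event_approx[OF J e] obtain N where approx: "\<forall>B. local_event J B \<longrightarrow> (\<exists>g. unit_valued g \<and> (\<forall>\<omega> \<eta>. fibre_eq \<omega> \<eta> \<longrightarrow> \<bar>g \<omega> - g \<eta>\<bar> \<le> e) \<and>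
        (\<forall>\<mu> A. prob_space \<mu> \<longrightarrow> sets \<mu> = sets (cfg_space UNIV) \<longrightarrow> (\<forall>i\<in>N. fibred q (A i) \<and> site_inv (A i) i \<mu>) \<longrightarrow>
          measure \<mu> B = (\<integral>\<omega>. g \<omega> \<partial>\<mu>)))" by (elim exE conjE)
      from approx[rule_format, OF lA] obtain g where g: "unit_valued g"
        and osc: "\<forall>\<omega> \<eta>. fibre_eq \<omega> \<eta> \<longrightarrow> \<bar>g \<omega> - g \<eta>\<bar> \<le> e"
        and meas: "\<forall>\<mu> B. prob_space \<mu> \<longrightarrow> sets \<mu> = sets (cfg_space UNIV) \<longrightarrow> (\<forall>i\<in>N. fibred q (B i) \<and> site_inv (B i) i \<mu>) \<longrightarrow>
          measure \<mu> A = (\<integral>\<omega>. g \<omega> \<partial>\<mu>)" by (elim exE conjE)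
      have "measure \<mu> A = (\<integral>\<omega>. g \<omega> \<partial>\<mu>)"
        using meas[rule_format, OF local_gibbsD(1,2)[OF \<mu>], of "\<lambda>_. S1"] local_gibbs_site_inv[OF \<mu>] by (simp add: fibred_def)
      moreover have "\<bar>(\<integral>\<omega>. g \<omega> - h \<omega> \<partial>\<mu>) - 0\<bar> \<le> e"
      proof (rule \<mu>.integral_close)
        show "integrable \<mu> (\<lambda>\<omega>. g \<omega> - h \<omega>)" using hi unit_valued_integrable[OF g local_gibbsD(1,2)[OF \<mu>]] by simp
        show "AE \<omega> in \<mu>. \<bar>g \<omega> - h \<omega> - 0\<bar> \<le> e"
        proof (rule AE_I2)
          fix \<omega> assume "\<omega> \<in> space \<mu>"
          then have \<omega>: "\<omega> \<in> Omega" by (simp add: sp)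
          let ?\<sigma> = "discr_cfg q \<omega>"
          have \<sigma>: "?\<sigma> \<in> UNIV \<rightarrow>\<^sub>E {1..q}" by (rule TD[OF \<omega>])
          note lg = cgibbs_local_gibbs(1)[OF \<sigma>]
          have "h \<omega> = (\<integral>\<eta>. g \<eta> \<partial>cgibbs ?\<sigma>)"
            unfolding h_def using meas[rule_format, OF local_gibbsD(1,2)[OF lg], of "arcs ?\<sigma>"] local_gibbs_site_inv[OF lg] arcs_fibred[OF \<sigma>]
            by simp
          moreover have "\<bar>(\<integral>\<eta>. g \<eta> \<partial>cgibbs ?\<sigma>) - g \<omega>\<bar> \<le> e"
          proof (rule prob_space.integral_close[OF local_gibbsD(1)[OF lg] unit_valued_integrable[OF g local_gibbsD(1,2)[OF lg]]])
            have \<omega>arc: "\<omega> \<in> Pi\<^sub>E UNIV (arcs ?\<sigma>)"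
              using \<omega> by (simp add: PiE_UNIV_iff arcs_def spin_arc_def discr_cfg_def)
            show "AE \<eta> in cgibbs ?\<sigma>. \<bar>g \<eta> - g \<omega>\<bar> \<le> e"
              using local_gibbs_AE[OF lg arcs_admissible[OF \<sigma>]]
              by eventually_elim (rule osc[rule_format, OF fibre_eq_arcs[OF _ \<omega>arc]])
          qed
          ultimately show "\<bar>g \<omega> - h \<omega> - 0\<bar> \<le> e" by linarith
        qed
      qed
      moreover have "(\<integral>\<omega>. g \<omega> - h \<omega> \<partial>\<mu>) = (\<integral>\<omega>. g \<omega> \<partial>\<mu>) - integral\<^sup>L \<mu> h"
        using hi unit_valued_integrable[OF g local_gibbsD(1,2)[OF \<mu>]] by simp
      ultimately show ?thesis by simp
    qed
    then have "\<bar>measure \<mu> A - integral\<^sup>L \<mu> h\<bar> \<le> 0" by (rule field_le_epsilon)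
    then show "emeasure \<mu> A = emeasure K A" by (simp add: K \<mu>.emeasure_eq_measure)
  qed (rule s\<mu>)
  then show ?thesis using eK[OF B] by simp
qed

end

section \<open>Removing the interaction with a finite set of sites\<close>

lemma restrict_measurable_cfg:
  "V' \<subseteq> V \<Longrightarrow> (\<lambda>\<omega>. restrict \<omega> V') \<in> cfg_space V \<rightarrow>\<^sub>M cfg_space V'"
  unfolding cfg_space_def by (rule measurable_restrict_subset)

context gibbs_model
begin

lemma inv_boltz_nn_integral:
  assumes \<mu>: "prob_space \<mu>" "sets \<mu> = sets (cfg_space V)" and \<Lambda>: "finite \<Lambda>"
  shows "(\<integral>\<^sup>+\<omega>. inv_boltz V \<Lambda> \<omega> \<partial>\<mu>) \<noteq> 0" "(\<integral>\<^sup>+\<omega>. inv_boltz V \<Lambda> \<omega> \<partial>\<mu>) \<noteq> \<infinity>"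
proof -
  interpret prob_space \<mu> by fact
  have sp: "space \<mu> = V \<rightarrow>\<^sub>E S1" using sets_eq_imp_space_eq[OF \<mu>(2)] by (simp add: space_cfg)
  have "(\<integral>\<^sup>+\<omega>. ennreal (exp (- hb \<Lambda>)) \<partial>\<mu>) \<le> (\<integral>\<^sup>+\<omega>. inv_boltz V \<Lambda> \<omega> \<partial>\<mu>)"
    by (intro nn_integral_mono boltz_bounds \<Lambda>) (simp add: sp)
  then have 1: "ennreal (exp (- hb \<Lambda>)) \<le> (\<integral>\<^sup>+\<omega>. inv_boltz V \<Lambda> \<omega> \<partial>\<mu>)" by (simp add: emeasure_space_1)
  have "0 < ennreal (exp (- hb \<Lambda>))" by simp
  with 1 show "(\<integral>\<^sup>+\<omega>. inv_boltz V \<Lambda> \<omega> \<partial>\<mu>) \<noteq> 0" by auto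
  have "(\<integral>\<^sup>+\<omega>. inv_boltz V \<Lambda> \<omega> \<partial>\<mu>) \<le> (\<integral>\<^sup>+\<omega>. ennreal (exp (hb \<Lambda>)) \<partial>\<mu>)"
    by (intro nn_integral_mono boltz_bounds \<Lambda>) (simp add: sp)
  then show "(\<integral>\<^sup>+\<omega>. inv_boltz V \<Lambda> \<omega> \<partial>\<mu>) \<noteq> \<infinity>" by (auto simp: emeasure_space_1 top_unique)
qed

text \<open>The factor \<open>inv_boltz\<close> undoes all interactions with \<open>\<Lambda>\<close> before the spins in \<open>\<Lambda>\<close> are forgotten.\<close>

definition cut :: "'d site set \<Rightarrow> 'd config measure \<Rightarrow> 'd config measure"
  where "cut \<Lambda> \<mu> = scale_measure (inverse (\<integral>\<^sup>+\<omega>. inv_boltz UNIV \<Lambda> \<omega> \<partial>\<mu>))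
    (distr (density \<mu> (inv_boltz UNIV \<Lambda>)) (cfg_space (UNIV - \<Lambda>)) (\<lambda>\<omega>. restrict \<omega> (UNIV - \<Lambda>)))"

lemma nn_integral_cut:
  assumes \<mu>: "sets \<mu> = sets (cfg_space UNIV)" and \<Lambda>: "finite \<Lambda>" and f[measurable]: "f \<in> borel_measurable (cfg_space (UNIV - \<Lambda>))"
  shows "(\<integral>\<^sup>+\<eta>. f \<eta> \<partial>cut \<Lambda> \<mu>) = (\<integral>\<^sup>+\<omega>. inv_boltz UNIV \<Lambda> \<omega> * f (restrict \<omega> (UNIV - \<Lambda>)) \<partial>\<mu>) / (\<integral>\<^sup>+\<omega>. inv_boltz UNIV \<Lambda> \<omega> \<partial>\<mu>)"
proof -
  note [measurable_cong] = \<mu>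
  note [measurable] = inv_boltz_measurable[OF \<Lambda>, of UNIV] restrict_measurable_cfg[of "UNIV - \<Lambda>" UNIV]
  have [measurable]: "(\<lambda>\<omega>. restrict \<omega> (UNIV - \<Lambda>)) \<in> cfg_space UNIV \<rightarrow>\<^sub>M cfg_space (UNIV - \<Lambda>)"
    by (rule restrict_measurable_cfg) simp
  show ?thesis
    unfolding cut_def
    by (simp add: nn_integral_scale_measure nn_integral_distr nn_integral_density divide_ennreal_def mult.commute)
qed

text \<open>By \<open>inv_boltz_Un\<close>, the factor of \<open>\<Lambda>\<close> times the one of \<open>i\<close> in the system off \<open>\<Lambda>\<close> is the factor of \<open>i\<close> in
  the full system times a term without the spin at \<open>i\<close>.\<close>

lemma local_gibbs_cut:
  assumes \<mu>: "local_gibbs UNIV S \<mu>" and S: "\<And>i. admissible (S i)" and \<Lambda>: "finite \<Lambda>"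
  shows "local_gibbs (UNIV - \<Lambda>) S (cut \<Lambda> \<mu>)"
  unfolding local_gibbs_def
proof (intro conjI ballI)
  let ?V = "UNIV - \<Lambda>"
  let ?N = "\<integral>\<^sup>+\<omega>. inv_boltz UNIV \<Lambda> \<omega> \<partial>\<mu>"
  note s\<mu> = local_gibbsD(2)[OF \<mu>] and sp = local_gibbsD(3)[OF \<mu>]
  note N = inv_boltz_nn_integral[OF local_gibbsD(1,2)[OF \<mu>] \<Lambda>]
  note nn = nn_integral_cut[OF s\<mu> \<Lambda>]
  show "sets (cut \<Lambda> \<mu>) = sets (cfg_space ?V)" by (simp add: cut_def)
  show "prob_space (cut \<Lambda> \<mu>)"
  proof
    have "emeasure (cut \<Lambda> \<mu>) (space (cut \<Lambda> \<mu>)) = (\<integral>\<^sup>+\<eta>. 1 \<partial>cut \<Lambda> \<mu>)" by simp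
    also have "\<dots> = 1" using N by (subst nn) (simp_all add: ennreal_divide_self less_top)
    finally show "emeasure (cut \<Lambda> \<mu>) (space (cut \<Lambda> \<mu>)) = 1" .
  qed
  fix i and f :: "'d config \<Rightarrow> ennreal" assume i: "i \<in> ?V" and f[measurable]: "f \<in> borel_measurable (cfg_space ?V)"
  define k where "k \<omega> = inv_boltz (UNIV - {i}) \<Lambda> (restrict \<omega> (UNIV - {i}))" for \<omega>
  define F where "F \<omega> = f (restrict \<omega> ?V)" for \<omega>
  have [measurable]: "(\<lambda>\<omega>. restrict \<omega> V') \<in> cfg_space UNIV \<rightarrow>\<^sub>M cfg_space V'" for V' :: "'d site set"
    by (rule restrict_measurable_cfg) simp
  note [measurable] = inv_boltz_measurable[OF \<Lambda>] inv_boltz_measurable[of "{i}"]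
    resample1_measurable[OF i S f] resample1_measurable[OF UNIV_I S]
  have [measurable]: "k \<in> borel_measurable (cfg_space UNIV)" "F \<in> borel_measurable (cfg_space UNIV)"
    unfolding k_def[abs_def] F_def[abs_def] by measurable
  have split: "inv_boltz UNIV \<Lambda> \<omega> * (inv_boltz ?V {i} (restrict \<omega> ?V) * x) = inv_boltz UNIV {i} \<omega> * (k \<omega> * x)"
    if "\<omega> \<in> Omega" for \<omega> x
    using inv_boltz_Un[of \<Lambda> "{i}" \<omega> UNIV] inv_boltz_Un[of "{i}" \<Lambda> \<omega> UNIV] \<Lambda> that
    by (simp add: k_def mult.assoc[symmetric])
  have R: "resample1 (S i) i F \<omega> = resample1 (S i) i f (restrict \<omega> ?V)" for \<omega>
  proof -
    have "restrict (fun_upd \<omega> i x) ?V = fun_upd (restrict \<omega> ?V) i x" for x using i by (auto simp: restrict_def)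
    then show ?thesis by (simp add: resample1_def F_def)
  qed
  have "(\<integral>\<^sup>+\<omega>. inv_boltz UNIV \<Lambda> \<omega> * (inv_boltz ?V {i} (restrict \<omega> ?V) * f (restrict \<omega> ?V)) \<partial>\<mu>) =
      (\<integral>\<^sup>+\<omega>. inv_boltz UNIV {i} \<omega> * (k \<omega> * F \<omega>) \<partial>\<mu>)"
    by (intro nn_integral_cong) (simp add: sp split F_def)
  also have "\<dots> = (\<integral>\<^sup>+\<omega>. inv_boltz UNIV {i} \<omega> * resample1 (S i) i (\<lambda>\<omega>. k \<omega> * F \<omega>) \<omega> \<partial>\<mu>)"
    by (rule local_gibbsD(4)[OF \<mu> UNIV_I]) measurable
  also have "\<dots> = (\<integral>\<^sup>+\<omega>. inv_boltz UNIV {i} \<omega> * (k \<omega> * resample1 (S i) i F \<omega>) \<partial>\<mu>)"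
    by (intro nn_integral_cong arg_cong2[where f=times] refl resample1_mult[of i UNIV])
       (simp_all add: sp k_def restrict_upd_off)
  also have "\<dots> = (\<integral>\<^sup>+\<omega>. inv_boltz UNIV \<Lambda> \<omega> * (inv_boltz ?V {i} (restrict \<omega> ?V) * resample1 (S i) i f (restrict \<omega> ?V)) \<partial>\<mu>)"
    by (intro nn_integral_cong) (simp add: sp split R)
  finally show "(\<integral>\<^sup>+\<eta>. inv_boltz ?V {i} \<eta> * f \<eta> \<partial>cut \<Lambda> \<mu>) = (\<integral>\<^sup>+\<eta>. inv_boltz ?V {i} \<eta> * resample1 (S i) i f \<eta> \<partial>cut \<Lambda> \<mu>)"
    by (subst (1 2) nn) simp_all
qed

text \<open>The inverse of removing a single site: an independent spin at \<open>i\<close> is added, and then \<open>glue\<close> applies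
  the Boltzmann factor of \<open>i\<close>. This transfers uniqueness from \<open>V\<close> to \<open>V - {i}\<close>.\<close>

definition glue_base :: "'d site set \<Rightarrow> ('d site \<Rightarrow> real set) \<Rightarrow> 'd site \<Rightarrow> 'd config measure \<Rightarrow> 'd config measure"
  where "glue_base V S i \<nu> = distr (\<nu> \<Otimes>\<^sub>M apriori (S i)) (cfg_space V) (\<lambda>(\<eta>, x). fun_upd \<eta> i x)"

definition glue :: "'d site set \<Rightarrow> ('d site \<Rightarrow> real set) \<Rightarrow> 'd site \<Rightarrow> 'd config measure \<Rightarrow> 'd config measure"
  where "glue V S i \<nu> = density (glue_base V S i \<nu>) (\<lambda>\<omega>. boltz V {i} \<omega> / (\<integral>\<^sup>+\<omega>. boltz V {i} \<omega> \<partial>glue_base V S i \<nu>))"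

lemma upd_measurable_glue:
  assumes "i \<in> V" shows "(\<lambda>(\<eta>, x). fun_upd \<eta> i x) \<in> cfg_space (V - {i}) \<Otimes>\<^sub>M circle_measure \<rightarrow>\<^sub>M cfg_space V"
  using measurable_add_dim[where I="V - {i}" and M="\<lambda>_. circle_measure" and i=i] assms
  by (simp add: cfg_space_def insert_absorb)

lemma nn_integral_glue_base:
  assumes i: "i \<in> V" and \<nu>: "prob_space \<nu>" "sets \<nu> = sets (cfg_space (V - {i}))" and S: "admissible (S i)"
    and f: "f \<in> borel_measurable (cfg_space V)"
  shows "(\<integral>\<^sup>+\<omega>. f \<omega> \<partial>glue_base V S i \<nu>) = (\<integral>\<^sup>+\<eta>. resample1 (S i) i f \<eta> \<partial>\<nu>)"
    and "resample1 (S i) i f \<in> borel_measurable (cfg_space (V - {i}))"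
proof -
  interpret A: prob_space "apriori (S i)" by (rule prob_space_apriori[OF S])
  have m: "(\<lambda>(\<eta>, x). fun_upd \<eta> i x) \<in> \<nu> \<Otimes>\<^sub>M apriori (S i) \<rightarrow>\<^sub>M cfg_space V"
    using upd_measurable_glue[OF i] by (simp cong: measurable_cong_sets sets_pair_measure_cong add: \<nu>(2))
  have mf: "(\<lambda>(\<eta>, x). f (fun_upd \<eta> i x)) \<in> borel_measurable (\<nu> \<Otimes>\<^sub>M apriori (S i))"
    using measurable_compose[OF m f] by (simp add: case_prod_beta')
  have "(\<integral>\<^sup>+\<omega>. f \<omega> \<partial>glue_base V S i \<nu>) = (\<integral>\<^sup>+p. (\<lambda>(\<eta>, x). f (fun_upd \<eta> i x)) p \<partial>(\<nu> \<Otimes>\<^sub>M apriori (S i)))"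
    unfolding glue_base_def by (subst nn_integral_distr[OF m]) (simp_all add: f case_prod_beta')
  also have "\<dots> = (\<integral>\<^sup>+\<eta>. resample1 (S i) i f \<eta> \<partial>\<nu>)"
    unfolding resample1_def using A.nn_integral_fst[OF mf] by simp
  finally show "(\<integral>\<^sup>+\<omega>. f \<omega> \<partial>glue_base V S i \<nu>) = (\<integral>\<^sup>+\<eta>. resample1 (S i) i f \<eta> \<partial>\<nu>)" .
  have "resample1 (S i) i f \<in> borel_measurable \<nu>"
    unfolding resample1_def[abs_def] by (rule A.borel_measurable_nn_integral[OF mf])
  then show "resample1 (S i) i f \<in> borel_measurable (cfg_space (V - {i}))"
    by (simp cong: measurable_cong_sets add: \<nu>(2))
qed

lemma resample1_upd: "resample1 A i f (fun_upd \<eta> i x) = resample1 A i f \<eta>"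
  by (simp add: resample1_def)

lemma resample1_commute:
  assumes ij: "i \<noteq> j" "i \<in> V" "j \<in> V" and \<eta>: "\<eta> \<in> (V - {i}) \<rightarrow>\<^sub>E S1" and A: "admissible A" "admissible B"
    and f: "f \<in> borel_measurable (cfg_space V)"
  shows "resample1 B j (resample1 A i f) \<eta> = resample1 A i (resample1 B j f) \<eta>"
proof -
  interpret A: prob_space "apriori A" by (rule prob_space_apriori[OF A(1)])
  interpret B: prob_space "apriori B" by (rule prob_space_apriori[OF A(2)])
  interpret AB: pair_sigma_finite "apriori A" "apriori B" ..
  have m1: "(\<lambda>x. fun_upd \<eta> i x) \<in> circle_measure \<rightarrow>\<^sub>M cfg_space V"
    using measurable_compose[OF measurable_Pair1' upd_measurable_glue[OF ij(2)], of \<eta>] \<eta> by (simp add: space_cfg)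
  have "(\<lambda>p. (\<lambda>(\<eta>, x). fun_upd \<eta> j x) (fun_upd \<eta> i (fst p), snd p)) \<in> circle_measure \<Otimes>\<^sub>M circle_measure \<rightarrow>\<^sub>M cfg_space V"
    by (rule measurable_compose[OF _ upd_measurable[OF ij(3)]]) (use m1 in measurable)
  from measurable_compose[OF this f] have "(\<lambda>(x, y). f (fun_upd (fun_upd \<eta> i x) j y)) \<in> borel_measurable (apriori A \<Otimes>\<^sub>M apriori B)"
    by (simp add: case_prod_beta' cong: measurable_cong_sets sets_pair_measure_cong)
  from AB.Fubini'[OF this] show ?thesis
    unfolding resample1_def using ij(1) by (simp add: fun_upd_twist)
qed

text \<open>At \<open>i\<close> the equation says that the added spin is independent with the a priori distribution. At
  another site \<open>j\<close> the Boltzmann factors split as for \<open>local_gibbs_cut\<close>, and the averages over the two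
  spins commute. The second claim recovers \<open>\<nu>\<close> from \<open>glue V S i \<nu>\<close>.\<close>

lemma local_gibbs_glue:
  assumes i: "i \<in> V" and \<nu>: "local_gibbs (V - {i}) S \<nu>" and S: "\<And>i. admissible (S i)"
  shows "local_gibbs V S (glue V S i \<nu>)"
    and "f \<in> borel_measurable (cfg_space (V - {i})) \<Longrightarrow>
      (\<integral>\<^sup>+\<omega>. inv_boltz V {i} \<omega> * f (restrict \<omega> (V - {i})) \<partial>glue V S i \<nu>) =
      (\<integral>\<^sup>+\<eta>. f \<eta> \<partial>\<nu>) * (\<integral>\<^sup>+\<omega>. inv_boltz V {i} \<omega> \<partial>glue V S i \<nu>)"
proof -
  let ?V = "V - {i}"
  let ?M = "glue_base V S i \<nu>"
  let ?Z = "\<integral>\<^sup>+\<omega>. boltz V {i} \<omega> \<partial>?M"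
  note p = local_gibbsD(1,2)[OF \<nu>] and sp\<nu> = local_gibbsD(3)[OF \<nu>]
  note base = nn_integral_glue_base[OF i p S]
  interpret \<nu>: prob_space \<nu> by (rule p(1))
  have sM: "sets ?M = sets (cfg_space V)" by (simp add: glue_base_def)
  have spM: "space ?M = V \<rightarrow>\<^sub>E S1" using sets_eq_imp_space_eq[OF sM] by (simp add: space_cfg)
  note [measurable_cong] = sM
  note [measurable] = boltz_measurable[of "{i}" V] inv_boltz_measurable[of "{i}" V]
  have pM: "prob_space ?M"
  proof
    have "emeasure ?M (space ?M) = (\<integral>\<^sup>+\<omega>. 1 \<partial>?M)" by simp
    also have "\<dots> = (\<integral>\<^sup>+\<eta>. resample1 (S i) i (\<lambda>_. 1) \<eta> \<partial>\<nu>)" by (rule base(1)) simp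
    also have "\<dots> = 1"
      unfolding resample1_def using prob_space.emeasure_space_1[OF prob_space_apriori[OF S, of i]] \<nu>.emeasure_space_1 by simp
    finally show "emeasure ?M (space ?M) = 1" .
  qed
  interpret M: prob_space ?M by (rule pM)
  have Z: "?Z \<noteq> 0" "?Z \<noteq> \<infinity>"
  proof -
    have "(\<integral>\<^sup>+\<omega>. ennreal (exp (- hb {i})) \<partial>?M) \<le> ?Z"
      by (intro nn_integral_mono boltz_bounds) (simp_all add: spM)
    then have "ennreal (exp (- hb {i})) \<le> ?Z" using M.emeasure_space_1 by simp
    moreover have "0 < ennreal (exp (- hb {i}))" by simp
    ultimately show "?Z \<noteq> 0" by auto
    have "?Z \<le> (\<integral>\<^sup>+\<omega>. ennreal (exp (hb {i})) \<partial>?M)"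
      by (intro nn_integral_mono boltz_bounds) (simp_all add: spM)
    then show "?Z \<noteq> \<infinity>" using M.emeasure_space_1 by (auto simp: top_unique)
  qed
  have sG: "sets (glue V S i \<nu>) = sets (cfg_space V)" by (simp add: glue_def sM)
  have nnG: "(\<integral>\<^sup>+\<omega>. g \<omega> \<partial>glue V S i \<nu>) = (\<integral>\<^sup>+\<omega>. boltz V {i} \<omega> * g \<omega> \<partial>?M) / ?Z"
    if [measurable]: "g \<in> borel_measurable (cfg_space V)" for g
  proof -
    have "(\<integral>\<^sup>+\<omega>. g \<omega> \<partial>glue V S i \<nu>) = (\<integral>\<^sup>+\<omega>. boltz V {i} \<omega> / ?Z * g \<omega> \<partial>?M)"
      unfolding glue_def by (rule nn_integral_density) measurable
    also have "\<dots> = (\<integral>\<^sup>+\<omega>. boltz V {i} \<omega> * g \<omega> / ?Z \<partial>?M)"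
      by (simp add: divide_ennreal_def ac_simps)
    also have "\<dots> = (\<integral>\<^sup>+\<omega>. boltz V {i} \<omega> * g \<omega> \<partial>?M) / ?Z"
      by (rule nn_integral_divide) measurable
    finally show ?thesis .
  qed
  show "local_gibbs V S (glue V S i \<nu>)"
    unfolding local_gibbs_def
  proof (intro conjI ballI sG)
    show "prob_space (glue V S i \<nu>)"
    proof
      have "emeasure (glue V S i \<nu>) (space (glue V S i \<nu>)) = (\<integral>\<^sup>+\<omega>. 1 \<partial>glue V S i \<nu>)" by simp
      also have "\<dots> = 1" using Z by (subst nnG) (simp_all add: ennreal_divide_self less_top)
      finally show "emeasure (glue V S i \<nu>) (space (glue V S i \<nu>)) = 1" .
    qed
    fix j and f :: "'d config \<Rightarrow> ennreal" assume j: "j \<in> V" and f[measurable]: "f \<in> borel_measurable (cfg_space V)"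
    note [measurable] = inv_boltz_measurable[of "{j}" V] resample1_measurable[OF j S]
    have main: "(\<integral>\<^sup>+\<omega>. boltz V {i} \<omega> * (inv_boltz V {j} \<omega> * f \<omega>) \<partial>?M) =
      (\<integral>\<^sup>+\<omega>. boltz V {i} \<omega> * (inv_boltz V {j} \<omega> * resample1 (S j) j f \<omega>) \<partial>?M)"
    proof (cases "j = i")
      case True
      have "(\<integral>\<^sup>+\<omega>. f \<omega> \<partial>?M) = (\<integral>\<^sup>+\<omega>. resample1 (S i) i f \<omega> \<partial>?M)"
      proof -
        have "(\<integral>\<^sup>+\<omega>. resample1 (S i) i f \<omega> \<partial>?M) = (\<integral>\<^sup>+\<eta>. resample1 (S i) i (resample1 (S i) i f) \<eta> \<partial>\<nu>)"
          by (rule base(1)[OF resample1_measurable[OF i S f]])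
        also have "\<dots> = (\<integral>\<^sup>+\<eta>. resample1 (S i) i f \<eta> \<partial>\<nu>)"
        proof -
          have "resample1 (S i) i (resample1 (S i) i f) \<eta> = resample1 (S i) i f \<eta>" for \<eta>
            unfolding resample1_def[of "S i" i "resample1 (S i) i f"] resample1_upd
            using prob_space.emeasure_space_1[OF prob_space_apriori[OF S, of i]] by simp
          then show ?thesis by simp
        qed
        also have "\<dots> = (\<integral>\<^sup>+\<omega>. f \<omega> \<partial>?M)" by (rule base(1)[symmetric]) measurable
        finally show ?thesis ..
      qed
      then show ?thesis by (simp add: True boltz_inv)
    next
      case False
      have jV: "j \<in> ?V" using j False by simp
      define k where "k \<omega> = boltz (V - {j}) {i} (restrict \<omega> (V - {j}))" for \<omega>
      have [measurable]: "(\<lambda>\<omega>. restrict \<omega> (V - A)) \<in> cfg_space V \<rightarrow>\<^sub>M cfg_space (V - A)" for A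
        by (rule restrict_measurable_cfg) auto
      have [measurable]: "k \<in> borel_measurable (cfg_space V)"
        using boltz_measurable[of "{i}" "V - {j}"] unfolding k_def[abs_def] by measurable
      define b where "b \<eta> = inv_boltz ?V {j} \<eta>" for \<eta>
      have bm: "b \<in> borel_measurable (cfg_space ?V)" unfolding b_def[abs_def] by (rule inv_boltz_measurable) simp
      \<comment> \<open>Both orders of splitting the factor of \<open>{i, j}\<close> are compared; \<open>b\<close> does not contain the spin at
          \<open>i\<close> and \<open>k\<close> does not contain the one at \<open>j\<close>.\<close>
      have split: "boltz V {i} \<omega> * (inv_boltz V {j} \<omega> * x) = b (restrict \<omega> ?V) * (k \<omega> * x)"
        if \<omega>: "\<omega> \<in> V \<rightarrow>\<^sub>E S1" for \<omega> x
      proof -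
        have "inv_boltz V {i} \<omega> * b (restrict \<omega> ?V) = inv_boltz V {j} \<omega> * inv_boltz (V - {j}) {i} (restrict \<omega> (V - {j}))"
          using inv_boltz_Un[of "{i}" "{j}" \<omega> V] inv_boltz_Un[of "{j}" "{i}" \<omega> V] \<omega> by (simp add: b_def insert_commute)
        then have "boltz V {i} \<omega> * (k \<omega> * ((inv_boltz V {i} \<omega> * b (restrict \<omega> ?V)) * x)) =
          boltz V {i} \<omega> * (k \<omega> * ((inv_boltz V {j} \<omega> * inv_boltz (V - {j}) {i} (restrict \<omega> (V - {j}))) * x))" by simp
        moreover have "boltz V {i} \<omega> * (k \<omega> * ((inv_boltz V {i} \<omega> * b (restrict \<omega> ?V)) * x)) = b (restrict \<omega> ?V) * (k \<omega> * x)"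
        proof -
          have "boltz V {i} \<omega> * (k \<omega> * ((inv_boltz V {i} \<omega> * b (restrict \<omega> ?V)) * x)) = boltz V {i} \<omega> * (inv_boltz V {i} \<omega> * (b (restrict \<omega> ?V) * (k \<omega> * x)))"
            by (simp only: ac_simps)
          then show ?thesis by (simp add: boltz_inv)
        qed
        moreover have "boltz V {i} \<omega> * (k \<omega> * ((inv_boltz V {j} \<omega> * inv_boltz (V - {j}) {i} (restrict \<omega> (V - {j}))) * x)) = boltz V {i} \<omega> * (inv_boltz V {j} \<omega> * x)"
        proof -
          have "boltz V {i} \<omega> * (k \<omega> * ((inv_boltz V {j} \<omega> * inv_boltz (V - {j}) {i} (restrict \<omega> (V - {j}))) * x)) =
            k \<omega> * (inv_boltz (V - {j}) {i} (restrict \<omega> (V - {j})) * (boltz V {i} \<omega> * (inv_boltz V {j} \<omega> * x)))"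
            by (simp only: ac_simps)
          then show ?thesis by (simp add: k_def boltz_inv)
        qed
        ultimately show ?thesis by simp
      qed
      have rest: "restrict (fun_upd \<eta> i x) ?V = \<eta>" if "\<eta> \<in> ?V \<rightarrow>\<^sub>E S1" for \<eta> x
        using that by (auto simp: restrict_def PiE_def extensional_def fun_eq_iff)
      have upd: "fun_upd \<eta> i x \<in> V \<rightarrow>\<^sub>E S1" if "\<eta> \<in> ?V \<rightarrow>\<^sub>E S1" "x \<in> S1" for \<eta> x
        using that i by (auto simp: PiE_def extensional_def Pi_iff)
      have form: "(\<integral>\<^sup>+\<omega>. boltz V {i} \<omega> * (inv_boltz V {j} \<omega> * g \<omega>) \<partial>?M) = (\<integral>\<^sup>+\<eta>. b \<eta> * resample1 (S i) i (\<lambda>\<omega>. k \<omega> * g \<omega>) \<eta> \<partial>\<nu>)"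
        if g[measurable]: "g \<in> borel_measurable (cfg_space V)" for g
      proof -
        have "(\<integral>\<^sup>+\<omega>. boltz V {i} \<omega> * (inv_boltz V {j} \<omega> * g \<omega>) \<partial>?M) =
            (\<integral>\<^sup>+\<eta>. resample1 (S i) i (\<lambda>\<omega>. boltz V {i} \<omega> * (inv_boltz V {j} \<omega> * g \<omega>)) \<eta> \<partial>\<nu>)"
          by (rule base(1)) measurable
        also have "\<dots> = (\<integral>\<^sup>+\<eta>. b \<eta> * resample1 (S i) i (\<lambda>\<omega>. k \<omega> * g \<omega>) \<eta> \<partial>\<nu>)"
        proof (rule nn_integral_cong)
          fix \<eta> assume "\<eta> \<in> space \<nu>"
          then have \<eta>: "\<eta> \<in> ?V \<rightarrow>\<^sub>E S1" by (simp add: sp\<nu>)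
          have "(\<lambda>x. fun_upd \<eta> i x) \<in> circle_measure \<rightarrow>\<^sub>M cfg_space V"
            using measurable_compose[OF measurable_Pair1' upd_measurable_glue[OF i], of \<eta>] \<eta> by (simp add: space_cfg)
          from measurable_compose[OF this, of "\<lambda>\<omega>. k \<omega> * g \<omega>" borel]
          have m: "(\<lambda>x. k (fun_upd \<eta> i x) * g (fun_upd \<eta> i x)) \<in> borel_measurable (apriori (S i))"
            by (simp cong: measurable_cong_sets)
          have "resample1 (S i) i (\<lambda>\<omega>. boltz V {i} \<omega> * (inv_boltz V {j} \<omega> * g \<omega>)) \<eta> =
              (\<integral>\<^sup>+x. b \<eta> * (k (fun_upd \<eta> i x) * g (fun_upd \<eta> i x)) \<partial>apriori (S i))"
            unfolding resample1_def
            by (intro nn_integral_cong) (simp add: split[OF upd[OF \<eta>]] rest[OF \<eta>])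
          also have "\<dots> = b \<eta> * resample1 (S i) i (\<lambda>\<omega>. k \<omega> * g \<omega>) \<eta>"
            unfolding resample1_def by (rule nn_integral_cmult[OF m])
          finally show "resample1 (S i) i (\<lambda>\<omega>. boltz V {i} \<omega> * (inv_boltz V {j} \<omega> * g \<omega>)) \<eta> =
            b \<eta> * resample1 (S i) i (\<lambda>\<omega>. k \<omega> * g \<omega>) \<eta>" .
        qed
        finally show ?thesis .
      qed
      have "(\<integral>\<^sup>+\<omega>. boltz V {i} \<omega> * (inv_boltz V {j} \<omega> * f \<omega>) \<partial>?M) = (\<integral>\<^sup>+\<eta>. b \<eta> * resample1 (S i) i (\<lambda>\<omega>. k \<omega> * f \<omega>) \<eta> \<partial>\<nu>)"
        by (rule form[OF f])
      also have "\<dots> = (\<integral>\<^sup>+\<eta>. b \<eta> * resample1 (S j) j (resample1 (S i) i (\<lambda>\<omega>. k \<omega> * f \<omega>)) \<eta> \<partial>\<nu>)"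
        unfolding b_def by (rule local_gibbsD(4)[OF \<nu> jV base(2)]) measurable
      also have "\<dots> = (\<integral>\<^sup>+\<eta>. b \<eta> * resample1 (S i) i (\<lambda>\<omega>. k \<omega> * resample1 (S j) j f \<omega>) \<eta> \<partial>\<nu>)"
      proof (intro nn_integral_cong arg_cong2[where f=times] refl)
        fix \<eta> assume "\<eta> \<in> space \<nu>"
        then have \<eta>: "\<eta> \<in> ?V \<rightarrow>\<^sub>E S1" by (simp add: sp\<nu>)
        have "resample1 (S j) j (resample1 (S i) i (\<lambda>\<omega>. k \<omega> * f \<omega>)) \<eta> = resample1 (S i) i (resample1 (S j) j (\<lambda>\<omega>. k \<omega> * f \<omega>)) \<eta>"
          by (rule resample1_commute[OF False[symmetric] i j \<eta> S S]) measurable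
        also have "\<dots> = resample1 (S i) i (\<lambda>\<omega>. k \<omega> * resample1 (S j) j f \<omega>) \<eta>"
          unfolding resample1_def[of "S i"]
        proof (intro nn_integral_cong)
          fix x assume "x \<in> space (apriori (S i))"
          then have x: "x \<in> S1" by simp
          show "resample1 (S j) j (\<lambda>\<omega>. k \<omega> * f \<omega>) (fun_upd \<eta> i x) = k (fun_upd \<eta> i x) * resample1 (S j) j f (fun_upd \<eta> i x)"
            by (rule resample1_mult[OF j upd[OF \<eta> x] f]) (simp add: k_def restrict_upd_off)
        qed
        finally show "resample1 (S j) j (resample1 (S i) i (\<lambda>\<omega>. k \<omega> * f \<omega>)) \<eta> = resample1 (S i) i (\<lambda>\<omega>. k \<omega> * resample1 (S j) j f \<omega>) \<eta>" .
      qed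
      also have "\<dots> = (\<integral>\<^sup>+\<omega>. boltz V {i} \<omega> * (inv_boltz V {j} \<omega> * resample1 (S j) j f \<omega>) \<partial>?M)"
        by (rule form[symmetric]) measurable
      finally show ?thesis .
    qed
    show "(\<integral>\<^sup>+\<omega>. inv_boltz V {j} \<omega> * f \<omega> \<partial>glue V S i \<nu>) = (\<integral>\<^sup>+\<omega>. inv_boltz V {j} \<omega> * resample1 (S j) j f \<omega> \<partial>glue V S i \<nu>)"
      by (simp add: nnG main)
  qed
  show "(\<integral>\<^sup>+\<omega>. inv_boltz V {i} \<omega> * f (restrict \<omega> ?V) \<partial>glue V S i \<nu>) =
      (\<integral>\<^sup>+\<eta>. f \<eta> \<partial>\<nu>) * (\<integral>\<^sup>+\<omega>. inv_boltz V {i} \<omega> \<partial>glue V S i \<nu>)"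
    if f[measurable]: "f \<in> borel_measurable (cfg_space ?V)"
  proof -
    have [measurable]: "(\<lambda>\<omega>. restrict \<omega> ?V) \<in> cfg_space V \<rightarrow>\<^sub>M cfg_space ?V"
      by (rule restrict_measurable_cfg) auto
    have rest: "restrict (fun_upd \<eta> i x) ?V = \<eta>" if "\<eta> \<in> ?V \<rightarrow>\<^sub>E S1" for \<eta> x
      using that by (auto simp: restrict_def PiE_def extensional_def fun_eq_iff)
    have "(\<integral>\<^sup>+\<omega>. f (restrict \<omega> ?V) \<partial>?M) = (\<integral>\<^sup>+\<eta>. resample1 (S i) i (\<lambda>\<omega>. f (restrict \<omega> ?V)) \<eta> \<partial>\<nu>)"
      by (rule base(1)) measurable
    also have "\<dots> = (\<integral>\<^sup>+\<eta>. f \<eta> \<partial>\<nu>)"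
      unfolding resample1_def
      using prob_space.emeasure_space_1[OF prob_space_apriori[OF S, of i]]
      by (intro nn_integral_cong) (simp add: sp\<nu> rest)
    finally have 1: "(\<integral>\<^sup>+\<omega>. f (restrict \<omega> ?V) \<partial>?M) = (\<integral>\<^sup>+\<eta>. f \<eta> \<partial>\<nu>)" .
    have 2: "(\<integral>\<^sup>+\<omega>. inv_boltz V {i} \<omega> \<partial>glue V S i \<nu>) = 1 / ?Z"
      using M.emeasure_space_1 boltz_inv(1)[of V "{i}" _ 1] by (subst nnG) simp_all
    have "(\<integral>\<^sup>+\<omega>. inv_boltz V {i} \<omega> * f (restrict \<omega> ?V) \<partial>glue V S i \<nu>) = (\<integral>\<^sup>+\<eta>. f \<eta> \<partial>\<nu>) / ?Z"
      by (subst nnG) (simp_all add: boltz_inv 1)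
    then show ?thesis unfolding 2 by (simp add: divide_ennreal_def)
  qed
qed

lemma local_gibbs_unique_remove:
  assumes uniq: "\<And>\<mu> \<mu>'. local_gibbs V S \<mu> \<Longrightarrow> local_gibbs V S \<mu>' \<Longrightarrow> \<mu> = \<mu>'" and i: "i \<in> V" and S: "\<And>i. admissible (S i)"
    and \<nu>: "local_gibbs (V - {i}) S \<nu>" and \<nu>': "local_gibbs (V - {i}) S \<nu>'"
  shows "\<nu> = \<nu>'"
proof (rule measure_eqI)
  have eq: "glue V S i \<nu> = glue V S i \<nu>'"
    by (rule uniq[OF local_gibbs_glue(1)[OF i \<nu> S] local_gibbs_glue(1)[OF i \<nu>' S]])
  have N: "(\<integral>\<^sup>+\<omega>. inv_boltz V {i} \<omega> \<partial>glue V S i \<nu>') \<noteq> 0" "(\<integral>\<^sup>+\<omega>. inv_boltz V {i} \<omega> \<partial>glue V S i \<nu>') \<noteq> \<infinity>"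
    using inv_boltz_nn_integral[OF local_gibbsD(1,2)[OF local_gibbs_glue(1)[OF i \<nu>' S]], of "{i}"] by auto
  show "sets \<nu> = sets \<nu>'" using local_gibbsD(2) \<nu> \<nu>' by blast
  fix B assume "B \<in> sets \<nu>"
  then have B: "B \<in> sets (cfg_space (V - {i}))" using local_gibbsD(2)[OF \<nu>] by simp
  have "(\<integral>\<^sup>+\<eta>. indicator B \<eta> \<partial>\<nu>) * (\<integral>\<^sup>+\<omega>. inv_boltz V {i} \<omega> \<partial>glue V S i \<nu>') = (\<integral>\<^sup>+\<eta>. indicator B \<eta> \<partial>\<nu>') * (\<integral>\<^sup>+\<omega>. inv_boltz V {i} \<omega> \<partial>glue V S i \<nu>')"
    using local_gibbs_glue(2)[OF i \<nu> S, of "indicator B"] local_gibbs_glue(2)[OF i \<nu>' S, of "indicator B"] B eq by simp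
  then have "(\<integral>\<^sup>+\<eta>. indicator B \<eta> \<partial>\<nu>) = (\<integral>\<^sup>+\<eta>. indicator B \<eta> \<partial>\<nu>')"
    using N by (metis mult_divide_eq_ennreal infinity_ennreal_def)
  then show "emeasure \<nu> B = emeasure \<nu>' B"
    using B local_gibbsD(2)[OF \<nu>] local_gibbsD(2)[OF \<nu>'] by simp
qed

lemma local_gibbs_cong:
  assumes "\<And>i. i \<in> V \<Longrightarrow> S i = S' i" shows "local_gibbs V S \<mu> \<longleftrightarrow> local_gibbs V S' \<mu>"
  unfolding local_gibbs_def using assms by (simp cong: ball_cong)

end

context dobrushin_model
begin

lemma local_gibbs_unique_off:
  assumes \<Lambda>: "finite \<Lambda>" and \<sigma>: "\<sigma> \<in> UNIV \<rightarrow>\<^sub>E {1..q}"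
  shows "local_gibbs (UNIV - \<Lambda>) (arcs \<sigma>) \<nu> \<Longrightarrow> local_gibbs (UNIV - \<Lambda>) (arcs \<sigma>) \<nu>' \<Longrightarrow> \<nu> = \<nu>'"
  using \<Lambda>
proof (induction \<Lambda> arbitrary: \<nu> \<nu>')
  case empty
  then show ?case using local_gibbs_unique[OF \<sigma>] by simp
next
  case (insert i \<Lambda>)
  have V: "UNIV - insert i \<Lambda> = (UNIV - \<Lambda>) - {i}" by auto
  have i: "i \<in> UNIV - \<Lambda>" using insert.hyps by simp
  show ?case
    by (rule local_gibbs_unique_remove[OF insert.IH i arcs_admissible[OF \<sigma>] insert.prems[unfolded V]])
qed

lemma constrained_gibbs_off:
  assumes \<Lambda>: "finite \<Lambda>" and \<sigma>: "\<sigma> \<in> UNIV \<rightarrow>\<^sub>E {1..q}"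
  shows "constrained_gibbs (- \<Lambda>) \<Phi> q \<sigma> = cut \<Lambda> (cgibbs \<sigma>)"
proof -
  have lg: "local_gibbs (UNIV - \<Lambda>) (arcs \<sigma>) (cut \<Lambda> (cgibbs \<sigma>))"
    by (rule local_gibbs_cut[OF cgibbs_local_gibbs(1)[OF \<sigma>] arcs_admissible[OF \<sigma>] \<Lambda>])
  show ?thesis
    unfolding Compl_eq_Diff_UNIV constrained_gibbs_eq[OF \<sigma>, where V="UNIV - \<Lambda>"]
    by (rule the_equality) (rule lg, erule local_gibbs_unique_off[OF \<Lambda> \<sigma> _ lg])
qed

text \<open>The construction uses \<open>\<sigma>\<close> on all sites, but its result solves the equations of the system off \<open>\<Lambda>\<close>,
  which mention \<open>\<sigma>\<close> only there and have a single solution.\<close>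

lemma cut_cong:
  assumes \<Lambda>: "finite \<Lambda>" and \<sigma>: "\<sigma> \<in> UNIV \<rightarrow>\<^sub>E {1..q}" "\<tau> \<in> UNIV \<rightarrow>\<^sub>E {1..q}" and eq: "\<And>i. i \<notin> \<Lambda> \<Longrightarrow> \<sigma> i = \<tau> i"
  shows "cut \<Lambda> (cgibbs \<sigma>) = cut \<Lambda> (cgibbs \<tau>)"
proof (rule local_gibbs_unique_off[OF \<Lambda> \<sigma>(1)])
  show "local_gibbs (UNIV - \<Lambda>) (arcs \<sigma>) (cut \<Lambda> (cgibbs \<sigma>))"
    by (rule local_gibbs_cut[OF cgibbs_local_gibbs(1)[OF \<sigma>(1)] arcs_admissible[OF \<sigma>(1)] \<Lambda>])
  have "local_gibbs (UNIV - \<Lambda>) (arcs \<tau>) (cut \<Lambda> (cgibbs \<tau>))"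
    by (rule local_gibbs_cut[OF cgibbs_local_gibbs(1)[OF \<sigma>(2)] arcs_admissible[OF \<sigma>(2)] \<Lambda>])
  then show "local_gibbs (UNIV - \<Lambda>) (arcs \<sigma>) (cut \<Lambda> (cgibbs \<tau>))"
    by (rule local_gibbs_cong[THEN iffD1, rotated]) (simp add: arcs_def eq)
qed

end

section \<open>The discretized specification\<close>

lemma (in gibbs_model) Omega_discr: "\<omega> \<in> Omega \<Longrightarrow> discr_cfg q \<omega> \<in> UNIV \<rightarrow>\<^sub>E {1..q}" for \<omega> :: "'d config"
  unfolding PiE_UNIV_iff discr_cfg_def by (intro allI discr_in[OF q]) (simp add: PiE_UNIV_iff)

lemma merge_dcfg:
  "\<tau> \<in> \<Lambda> \<rightarrow>\<^sub>E {1..q} \<Longrightarrow> \<sigma> \<in> UNIV \<rightarrow>\<^sub>E {1..q} \<Longrightarrow> merge \<Lambda> (- \<Lambda>) (\<tau>, \<sigma>) \<in> UNIV \<rightarrow>\<^sub>E {1..q}"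
  by (auto simp: merge_def PiE_def Pi_iff)

lemma merge_dcfg_measurable:
  assumes \<tau>: "\<tau> \<in> \<Lambda> \<rightarrow>\<^sub>E {1..q}"
  shows "(\<lambda>\<sigma>. merge \<Lambda> (- \<Lambda>) (\<tau>, \<sigma>)) \<in> dcfg_space q \<rightarrow>\<^sub>M (dcfg_space q :: 'd::finite dconfig measure)"
  unfolding dcfg_space_def
proof (rule measurable_PiM_single')
  fix i :: "'d site"
  show "(\<lambda>\<sigma>. merge \<Lambda> (- \<Lambda>) (\<tau>, \<sigma>) i) \<in> PiM UNIV (\<lambda>_. count_space {1..q}) \<rightarrow>\<^sub>M count_space {1..q}"
  proof (cases "i \<in> \<Lambda>")
    case True
    then have "\<tau> i \<in> {1..q}" using \<tau> by (rule PiE_mem[rotated])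
    then show ?thesis using True by (simp add: merge_def)
  qed (simp add: merge_def)
next
  show "(\<lambda>\<sigma>. merge \<Lambda> (- \<Lambda>) (\<tau>, \<sigma>)) \<in> space (PiM UNIV (\<lambda>_. count_space {1..q})) \<rightarrow> (UNIV \<rightarrow>\<^sub>E space (count_space {1..q}))"
    using merge_dcfg[OF \<tau>] by (auto simp: space_PiM simp del: One_nat_def)
qed

lemma merge_self: "merge \<Lambda> (- \<Lambda>) (restrict \<sigma> \<Lambda>, \<sigma>) = \<sigma>"
  by (auto simp: merge_def)

text \<open>Only the summand where \<open>\<tau>\<close> is the restriction of \<open>\<sigma>\<close> to \<open>\<Lambda>\<close> survives.\<close>

lemma sum_merge_indicator:
  fixes h :: "'d::finite dconfig \<Rightarrow> ennreal"
  assumes \<Lambda>: "finite \<Lambda>" and \<sigma>: "\<sigma> \<in> UNIV \<rightarrow>\<^sub>E {1..q}"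
  shows "(\<Sum>\<tau>\<in>\<Lambda> \<rightarrow>\<^sub>E {1..q}. indicator {\<sigma>. restrict \<sigma> \<Lambda> = \<tau>} \<sigma> * h (merge \<Lambda> (- \<Lambda>) (\<tau>, \<sigma>))) = h \<sigma>"
proof -
  have r: "restrict \<sigma> \<Lambda> \<in> \<Lambda> \<rightarrow>\<^sub>E {1..q}" using \<sigma> by auto
  have fin: "finite (\<Lambda> \<rightarrow>\<^sub>E {1..q})" using \<Lambda> by (intro finite_PiE) auto
  have "(\<Sum>\<tau>\<in>\<Lambda> \<rightarrow>\<^sub>E {1..q}. indicator {\<sigma>. restrict \<sigma> \<Lambda> = \<tau>} \<sigma> * h (merge \<Lambda> (- \<Lambda>) (\<tau>, \<sigma>))) =
    (\<Sum>\<tau>\<in>\<Lambda> \<rightarrow>\<^sub>E {1..q}. if \<tau> = restrict \<sigma> \<Lambda> then h \<sigma> else 0)"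
    by (intro sum.cong refl) (auto simp: indicator_def merge_self simp del: merge_restrict)
  then show ?thesis using r fin by simp
qed

context dobrushin_model
begin

text \<open>Up to normalization over the spins in \<open>\<Lambda>\<close>, the probability of \<open>\<sigma>\<close> under the discretized
  specification; see \<open>discr_prob_eq\<close>.\<close>

definition weight :: "'d site set \<Rightarrow> 'd dconfig \<Rightarrow> ennreal"
  where "weight \<Lambda> \<sigma> = inverse (\<integral>\<^sup>+\<omega>. inv_boltz UNIV \<Lambda> \<omega> \<partial>cgibbs \<sigma>)"

definition total_weight :: "'d site set \<Rightarrow> 'd dconfig \<Rightarrow> ennreal"
  where "total_weight \<Lambda> \<sigma> = (\<Sum>\<tau>\<in>\<Lambda> \<rightarrow>\<^sub>E {1..q}. weight \<Lambda> (merge \<Lambda> (- \<Lambda>) (\<tau>, \<sigma>)))"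

lemma cgibbs_norm:
  assumes "finite \<Lambda>" "\<sigma> \<in> UNIV \<rightarrow>\<^sub>E {1..q}"
  shows "(\<integral>\<^sup>+\<omega>. inv_boltz UNIV \<Lambda> \<omega> \<partial>cgibbs \<sigma>) \<noteq> 0" "(\<integral>\<^sup>+\<omega>. inv_boltz UNIV \<Lambda> \<omega> \<partial>cgibbs \<sigma>) \<noteq> \<infinity>"
  using inv_boltz_nn_integral[OF local_gibbsD(1,2)[OF cgibbs_local_gibbs(1)[OF assms(2)]] assms(1)] by auto

lemma weight_bounds:
  assumes "finite \<Lambda>" "\<sigma> \<in> UNIV \<rightarrow>\<^sub>E {1..q}"
  shows "weight \<Lambda> \<sigma> \<noteq> 0" "weight \<Lambda> \<sigma> \<noteq> \<infinity>" "(\<integral>\<^sup>+\<omega>. inv_boltz UNIV \<Lambda> \<omega> \<partial>cgibbs \<sigma>) * weight \<Lambda> \<sigma> = 1"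
proof -
  let ?N = "\<integral>\<^sup>+\<omega>. inv_boltz UNIV \<Lambda> \<omega> \<partial>cgibbs \<sigma>"
  note N = cgibbs_norm[OF assms]
  show "weight \<Lambda> \<sigma> \<noteq> 0" "weight \<Lambda> \<sigma> \<noteq> \<infinity>" using N by (auto simp: weight_def)
  have "?N * weight \<Lambda> \<sigma> = ?N / ?N" by (simp add: weight_def divide_ennreal_def)
  then show "?N * weight \<Lambda> \<sigma> = 1" using N by (simp add: ennreal_divide_self less_top)
qed

lemma total_weight_bounds:
  assumes \<Lambda>: "finite \<Lambda>" and \<sigma>: "\<sigma> \<in> UNIV \<rightarrow>\<^sub>E {1..q}"
  shows "total_weight \<Lambda> \<sigma> \<noteq> 0" "total_weight \<Lambda> \<sigma> \<noteq> \<infinity>"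
proof -
  have fin: "finite (\<Lambda> \<rightarrow>\<^sub>E {1..q})" using \<Lambda> by (intro finite_PiE) auto
  have w: "weight \<Lambda> (merge \<Lambda> (- \<Lambda>) (\<tau>, \<sigma>)) \<noteq> 0" "weight \<Lambda> (merge \<Lambda> (- \<Lambda>) (\<tau>, \<sigma>)) \<noteq> \<infinity>" if "\<tau> \<in> \<Lambda> \<rightarrow>\<^sub>E {1..q}" for \<tau>
    using weight_bounds[OF \<Lambda> merge_dcfg[OF that \<sigma>]] by auto
  have r: "restrict \<sigma> \<Lambda> \<in> \<Lambda> \<rightarrow>\<^sub>E {1..q}" using \<sigma> by auto
  show "total_weight \<Lambda> \<sigma> \<noteq> 0" unfolding total_weight_def using fin w(1)[OF r] r by (subst sum_eq_0_iff) (assumption, blast)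
  show "total_weight \<Lambda> \<sigma> \<noteq> \<infinity>" unfolding total_weight_def using w(2) by (simp add: fin del: One_nat_def)
qed

lemma nn_integral_cgibbs_measurable:
  assumes "f \<in> borel_measurable (cfg_space UNIV)"
  shows "(\<lambda>\<sigma>. \<integral>\<^sup>+\<omega>. f \<omega> \<partial>cgibbs \<sigma>) \<in> borel_measurable (dcfg_space q)"
  by (rule measurable_compose[OF measurable_prob_algebraD[OF cgibbs_kernel] nn_integral_measurable_subprob_algebra[OF assms]])

lemma weight_measurable: "finite \<Lambda> \<Longrightarrow> weight \<Lambda> \<in> borel_measurable (dcfg_space q)"
  unfolding weight_def[abs_def] using nn_integral_cgibbs_measurable[OF inv_boltz_measurable] by measurable

lemma total_weight_measurable:
  assumes "finite \<Lambda>" shows "total_weight \<Lambda> \<in> borel_measurable (dcfg_space q)"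
  unfolding total_weight_def[abs_def]
  by (intro borel_measurable_sum measurable_compose[OF merge_dcfg_measurable weight_measurable[OF assms]])

lemma merge_merge': "merge \<Lambda> (- \<Lambda>) (\<tau>, merge \<Lambda> (- \<Lambda>) (\<tau>', \<sigma>)) = merge \<Lambda> (- \<Lambda>) (\<tau>, \<sigma>)"
  by (auto simp: merge_def)

lemma total_weight_merge: "total_weight \<Lambda> (merge \<Lambda> (- \<Lambda>) (\<tau>, \<sigma>)) = total_weight \<Lambda> \<sigma>"
  by (simp add: total_weight_def merge_merge')

text \<open>The factor \<open>inv_boltz\<close> in \<open>cut\<close> removes the averaging over the spins in \<open>\<Lambda>\<close> by \<open>local_gibbs_multi\<close> and
  then cancels against \<open>boltz\<close>, so only the normalizing constant of \<open>cut\<close> remains.\<close>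

lemma cut_resample:
  assumes \<Lambda>: "finite \<Lambda>" and \<sigma>: "\<sigma> \<in> UNIV \<rightarrow>\<^sub>E {1..q}"
  shows "(\<integral>\<^sup>+\<eta>. resample UNIV (arcs \<sigma>) \<Lambda> (boltz UNIV \<Lambda>) (extend (- \<Lambda>) \<eta>) \<partial>cut \<Lambda> (cgibbs \<sigma>)) = weight \<Lambda> \<sigma>"
proof -
  note lg = cgibbs_local_gibbs(1)[OF \<sigma>]
  note S = arcs_admissible[OF \<sigma>]
  have \<Lambda>U: "\<Lambda> \<subseteq> UNIV" by simp
  note bm[measurable] = boltz_measurable[OF \<Lambda>, of UNIV]
  have [measurable]: "resample UNIV (arcs \<sigma>) \<Lambda> (boltz UNIV \<Lambda>) \<in> borel_measurable (cfg_space UNIV)"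
    by (rule resample_measurable[OF \<Lambda>U \<Lambda> S bm])
  have "resample UNIV (arcs \<sigma>) \<Lambda> f (extend (- \<Lambda>) (restrict \<omega> (UNIV - \<Lambda>))) = resample UNIV (arcs \<sigma>) \<Lambda> f \<omega>" for f \<omega>
  proof -
    have "merge \<Lambda> (UNIV - \<Lambda>) (\<xi>, extend (- \<Lambda>) (restrict \<omega> (UNIV - \<Lambda>))) = merge \<Lambda> (UNIV - \<Lambda>) (\<xi>, \<omega>)" for \<xi>
      by (auto simp: merge_def extend_def)
    then show ?thesis by (simp add: resample_def)
  qed
  note ext = this
  have "(\<integral>\<^sup>+\<eta>. resample UNIV (arcs \<sigma>) \<Lambda> (boltz UNIV \<Lambda>) (extend (- \<Lambda>) \<eta>) \<partial>cut \<Lambda> (cgibbs \<sigma>)) =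
    (\<integral>\<^sup>+\<omega>. inv_boltz UNIV \<Lambda> \<omega> * resample UNIV (arcs \<sigma>) \<Lambda> (boltz UNIV \<Lambda>) (extend (- \<Lambda>) (restrict \<omega> (UNIV - \<Lambda>))) \<partial>cgibbs \<sigma>) / (\<integral>\<^sup>+\<omega>. inv_boltz UNIV \<Lambda> \<omega> \<partial>cgibbs \<sigma>)"
  proof (rule nn_integral_cut[OF local_gibbsD(2)[OF lg] \<Lambda>])
    have "extend (UNIV - \<Lambda>) \<in> cfg_space (UNIV - \<Lambda>) \<rightarrow>\<^sub>M cfg_space (UNIV :: 'd site set)" by (rule extend_measurable)
    then have [measurable]: "extend (- \<Lambda>) \<in> cfg_space (UNIV - \<Lambda>) \<rightarrow>\<^sub>M cfg_space (UNIV :: 'd site set)"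
      by (simp add: Compl_eq_Diff_UNIV)
    show "(\<lambda>\<eta>. resample UNIV (arcs \<sigma>) \<Lambda> (boltz UNIV \<Lambda>) (extend (- \<Lambda>) \<eta>)) \<in> borel_measurable (cfg_space (UNIV - \<Lambda>))"
      by measurable
  qed
  also have "(\<integral>\<^sup>+\<omega>. inv_boltz UNIV \<Lambda> \<omega> * resample UNIV (arcs \<sigma>) \<Lambda> (boltz UNIV \<Lambda>) (extend (- \<Lambda>) (restrict \<omega> (UNIV - \<Lambda>))) \<partial>cgibbs \<sigma>) =
     (\<integral>\<^sup>+\<omega>. inv_boltz UNIV \<Lambda> \<omega> * boltz UNIV \<Lambda> \<omega> \<partial>cgibbs \<sigma>)"
    unfolding ext by (rule local_gibbs_multi[OF lg S \<Lambda> \<Lambda>U bm, symmetric])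
  also have "\<dots> = 1"
    using boltz_inv(2)[of UNIV \<Lambda> _ 1] prob_space.emeasure_space_1[OF local_gibbsD(1)[OF lg]] by simp
  finally show ?thesis by (simp add: weight_def divide_ennreal_def)
qed

definition arc_mass :: ennreal where "arc_mass = ennreal (2 * pi / real q)"

lemma arc_mass_bounds: "arc_mass ^ n \<noteq> 0" "arc_mass ^ n \<noteq> \<infinity>"
  using q by (simp_all add: arc_mass_def ennreal_power)

lemma arcs_merge:
  assumes "i \<in> \<Lambda>" shows "arcs (merge \<Lambda> (- \<Lambda>) (\<tau>, \<sigma>)) i = spin_arc q (\<tau> i)"
  using assms by (simp add: arcs_def merge_def)

text \<open>Integrating the spins over their arcs differs from averaging them by the lengths of the arcs,
  which are all equal.\<close>

lemma inner_weight:
  assumes \<Lambda>: "finite \<Lambda>" and \<sigma>: "\<sigma> \<in> UNIV \<rightarrow>\<^sub>E {1..q}" and \<tau>: "\<tau> \<in> \<Lambda> \<rightarrow>\<^sub>E {1..q}" and \<eta>: "\<eta> \<in> (- \<Lambda>) \<rightarrow>\<^sub>E S1"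
  shows "(\<integral>\<^sup>+\<xi>. boltz UNIV \<Lambda> (merge \<Lambda> (- \<Lambda>) (\<xi>, \<eta>)) * indicator {\<xi>. \<forall>j\<in>\<Lambda>. discr q (\<xi> j) = \<tau> j} \<xi> \<partial>PiM \<Lambda> (\<lambda>_. circle_measure)) =
    arc_mass ^ card \<Lambda> * resample UNIV (arcs (merge \<Lambda> (- \<Lambda>) (\<tau>, \<sigma>))) \<Lambda> (boltz UNIV \<Lambda>) (extend (- \<Lambda>) \<eta>)" (is "?L = _ * ?R")
proof -
  let ?S = "arcs (merge \<Lambda> (- \<Lambda>) (\<tau>, \<sigma>))"
  let ?ind = "\<lambda>\<xi>. indicator {\<xi>. \<forall>j\<in>\<Lambda>. discr q (\<xi> j) = \<tau> j} \<xi> :: ennreal"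
  note S = arcs_admissible[OF merge_dcfg[OF \<tau> \<sigma>]]
  have m: "merge \<Lambda> (UNIV - \<Lambda>) (\<xi>, extend (- \<Lambda>) \<eta>) = merge \<Lambda> (- \<Lambda>) (\<xi>, \<eta>)" for \<xi>
    by (auto simp: merge_def extend_def)
  have mO: "merge \<Lambda> (- \<Lambda>) (\<xi>, \<eta>) \<in> Omega" if "\<xi> \<in> \<Lambda> \<rightarrow>\<^sub>E S1" for \<xi>
    using that \<eta> by (auto simp: merge_def PiE_UNIV_iff PiE_def Pi_iff)
  have "extend (- \<Lambda>) \<eta> \<in> Omega" by (rule extend_Omega[OF \<eta>])
  then have "(\<lambda>\<xi>. merge \<Lambda> (UNIV - \<Lambda>) (\<xi>, extend (- \<Lambda>) \<eta>)) \<in> PiM \<Lambda> (\<lambda>_. circle_measure) \<rightarrow>\<^sub>M cfg_space UNIV"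
    by (intro merge_measurable') auto
  then have [measurable]: "(\<lambda>\<xi>. merge \<Lambda> (- \<Lambda>) (\<xi>, \<eta>)) \<in> PiM \<Lambda> (\<lambda>_. circle_measure) \<rightarrow>\<^sub>M cfg_space UNIV" by (simp add: m)
  note [measurable] = boltz_measurable[OF \<Lambda>, of UNIV]
  have arc: "i \<in> \<Lambda> \<Longrightarrow> emeasure circle_measure (?S i) = arc_mass" for i
    unfolding arcs_merge arc_mass_def using \<tau> by (intro emeasure_spin_arc[OF q]) auto
  have S_sets: "?S i \<in> sets circle_measure" for i using S[of i] by (simp add: admissible_def)
  have prod: "(\<Prod>i\<in>\<Lambda>. indicator (?S i) (\<xi> i) / emeasure circle_measure (?S i)) = ?ind \<xi> / arc_mass ^ card \<Lambda>"
    if \<xi>: "\<xi> \<in> \<Lambda> \<rightarrow>\<^sub>E S1" for \<xi>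
  proof -
    have am: "arc_mass \<noteq> 0" "arc_mass \<noteq> top" using arc_mass_bounds[of 1] by auto
    have "(\<Prod>i\<in>\<Lambda>. indicator (?S i) (\<xi> i) / emeasure circle_measure (?S i)) = (\<Prod>i\<in>\<Lambda>. (indicator {x. discr q x = \<tau> i} (\<xi> i) :: ennreal) * inverse arc_mass)"
    proof (intro prod.cong refl)
      fix i assume i: "i \<in> \<Lambda>"
      have "(indicator (?S i) (\<xi> i) :: ennreal) = indicator {x. discr q x = \<tau> i} (\<xi> i)"
        using \<xi> i by (auto simp: arcs_merge spin_arc_def indicator_def)
      then show "indicator (?S i) (\<xi> i) / emeasure circle_measure (?S i) = (indicator {x. discr q x = \<tau> i} (\<xi> i) :: ennreal) * inverse arc_mass"
        by (simp only: arc[OF i] divide_ennreal_def)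
    qed
    also have "\<dots> = (\<Prod>i\<in>\<Lambda>. indicator {x. discr q x = \<tau> i} (\<xi> i)) * inverse arc_mass ^ card \<Lambda>"
      by (simp add: prod.distrib)
    also have "inverse arc_mass ^ card \<Lambda> = inverse (arc_mass ^ card \<Lambda>)"
      using am by (simp add: ennreal_inverse_power)
    also have "(\<Prod>i\<in>\<Lambda>. indicator {x. discr q x = \<tau> i} (\<xi> i)) = ?ind \<xi>"
      using \<Lambda> by (auto simp: indicator_def prod_zero_iff)
    finally show ?thesis by (simp add: divide_ennreal_def)
  qed
  let ?P = "PiM \<Lambda> (\<lambda>_. circle_measure)"
  have ind_m: "?ind \<in> borel_measurable ?P"
  proof -
    have "(\<lambda>\<xi>. \<Prod>i\<in>\<Lambda>. indicator (?S i) (\<xi> i) :: ennreal) \<in> borel_measurable ?P"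
      using S_sets by measurable
    then show ?thesis
    proof (rule measurable_cong[THEN iffD1, rotated])
      fix \<xi> assume "\<xi> \<in> space ?P"
      then have "\<xi> \<in> \<Lambda> \<rightarrow>\<^sub>E S1" by (simp add: space_PiM)
      then have "(\<Prod>i\<in>\<Lambda>. indicator (?S i) (\<xi> i) :: ennreal) = (\<Prod>i\<in>\<Lambda>. indicator {x. discr q x = \<tau> i} (\<xi> i))"
        by (intro prod.cong refl) (auto simp: indicator_def arcs_merge spin_arc_def)
      also have "\<dots> = ?ind \<xi>" using \<Lambda> by (auto simp: indicator_def prod_zero_iff)
      finally show "(\<Prod>i\<in>\<Lambda>. indicator (?S i) (\<xi> i)) = ?ind \<xi>" .
    qed
  qed
  have "?R = (\<integral>\<^sup>+\<xi>. (\<Prod>i\<in>\<Lambda>. indicator (?S i) (\<xi> i) / emeasure circle_measure (?S i)) * boltz UNIV \<Lambda> (merge \<Lambda> (- \<Lambda>) (\<xi>, \<eta>)) \<partial>?P)"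
    unfolding resample_def m by (rule nn_integral_PiM_apriori[OF \<Lambda> S]) measurable
  also have "\<dots> = (\<integral>\<^sup>+\<xi>. boltz UNIV \<Lambda> (merge \<Lambda> (- \<Lambda>) (\<xi>, \<eta>)) * ?ind \<xi> / arc_mass ^ card \<Lambda> \<partial>?P)"
  proof (rule nn_integral_cong)
    fix \<xi> assume "\<xi> \<in> space ?P"
    then have \<xi>: "\<xi> \<in> \<Lambda> \<rightarrow>\<^sub>E S1" by (simp add: space_PiM)
    show "(\<Prod>i\<in>\<Lambda>. indicator (?S i) (\<xi> i) / emeasure circle_measure (?S i)) * boltz UNIV \<Lambda> (merge \<Lambda> (- \<Lambda>) (\<xi>, \<eta>)) =
      boltz UNIV \<Lambda> (merge \<Lambda> (- \<Lambda>) (\<xi>, \<eta>)) * ?ind \<xi> / arc_mass ^ card \<Lambda>"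
      unfolding prod[OF \<xi>] by (simp add: divide_ennreal_def ac_simps)
  qed
  also have "\<dots> = ?L / arc_mass ^ card \<Lambda>"
    by (rule nn_integral_divide) (use ind_m in measurable)
  finally show ?thesis
    using arc_mass_bounds[of "card \<Lambda>"]
    by (simp add: ennreal_times_divide mult.commute[of "arc_mass ^ card \<Lambda>"] mult_divide_eq_ennreal)
qed

lemma discr_weight_ennreal:
  assumes \<Lambda>: "finite \<Lambda>" and \<sigma>: "\<sigma> \<in> UNIV \<rightarrow>\<^sub>E {1..q}"
    and f[measurable]: "f \<in> borel_measurable (PiM \<Lambda> (\<lambda>_. circle_measure))" and f01: "\<And>\<xi>. 0 \<le> f \<xi> \<and> f \<xi> \<le> 1"
  shows "discr_weight \<Phi> q \<Lambda> \<sigma> f = enn2real (\<integral>\<^sup>+\<eta>. \<integral>\<^sup>+\<xi>. boltz UNIV \<Lambda> (merge \<Lambda> (- \<Lambda>) (\<xi>, \<eta>)) * ennreal (f \<xi>) \<partial>PiM \<Lambda> (\<lambda>_. circle_measure) \<partial>cut \<Lambda> (cgibbs \<sigma>))"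
proof -
  let ?P = "PiM \<Lambda> (\<lambda>_. circle_measure)" and ?\<nu> = "cut \<Lambda> (cgibbs \<sigma>)"
  define J where "J \<eta> = (\<integral>\<^sup>+\<xi>. boltz UNIV \<Lambda> (merge \<Lambda> (- \<Lambda>) (\<xi>, \<eta>)) * ennreal (f \<xi>) \<partial>?P)" for \<eta>
  interpret c: product_sigma_finite "\<lambda>_. circle_measure"
    by (intro product_sigma_finite.intro finite_measure.axioms finite_circle)
  interpret P: finite_measure ?P
  proof
    have "emeasure ?P (space ?P) = (\<Prod>i\<in>\<Lambda>. emeasure circle_measure S1)"
      using c.emeasure_PiM[OF \<Lambda>, of "\<lambda>_. S1"] by (simp add: space_PiM)
    then show "emeasure ?P (space ?P) \<noteq> \<infinity>" by (simp add: emeasure_S1 ennreal_power)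
  qed
  note lg = local_gibbs_cut[OF cgibbs_local_gibbs(1)[OF \<sigma>] arcs_admissible[OF \<sigma>] \<Lambda>]
  have sp: "space ?\<nu> = (- \<Lambda>) \<rightarrow>\<^sub>E S1" using local_gibbsD(3)[OF lg] by (simp add: Compl_eq_Diff_UNIV)
  have s\<nu>: "sets ?\<nu> = sets (cfg_space (- \<Lambda>))" using local_gibbsD(2)[OF lg] by (simp add: Compl_eq_Diff_UNIV)
  have mm: "(\<lambda>(\<eta>, \<xi>). merge \<Lambda> (- \<Lambda>) (\<xi>, \<eta>)) \<in> cfg_space (- \<Lambda>) \<Otimes>\<^sub>M ?P \<rightarrow>\<^sub>M cfg_space UNIV"
  proof -
    have U: "\<Lambda> \<union> - \<Lambda> = UNIV" by auto
    have "merge \<Lambda> (- \<Lambda>) \<in> ?P \<Otimes>\<^sub>M cfg_space (- \<Lambda>) \<rightarrow>\<^sub>M cfg_space UNIV"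
      using measurable_merge[of \<Lambda> "- \<Lambda>" "\<lambda>_. circle_measure"] unfolding cfg_space_def U .
    from measurable_compose[OF measurable_pair_swap' this] show ?thesis by (simp add: case_prod_beta')
  qed
  have mO: "merge \<Lambda> (- \<Lambda>) (\<xi>, \<eta>) \<in> Omega" if "\<xi> \<in> \<Lambda> \<rightarrow>\<^sub>E S1" "\<eta> \<in> (- \<Lambda>) \<rightarrow>\<^sub>E S1" for \<xi> \<eta>
    using that by (auto simp: merge_def PiE_UNIV_iff PiE_def Pi_iff)
  have Jm: "J \<in> borel_measurable ?\<nu>"
  proof -
    have "(\<lambda>p. boltz UNIV \<Lambda> ((\<lambda>(\<eta>, \<xi>). merge \<Lambda> (- \<Lambda>) (\<xi>, \<eta>)) p)) \<in> borel_measurable (cfg_space (- \<Lambda>) \<Otimes>\<^sub>M ?P)"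
      by (rule measurable_compose[OF mm boltz_measurable[OF \<Lambda>]])
    then have [measurable]: "(\<lambda>p. boltz UNIV \<Lambda> (merge \<Lambda> (- \<Lambda>) (snd p, fst p))) \<in> borel_measurable (cfg_space (- \<Lambda>) \<Otimes>\<^sub>M ?P)"
      by (simp add: case_prod_beta')
    have "(\<lambda>(\<eta>, \<xi>). boltz UNIV \<Lambda> (merge \<Lambda> (- \<Lambda>) (\<xi>, \<eta>)) * ennreal (f \<xi>)) \<in> borel_measurable (cfg_space (- \<Lambda>) \<Otimes>\<^sub>M ?P)"
      unfolding case_prod_beta' by measurable
    from P.borel_measurable_nn_integral[OF this] show ?thesis
      unfolding J_def[abs_def] by (simp cong: measurable_cong_sets add: s\<nu>)
  qed
  have Jfin: "J \<eta> \<noteq> top" if \<eta>: "\<eta> \<in> (- \<Lambda>) \<rightarrow>\<^sub>E S1" for \<eta>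
  proof -
    have "J \<eta> \<le> (\<integral>\<^sup>+\<xi>. ennreal (exp (hb \<Lambda>)) * 1 \<partial>?P)"
      unfolding J_def using f01 mO[OF _ \<eta>] by (intro nn_integral_mono mult_mono boltz_bounds \<Lambda>) (auto simp: space_PiM)
    also have "\<dots> < top" proof -
      have "emeasure ?P (space ?P) < top" by (metis P.emeasure_finite infinity_ennreal_def top.not_eq_extremum)
      then show ?thesis by (simp add: ennreal_mult_less_top)
    qed
    finally show ?thesis by simp
  qed
  have inner: "(LINT \<xi>|?P. exp (- ham UNIV \<Lambda> (merge \<Lambda> (- \<Lambda>) (\<xi>, \<eta>))) * f \<xi>) = enn2real (J \<eta>)" if \<eta>: "\<eta> \<in> (- \<Lambda>) \<rightarrow>\<^sub>E S1" for \<eta>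
  proof -
    have "(\<lambda>\<xi>. merge \<Lambda> (- \<Lambda>) (\<xi>, \<eta>)) \<in> ?P \<rightarrow>\<^sub>M cfg_space UNIV"
      using measurable_compose[OF measurable_Pair1' mm, of \<eta>] \<eta> by (simp add: space_cfg)
    from measurable_compose[OF this ham_measurable[OF \<Lambda>]]
    have [measurable]: "(\<lambda>\<xi>. ham UNIV \<Lambda> (merge \<Lambda> (- \<Lambda>) (\<xi>, \<eta>))) \<in> borel_measurable ?P" .
    have "(LINT \<xi>|?P. exp (- ham UNIV \<Lambda> (merge \<Lambda> (- \<Lambda>) (\<xi>, \<eta>))) * f \<xi>) = enn2real (\<integral>\<^sup>+\<xi>. ennreal (exp (- ham UNIV \<Lambda> (merge \<Lambda> (- \<Lambda>) (\<xi>, \<eta>))) * f \<xi>) \<partial>?P)"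
      by (rule integral_eq_nn_integral) (use f01 in auto)
    then show ?thesis by (simp add: J_def boltz_def ennreal_mult')
  qed
  have "discr_weight \<Phi> q \<Lambda> \<sigma> f = (LINT \<eta>|?\<nu>. enn2real (J \<eta>))"
    unfolding discr_weight_def constrained_gibbs_off[OF \<Lambda> \<sigma>]
    by (intro Bochner_Integration.integral_cong refl inner) (simp add: sp)
  also have "\<dots> = enn2real (\<integral>\<^sup>+\<eta>. ennreal (enn2real (J \<eta>)) \<partial>?\<nu>)"
    by (rule integral_eq_nn_integral) (use Jm in auto)
  also have "(\<integral>\<^sup>+\<eta>. ennreal (enn2real (J \<eta>)) \<partial>?\<nu>) = (\<integral>\<^sup>+\<eta>. J \<eta> \<partial>?\<nu>)"
    using Jfin by (intro nn_integral_cong) (simp add: sp less_top)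
  finally show ?thesis by (simp add: J_def)
qed

text \<open>The Boltzmann weight of \<open>\<tau>\<close> under the constrained measure off \<open>\<Lambda>\<close> is given by \<open>inner_weight\<close> and
  \<open>cut_resample\<close>; the latter applies to every \<open>\<tau>\<close> because of \<open>cut_cong\<close>. The powers of the arc length
  cancel.\<close>

lemma discr_prob_eq:
  assumes \<Lambda>: "finite \<Lambda>" and \<sigma>: "\<sigma> \<in> UNIV \<rightarrow>\<^sub>E {1..q}" and \<tau>: "\<tau> \<in> \<Lambda> \<rightarrow>\<^sub>E {1..q}"
  shows "ennreal (discr_prob \<Phi> q \<Lambda> \<sigma> \<tau>) = weight \<Lambda> (merge \<Lambda> (- \<Lambda>) (\<tau>, \<sigma>)) / total_weight \<Lambda> \<sigma>"
proof -
  let ?P = "PiM \<Lambda> (\<lambda>_. circle_measure)" and ?\<nu> = "cut \<Lambda> (cgibbs \<sigma>)"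
  let ?ind = "\<lambda>\<tau>. indicator {\<xi>. \<forall>j\<in>\<Lambda>. discr q (\<xi> j) = \<tau> j}"
  let ?w = "\<lambda>\<tau>. weight \<Lambda> (merge \<Lambda> (- \<Lambda>) (\<tau>, \<sigma>))"
  have fin: "finite (\<Lambda> \<rightarrow>\<^sub>E {1..q})" using \<Lambda> by (intro finite_PiE) auto
  note lg = local_gibbs_cut[OF cgibbs_local_gibbs(1)[OF \<sigma>] arcs_admissible[OF \<sigma>] \<Lambda>]
  have sp: "space ?\<nu> = (- \<Lambda>) \<rightarrow>\<^sub>E S1" using local_gibbsD(3)[OF lg] by (simp add: Compl_eq_Diff_UNIV)
  have s\<nu>: "sets ?\<nu> = sets (cfg_space (- \<Lambda>))" using local_gibbsD(2)[OF lg] by (simp add: Compl_eq_Diff_UNIV)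
  let ?R = "\<lambda>\<tau> \<eta>. resample UNIV (arcs (merge \<Lambda> (- \<Lambda>) (\<tau>, \<sigma>))) \<Lambda> (boltz UNIV \<Lambda>) (extend (- \<Lambda>) \<eta>)"
  have Rm: "?R \<tau> \<in> borel_measurable ?\<nu>" if "\<tau> \<in> \<Lambda> \<rightarrow>\<^sub>E {1..q}" for \<tau>
  proof -
    have "?R \<tau> \<in> borel_measurable (cfg_space (- \<Lambda>))"
      by (rule measurable_compose[OF extend_measurable resample_measurable[OF _ \<Lambda> arcs_admissible[OF merge_dcfg[OF that \<sigma>]] boltz_measurable[OF \<Lambda>]]]) simp
    then show ?thesis by (simp cong: measurable_cong_sets add: s\<nu>)
  qed
  have Rw: "(\<integral>\<^sup>+\<eta>. ?R \<tau> \<eta> \<partial>?\<nu>) = ?w \<tau>" if \<tau>: "\<tau> \<in> \<Lambda> \<rightarrow>\<^sub>E {1..q}" for \<tau>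
  proof -
    have "?\<nu> = cut \<Lambda> (cgibbs (merge \<Lambda> (- \<Lambda>) (\<tau>, \<sigma>)))"
      by (rule cut_cong[OF \<Lambda> \<sigma> merge_dcfg[OF \<tau> \<sigma>]]) (simp add: merge_def)
    then show ?thesis using cut_resample[OF \<Lambda> merge_dcfg[OF \<tau> \<sigma>]] by simp
  qed
  have disc_sets: "{\<xi> \<in> space ?P. \<forall>j\<in>\<Lambda>. discr q (\<xi> j) = \<tau> j} \<in> sets ?P" for \<tau> :: "'d dconfig"
  proof -
    have "{\<xi> \<in> space ?P. discr q (\<xi> j) = \<tau> j} \<in> sets ?P" if "j \<in> \<Lambda>" for j
    proof -
      have "(\<lambda>\<xi>. \<xi> j) -` spin_arc q (\<tau> j) \<inter> space ?P \<in> sets ?P"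
        using that by (intro measurable_sets[OF _ spin_arc_sets[OF q]]) simp
      also have "(\<lambda>\<xi>. \<xi> j) -` spin_arc q (\<tau> j) \<inter> space ?P = {\<xi> \<in> space ?P. discr q (\<xi> j) = \<tau> j}"
        using that by (auto simp: spin_arc_def space_PiM)
      finally show ?thesis .
    qed
    then show ?thesis using \<Lambda> by (intro sets.sets_Collect_finite_All) auto
  qed
  have ind_m: "(?ind \<tau> :: _ \<Rightarrow> real) \<in> borel_measurable ?P" for \<tau> :: "'d dconfig"
    using disc_sets[of \<tau>] by (subst borel_measurable_indicator_iff) (simp add: Int_def conj_commute)
  have num: "discr_weight \<Phi> q \<Lambda> \<sigma> (?ind \<tau>) = enn2real (arc_mass ^ card \<Lambda> * ?w \<tau>)"
  proof -
    have "discr_weight \<Phi> q \<Lambda> \<sigma> (?ind \<tau>) = enn2real (\<integral>\<^sup>+\<eta>. \<integral>\<^sup>+\<xi>. boltz UNIV \<Lambda> (merge \<Lambda> (- \<Lambda>) (\<xi>, \<eta>)) * ennreal (?ind \<tau> \<xi>) \<partial>?P \<partial>?\<nu>)"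
      by (rule discr_weight_ennreal[OF \<Lambda> \<sigma> ind_m]) (simp add: indicator_def)
    also have "(\<integral>\<^sup>+\<eta>. \<integral>\<^sup>+\<xi>. boltz UNIV \<Lambda> (merge \<Lambda> (- \<Lambda>) (\<xi>, \<eta>)) * ennreal (?ind \<tau> \<xi>) \<partial>?P \<partial>?\<nu>) = (\<integral>\<^sup>+\<eta>. arc_mass ^ card \<Lambda> * ?R \<tau> \<eta> \<partial>?\<nu>)"
      by (intro nn_integral_cong) (simp add: ennreal_indicator inner_weight[OF \<Lambda> \<sigma> \<tau>] sp)
    also have "\<dots> = arc_mass ^ card \<Lambda> * ?w \<tau>"
      by (simp add: nn_integral_cmult[OF Rm[OF \<tau>]] Rw[OF \<tau>])
    finally show ?thesis .
  qed
  have den: "discr_weight \<Phi> q \<Lambda> \<sigma> (\<lambda>_. 1) = enn2real (arc_mass ^ card \<Lambda> * total_weight \<Lambda> \<sigma>)"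
  proof -
    have "discr_weight \<Phi> q \<Lambda> \<sigma> (\<lambda>_. 1) = enn2real (\<integral>\<^sup>+\<eta>. \<integral>\<^sup>+\<xi>. boltz UNIV \<Lambda> (merge \<Lambda> (- \<Lambda>) (\<xi>, \<eta>)) * ennreal 1 \<partial>?P \<partial>?\<nu>)"
      by (rule discr_weight_ennreal[OF \<Lambda> \<sigma>]) auto
    also have "(\<integral>\<^sup>+\<eta>. \<integral>\<^sup>+\<xi>. boltz UNIV \<Lambda> (merge \<Lambda> (- \<Lambda>) (\<xi>, \<eta>)) * ennreal 1 \<partial>?P \<partial>?\<nu>) = (\<integral>\<^sup>+\<eta>. (\<Sum>\<tau>\<in>\<Lambda> \<rightarrow>\<^sub>E {1..q}. arc_mass ^ card \<Lambda> * ?R \<tau> \<eta>) \<partial>?\<nu>)"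
    proof (rule nn_integral_cong)
      fix \<eta> assume "\<eta> \<in> space ?\<nu>"
      then have \<eta>: "\<eta> \<in> (- \<Lambda>) \<rightarrow>\<^sub>E S1" by (simp add: sp)
      have "extend (- \<Lambda>) \<eta> \<in> Omega" by (rule extend_Omega[OF \<eta>])
      then have "(\<lambda>\<xi>. merge \<Lambda> (UNIV - \<Lambda>) (\<xi>, extend (- \<Lambda>) \<eta>)) \<in> ?P \<rightarrow>\<^sub>M cfg_space UNIV"
        by (intro merge_measurable') auto
      moreover have "merge \<Lambda> (UNIV - \<Lambda>) (\<xi>, extend (- \<Lambda>) \<eta>) = merge \<Lambda> (- \<Lambda>) (\<xi>, \<eta>)" for \<xi>
        by (auto simp: merge_def extend_def)
      ultimately have mm: "(\<lambda>\<xi>. merge \<Lambda> (- \<Lambda>) (\<xi>, \<eta>)) \<in> ?P \<rightarrow>\<^sub>M cfg_space UNIV" by simp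
      note [measurable] = measurable_compose[OF mm boltz_measurable[OF \<Lambda>]]
      have "(\<integral>\<^sup>+\<xi>. boltz UNIV \<Lambda> (merge \<Lambda> (- \<Lambda>) (\<xi>, \<eta>)) * ennreal 1 \<partial>?P) =
        (\<integral>\<^sup>+\<xi>. (\<Sum>\<tau>\<in>\<Lambda> \<rightarrow>\<^sub>E {1..q}. boltz UNIV \<Lambda> (merge \<Lambda> (- \<Lambda>) (\<xi>, \<eta>)) * ?ind \<tau> \<xi>) \<partial>?P)"
      proof (rule nn_integral_cong)
        fix \<xi> assume "\<xi> \<in> space ?P"
        then have \<xi>: "\<xi> \<in> \<Lambda> \<rightarrow>\<^sub>E S1" by (simp add: space_PiM)
        define \<tau>0 where "\<tau>0 = (\<lambda>j\<in>\<Lambda>. discr q (\<xi> j))"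
        have \<tau>0: "\<tau>0 \<in> \<Lambda> \<rightarrow>\<^sub>E {1..q}" unfolding \<tau>0_def using \<xi> by (intro restrict_PiE_iff[THEN iffD2] ballI discr_in[OF q]) auto
        have "(\<Sum>\<tau>\<in>\<Lambda> \<rightarrow>\<^sub>E {1..q}. ?ind \<tau> \<xi>) = (\<Sum>\<tau>\<in>\<Lambda> \<rightarrow>\<^sub>E {1..q}. if \<tau> = \<tau>0 then 1 else (0::ennreal))"
        proof (rule sum.cong[OF refl])
          fix \<tau> assume "\<tau> \<in> \<Lambda> \<rightarrow>\<^sub>E {1..q}"
          then have "(\<forall>j\<in>\<Lambda>. discr q (\<xi> j) = \<tau> j) \<longleftrightarrow> \<tau> = \<tau>0"
            by (auto simp: \<tau>0_def fun_eq_iff PiE_def extensional_def)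
          then show "?ind \<tau> \<xi> = (if \<tau> = \<tau>0 then 1 else (0::ennreal))" by (simp add: indicator_def)
        qed
        also have "\<dots> = 1" using \<tau>0 fin by simp
        finally show "boltz UNIV \<Lambda> (merge \<Lambda> (- \<Lambda>) (\<xi>, \<eta>)) * ennreal 1 = (\<Sum>\<tau>\<in>\<Lambda> \<rightarrow>\<^sub>E {1..q}. boltz UNIV \<Lambda> (merge \<Lambda> (- \<Lambda>) (\<xi>, \<eta>)) * ?ind \<tau> \<xi>)"
          by (simp add: sum_distrib_left[symmetric])
      qed
      also have "\<dots> = (\<Sum>\<tau>\<in>\<Lambda> \<rightarrow>\<^sub>E {1..q}. \<integral>\<^sup>+\<xi>. boltz UNIV \<Lambda> (merge \<Lambda> (- \<Lambda>) (\<xi>, \<eta>)) * ?ind \<tau> \<xi> \<partial>?P)"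
      proof (rule nn_integral_sum)
        fix \<tau> :: "'d dconfig"
        have "(\<lambda>\<xi>. ennreal (?ind \<tau> \<xi>)) \<in> borel_measurable ?P" using ind_m[of \<tau>] by measurable
        then have [measurable]: "(\<lambda>\<xi>. ?ind \<tau> \<xi> :: ennreal) \<in> borel_measurable ?P" by (simp add: ennreal_indicator)
        show "(\<lambda>\<xi>. boltz UNIV \<Lambda> (merge \<Lambda> (- \<Lambda>) (\<xi>, \<eta>)) * ?ind \<tau> \<xi>) \<in> borel_measurable ?P" by measurable
      qed
      also have "\<dots> = (\<Sum>\<tau>\<in>\<Lambda> \<rightarrow>\<^sub>E {1..q}. arc_mass ^ card \<Lambda> * ?R \<tau> \<eta>)"
        by (intro sum.cong refl inner_weight[OF \<Lambda> \<sigma> _ \<eta>])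
      finally show "(\<integral>\<^sup>+\<xi>. boltz UNIV \<Lambda> (merge \<Lambda> (- \<Lambda>) (\<xi>, \<eta>)) * ennreal 1 \<partial>?P) = (\<Sum>\<tau>\<in>\<Lambda> \<rightarrow>\<^sub>E {1..q}. arc_mass ^ card \<Lambda> * ?R \<tau> \<eta>)" .
    qed
    also have "\<dots> = (\<Sum>\<tau>\<in>\<Lambda> \<rightarrow>\<^sub>E {1..q}. arc_mass ^ card \<Lambda> * ?w \<tau>)"
      using Rm by (subst nn_integral_sum) (auto intro!: sum.cong simp: nn_integral_cmult Rw simp del: One_nat_def)
    also have "\<dots> = arc_mass ^ card \<Lambda> * total_weight \<Lambda> \<sigma>"
      by (simp add: total_weight_def sum_distrib_left)
    finally show ?thesis .
  qed
  let ?c = "arc_mass ^ card \<Lambda>"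
  note c = arc_mass_bounds[of "card \<Lambda>"] and t = total_weight_bounds[OF \<Lambda> \<sigma>] and w = weight_bounds[OF \<Lambda> merge_dcfg[OF \<tau> \<sigma>]]
  have ct: "?c * total_weight \<Lambda> \<sigma> \<noteq> 0" "?c * total_weight \<Lambda> \<sigma> \<noteq> top" "?c * ?w \<tau> \<noteq> top"
    using c t w by (auto simp: ennreal_mult_eq_top_iff)
  note lt = top.not_eq_extremum[THEN iffD1, OF ct(2)] top.not_eq_extremum[THEN iffD1, OF ct(3)] zero_less_iff_neq_zero[THEN iffD2, OF ct(1)]
  from lt have "0 < enn2real (?c * total_weight \<Lambda> \<sigma>)"
    by (simp only: enn2real_positive_iff)
  then have "ennreal (discr_prob \<Phi> q \<Lambda> \<sigma> \<tau>) = ennreal (enn2real (?c * ?w \<tau>)) / ennreal (enn2real (?c * total_weight \<Lambda> \<sigma>))"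
    unfolding discr_prob_def num den by (rule divide_ennreal[OF enn2real_nonneg, symmetric])
  also have "\<dots> = (?c * ?w \<tau>) / (?c * total_weight \<Lambda> \<sigma>)"
    by (simp only: ennreal_enn2real[OF lt(1)] ennreal_enn2real[OF lt(2)])
  also have "\<dots> = ?w \<tau> / total_weight \<Lambda> \<sigma>"
    by (rule ennreal_mult_cancel_divide[OF c t(2)])
  finally show ?thesis .
qed

lemma nn_integral_discr_spec:
  assumes \<Lambda>: "finite \<Lambda>" and \<sigma>: "\<sigma> \<in> UNIV \<rightarrow>\<^sub>E {1..q}" and h[measurable]: "h \<in> borel_measurable (dcfg_space q)"
  shows "(\<integral>\<^sup>+\<sigma>. h \<sigma> \<partial>discr_spec \<Phi> q \<Lambda> \<sigma>) =
    (\<Sum>\<tau>\<in>\<Lambda> \<rightarrow>\<^sub>E {1..q}. weight \<Lambda> (merge \<Lambda> (- \<Lambda>) (\<tau>, \<sigma>)) / total_weight \<Lambda> \<sigma> * h (merge \<Lambda> (- \<Lambda>) (\<tau>, \<sigma>)))"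
proof -
  have fin: "finite (\<Lambda> \<rightarrow>\<^sub>E {1..q})" using \<Lambda> by (intro finite_PiE) auto
  have m: "(\<lambda>\<tau>. merge \<Lambda> (- \<Lambda>) (\<tau>, \<sigma>)) \<in> point_measure (\<Lambda> \<rightarrow>\<^sub>E {1..q}) (\<lambda>\<tau>. ennreal (discr_prob \<Phi> q \<Lambda> \<sigma> \<tau>)) \<rightarrow>\<^sub>M dcfg_space q"
    using merge_dcfg[OF _ \<sigma>] by (simp add: space_dcfg del: One_nat_def atLeastAtMost_iff)
  have "(\<integral>\<^sup>+\<sigma>. h \<sigma> \<partial>discr_spec \<Phi> q \<Lambda> \<sigma>) = (\<Sum>\<tau>\<in>\<Lambda> \<rightarrow>\<^sub>E {1..q}. ennreal (discr_prob \<Phi> q \<Lambda> \<sigma> \<tau>) * h (merge \<Lambda> (- \<Lambda>) (\<tau>, \<sigma>)))"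
    unfolding discr_spec_def using fin by (simp add: nn_integral_distr[OF m] nn_integral_point_measure_finite del: One_nat_def)
  also have "\<dots> = (\<Sum>\<tau>\<in>\<Lambda> \<rightarrow>\<^sub>E {1..q}. weight \<Lambda> (merge \<Lambda> (- \<Lambda>) (\<tau>, \<sigma>)) / total_weight \<Lambda> \<sigma> * h (merge \<Lambda> (- \<Lambda>) (\<tau>, \<sigma>)))"
    by (intro sum.cong refl) (simp add: discr_prob_eq[OF \<Lambda> \<sigma>] del: One_nat_def)
  finally show ?thesis .
qed

lemma emeasure_discr_spec:
  assumes \<Lambda>: "finite \<Lambda>" and \<sigma>: "\<sigma> \<in> UNIV \<rightarrow>\<^sub>E {1..q}" and B: "B \<in> sets (dcfg_space q)"
  shows "emeasure (discr_spec \<Phi> q \<Lambda> \<sigma>) B =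
    (\<Sum>\<tau>\<in>\<Lambda> \<rightarrow>\<^sub>E {1..q}. weight \<Lambda> (merge \<Lambda> (- \<Lambda>) (\<tau>, \<sigma>)) / total_weight \<Lambda> \<sigma> * indicator B (merge \<Lambda> (- \<Lambda>) (\<tau>, \<sigma>)))"
proof -
  have "B \<in> sets (discr_spec \<Phi> q \<Lambda> \<sigma>)" using B by (simp add: discr_spec_def)
  then have "emeasure (discr_spec \<Phi> q \<Lambda> \<sigma>) B = (\<integral>\<^sup>+\<sigma>. indicator B \<sigma> \<partial>discr_spec \<Phi> q \<Lambda> \<sigma>)" by simp
  also have "\<dots> = (\<Sum>\<tau>\<in>\<Lambda> \<rightarrow>\<^sub>E {1..q}. weight \<Lambda> (merge \<Lambda> (- \<Lambda>) (\<tau>, \<sigma>)) / total_weight \<Lambda> \<sigma> * indicator B (merge \<Lambda> (- \<Lambda>) (\<tau>, \<sigma>)))"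
    using B by (intro nn_integral_discr_spec[OF \<Lambda> \<sigma>]) simp
  finally show ?thesis .
qed

end

section \<open>Gibbs measures of the two specifications\<close>

context dobrushin_model
begin

lemma emeasure_lift:
  assumes \<mu>': "prob_space \<mu>'" "sets \<mu>' = sets (dcfg_space q)" and B: "B \<in> sets (cfg_space UNIV)"
  shows "emeasure (lift_measure \<Phi> q \<mu>') B = (\<integral>\<^sup>+\<sigma>. emeasure (cgibbs \<sigma>) B \<partial>\<mu>')"
  unfolding lift_measure_def
  by (rule emeasure_bind[OF prob_space.not_empty[OF \<mu>'(1)] _ B])
     (simp add: measurable_cong_sets[OF \<mu>'(2) refl] measurable_prob_algebraD[OF cgibbs_kernel])

lemma lift_measure_prob:
  assumes \<mu>': "prob_space \<mu>'" "sets \<mu>' = sets (dcfg_space q)"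
  shows "prob_space (lift_measure \<Phi> q \<mu>')" "sets (lift_measure \<Phi> q \<mu>') = sets (cfg_space UNIV)"
proof -
  interpret prob_space \<mu>' by fact
  have k: "cgibbs \<in> \<mu>' \<rightarrow>\<^sub>M prob_algebra (cfg_space UNIV)"
    using cgibbs_kernel by (simp add: measurable_cong_sets[OF \<mu>'(2) refl])
  show s: "sets (lift_measure \<Phi> q \<mu>') = sets (cfg_space UNIV)"
    unfolding lift_measure_def using not_empty sets_kernel[OF measurable_prob_algebraD[OF k]]
    by (intro sets_bind[where N="cfg_space UNIV"]) auto
  show "prob_space (lift_measure \<Phi> q \<mu>')"
  proof
    have sp: "space (lift_measure \<Phi> q \<mu>') = space (cfg_space UNIV)" by (rule sets_eq_imp_space_eq[OF s])
    have "emeasure (lift_measure \<Phi> q \<mu>') (space (lift_measure \<Phi> q \<mu>')) = (\<integral>\<^sup>+\<sigma>. emeasure (cgibbs \<sigma>) (space (cfg_space UNIV)) \<partial>\<mu>')"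
      unfolding sp by (rule emeasure_lift[OF \<mu>']) simp
    also have "\<dots> = (\<integral>\<^sup>+\<sigma>. 1 \<partial>\<mu>')"
    proof (rule nn_integral_cong)
      fix \<sigma> assume "\<sigma> \<in> space \<mu>'"
      then have \<sigma>: "\<sigma> \<in> UNIV \<rightarrow>\<^sub>E {1..q}" using sets_eq_imp_space_eq[OF \<mu>'(2)] by (simp add: space_dcfg)
      note lg = cgibbs_local_gibbs(1)[OF \<sigma>]
      show "emeasure (cgibbs \<sigma>) (space (cfg_space UNIV)) = 1"
        using prob_space.emeasure_space_1[OF local_gibbsD(1)[OF lg]] sets_eq_imp_space_eq[OF local_gibbsD(2)[OF lg]] by simp
    qed
    finally show "emeasure (lift_measure \<Phi> q \<mu>') (space (lift_measure \<Phi> q \<mu>')) = 1" by (simp add: emeasure_space_1)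
  qed
qed

lemma nn_integral_lift:
  assumes \<mu>': "prob_space \<mu>'" "sets \<mu>' = sets (dcfg_space q)" and f: "f \<in> borel_measurable (cfg_space UNIV)"
  shows "(\<integral>\<^sup>+\<omega>. f \<omega> \<partial>lift_measure \<Phi> q \<mu>') = (\<integral>\<^sup>+\<sigma>. \<integral>\<^sup>+\<omega>. f \<omega> \<partial>cgibbs \<sigma> \<partial>\<mu>')"
  unfolding lift_measure_def
  by (rule nn_integral_bind[OF f]) (simp add: measurable_cong_sets[OF \<mu>'(2) refl] measurable_prob_algebraD[OF cgibbs_kernel])

lemma cgibbs_AE_discr:
  assumes \<sigma>: "\<sigma> \<in> UNIV \<rightarrow>\<^sub>E {1..q}" shows "AE \<omega> in cgibbs \<sigma>. discr_cfg q \<omega> = \<sigma>"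
  using local_gibbs_AE[OF cgibbs_local_gibbs(1)[OF \<sigma>] arcs_admissible[OF \<sigma>]]
  by eventually_elim (auto simp: discr_cfg_def arcs_def spin_arc_def PiE_UNIV_iff)

lemma discr_measurable_on:
  assumes "sets \<mu> = sets (cfg_space UNIV)" shows "discr_cfg q \<in> \<mu> \<rightarrow>\<^sub>M dcfg_space q"
  unfolding measurable_cong_sets[OF assms refl] by (rule discr_cfg_measurable[OF q])

text \<open>The measure \<open>cgibbs \<sigma>\<close> is carried by the configurations with discretization \<open>\<sigma>\<close>.\<close>

lemma discr_lift:
  assumes \<mu>': "prob_space \<mu>'" "sets \<mu>' = sets (dcfg_space q)"
  shows "discr_measure q (lift_measure \<Phi> q \<mu>') = \<mu>'"
proof (rule measure_eqI)
  show "sets (discr_measure q (lift_measure \<Phi> q \<mu>')) = sets \<mu>'" by (simp add: discr_measure_def \<mu>'(2))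
  fix B assume "B \<in> sets (discr_measure q (lift_measure \<Phi> q \<mu>'))"
  then have B: "B \<in> sets (dcfg_space q)" by (simp add: discr_measure_def)
  let ?T = "discr_cfg q -` B \<inter> space (cfg_space UNIV)"
  have T: "?T \<in> sets (cfg_space UNIV)" by (rule measurable_sets[OF discr_cfg_measurable[OF q] B])
  note s = lift_measure_prob(2)[OF \<mu>']
  have "emeasure (discr_measure q (lift_measure \<Phi> q \<mu>')) B = emeasure (lift_measure \<Phi> q \<mu>') ?T"
    unfolding discr_measure_def using sets_eq_imp_space_eq[OF s]
    by (subst emeasure_distr[OF discr_measurable_on[OF s] B]) simp
  also have "\<dots> = (\<integral>\<^sup>+\<sigma>. emeasure (cgibbs \<sigma>) ?T \<partial>\<mu>')" by (rule emeasure_lift[OF \<mu>' T])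
  also have "\<dots> = (\<integral>\<^sup>+\<sigma>. indicator B \<sigma> \<partial>\<mu>')"
  proof (rule nn_integral_cong)
    fix \<sigma> assume "\<sigma> \<in> space \<mu>'"
    then have \<sigma>: "\<sigma> \<in> UNIV \<rightarrow>\<^sub>E {1..q}" using sets_eq_imp_space_eq[OF \<mu>'(2)] by (simp add: space_dcfg)
    note lg = cgibbs_local_gibbs(1)[OF \<sigma>]
    note s' = local_gibbsD(2)[OF lg]
    have "emeasure (cgibbs \<sigma>) ?T = (\<integral>\<^sup>+\<omega>. indicator ?T \<omega> \<partial>cgibbs \<sigma>)" using T s' by simp
    also have "\<dots> = (\<integral>\<^sup>+\<omega>. indicator B \<sigma> \<partial>cgibbs \<sigma>)"
    proof (rule nn_integral_cong_AE)
      show "AE \<omega> in cgibbs \<sigma>. (indicator ?T \<omega> :: ennreal) = indicator B \<sigma>"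
        using cgibbs_AE_discr[OF \<sigma>] AE_space
        by eventually_elim (auto simp: indicator_def sets_eq_imp_space_eq[OF s'])
    qed
    also have "\<dots> = indicator B \<sigma>" using prob_space.emeasure_space_1[OF local_gibbsD(1)[OF lg]] by simp
    finally show "emeasure (cgibbs \<sigma>) ?T = indicator B \<sigma>" .
  qed
  also have "\<dots> = emeasure \<mu>' B" using B \<mu>'(2) by simp
  finally show "emeasure (discr_measure q (lift_measure \<Phi> q \<mu>')) B = emeasure \<mu>' B" .
qed

lemma discr_measure_prob:
  assumes \<mu>: "prob_space \<mu>" "sets \<mu> = sets (cfg_space UNIV)"
  shows "prob_space (discr_measure q \<mu>)" "sets (discr_measure q \<mu>) = sets (dcfg_space q)"
  unfolding discr_measure_def by (rule prob_space.prob_space_distr[OF \<mu>(1) discr_measurable_on[OF \<mu>(2)]]) simp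

lemma lift_discr:
  assumes \<mu>: "local_gibbs UNIV (\<lambda>_. S1) \<mu>"
  shows "lift_measure \<Phi> q (discr_measure q \<mu>) = \<mu>"
proof (rule measure_eqI)
  note d = discr_measure_prob[OF local_gibbsD(1,2)[OF \<mu>]]
  note l = lift_measure_prob[OF d]
  show "sets (lift_measure \<Phi> q (discr_measure q \<mu>)) = sets \<mu>" by (simp add: l(2) local_gibbsD(2)[OF \<mu>])
  fix B assume "B \<in> sets (lift_measure \<Phi> q (discr_measure q \<mu>))"
  then have B: "B \<in> sets (cfg_space UNIV)" by (simp add: l(2))
  have "(\<lambda>\<sigma>. emeasure (cgibbs \<sigma>) B) \<in> borel_measurable (dcfg_space q)"
    by (rule measurable_compose[OF measurable_prob_algebraD[OF cgibbs_kernel] measurable_emeasure_subprob_algebra[OF B]])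
  then have "(\<integral>\<^sup>+\<sigma>. emeasure (cgibbs \<sigma>) B \<partial>discr_measure q \<mu>) = (\<integral>\<^sup>+\<omega>. emeasure (cgibbs (discr_cfg q \<omega>)) B \<partial>\<mu>)"
    unfolding discr_measure_def by (intro nn_integral_distr discr_measurable_on local_gibbsD(2)[OF \<mu>]) simp
  then show "emeasure (lift_measure \<Phi> q (discr_measure q \<mu>)) B = emeasure \<mu> B"
    using emeasure_lift[OF d B] gibbs_disintegration[OF \<mu> B] by simp
qed

lemma nn_integral_disintegration:
  assumes \<mu>: "local_gibbs UNIV (\<lambda>_. S1) \<mu>" and f: "f \<in> borel_measurable (cfg_space UNIV)"
  shows "(\<integral>\<^sup>+\<omega>. f \<omega> \<partial>\<mu>) = (\<integral>\<^sup>+\<omega>. \<integral>\<^sup>+\<omega>'. f \<omega>' \<partial>cgibbs (discr_cfg q \<omega>) \<partial>\<mu>)"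
proof -
  have "(\<integral>\<^sup>+\<omega>. f \<omega> \<partial>\<mu>) = (\<integral>\<^sup>+\<sigma>. \<integral>\<^sup>+\<omega>. f \<omega> \<partial>cgibbs \<sigma> \<partial>discr_measure q \<mu>)"
    using nn_integral_lift[OF discr_measure_prob[OF local_gibbsD(1,2)[OF \<mu>]] f] by (simp add: lift_discr[OF \<mu>])
  also have "\<dots> = (\<integral>\<^sup>+\<omega>. \<integral>\<^sup>+\<omega>'. f \<omega>' \<partial>cgibbs (discr_cfg q \<omega>) \<partial>\<mu>)"
    unfolding discr_measure_def
    by (intro nn_integral_distr discr_measurable_on local_gibbsD(2)[OF \<mu>]) (simp add: nn_integral_cgibbs_measurable[OF f])
  finally show ?thesis .
qed

abbreviation spin_at :: "'d site set \<Rightarrow> 'd dconfig \<Rightarrow> 'd dconfig \<Rightarrow> ennreal"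
  where "spin_at \<Lambda> \<tau> \<equiv> indicator {\<sigma>. restrict \<sigma> \<Lambda> = \<tau>}"

lemma spin_at_measurable:
  assumes \<Lambda>: "finite \<Lambda>" and \<tau>: "\<tau> \<in> \<Lambda> \<rightarrow>\<^sub>E {1..q}"
  shows "spin_at \<Lambda> \<tau> \<in> borel_measurable (dcfg_space q)"
proof -
  have "{\<sigma> \<in> space (dcfg_space q). \<sigma> j = \<tau> j} \<in> sets (dcfg_space q)" if "j \<in> \<Lambda>" for j
  proof -
    have "\<tau> j \<in> {1..q}" using \<tau> that by (rule PiE_mem)
    then have "(\<lambda>\<sigma>. \<sigma> j) -` {\<tau> j} \<inter> space (dcfg_space q) \<in> sets (dcfg_space q)"
      by (intro measurable_sets[of _ _ "count_space {1..q}"]) (auto simp: dcfg_space_def simp del: One_nat_def)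
    also have "(\<lambda>\<sigma>. \<sigma> j) -` {\<tau> j} \<inter> space (dcfg_space q) = {\<sigma> \<in> space (dcfg_space q). \<sigma> j = \<tau> j}" by auto
    finally show ?thesis .
  qed
  then have "{\<sigma> \<in> space (dcfg_space q). \<forall>j\<in>\<Lambda>. \<sigma> j = \<tau> j} \<in> sets (dcfg_space q)"
    using \<Lambda> by (intro sets.sets_Collect_finite_All) auto
  also have "{\<sigma> \<in> space (dcfg_space q). \<forall>j\<in>\<Lambda>. \<sigma> j = \<tau> j} = {\<sigma>. restrict \<sigma> \<Lambda> = \<tau>} \<inter> space (dcfg_space q)"
    using \<tau> by (auto simp: fun_eq_iff restrict_def PiE_def extensional_def)
  finally show ?thesis by (simp add: borel_measurable_indicator_iff)
qed

text \<open>The a priori spins are independent, and every arc has the same probability.\<close>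

lemma resample_spin_at:
  assumes \<Lambda>: "finite \<Lambda>" and \<tau>: "\<tau> \<in> \<Lambda> \<rightarrow>\<^sub>E {1..q}"
  shows "resample UNIV (\<lambda>_. S1) \<Lambda> (\<lambda>\<omega>. spin_at \<Lambda> \<tau> (discr_cfg q \<omega>)) \<omega> = (arc_mass / ennreal (2 * pi)) ^ card \<Lambda>"
proof -
  interpret product_sigma_finite "\<lambda>_. apriori S1"
    by (intro product_sigma_finite.intro prob_space_imp_sigma_finite prob_space_apriori admissible_S1)
  have \<tau>j: "\<tau> j \<in> {1..q}" if "j \<in> \<Lambda>" for j using \<tau> that by (rule PiE_mem)
  have "resample UNIV (\<lambda>_. S1) \<Lambda> (\<lambda>\<omega>. spin_at \<Lambda> \<tau> (discr_cfg q \<omega>)) \<omega> = (\<integral>\<^sup>+\<xi>. (\<Prod>j\<in>\<Lambda>. indicator (spin_arc q (\<tau> j)) (\<xi> j)) \<partial>PiM \<Lambda> (\<lambda>_. apriori S1))"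
    unfolding resample_def
  proof (rule nn_integral_cong)
    fix \<xi> assume "\<xi> \<in> space (PiM \<Lambda> (\<lambda>_. apriori S1))"
    then have \<xi>: "\<xi> \<in> \<Lambda> \<rightarrow>\<^sub>E S1" by (simp add: space_PiM)
    have "restrict (discr_cfg q (merge \<Lambda> (UNIV - \<Lambda>) (\<xi>, \<omega>))) \<Lambda> = \<tau> \<longleftrightarrow> (\<forall>j\<in>\<Lambda>. \<xi> j \<in> spin_arc q (\<tau> j))"
      using \<tau> \<xi> by (auto simp: fun_eq_iff restrict_def discr_cfg_def merge_def spin_arc_def PiE_def extensional_def)
    then show "spin_at \<Lambda> \<tau> (discr_cfg q (merge \<Lambda> (UNIV - \<Lambda>) (\<xi>, \<omega>))) = (\<Prod>j\<in>\<Lambda>. indicator (spin_arc q (\<tau> j)) (\<xi> j))"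
      using \<Lambda> by (auto simp: indicator_def prod_zero_iff)
  qed
  also have "\<dots> = (\<Prod>j\<in>\<Lambda>. \<integral>\<^sup>+x. indicator (spin_arc q (\<tau> j)) x \<partial>apriori S1)"
    by (rule product_nn_integral_prod[OF \<Lambda>]) (use spin_arc_sets[OF q] in simp)
  also have "\<dots> = (\<Prod>j\<in>\<Lambda>. arc_mass / ennreal (2 * pi))"
  proof (rule prod.cong[OF refl])
    fix j assume j: "j \<in> \<Lambda>"
    have "S1 \<inter> spin_arc q (\<tau> j) = spin_arc q (\<tau> j)" by (auto simp: spin_arc_def)
    then show "(\<integral>\<^sup>+x. indicator (spin_arc q (\<tau> j)) x \<partial>apriori S1) = arc_mass / ennreal (2 * pi)"
      using emeasure_spin_arc[OF q \<tau>j[OF j]] spin_arc_sets[OF q, of "\<tau> j"]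
      by (simp add: apriori_def emeasure_S1 arc_mass_def)
  qed
  finally show ?thesis by simp
qed

lemma discr_merge:
  "discr_cfg q (merge \<Lambda> (- \<Lambda>) (\<xi>, \<omega>)) = merge \<Lambda> (- \<Lambda>) (discr_cfg q \<xi>, discr_cfg q \<omega>)"
  by (auto simp: discr_cfg_def merge_def)

text \<open>One integral is computed in two ways. Averaging the spins in \<open>\<Lambda>\<close> produces the constant, because
  the other factors do not depend on the discretized spins in \<open>\<Lambda>\<close>. Disintegration over the fibres
  replaces \<open>inv_boltz\<close> by its mean on the fibre, the inverse of the weight, which cancels. Hence
  \<open>weight \<Lambda>\<close> is the density of the discretized spins in \<open>\<Lambda>\<close>, up to a factor without them.\<close>

lemma discr_weight_density:
  assumes \<mu>: "local_gibbs UNIV (\<lambda>_. S1) \<mu>" and \<Lambda>: "finite \<Lambda>" and \<tau>: "\<tau> \<in> \<Lambda> \<rightarrow>\<^sub>E {1..q}"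
    and g[measurable]: "g \<in> borel_measurable (dcfg_space q)" and off: "\<And>\<tau> \<sigma>. g (merge \<Lambda> (- \<Lambda>) (\<tau>, \<sigma>)) = g \<sigma>"
  shows "(\<integral>\<^sup>+\<omega>. spin_at \<Lambda> \<tau> (discr_cfg q \<omega>) * g (discr_cfg q \<omega>) \<partial>\<mu>) =
    (\<integral>\<^sup>+\<omega>. inv_boltz UNIV \<Lambda> \<omega> * (g (discr_cfg q \<omega>) * weight \<Lambda> (merge \<Lambda> (- \<Lambda>) (\<tau>, discr_cfg q \<omega>))) \<partial>\<mu>) *
      (arc_mass / ennreal (2 * pi)) ^ card \<Lambda>"
proof -
  note s\<mu> = local_gibbsD(2)[OF \<mu>] and sp = local_gibbsD(3)[OF \<mu>]
  note [measurable_cong] = s\<mu>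
  note [measurable] = discr_cfg_measurable[OF q] inv_boltz_measurable[OF \<Lambda>, of UNIV] spin_at_measurable[OF \<Lambda> \<tau>]
  define h where "h \<sigma> = g \<sigma> * weight \<Lambda> (merge \<Lambda> (- \<Lambda>) (\<tau>, \<sigma>))" for \<sigma>
  have [measurable]: "h \<in> borel_measurable (dcfg_space q)"
    unfolding h_def[abs_def] using measurable_compose[OF merge_dcfg_measurable[OF \<tau>] weight_measurable[OF \<Lambda>]] by measurable
  have h_off: "h (merge \<Lambda> (- \<Lambda>) (\<tau>', \<sigma>)) = h \<sigma>" for \<tau>' \<sigma> by (simp add: h_def off merge_merge')
  let ?\<kappa> = "(arc_mass / ennreal (2 * pi)) ^ card \<Lambda>"
  let ?T = "discr_cfg q"
  have "(\<integral>\<^sup>+\<omega>. inv_boltz UNIV \<Lambda> \<omega> * (h (?T \<omega>) * spin_at \<Lambda> \<tau> (?T \<omega>)) \<partial>\<mu>) =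
      (\<integral>\<^sup>+\<omega>. inv_boltz UNIV \<Lambda> \<omega> * resample UNIV (\<lambda>_. S1) \<Lambda> (\<lambda>\<omega>. h (?T \<omega>) * spin_at \<Lambda> \<tau> (?T \<omega>)) \<omega> \<partial>\<mu>)"
    by (rule local_gibbs_multi[OF \<mu> admissible_S1 \<Lambda>]) measurable
  also have "\<dots> = (\<integral>\<^sup>+\<omega>. inv_boltz UNIV \<Lambda> \<omega> * h (?T \<omega>) * ?\<kappa> \<partial>\<mu>)"
  proof (rule nn_integral_cong)
    fix \<omega> assume "\<omega> \<in> space \<mu>"
    then have \<omega>: "\<omega> \<in> Omega" by (simp add: sp)
    have "resample UNIV (\<lambda>_. S1) \<Lambda> (\<lambda>\<omega>. h (?T \<omega>) * spin_at \<Lambda> \<tau> (?T \<omega>)) \<omega> = h (?T \<omega>) * resample UNIV (\<lambda>_. S1) \<Lambda> (\<lambda>\<omega>. spin_at \<Lambda> \<tau> (?T \<omega>)) \<omega>"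
      by (rule resample_mult[OF subset_UNIV \<omega>]) (measurable, simp add: Compl_eq_Diff_UNIV[symmetric] discr_merge h_off)
    then show "inv_boltz UNIV \<Lambda> \<omega> * resample UNIV (\<lambda>_. S1) \<Lambda> (\<lambda>\<omega>. h (?T \<omega>) * spin_at \<Lambda> \<tau> (?T \<omega>)) \<omega> = inv_boltz UNIV \<Lambda> \<omega> * h (?T \<omega>) * ?\<kappa>"
      by (simp add: resample_spin_at[OF \<Lambda> \<tau>] mult.assoc)
  qed
  also have "\<dots> = (\<integral>\<^sup>+\<omega>. inv_boltz UNIV \<Lambda> \<omega> * h (?T \<omega>) \<partial>\<mu>) * ?\<kappa>"
    by (rule nn_integral_multc) measurable
  finally have 1: "(\<integral>\<^sup>+\<omega>. inv_boltz UNIV \<Lambda> \<omega> * (h (?T \<omega>) * spin_at \<Lambda> \<tau> (?T \<omega>)) \<partial>\<mu>) = (\<integral>\<^sup>+\<omega>. inv_boltz UNIV \<Lambda> \<omega> * h (?T \<omega>) \<partial>\<mu>) * ?\<kappa>" .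
  have "(\<integral>\<^sup>+\<omega>. inv_boltz UNIV \<Lambda> \<omega> * (h (?T \<omega>) * spin_at \<Lambda> \<tau> (?T \<omega>)) \<partial>\<mu>) =
      (\<integral>\<^sup>+\<omega>. \<integral>\<^sup>+\<omega>'. inv_boltz UNIV \<Lambda> \<omega>' * (h (?T \<omega>') * spin_at \<Lambda> \<tau> (?T \<omega>')) \<partial>cgibbs (?T \<omega>) \<partial>\<mu>)"
    by (rule nn_integral_disintegration[OF \<mu>]) measurable
  also have "\<dots> = (\<integral>\<^sup>+\<omega>. spin_at \<Lambda> \<tau> (?T \<omega>) * g (?T \<omega>) \<partial>\<mu>)"
  proof (rule nn_integral_cong)
    fix \<omega> assume "\<omega> \<in> space \<mu>"
    then have \<omega>: "\<omega> \<in> Omega" by (simp add: sp)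
    let ?\<sigma> = "?T \<omega>"
    have \<sigma>: "?\<sigma> \<in> UNIV \<rightarrow>\<^sub>E {1..q}" by (rule Omega_discr[OF \<omega>])
    note lg = cgibbs_local_gibbs(1)[OF \<sigma>]
    have "(\<integral>\<^sup>+\<omega>'. inv_boltz UNIV \<Lambda> \<omega>' * (h (?T \<omega>') * spin_at \<Lambda> \<tau> (?T \<omega>')) \<partial>cgibbs ?\<sigma>) =
        (\<integral>\<^sup>+\<omega>'. inv_boltz UNIV \<Lambda> \<omega>' * (h ?\<sigma> * spin_at \<Lambda> \<tau> ?\<sigma>) \<partial>cgibbs ?\<sigma>)"
    proof (rule nn_integral_cong_AE)
      show "AE \<omega>' in cgibbs ?\<sigma>. inv_boltz UNIV \<Lambda> \<omega>' * (h (?T \<omega>') * spin_at \<Lambda> \<tau> (?T \<omega>')) = inv_boltz UNIV \<Lambda> \<omega>' * (h ?\<sigma> * spin_at \<Lambda> \<tau> ?\<sigma>)"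
        using cgibbs_AE_discr[OF \<sigma>] by eventually_elim simp
    qed
    also have "\<dots> = (\<integral>\<^sup>+\<omega>'. inv_boltz UNIV \<Lambda> \<omega>' \<partial>cgibbs ?\<sigma>) * (h ?\<sigma> * spin_at \<Lambda> \<tau> ?\<sigma>)"
      by (rule nn_integral_multc) (simp cong: measurable_cong_sets add: local_gibbsD(2)[OF lg] inv_boltz_measurable[OF \<Lambda>])
    also have "\<dots> = spin_at \<Lambda> \<tau> ?\<sigma> * g ?\<sigma>"
    proof (cases "restrict ?\<sigma> \<Lambda> = \<tau>")
      case True
      then have "merge \<Lambda> (- \<Lambda>) (\<tau>, ?\<sigma>) = ?\<sigma>" using merge_self[of \<Lambda> ?\<sigma>] by simp
      then have "h ?\<sigma> = g ?\<sigma> * weight \<Lambda> ?\<sigma>" by (simp add: h_def)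
      then have "(\<integral>\<^sup>+\<omega>'. inv_boltz UNIV \<Lambda> \<omega>' \<partial>cgibbs ?\<sigma>) * h ?\<sigma> = ((\<integral>\<^sup>+\<omega>'. inv_boltz UNIV \<Lambda> \<omega>' \<partial>cgibbs ?\<sigma>) * weight \<Lambda> ?\<sigma>) * g ?\<sigma>"
        by (simp add: ac_simps)
      then show ?thesis using weight_bounds(3)[OF \<Lambda> \<sigma>] True by simp
    qed simp
    finally show "(\<integral>\<^sup>+\<omega>'. inv_boltz UNIV \<Lambda> \<omega>' * (h (?T \<omega>') * spin_at \<Lambda> \<tau> (?T \<omega>')) \<partial>cgibbs ?\<sigma>) = spin_at \<Lambda> \<tau> ?\<sigma> * g ?\<sigma>" .
  qed
  finally show ?thesis using 1 by (simp add: h_def)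
qed

text \<open>By \<open>discr_weight_density\<close> the conditional probabilities of the discretized spins in \<open>\<Lambda>\<close> are
  proportional to their weights.\<close>

lemma discr_measure_gibbs:
  assumes \<mu>: "local_gibbs UNIV (\<lambda>_. S1) \<mu>"
  shows "discr_measure q \<mu> \<in> gibbs_measures UNIV (dcfg_space q) (discr_spec \<Phi> q)"
  unfolding gibbs_measures_def
proof (safe intro!: discr_measure_prob[OF local_gibbsD(1,2)[OF \<mu>]])
  fix \<Lambda> :: "'d site set" and B :: "'d dconfig set" assume \<Lambda>: "finite \<Lambda>" and B[measurable]: "B \<in> sets (dcfg_space q)"
  note s\<mu> = local_gibbsD(2)[OF \<mu>] and sp = local_gibbsD(3)[OF \<mu>]
  note [measurable_cong] = s\<mu>
  let ?T = "discr_cfg q" and ?PE = "\<Lambda> \<rightarrow>\<^sub>E {1..q}"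
  let ?\<kappa> = "(arc_mass / ennreal (2 * pi)) ^ card \<Lambda>"
  let ?m = "\<lambda>\<tau> \<sigma>. merge \<Lambda> (- \<Lambda>) (\<tau>, \<sigma>)"
  have fin: "finite ?PE" using \<Lambda> by (intro finite_PiE) auto
  define G where "G \<tau> \<sigma> = weight \<Lambda> (?m \<tau> \<sigma>) / total_weight \<Lambda> \<sigma> * indicator B (?m \<tau> \<sigma>)" for \<tau> \<sigma>
  note [measurable] = discr_cfg_measurable[OF q] inv_boltz_measurable[OF \<Lambda>, of UNIV] total_weight_measurable[OF \<Lambda>]
  have wm[measurable]: "(\<lambda>\<sigma>. weight \<Lambda> (?m \<tau> \<sigma>)) \<in> borel_measurable (dcfg_space q)"
    and Bm[measurable]: "(\<lambda>\<sigma>. indicator B (?m \<tau> \<sigma>) :: ennreal) \<in> borel_measurable (dcfg_space q)"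
    and am[measurable]: "spin_at \<Lambda> \<tau> \<in> borel_measurable (dcfg_space q)" if "\<tau> \<in> ?PE" for \<tau>
    using measurable_compose[OF merge_dcfg_measurable[OF that] weight_measurable[OF \<Lambda>]]
      measurable_compose[OF merge_dcfg_measurable[OF that] borel_measurable_indicator[OF B]] spin_at_measurable[OF \<Lambda> that] by auto
  have Gm: "G \<tau> \<in> borel_measurable (dcfg_space q)" if "\<tau> \<in> ?PE" for \<tau>
    unfolding G_def[abs_def] using wm[OF that] Bm[OF that] by measurable
  have G_off: "G \<tau> (?m \<tau>' \<sigma>) = G \<tau> \<sigma>" for \<tau> \<tau>' \<sigma> by (simp add: G_def merge_merge' total_weight_merge)
  have step: "(\<integral>\<^sup>+\<omega>. G \<tau> (?T \<omega>) \<partial>\<mu>) = (\<integral>\<^sup>+\<omega>. spin_at \<Lambda> \<tau> (?T \<omega>) * indicator B (?m \<tau> (?T \<omega>)) \<partial>\<mu>)" if \<tau>: "\<tau> \<in> ?PE" for \<tau>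
  proof -
    note [measurable] = Gm[OF \<tau>]
    have "(\<integral>\<^sup>+\<omega>. G \<tau> (?T \<omega>) \<partial>\<mu>) = (\<integral>\<^sup>+\<omega>. (\<Sum>\<tau>'\<in>?PE. spin_at \<Lambda> \<tau>' (?T \<omega>) * G \<tau> (?T \<omega>)) \<partial>\<mu>)"
    proof (rule nn_integral_cong)
      fix \<omega> assume "\<omega> \<in> space \<mu>"
      then have "?T \<omega> \<in> UNIV \<rightarrow>\<^sub>E {1..q}" by (intro Omega_discr) (simp add: sp)
      from sum_merge_indicator[OF \<Lambda> this, of "G \<tau>"]
      show "G \<tau> (?T \<omega>) = (\<Sum>\<tau>'\<in>?PE. spin_at \<Lambda> \<tau>' (?T \<omega>) * G \<tau> (?T \<omega>))" by (simp only: G_off)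
    qed
    also have "\<dots> = (\<Sum>\<tau>'\<in>?PE. \<integral>\<^sup>+\<omega>. spin_at \<Lambda> \<tau>' (?T \<omega>) * G \<tau> (?T \<omega>) \<partial>\<mu>)"
      by (rule nn_integral_sum) (use am in measurable)
    also have "\<dots> = (\<Sum>\<tau>'\<in>?PE. (\<integral>\<^sup>+\<omega>. inv_boltz UNIV \<Lambda> \<omega> * (G \<tau> (?T \<omega>) * weight \<Lambda> (?m \<tau>' (?T \<omega>))) \<partial>\<mu>) * ?\<kappa>)"
      by (intro sum.cong refl discr_weight_density[OF \<mu> \<Lambda> _ Gm[OF \<tau>] G_off])
    also have "\<dots> = (\<Sum>\<tau>'\<in>?PE. \<integral>\<^sup>+\<omega>. inv_boltz UNIV \<Lambda> \<omega> * (G \<tau> (?T \<omega>) * weight \<Lambda> (?m \<tau>' (?T \<omega>))) \<partial>\<mu>) * ?\<kappa>"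
      by (simp only: sum_distrib_right)
    also have "(\<Sum>\<tau>'\<in>?PE. \<integral>\<^sup>+\<omega>. inv_boltz UNIV \<Lambda> \<omega> * (G \<tau> (?T \<omega>) * weight \<Lambda> (?m \<tau>' (?T \<omega>))) \<partial>\<mu>) =
        (\<integral>\<^sup>+\<omega>. (\<Sum>\<tau>'\<in>?PE. inv_boltz UNIV \<Lambda> \<omega> * (G \<tau> (?T \<omega>) * weight \<Lambda> (?m \<tau>' (?T \<omega>)))) \<partial>\<mu>)"
      by (rule nn_integral_sum[symmetric]) (use wm in measurable)
    also have "\<dots> = (\<integral>\<^sup>+\<omega>. inv_boltz UNIV \<Lambda> \<omega> * (indicator B (?m \<tau> (?T \<omega>)) * weight \<Lambda> (?m \<tau> (?T \<omega>))) \<partial>\<mu>)"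
    proof (rule nn_integral_cong)
      fix \<omega> assume "\<omega> \<in> space \<mu>"
      then have \<sigma>: "?T \<omega> \<in> UNIV \<rightarrow>\<^sub>E {1..q}" by (intro Omega_discr) (simp add: sp)
      have "G \<tau> (?T \<omega>) * total_weight \<Lambda> (?T \<omega>) = indicator B (?m \<tau> (?T \<omega>)) * (weight \<Lambda> (?m \<tau> (?T \<omega>)) / total_weight \<Lambda> (?T \<omega>) * total_weight \<Lambda> (?T \<omega>))"
        by (simp only: G_def ac_simps)
      also have "weight \<Lambda> (?m \<tau> (?T \<omega>)) / total_weight \<Lambda> (?T \<omega>) * total_weight \<Lambda> (?T \<omega>) = weight \<Lambda> (?m \<tau> (?T \<omega>))"
        using total_weight_bounds[OF \<Lambda> \<sigma>] by (simp add: ennreal_divide_times ennreal_divide_self less_top)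
      finally show "(\<Sum>\<tau>'\<in>?PE. inv_boltz UNIV \<Lambda> \<omega> * (G \<tau> (?T \<omega>) * weight \<Lambda> (?m \<tau>' (?T \<omega>)))) =
          inv_boltz UNIV \<Lambda> \<omega> * (indicator B (?m \<tau> (?T \<omega>)) * weight \<Lambda> (?m \<tau> (?T \<omega>)))"
        by (simp only: sum_distrib_left[symmetric] total_weight_def[symmetric])
    qed
    also have "(\<integral>\<^sup>+\<omega>. inv_boltz UNIV \<Lambda> \<omega> * (indicator B (?m \<tau> (?T \<omega>)) * weight \<Lambda> (?m \<tau> (?T \<omega>))) \<partial>\<mu>) * ?\<kappa> =
        (\<integral>\<^sup>+\<omega>. spin_at \<Lambda> \<tau> (?T \<omega>) * indicator B (?m \<tau> (?T \<omega>)) \<partial>\<mu>)"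
      by (rule discr_weight_density[OF \<mu> \<Lambda> \<tau> Bm[OF \<tau>], symmetric]) (simp add: merge_merge')
    finally show ?thesis .
  qed
  have "(\<integral>\<^sup>+\<sigma>. emeasure (discr_spec \<Phi> q \<Lambda> \<sigma>) B \<partial>discr_measure q \<mu>) = (\<integral>\<^sup>+\<sigma>. (\<Sum>\<tau>\<in>?PE. G \<tau> \<sigma>) \<partial>discr_measure q \<mu>)"
    by (intro nn_integral_cong) (simp add: discr_measure_def space_dcfg emeasure_discr_spec[OF \<Lambda> _ B] G_def del: One_nat_def atLeastAtMost_iff)
  also have "\<dots> = (\<integral>\<^sup>+\<omega>. (\<Sum>\<tau>\<in>?PE. G \<tau> (?T \<omega>)) \<partial>\<mu>)"
    unfolding discr_measure_def using Gm by (intro nn_integral_distr) measurable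
  also have "\<dots> = (\<Sum>\<tau>\<in>?PE. \<integral>\<^sup>+\<omega>. G \<tau> (?T \<omega>) \<partial>\<mu>)"
    by (rule nn_integral_sum) (use Gm in measurable)
  also have "\<dots> = (\<Sum>\<tau>\<in>?PE. \<integral>\<^sup>+\<omega>. spin_at \<Lambda> \<tau> (?T \<omega>) * indicator B (?m \<tau> (?T \<omega>)) \<partial>\<mu>)"
    by (rule sum.cong[OF refl step])
  also have "\<dots> = (\<integral>\<^sup>+\<omega>. (\<Sum>\<tau>\<in>?PE. spin_at \<Lambda> \<tau> (?T \<omega>) * indicator B (?m \<tau> (?T \<omega>))) \<partial>\<mu>)"
    by (rule nn_integral_sum[symmetric]) (use am Bm in measurable)
  also have "\<dots> = (\<integral>\<^sup>+\<omega>. indicator B (?T \<omega>) \<partial>\<mu>)"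
    by (intro nn_integral_cong sum_merge_indicator[OF \<Lambda>] Omega_discr) (simp add: sp)
  also have "\<dots> = (\<integral>\<^sup>+\<sigma>. indicator B \<sigma> \<partial>discr_measure q \<mu>)"
    unfolding discr_measure_def by (rule nn_integral_distr[symmetric]) measurable
  also have "\<dots> = emeasure (discr_measure q \<mu>) B"
    using B by (simp add: discr_measure_def)
  finally show "emeasure (discr_measure q \<mu>) B = (\<integral>\<^sup>+\<sigma>. emeasure (discr_spec \<Phi> q \<Lambda> \<sigma>) B \<partial>discr_measure q \<mu>)" ..
qed

lemma discr_spec_kernel:
  assumes \<Lambda>: "finite \<Lambda>" shows "discr_spec \<Phi> q \<Lambda> \<in> dcfg_space q \<rightarrow>\<^sub>M subprob_algebra (dcfg_space q)"
proof (rule measurable_subprob_algebra)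
  let ?PE = "\<Lambda> \<rightarrow>\<^sub>E {1..q}"
  have fin: "finite ?PE" using \<Lambda> by (intro finite_PiE) auto
  show "sets (discr_spec \<Phi> q \<Lambda> \<sigma>) = sets (dcfg_space q)" for \<sigma> by (simp add: discr_spec_def)
  fix \<sigma> :: "'d dconfig" assume "\<sigma> \<in> space (dcfg_space q)"
  then have \<sigma>: "\<sigma> \<in> UNIV \<rightarrow>\<^sub>E {1..q}" by (simp add: space_dcfg)
  have "prob_space (discr_spec \<Phi> q \<Lambda> \<sigma>)"
  proof
    have "emeasure (discr_spec \<Phi> q \<Lambda> \<sigma>) (space (discr_spec \<Phi> q \<Lambda> \<sigma>)) = (\<integral>\<^sup>+\<sigma>. 1 \<partial>discr_spec \<Phi> q \<Lambda> \<sigma>)" by simp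
    also have "\<dots> = (\<Sum>\<tau>\<in>?PE. weight \<Lambda> (merge \<Lambda> (- \<Lambda>) (\<tau>, \<sigma>)) / total_weight \<Lambda> \<sigma>)"
      by (subst nn_integral_discr_spec[OF \<Lambda> \<sigma>]) (simp_all del: One_nat_def)
    also have "\<dots> = total_weight \<Lambda> \<sigma> / total_weight \<Lambda> \<sigma>"
      unfolding divide_ennreal_def by (simp only: sum_distrib_right[symmetric] total_weight_def[symmetric])
    also have "\<dots> = 1" using total_weight_bounds[OF \<Lambda> \<sigma>] by (simp add: ennreal_divide_self less_top)
    finally show "emeasure (discr_spec \<Phi> q \<Lambda> \<sigma>) (space (discr_spec \<Phi> q \<Lambda> \<sigma>)) = 1" .
  qed
  then show "subprob_space (discr_spec \<Phi> q \<Lambda> \<sigma>)" by (rule prob_space_imp_subprob_space)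
next
  let ?PE = "\<Lambda> \<rightarrow>\<^sub>E {1..q}"
  fix B assume B: "B \<in> sets (dcfg_space q :: 'd dconfig measure)"
  have "(\<lambda>\<sigma>. \<Sum>\<tau>\<in>?PE. weight \<Lambda> (merge \<Lambda> (- \<Lambda>) (\<tau>, \<sigma>)) / total_weight \<Lambda> \<sigma> * indicator B (merge \<Lambda> (- \<Lambda>) (\<tau>, \<sigma>))) \<in> borel_measurable (dcfg_space q)"
    using measurable_compose[OF merge_dcfg_measurable weight_measurable[OF \<Lambda>]] total_weight_measurable[OF \<Lambda>]
      measurable_compose[OF merge_dcfg_measurable borel_measurable_indicator[OF B]]
    by (intro borel_measurable_sum borel_measurable_times_ennreal borel_measurable_divide_ennreal) auto
  then show "(\<lambda>\<sigma>. emeasure (discr_spec \<Phi> q \<Lambda> \<sigma>) B) \<in> borel_measurable (dcfg_space q)"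
    by (rule measurable_cong[THEN iffD1, rotated]) (simp add: space_dcfg emeasure_discr_spec[OF \<Lambda> _ B] del: One_nat_def atLeastAtMost_iff)
qed

lemma gibbs_discr_nn_integral:
  assumes \<mu>': "\<mu>' \<in> gibbs_measures UNIV (dcfg_space q) (discr_spec \<Phi> q)" and \<Lambda>: "finite \<Lambda>"
    and h: "h \<in> borel_measurable (dcfg_space q)"
  shows "(\<integral>\<^sup>+\<sigma>. h \<sigma> \<partial>\<mu>') = (\<integral>\<^sup>+\<sigma>. \<integral>\<^sup>+\<sigma>'. h \<sigma>' \<partial>discr_spec \<Phi> q \<Lambda> \<sigma> \<partial>\<mu>')"
proof -
  have p: "prob_space \<mu>'" and s: "sets \<mu>' = sets (dcfg_space q)"
    and dlr: "\<And>B. B \<in> sets (dcfg_space q) \<Longrightarrow> emeasure \<mu>' B = (\<integral>\<^sup>+\<sigma>. emeasure (discr_spec \<Phi> q \<Lambda> \<sigma>) B \<partial>\<mu>')"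
    using \<mu>' \<Lambda> by (auto simp: gibbs_measures_def)
  have K: "discr_spec \<Phi> q \<Lambda> \<in> \<mu>' \<rightarrow>\<^sub>M subprob_algebra (dcfg_space q)"
    unfolding measurable_cong_sets[OF s refl] by (rule discr_spec_kernel[OF \<Lambda>])
  have "\<mu>' = \<mu>' \<bind> discr_spec \<Phi> q \<Lambda>"
  proof (rule measure_eqI)
    show "sets \<mu>' = sets (\<mu>' \<bind> discr_spec \<Phi> q \<Lambda>)"
      using prob_space.not_empty[OF p] sets_kernel[OF K] s by (subst sets_bind[where N="dcfg_space q"]) auto
    fix B assume "B \<in> sets \<mu>'"
    then have B: "B \<in> sets (dcfg_space q)" by (simp add: s)
    show "emeasure \<mu>' B = emeasure (\<mu>' \<bind> discr_spec \<Phi> q \<Lambda>) B"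
      unfolding emeasure_bind[OF prob_space.not_empty[OF p] K B] by (rule dlr[OF B])
  qed
  then have "(\<integral>\<^sup>+\<sigma>. h \<sigma> \<partial>\<mu>') = (\<integral>\<^sup>+\<sigma>. h \<sigma> \<partial>(\<mu>' \<bind> discr_spec \<Phi> q \<Lambda>))" by simp
  also have "\<dots> = (\<integral>\<^sup>+\<sigma>. \<integral>\<^sup>+\<sigma>'. h \<sigma>' \<partial>discr_spec \<Phi> q \<Lambda> \<sigma> \<partial>\<mu>')" by (rule nn_integral_bind[OF h K])
  finally show ?thesis .
qed

lemma sum_PiE_singleton:
  fixes F :: "nat \<Rightarrow> ennreal"
  shows "(\<Sum>\<tau>\<in>{i::'d site} \<rightarrow>\<^sub>E {1..q}. F (\<tau> i)) = (\<Sum>a\<in>{1..q}. F a)"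
proof -
  have "bij_betw (\<lambda>\<tau>. \<tau> i) ({i} \<rightarrow>\<^sub>E {1..q}) {1..q}"
    by (rule bij_betw_byWitness[where f'="\<lambda>a. \<lambda>j\<in>{i}. a"]) (auto simp: PiE_def extensional_def fun_eq_iff restrict_def)
  then show ?thesis by (rule sum.reindex_bij_betw)
qed

text \<open>Weighting with \<open>inv_boltz\<close> decouples the site \<open>i\<close>: its spin becomes uniform on its arc, and the
  others are distributed according to \<open>cut {i} (cgibbs \<sigma>)\<close>.\<close>

lemma weight_cgibbs_resample:
  assumes \<sigma>: "\<sigma> \<in> UNIV \<rightarrow>\<^sub>E {1..q}" and f: "f \<in> borel_measurable (cfg_space UNIV)"
  shows "weight {i} \<sigma> * (\<integral>\<^sup>+\<omega>. inv_boltz UNIV {i} \<omega> * f \<omega> \<partial>cgibbs \<sigma>) =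
    (\<integral>\<^sup>+\<eta>. resample1 (spin_arc q (\<sigma> i)) i f \<eta> \<partial>cut {i} (cgibbs \<sigma>))"
proof -
  note lg = cgibbs_local_gibbs(1)[OF \<sigma>] and S = arcs_admissible[OF \<sigma>]
  note lc = local_gibbs_cut[OF lg S, of "{i}"]
  let ?R = "resample1 (arcs \<sigma> i) i f"
  have Rm: "?R \<in> borel_measurable (cfg_space (UNIV - {i}))"
    by (rule nn_integral_glue_base(2)[OF UNIV_I local_gibbsD(1)[OF lc] local_gibbsD(2)[OF lc] S f]) simp_all
  have "(\<integral>\<^sup>+\<eta>. ?R \<eta> \<partial>cut {i} (cgibbs \<sigma>)) = (\<integral>\<^sup>+\<omega>. inv_boltz UNIV {i} \<omega> * ?R (restrict \<omega> (UNIV - {i})) \<partial>cgibbs \<sigma>) / (\<integral>\<^sup>+\<omega>. inv_boltz UNIV {i} \<omega> \<partial>cgibbs \<sigma>)"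
    by (rule nn_integral_cut[OF local_gibbsD(2)[OF lg] _ Rm]) simp
  also have "(\<lambda>\<omega>. ?R (restrict \<omega> (UNIV - {i}))) = ?R"
  proof
    fix \<omega> :: "'d config"
    have "fun_upd (restrict \<omega> (UNIV - {i})) i x = fun_upd \<omega> i x" for x by (auto simp: restrict_def)
    then show "?R (restrict \<omega> (UNIV - {i})) = ?R \<omega>" by (simp add: resample1_def)
  qed
  also have "(\<integral>\<^sup>+\<omega>. inv_boltz UNIV {i} \<omega> * ?R \<omega> \<partial>cgibbs \<sigma>) = (\<integral>\<^sup>+\<omega>. inv_boltz UNIV {i} \<omega> * f \<omega> \<partial>cgibbs \<sigma>)"
    by (rule local_gibbsD(4)[OF lg UNIV_I f, symmetric])
  finally show ?thesis by (simp add: weight_def divide_ennreal_def mult.commute arcs_def)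
qed

text \<open>Apply the DLR equation of \<open>\<mu>'\<close> at \<open>i\<close>. The probabilities of the arcs at \<open>i\<close> cancel against the
  normalizing constants of the constrained measures, and averages over the arcs add up to an
  average over the circle. The result depends on \<open>f\<close> only through \<open>resample1 S1 i f\<close>.\<close>

lemma lift_measure_gibbs:
  assumes \<mu>': "\<mu>' \<in> gibbs_measures UNIV (dcfg_space q) (discr_spec \<Phi> q)"
  shows "local_gibbs UNIV (\<lambda>_. S1) (lift_measure \<Phi> q \<mu>')"
  unfolding local_gibbs_def
proof (intro conjI ballI)
  have p: "prob_space \<mu>'" and s: "sets \<mu>' = sets (dcfg_space q)" using \<mu>' by (auto simp: gibbs_measures_def)
  show "prob_space (lift_measure \<Phi> q \<mu>')" "sets (lift_measure \<Phi> q \<mu>') = sets (cfg_space UNIV)"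
    by (rule lift_measure_prob[OF p s])+
  fix i :: "'d site" and f :: "'d config \<Rightarrow> ennreal" assume f: "f \<in> borel_measurable (cfg_space UNIV)"
  have R1: "resample1 S1 i f \<in> borel_measurable (cfg_space UNIV)" by (rule resample1_measurable[OF UNIV_I admissible_S1 f])
  \<comment> \<open>The average over the circle is the mean, not the sum, of the averages over the arcs; this is
    the factor \<open>of_nat q\<close>.\<close>
  have form: "(\<integral>\<^sup>+\<omega>. inv_boltz UNIV {i} \<omega> * g \<omega> \<partial>lift_measure \<Phi> q \<mu>') =
      (\<integral>\<^sup>+\<sigma>. (\<integral>\<^sup>+\<eta>. of_nat q * resample1 S1 i g \<eta> \<partial>cut {i} (cgibbs \<sigma>)) / total_weight {i} \<sigma> \<partial>\<mu>')"
    if g: "g \<in> borel_measurable (cfg_space UNIV)" for g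
  proof -
    define E where "E \<sigma> = (\<integral>\<^sup>+\<omega>. inv_boltz UNIV {i} \<omega> * g \<omega> \<partial>cgibbs \<sigma>)" for \<sigma>
    have im: "(\<lambda>\<omega>. inv_boltz UNIV {i} \<omega> * g \<omega>) \<in> borel_measurable (cfg_space UNIV)"
      using g inv_boltz_measurable[of "{i}" UNIV] by measurable
    have "(\<integral>\<^sup>+\<omega>. inv_boltz UNIV {i} \<omega> * g \<omega> \<partial>lift_measure \<Phi> q \<mu>') = (\<integral>\<^sup>+\<sigma>. E \<sigma> \<partial>\<mu>')"
      unfolding E_def by (rule nn_integral_lift[OF p s im])
    also have "\<dots> = (\<integral>\<^sup>+\<sigma>. \<integral>\<^sup>+\<sigma>'. E \<sigma>' \<partial>discr_spec \<Phi> q {i} \<sigma> \<partial>\<mu>')"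
      by (rule gibbs_discr_nn_integral[OF \<mu>']) (simp_all add: E_def[abs_def] nn_integral_cgibbs_measurable[OF im])
    also have "\<dots> = (\<integral>\<^sup>+\<sigma>. (\<integral>\<^sup>+\<eta>. of_nat q * resample1 S1 i g \<eta> \<partial>cut {i} (cgibbs \<sigma>)) / total_weight {i} \<sigma> \<partial>\<mu>')"
    proof (rule nn_integral_cong)
      fix \<sigma> assume "\<sigma> \<in> space \<mu>'"
      then have \<sigma>: "\<sigma> \<in> UNIV \<rightarrow>\<^sub>E {1..q}" using sets_eq_imp_space_eq[OF s] by (simp add: space_dcfg)
      let ?m = "\<lambda>\<tau>. merge {i} (- {i}) (\<tau>, \<sigma>)" and ?\<nu> = "cut {i} (cgibbs \<sigma>)"
      note lc = local_gibbs_cut[OF cgibbs_local_gibbs(1)[OF \<sigma>] arcs_admissible[OF \<sigma>], of "{i}"]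
      have s\<nu>: "sets ?\<nu> = sets (cfg_space (UNIV - {i}))" and sp\<nu>: "space ?\<nu> = (UNIV - {i}) \<rightarrow>\<^sub>E S1"
        using local_gibbsD(2,3)[OF lc] by simp_all
      have Rm: "resample1 (spin_arc q a) i g \<in> borel_measurable ?\<nu>" if "a \<in> {1..q}" for a
      proof -
        have "resample1 (spin_arc q a) i g \<in> borel_measurable (cfg_space (UNIV - {i}))"
          by (rule nn_integral_glue_base(2)[where \<nu>="?\<nu>" and S="\<lambda>_. spin_arc q a", OF UNIV_I _ s\<nu> admissible_arc[OF q that] g])
             (use local_gibbsD(1)[OF lc] in simp)
        then show ?thesis by (simp cong: measurable_cong_sets add: s\<nu>)
      qed
      have "(\<integral>\<^sup>+\<sigma>'. E \<sigma>' \<partial>discr_spec \<Phi> q {i} \<sigma>) = (\<Sum>\<tau>\<in>{i} \<rightarrow>\<^sub>E {1..q}. weight {i} (?m \<tau>) / total_weight {i} \<sigma> * E (?m \<tau>))"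
        by (rule nn_integral_discr_spec[OF _ \<sigma>]) (simp_all add: E_def[abs_def] nn_integral_cgibbs_measurable[OF im])
      also have "\<dots> = (\<Sum>\<tau>\<in>{i} \<rightarrow>\<^sub>E {1..q}. (\<integral>\<^sup>+\<eta>. resample1 (spin_arc q (\<tau> i)) i g \<eta> \<partial>?\<nu>) / total_weight {i} \<sigma>)"
      proof (rule sum.cong[OF refl])
        fix \<tau> assume \<tau>: "\<tau> \<in> {i} \<rightarrow>\<^sub>E {1..q}"
        note m = merge_dcfg[OF \<tau> \<sigma>]
        have "cut {i} (cgibbs (?m \<tau>)) = ?\<nu>" by (rule cut_cong[OF _ m \<sigma>]) (simp_all add: merge_def)
        moreover have "?m \<tau> i = \<tau> i" by (simp add: merge_def)
        ultimately have "weight {i} (?m \<tau>) * E (?m \<tau>) = (\<integral>\<^sup>+\<eta>. resample1 (spin_arc q (\<tau> i)) i g \<eta> \<partial>?\<nu>)"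
          using weight_cgibbs_resample[OF m g, of i] by (simp add: E_def)
        then show "weight {i} (?m \<tau>) / total_weight {i} \<sigma> * E (?m \<tau>) = (\<integral>\<^sup>+\<eta>. resample1 (spin_arc q (\<tau> i)) i g \<eta> \<partial>?\<nu>) / total_weight {i} \<sigma>"
          by (simp add: divide_ennreal_def ac_simps flip: mult.assoc)
      qed
      also have "\<dots> = (\<Sum>a\<in>{1..q}. (\<integral>\<^sup>+\<eta>. resample1 (spin_arc q a) i g \<eta> \<partial>?\<nu>) / total_weight {i} \<sigma>)"
        by (rule sum_PiE_singleton[of "\<lambda>a. (\<integral>\<^sup>+\<eta>. resample1 (spin_arc q a) i g \<eta> \<partial>?\<nu>) / total_weight {i} \<sigma>"])
      also have "\<dots> = (\<Sum>a\<in>{1..q}. \<integral>\<^sup>+\<eta>. resample1 (spin_arc q a) i g \<eta> \<partial>?\<nu>) / total_weight {i} \<sigma>"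
        unfolding divide_ennreal_def by (rule sum_distrib_right[symmetric])
      also have "(\<Sum>a\<in>{1..q}. \<integral>\<^sup>+\<eta>. resample1 (spin_arc q a) i g \<eta> \<partial>?\<nu>) = (\<integral>\<^sup>+\<eta>. (\<Sum>a\<in>{1..q}. resample1 (spin_arc q a) i g \<eta>) \<partial>?\<nu>)"
        by (rule nn_integral_sum[symmetric]) (rule Rm)
      also have "\<dots> = (\<integral>\<^sup>+\<eta>. of_nat q * resample1 S1 i g \<eta> \<partial>?\<nu>)"
      proof (rule nn_integral_cong)
        fix \<eta> assume "\<eta> \<in> space ?\<nu>"
        then have "(\<lambda>x. fun_upd \<eta> i x) \<in> circle_measure \<rightarrow>\<^sub>M cfg_space UNIV"
          using measurable_compose[OF measurable_Pair1' upd_measurable_glue[of i UNIV], of \<eta>] by (simp add: space_cfg sp\<nu>)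
        from nn_integral_S1_arcs[OF q measurable_compose[OF this g]]
        have "resample1 S1 i g \<eta> = (\<Sum>a\<in>{1..q}. resample1 (spin_arc q a) i g \<eta>) / of_nat q"
          unfolding resample1_def .
        moreover have "(of_nat q :: ennreal) \<noteq> 0" "(of_nat q :: ennreal) \<noteq> top" using q by (simp_all add: ennreal_of_nat_neq_top)
        ultimately show "(\<Sum>a\<in>{1..q}. resample1 (spin_arc q a) i g \<eta>) = of_nat q * resample1 S1 i g \<eta>"
          by (simp only: ennreal_times_divide mult.commute[of "of_nat q"] mult_divide_eq_ennreal not_False_eq_True)
      qed
      finally show "(\<integral>\<^sup>+\<sigma>'. E \<sigma>' \<partial>discr_spec \<Phi> q {i} \<sigma>) = (\<integral>\<^sup>+\<eta>. of_nat q * resample1 S1 i g \<eta> \<partial>?\<nu>) / total_weight {i} \<sigma>" .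
    qed
    finally show ?thesis .
  qed
  have "resample1 S1 i (resample1 S1 i f) \<eta> = resample1 S1 i f \<eta>" for \<eta>
    unfolding resample1_def[of S1 i "resample1 S1 i f"] resample1_upd
    using prob_space.emeasure_space_1[OF prob_space_apriori[OF admissible_S1]] by simp
  then show "(\<integral>\<^sup>+\<omega>. inv_boltz UNIV {i} \<omega> * f \<omega> \<partial>lift_measure \<Phi> q \<mu>') = (\<integral>\<^sup>+\<omega>. inv_boltz UNIV {i} \<omega> * resample1 S1 i f \<omega> \<partial>lift_measure \<Phi> q \<mu>')"
    unfolding form[OF f] form[OF R1] by simp
qed

end

section \<open>Translations\<close>

lemma shift_measurable: "shift x \<in> PiM UNIV (\<lambda>_. M) \<rightarrow>\<^sub>M PiM UNIV (\<lambda>_. M)"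
proof (rule measurable_PiM_single')
  show "(\<lambda>\<omega>. shift x \<omega> i) \<in> PiM UNIV (\<lambda>_. M) \<rightarrow>\<^sub>M M" for i
    unfolding shift_def by (rule measurable_component_singleton) simp
  show "shift x \<in> space (PiM UNIV (\<lambda>_. M)) \<rightarrow> (UNIV \<rightarrow>\<^sub>E space M)"
    by (auto simp: shift_def space_PiM PiE_UNIV_iff)
qed

lemma shift_discr_cfg: "shift x (discr_cfg q \<omega>) = discr_cfg q (shift x \<omega>)"
  by (simp add: shift_def discr_cfg_def)

context gibbs_model
begin

lemma ham_shift:
  assumes ti: "translation_invariant \<Phi>" and \<omega>: "\<omega> \<in> Omega"
  shows "ham UNIV {i} (shift x \<omega>) = ham UNIV {i - x} \<omega>"
proof -
  have "bij_betw (\<lambda>A. (+) x ` A) (acts UNIV {i - x}) (acts UNIV {i})"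
  proof (rule bij_betw_byWitness[where f'="\<lambda>A. (+) (- x) ` A"])
    have "i \<in> (+) x ` A" if "i - x \<in> A" for A
      using imageI[OF that, of "(+) x"] by simp
    then show "(\<lambda>A. (+) x ` A) ` acts UNIV {i - x} \<subseteq> acts UNIV {i}" by (auto simp: acts_def)
    have "i - x \<in> (+) (- x) ` A" if "i \<in> A" for A
      using imageI[OF that, of "(+) (- x)"] by simp
    then show "(\<lambda>A. (+) (- x) ` A) ` acts UNIV {i} \<subseteq> acts UNIV {i - x}" by (auto simp: acts_def)
  qed (simp_all add: image_image)
  then have "(\<Sum>\<^sub>\<infinity>A\<in>acts UNIV {i - x}. \<Phi> ((+) x ` A) (shift x \<omega>)) = (\<Sum>\<^sub>\<infinity>A\<in>acts UNIV {i}. \<Phi> A (shift x \<omega>))"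
    by (rule infsum_reindex_bij_betw)
  moreover have "(\<Sum>\<^sub>\<infinity>A\<in>acts UNIV {i - x}. \<Phi> ((+) x ` A) (shift x \<omega>)) = (\<Sum>\<^sub>\<infinity>A\<in>acts UNIV {i - x}. \<Phi> A \<omega>)"
    using ti \<omega> by (intro infsum_cong) (simp add: translation_invariant_def acts_def)
  ultimately show ?thesis by (simp add: ham_infsum)
qed

lemma local_gibbs_shift:
  assumes ti: "translation_invariant \<Phi>" and \<mu>: "local_gibbs UNIV (\<lambda>_. S1) \<mu>"
  shows "local_gibbs UNIV (\<lambda>_. S1) (distr \<mu> (cfg_space UNIV) (shift x))"
  unfolding local_gibbs_def
proof (intro conjI ballI)
  note s\<mu> = local_gibbsD(2)[OF \<mu>] and sp = local_gibbsD(3)[OF \<mu>]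
  have sm': "shift x \<in> cfg_space UNIV \<rightarrow>\<^sub>M cfg_space UNIV" unfolding cfg_space_def by (rule shift_measurable)
  then have sm: "shift x \<in> \<mu> \<rightarrow>\<^sub>M cfg_space UNIV" by (simp add: measurable_cong_sets[OF s\<mu> refl])
  show "prob_space (distr \<mu> (cfg_space UNIV) (shift x))" by (rule prob_space.prob_space_distr[OF local_gibbsD(1)[OF \<mu>] sm])
  show "sets (distr \<mu> (cfg_space UNIV) (shift x)) = sets (cfg_space UNIV)" by simp
  fix i and f :: "'d config \<Rightarrow> ennreal" assume f[measurable]: "f \<in> borel_measurable (cfg_space UNIV)"
  note [measurable] = inv_boltz_measurable[of "{i}" UNIV] resample1_measurable[OF UNIV_I admissible_S1]
  have inv: "inv_boltz UNIV {i} (shift x \<omega>) = inv_boltz UNIV {i - x} \<omega>" if "\<omega> \<in> Omega" for \<omega>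
    by (simp add: inv_boltz_def ham_shift[OF ti that])
  have res: "resample1 S1 i f (shift x \<omega>) = resample1 S1 (i - x) (\<lambda>\<omega>. f (shift x \<omega>)) \<omega>" for \<omega>
  proof -
    have "shift x (fun_upd \<omega> (i - x) y) = fun_upd (shift x \<omega>) i y" for y by (auto simp: shift_def fun_eq_iff)
    then show ?thesis by (simp add: resample1_def)
  qed
  have fs: "(\<lambda>\<omega>. f (shift x \<omega>)) \<in> borel_measurable (cfg_space UNIV)" by (rule measurable_compose[OF sm' f])
  have "(\<integral>\<^sup>+\<omega>. inv_boltz UNIV {i} \<omega> * f \<omega> \<partial>distr \<mu> (cfg_space UNIV) (shift x)) = (\<integral>\<^sup>+\<omega>. inv_boltz UNIV {i} (shift x \<omega>) * f (shift x \<omega>) \<partial>\<mu>)"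
    by (rule nn_integral_distr[OF sm]) simp
  also have "\<dots> = (\<integral>\<^sup>+\<omega>. inv_boltz UNIV {i - x} \<omega> * f (shift x \<omega>) \<partial>\<mu>)"
    by (intro nn_integral_cong) (simp add: sp inv)
  also have "\<dots> = (\<integral>\<^sup>+\<omega>. inv_boltz UNIV {i - x} \<omega> * resample1 S1 (i - x) (\<lambda>\<omega>. f (shift x \<omega>)) \<omega> \<partial>\<mu>)"
    by (rule local_gibbsD(4)[OF \<mu> UNIV_I fs])
  also have "\<dots> = (\<integral>\<^sup>+\<omega>. inv_boltz UNIV {i} (shift x \<omega>) * resample1 S1 i f (shift x \<omega>) \<partial>\<mu>)"
    by (intro nn_integral_cong) (simp add: sp inv res)
  also have "\<dots> = (\<integral>\<^sup>+\<omega>. inv_boltz UNIV {i} \<omega> * resample1 S1 i f \<omega> \<partial>distr \<mu> (cfg_space UNIV) (shift x))"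
    by (rule nn_integral_distr[OF sm, symmetric]) simp
  finally show "(\<integral>\<^sup>+\<omega>. inv_boltz UNIV {i} \<omega> * f \<omega> \<partial>distr \<mu> (cfg_space UNIV) (shift x)) =
    (\<integral>\<^sup>+\<omega>. inv_boltz UNIV {i} \<omega> * resample1 S1 i f \<omega> \<partial>distr \<mu> (cfg_space UNIV) (shift x))" .
qed

end

section \<open>Extreme points\<close>

definition mixture :: "real \<Rightarrow> 'b measure \<Rightarrow> 'b measure \<Rightarrow> 'b measure \<Rightarrow> bool"
  where "mixture t \<mu> \<nu>\<^sub>1 \<nu>\<^sub>2 \<longleftrightarrow> (\<forall>B\<in>sets \<mu>. measure \<mu> B = t * measure \<nu>\<^sub>1 B + (1 - t) * measure \<nu>\<^sub>2 B)"

lemma nn_integral_mixture: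
  fixes \<mu> \<nu>\<^sub>1 \<nu>\<^sub>2 :: "'b measure"
  assumes mix: "mixture t \<mu> \<nu>\<^sub>1 \<nu>\<^sub>2" and t: "0 < t" "t < 1"
    and p: "prob_space \<mu>" "prob_space \<nu>\<^sub>1" "prob_space \<nu>\<^sub>2" and s: "sets \<nu>\<^sub>1 = sets \<mu>" "sets \<nu>\<^sub>2 = sets \<mu>"
    and f: "f \<in> borel_measurable \<mu>"
  shows "(\<integral>\<^sup>+x. f x \<partial>\<mu>) = ennreal t * (\<integral>\<^sup>+x. f x \<partial>\<nu>\<^sub>1) + ennreal (1 - t) * (\<integral>\<^sup>+x. f x \<partial>\<nu>\<^sub>2)"
proof -
  have mc: "(u \<in> borel_measurable \<nu>\<^sub>1) = (u \<in> borel_measurable \<mu>)" "(u \<in> borel_measurable \<nu>\<^sub>2) = (u \<in> borel_measurable \<mu>)"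
    for u :: "'b \<Rightarrow> ennreal" by (simp_all only: measurable_cong_sets[OF s(1) refl] measurable_cong_sets[OF s(2) refl])
  show ?thesis using f
proof (induction rule: borel_measurable_induct)
  case (cong f g)
  have "space \<nu>\<^sub>1 = space \<mu>" "space \<nu>\<^sub>2 = space \<mu>" by (rule sets_eq_imp_space_eq[OF s(1)], rule sets_eq_imp_space_eq[OF s(2)])
  then have "(\<integral>\<^sup>+x. f x \<partial>\<mu>) = (\<integral>\<^sup>+x. g x \<partial>\<mu>)" "(\<integral>\<^sup>+x. f x \<partial>\<nu>\<^sub>1) = (\<integral>\<^sup>+x. g x \<partial>\<nu>\<^sub>1)" "(\<integral>\<^sup>+x. f x \<partial>\<nu>\<^sub>2) = (\<integral>\<^sup>+x. g x \<partial>\<nu>\<^sub>2)"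
    using cong(3) by (auto intro!: nn_integral_cong)
  then show ?case using cong(4) by (simp only:)
next
  case (set A)
  interpret \<mu>: prob_space \<mu> by fact
  interpret \<nu>1: prob_space \<nu>\<^sub>1 by fact
  interpret \<nu>2: prob_space \<nu>\<^sub>2 by fact
  have "emeasure \<mu> A = ennreal (t * measure \<nu>\<^sub>1 A + (1 - t) * measure \<nu>\<^sub>2 A)" using mix set by (simp add: mixture_def \<mu>.emeasure_eq_measure)
  also have "\<dots> = ennreal t * emeasure \<nu>\<^sub>1 A + ennreal (1 - t) * emeasure \<nu>\<^sub>2 A"
    using t by (simp add: \<nu>1.emeasure_eq_measure \<nu>2.emeasure_eq_measure ennreal_mult ennreal_plus)
  finally show ?case using set by (simp add: s)
next
  case (mult u c)
  have "u \<in> borel_measurable \<nu>\<^sub>1" "u \<in> borel_measurable \<nu>\<^sub>2" unfolding mc by (rule mult(2))+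
  then show ?case using mult by (simp add: nn_integral_cmult distrib_left ac_simps)
next
  case (add u v)
  have "u \<in> borel_measurable \<nu>\<^sub>1" "u \<in> borel_measurable \<nu>\<^sub>2" "v \<in> borel_measurable \<nu>\<^sub>1" "v \<in> borel_measurable \<nu>\<^sub>2"
    unfolding mc by (rule add(1) add(3) add(2) add(4))+
  then show ?case using add by (simp add: nn_integral_add distrib_left ac_simps)
next
  case (seq U)
  have U: "U i \<in> borel_measurable \<nu>\<^sub>1" "U i \<in> borel_measurable \<nu>\<^sub>2" for i unfolding mc by (rule seq(1))+
  have inc: "incseq (\<lambda>i. integral\<^sup>N M (U i))" for M
    using seq(3) by (intro incseq_SucI nn_integral_mono) (simp add: incseq_Suc_iff le_fun_def)
  have lim: "(\<lambda>i. integral\<^sup>N M (U i)) \<longlonglongrightarrow> (\<integral>\<^sup>+x. (SUP i. U i) x \<partial>M)" if "\<And>i. U i \<in> borel_measurable M" for M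
    using nn_integral_monotone_convergence_SUP[OF seq(3) that] LIMSEQ_SUP[OF inc[of M]] by (simp add: image_comp)
  have "(\<lambda>i. integral\<^sup>N \<mu> (U i)) \<longlonglongrightarrow> ennreal t * (\<integral>\<^sup>+x. (SUP i. U i) x \<partial>\<nu>\<^sub>1) + ennreal (1 - t) * (\<integral>\<^sup>+x. (SUP i. U i) x \<partial>\<nu>\<^sub>2)"
    unfolding seq.IH by (intro tendsto_add ennreal_tendsto_cmult lim U) auto
  then show ?case by (rule LIMSEQ_unique[OF lim[OF seq(1)]])
qed
qed

lemma mixture_distr:
  assumes "mixture t \<mu> \<nu>\<^sub>1 \<nu>\<^sub>2" "f \<in> \<mu> \<rightarrow>\<^sub>M N" "sets \<nu>\<^sub>1 = sets \<mu>" "sets \<nu>\<^sub>2 = sets \<mu>"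
  shows "mixture t (distr \<mu> N f) (distr \<nu>\<^sub>1 N f) (distr \<nu>\<^sub>2 N f)"
proof -
  have "f \<in> \<nu>\<^sub>1 \<rightarrow>\<^sub>M N" "f \<in> \<nu>\<^sub>2 \<rightarrow>\<^sub>M N"
    unfolding measurable_cong_sets[OF assms(3) refl] measurable_cong_sets[OF assms(4) refl] by (rule assms(2))+
  moreover have "space \<nu>\<^sub>1 = space \<mu>" "space \<nu>\<^sub>2 = space \<mu>" by (rule sets_eq_imp_space_eq[OF assms(3)], rule sets_eq_imp_space_eq[OF assms(4)])
  ultimately show ?thesis using assms(1,2) measurable_sets[OF assms(2)] by (simp add: mixture_def measure_distr)
qed

text \<open>An affine inverse carries a decomposition of \<open>T \<mu>\<close> over to a decomposition of \<open>\<mu>\<close>.\<close>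

lemma extreme_measures_image:
  assumes T: "\<And>\<mu>. \<mu> \<in> A \<Longrightarrow> T \<mu> \<in> B \<and> K (T \<mu>) = \<mu>" and K: "\<And>\<mu>'. \<mu>' \<in> B \<Longrightarrow> K \<mu>' \<in> A \<and> T (K \<mu>') = \<mu>'"
    and aff: "\<And>t \<mu>' \<nu>\<^sub>1 \<nu>\<^sub>2. \<mu>' \<in> B \<Longrightarrow> \<nu>\<^sub>1 \<in> B \<Longrightarrow> \<nu>\<^sub>2 \<in> B \<Longrightarrow> 0 < t \<Longrightarrow> t < 1 \<Longrightarrow> mixture t \<mu>' \<nu>\<^sub>1 \<nu>\<^sub>2 \<Longrightarrow> mixture t (K \<mu>') (K \<nu>\<^sub>1) (K \<nu>\<^sub>2)"
    and \<mu>: "\<mu> \<in> extreme_measures A"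
  shows "T \<mu> \<in> extreme_measures B"
proof -
  have \<mu>A: "\<mu> \<in> A" and ext: "\<And>\<nu>\<^sub>1 \<nu>\<^sub>2 t. \<nu>\<^sub>1 \<in> A \<Longrightarrow> \<nu>\<^sub>2 \<in> A \<Longrightarrow> 0 < t \<Longrightarrow> t < 1 \<Longrightarrow> mixture t \<mu> \<nu>\<^sub>1 \<nu>\<^sub>2 \<Longrightarrow> \<nu>\<^sub>1 = \<mu> \<and> \<nu>\<^sub>2 = \<mu>"
    using \<mu> unfolding extreme_measures_def mixture_def by blast+
  have "\<nu>\<^sub>1 = T \<mu> \<and> \<nu>\<^sub>2 = T \<mu>" if \<nu>: "\<nu>\<^sub>1 \<in> B" "\<nu>\<^sub>2 \<in> B" and t: "0 < t" "t < 1" and mix: "mixture t (T \<mu>) \<nu>\<^sub>1 \<nu>\<^sub>2" for \<nu>\<^sub>1 \<nu>\<^sub>2 t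
  proof -
    have "mixture t (K (T \<mu>)) (K \<nu>\<^sub>1) (K \<nu>\<^sub>2)" using T[OF \<mu>A] by (intro aff \<nu> t mix) simp
    then have "K \<nu>\<^sub>1 = \<mu> \<and> K \<nu>\<^sub>2 = \<mu>" using T[OF \<mu>A] K[OF \<nu>(1)] K[OF \<nu>(2)] t by (intro ext) auto
    then show ?thesis using K[OF \<nu>(1)] K[OF \<nu>(2)] by auto
  qed
  then show ?thesis using T[OF \<mu>A] unfolding extreme_measures_def mixture_def by blast
qed

theorem theorem1p2:
  fixes \<Phi> :: "'d::finite potential" and q :: nat
  assumes "is_potential \<Phi>"
    and "absolutely_summable \<Phi>"
    and "translation_invariant \<Phi>"
    and "rotation_invariant \<Phi>"
    and "continuous_symmetry_breaking \<Phi>"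
    and "q \<ge> 1"
    and "c_bar \<Phi> q < 1"
  defines "exG \<equiv> extreme_measures (ti_gibbs_measures (cfg_space UNIV) (gibbs_spec UNIV \<Phi>))"
    and "exG' \<equiv> extreme_measures (ti_gibbs_measures (dcfg_space q) (discr_spec \<Phi> q))"
  shows "bij_betw (discr_measure q) exG exG' \<and>
    constrained_gibbs UNIV \<Phi> q \<in> dcfg_space q \<rightarrow>\<^sub>M prob_algebra (cfg_space UNIV) \<and>
    (\<forall>\<mu>'\<in>exG'. lift_measure \<Phi> q \<mu>' = the_inv_into exG (discr_measure q) \<mu>')"
proof -
  interpret dobrushin_model \<Phi> q
    by unfold_locales (fact assms)+
  let ?T = "discr_measure q :: 'd config measure \<Rightarrow> 'd dconfig measure" and ?K = "lift_measure \<Phi> q"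
  let ?A = "ti_gibbs_measures (cfg_space UNIV) (gibbs_spec UNIV \<Phi>)"
  let ?B = "ti_gibbs_measures (dcfg_space q) (discr_spec \<Phi> q)"
  have A: "\<mu> \<in> ?A \<longleftrightarrow> local_gibbs UNIV (\<lambda>_. S1) \<mu> \<and> (\<forall>x. distr \<mu> (cfg_space UNIV) (shift x) = \<mu>)" for \<mu>
    by (simp add: ti_gibbs_measures_def gibbs_measures_free)
  have Ap: "prob_space \<mu>" "sets \<mu> = sets (cfg_space UNIV)" if "\<mu> \<in> ?A" for \<mu>
    using that local_gibbsD(1,2)[of UNIV "\<lambda>_. S1" \<mu>] by (simp_all add: A)
  have Bp: "prob_space \<mu>'" "sets \<mu>' = sets (dcfg_space q)" if "\<mu>' \<in> ?B" for \<mu>'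
    using that by (auto simp: ti_gibbs_measures_def gibbs_measures_def)
  have sm: "shift x \<in> cfg_space UNIV \<rightarrow>\<^sub>M (cfg_space UNIV :: 'd config measure)"
    and sm': "shift x \<in> dcfg_space q \<rightarrow>\<^sub>M (dcfg_space q :: 'd dconfig measure)" for x
    unfolding cfg_space_def dcfg_space_def by (rule shift_measurable)+
  have comm: "distr (?T \<mu>) (dcfg_space q) (shift x) = ?T (distr \<mu> (cfg_space UNIV) (shift x))"
    if s: "sets \<mu> = sets (cfg_space UNIV)" for \<mu> x
  proof -
    note dm = discr_measurable_on[OF s]
    have sm\<mu>: "shift x \<in> \<mu> \<rightarrow>\<^sub>M cfg_space UNIV" using sm by (simp add: measurable_cong_sets[OF s refl])
    show ?thesis
      unfolding discr_measure_def distr_distr[OF sm' dm] distr_distr[OF discr_cfg_measurable[OF q] sm\<mu>]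
      by (simp add: comp_def shift_discr_cfg)
  qed
  have T: "?T \<mu> \<in> ?B \<and> ?K (?T \<mu>) = \<mu>" if \<mu>: "\<mu> \<in> ?A" for \<mu>
  proof -
    have lg: "local_gibbs UNIV (\<lambda>_. S1) \<mu>" and ti: "\<And>x. distr \<mu> (cfg_space UNIV) (shift x) = \<mu>" using \<mu> by (auto simp: A)
    show ?thesis
      using discr_measure_gibbs[OF lg] lift_discr[OF lg] by (simp add: ti_gibbs_measures_def comm[OF local_gibbsD(2)[OF lg]] ti)
  qed
  have K: "?K \<mu>' \<in> ?A \<and> ?T (?K \<mu>') = \<mu>'" if \<mu>': "\<mu>' \<in> ?B" for \<mu>'
  proof -
    have g: "\<mu>' \<in> gibbs_measures UNIV (dcfg_space q) (discr_spec \<Phi> q)" and ti: "\<And>x. distr \<mu>' (dcfg_space q) (shift x) = \<mu>'"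
      using \<mu>' by (auto simp: ti_gibbs_measures_def)
    note lg = lift_measure_gibbs[OF g]
    have TK: "?T (?K \<mu>') = \<mu>'" by (rule discr_lift[OF Bp[OF \<mu>']])
    \<comment> \<open>The shifted lift is a Gibbs measure with the same image, hence the same measure.\<close>
    have "distr (?K \<mu>') (cfg_space UNIV) (shift x) = ?K \<mu>'" for x
    proof -
      have "?T (distr (?K \<mu>') (cfg_space UNIV) (shift x)) = \<mu>'"
        using comm[OF local_gibbsD(2)[OF lg], of x] by (simp add: TK ti)
      then show ?thesis using lift_discr[OF local_gibbs_shift[OF assms(3) lg, of x]] by simp
    qed
    then show ?thesis using lg TK by (simp add: A)
  qed
  have aT: "mixture t (?T \<mu>) (?T \<nu>\<^sub>1) (?T \<nu>\<^sub>2)"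
    if "\<mu> \<in> ?A" "\<nu>\<^sub>1 \<in> ?A" "\<nu>\<^sub>2 \<in> ?A" "0 < t" "t < 1" "mixture t \<mu> \<nu>\<^sub>1 \<nu>\<^sub>2" for t \<mu> \<nu>\<^sub>1 \<nu>\<^sub>2
    unfolding discr_measure_def
    by (rule mixture_distr[OF that(6) discr_measurable_on]) (simp_all add: Ap(2) that)
  have aK: "mixture t (?K \<mu>') (?K \<nu>\<^sub>1) (?K \<nu>\<^sub>2)"
    if m: "\<mu>' \<in> ?B" "\<nu>\<^sub>1 \<in> ?B" "\<nu>\<^sub>2 \<in> ?B" and t: "0 < t" "t < 1" and mix: "mixture t \<mu>' \<nu>\<^sub>1 \<nu>\<^sub>2" for t \<mu>' \<nu>\<^sub>1 \<nu>\<^sub>2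
    unfolding mixture_def
  proof
    fix C assume "C \<in> sets (?K \<mu>')"
    then have C: "C \<in> sets (cfg_space UNIV)" by (simp add: lift_measure_prob(2)[OF Bp[OF m(1)]])
    have km: "(\<lambda>\<sigma>. emeasure (cgibbs \<sigma>) C) \<in> borel_measurable \<mu>'"
      using measurable_compose[OF measurable_prob_algebraD[OF cgibbs_kernel] measurable_emeasure_subprob_algebra[OF C]]
      by (simp cong: measurable_cong_sets add: Bp(2)[OF m(1)])
    have e: "emeasure (?K \<nu>) C = ennreal (measure (?K \<nu>) C)" if "\<nu> \<in> ?B" for \<nu>
      by (rule finite_measure.emeasure_eq_measure) (rule prob_space.finite_measure[OF lift_measure_prob(1)[OF Bp[OF that]]])
    have "emeasure (?K \<mu>') C = ennreal t * emeasure (?K \<nu>\<^sub>1) C + ennreal (1 - t) * emeasure (?K \<nu>\<^sub>2) C"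
      unfolding emeasure_lift[OF Bp[OF m(1)] C] emeasure_lift[OF Bp[OF m(2)] C] emeasure_lift[OF Bp[OF m(3)] C]
      by (rule nn_integral_mixture[OF mix t]) (simp_all add: Bp m km)
    then show "measure (?K \<mu>') C = t * measure (?K \<nu>\<^sub>1) C + (1 - t) * measure (?K \<nu>\<^sub>2) C"
      using t unfolding e[OF m(1)] e[OF m(2)] e[OF m(3)]
      by (simp add: ennreal_mult[symmetric] ennreal_plus[symmetric] del: ennreal_plus)
  qed
  have Tex: "?T \<mu> \<in> exG'" if "\<mu> \<in> exG" for \<mu>
    unfolding exG'_def by (rule extreme_measures_image[where A="?A" and K="?K", OF T K aK]) (use that in \<open>simp_all add: exG_def\<close>)
  have Kex: "?K \<mu>' \<in> exG" if "\<mu>' \<in> exG'" for \<mu>'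
    unfolding exG_def by (rule extreme_measures_image[where A="?B" and K="?T", OF K T aT]) (use that in \<open>simp_all add: exG'_def\<close>)
  have sub: "\<mu> \<in> ?A" if "\<mu> \<in> exG" for \<mu> using that by (simp add: exG_def extreme_measures_def)
  have sub': "\<mu>' \<in> ?B" if "\<mu>' \<in> exG'" for \<mu>' using that by (simp add: exG'_def extreme_measures_def)
  have bij: "bij_betw ?T exG exG'"
    by (rule bij_betw_byWitness[where f'="?K"]) (use T K Tex Kex sub sub' in auto)
  have "?K \<mu>' = the_inv_into exG ?T \<mu>'" if "\<mu>' \<in> exG'" for \<mu>'
    using K[OF sub'[OF that]] Kex[OF that] by (intro the_inv_into_f_eq[symmetric] bij_betw_imp_inj_on[OF bij]) auto
  then show ?thesis using bij cgibbs_kernel by blast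
qed

end
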